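(* Consider either the asymmetric setting or the symmetric setting, and suppose assumptions (i$'$)–(iv$'$) (all stated in the context) hold, with $\|f\|_\mu>0$. Let $Y_n := n^{-1/2} f(n^{1-1/(2\ell_* )} X_n + Z_n)$, and define $$\tilde u_1:=\frac{(u_1(X_n))^{\odot\ell_*}}{\|(u_1(X_n))^{\odot\ell_*}\|_2},\qquad \tilde v_1:=\frac{(v_1(X_n))^{\odot\ell_*}}{\|(v_1(X_n))^{\odot\ell_*}\|_2},$$ $$A_{\ell_*,n}:=\frac{\tau_{\ell_*}(f,\mu)\sqrt{m^u_{2\ell_*}m^v_{2\ell_*}}\,\|f\|_\mu}{\ell_*!\,\gamma^{(\ell_*-1)/2}}\,\sigma_1^{\ell_*}(X_n)\,\tilde u_1\tilde v_1^\top+\frac1{\sqrt n}f(Z_n).$$ Then, as $n\to\infty$, $\|Y_n-A_{\ell_*,n}\|_2\xrightarrow{a.s.}0$.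
   Context: Notation. For $f:\mathbb{R}\to\mathbb{R}$ and a matrix $M$, $f(M)$ denotes elementwise application; $\odot$ is the Hadamard product and $(\cdot)^{\odot\ell}$ the elementwise $\ell$-th power. $\|\cdot\|_2$ is the operator norm for matrices and the Euclidean norm for vectors; $\|\cdot\|_\ell$ is the $\ell^\ell$-norm on vectors, i.e. $\|x\|_\ell^\ell=\sum_i|x_i|^\ell$. $\sigma_1(M),u_1(M),v_1(M)$ are the largest singular value and corresponding unit left and right singular vectors. All random matrices ($n\ge1$) are defined on a common probability space. Asymmetric setting: $X_n,Z_n$ are real $n\times p$ matrices, $p=p_n$, $p/n\to\gamma\in(0,\infty)$ as $n\to\infty$; $X_n$ is deterministic with fixed nonzero singular values (not depending on $n$); the elements of $Z_n$ are i.i.d. with law $\mu$. Symmetric setting: $X_n,Z_n$ are real symmetric $n\times n$ matrices ($p=n$, $\gamma=1$); $X_n$ is deterministic with fixed nonzero eigenvalues; the upper triangular elements (including the diagonal) of $Z_n$ are i.i.d. with law $\mu$. Inner product: $\langle g,h\rangle_\mu=\int gh\,d\mu$, $\|g\|_\mu^2=\langle g,g\rangle_\mu$. $\{q_k\}_{k\ge0}$ denotes the orthonormal polynomials of $\mu$: $\deg q_k=k$, positive leading coefficient, $\langle q_k,q_\ell\rangle_\mu=\delta_{k\ell}$. Put $a_k:=\langle f,q_k\rangle_\mu$, $b_{k\ell}:=\langle q_k^{(\ell)},1\rangle_\mu$ (with $q_k^{(\ell)}$ the $\ell$-th derivative), $$\tau_\ell(f,\mu):=\frac1{\|f\|_\mu}\sum_{k=\ell}^\infty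 a_kb_{k\ell},\qquad \ell_*:=\inf\{\ell\in\mathbb{N}:\tau_\ell(f,\mu)\ne0\}\quad(\mathbb{N}=\{1,2,\dots\}).$$ (Under (ii$'$)–(iii$'$) below the series converge for $\ell\le\ell_*$.) Assumptions: (i$'$) $X_n$ has rank one, and the elements of $n^{1-1/(2\ell_* )}X_n$ converge to zero uniformly. For every even $\ell\in\mathbb{N}$ the limits $m_\ell^u:=\lim_{n\to\infty}\frac1n\|\sqrt n\,u_1(X_n)\|_\ell^\ell$ and $m_\ell^v:=\lim_{n\to\infty}\frac1p\|\sqrt p\,v_1(X_n)\|_\ell^\ell$ exist (and are finite). (ii$'$) $\mu$ has a probability density $\omega$ with $\mathrm{supp}(\omega)=\mathbb{R}$ and finite moment generating function in a neighborhood of zero; for $\ell\le\ell_*$ the derivative $\omega^{(\ell)}$ exists and $\omega^{(\ell)}/\omega$ is polynomially bounded. (iii$'$) $f:\mathbb{R}\to\mathbb{R}$ is polynomially bounded and Lebesgue-almost everywhere continuous, and $a_0=\langle f,q_0\rangle_\mu=0$. (iv$'$) $\ell_*<\infty$, and for each $\ell<\ell_*$, for all sufficiently large integers $K$, $\sum_{k=\ell}^Ka_kb_{k\ell}=0$. *)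

theory Defs
  imports
    "HOL-Probability.Probability"
    "HOL-Computational_Algebra.Polynomial"
    "HOL-Library.Extended_Nat"
    "Jordan_Normal_Form.Matrix"
    "Jordan_Normal_Form.Char_Poly"
    "Jordan_Normal_Form.DL_Rank"
begin

(* Dimensions vary with n, so matrices and vectors are those of Jordan_Normal_Form.  Several
   names also exist in HOL-Analysis and are therefore qualified. *)

definition vec_norm2 :: "real Matrix.vec \<Rightarrow> real" where
  "vec_norm2 x = sqrt (\<Sum>i<dim_vec x. (vec_index x i)\<^sup>2)"

text \<open>The \<open>l\<close>-th power of the \<open>l\<close>-norm.\<close>

definition lnorm_pow :: "nat \<Rightarrow> real Matrix.vec \<Rightarrow> real" where
  "lnorm_pow l x = (\<Sum>i<dim_vec x. \<bar>vec_index x i\<bar> ^ l)"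

definition op_norm :: "real Matrix.mat \<Rightarrow> real" where
  "op_norm A = (SUP x\<in>{x \<in> carrier_vec (dim_col A). vec_norm2 x \<le> 1}. vec_norm2 (A *\<^sub>v x))"

definition outer_prod :: "real Matrix.vec \<Rightarrow> real Matrix.vec \<Rightarrow> real Matrix.mat" where
  "outer_prod u v = Matrix.mat (dim_vec u) (dim_vec v) (\<lambda>(i, j). vec_index u i * vec_index v j)"

text \<open>\<open>s\<close> is a singular value of \<open>A\<close> with unit left and right singular vectors \<open>u\<close> and \<open>v\<close>.
  For an \<open>n \<times> p\<close> matrix this yields the usual \<open>min n p\<close> singular values (without multiplicity):
  \<open>0\<close> counts only if both \<open>A\<close> and its transpose have a nontrivial kernel.\<close>

definition singular_triple ::
    "real Matrix.mat \<Rightarrow> real \<Rightarrow> real Matrix.vec \<Rightarrow> real Matrix.vec \<Rightarrow> bool" where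
  "singular_triple A s u v \<longleftrightarrow>
     s \<ge> 0 \<and> u \<in> carrier_vec (dim_row A) \<and> v \<in> carrier_vec (dim_col A) \<and>
     vec_norm2 u = 1 \<and> vec_norm2 v = 1 \<and>
     A *\<^sub>v v = s \<cdot>\<^sub>v u \<and> transpose_mat A *\<^sub>v u = s \<cdot>\<^sub>v v"

definition singular_values :: "real Matrix.mat \<Rightarrow> real set" where
  "singular_values A = {s. \<exists>u v. singular_triple A s u v}"

definition sigma1 :: "real Matrix.mat \<Rightarrow> real" where
  "sigma1 A = Max (singular_values A)"

definition hadamard_power_vec :: "nat \<Rightarrow> real Matrix.vec \<Rightarrow> real Matrix.vec" where
  "hadamard_power_vec l x = map_vec (\<lambda>t. t ^ l) x"

definition normalized_hadamard_power :: "nat \<Rightarrow> real Matrix.vec \<Rightarrow> real Matrix.vec" where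
  "normalized_hadamard_power l x =
     (1 / vec_norm2 (hadamard_power_vec l x)) \<cdot>\<^sub>v hadamard_power_vec l x"

definition mat_rank :: "real Matrix.mat \<Rightarrow> nat" where
  "mat_rank A = vec_space.rank (dim_row A) A"

definition poly_bounded :: "(real \<Rightarrow> real) \<Rightarrow> bool" where
  "poly_bounded g \<longleftrightarrow> (\<exists>C (k::nat). \<forall>x. \<bar>g x\<bar> \<le> C * (1 + \<bar>x\<bar>) ^ k)"

text \<open>Integration is with respect to the completion of \<open>\<mu>\<close>: an almost everywhere continuous
  function is Lebesgue measurable but need not be Borel measurable, and the Bochner integral over
  the Borel sets would then be \<open>0\<close>.  For Borel functions the completion makes no difference.\<close>

definition inner_mu :: "real measure \<Rightarrow> (real \<Rightarrow> real) \<Rightarrow> (real \<Rightarrow> real) \<Rightarrow> real" where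
  "inner_mu \<mu> g h = (LINT x|completion \<mu>. g x * h x)"

definition norm_mu :: "real measure \<Rightarrow> (real \<Rightarrow> real) \<Rightarrow> real" where
  "norm_mu \<mu> g = sqrt (inner_mu \<mu> g g)"

definition orthonormal_polys :: "real measure \<Rightarrow> (nat \<Rightarrow> real poly) \<Rightarrow> bool" where
  "orthonormal_polys \<mu> q \<longleftrightarrow>
     (\<forall>k. degree (q k) = k \<and> lead_coeff (q k) > 0) \<and>
     (\<forall>k l. inner_mu \<mu> (poly (q k)) (poly (q l)) = (if k = l then 1 else 0))"

definition coeff_a :: "(real \<Rightarrow> real) \<Rightarrow> real measure \<Rightarrow> (nat \<Rightarrow> real poly) \<Rightarrow> nat \<Rightarrow> real" where
  "coeff_a f \<mu> q k = inner_mu \<mu> f (poly (q k))"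

definition coeff_b :: "real measure \<Rightarrow> (nat \<Rightarrow> real poly) \<Rightarrow> nat \<Rightarrow> nat \<Rightarrow> real" where
  "coeff_b \<mu> q k l = inner_mu \<mu> (poly ((pderiv ^^ l) (q k))) (\<lambda>_. 1)"

definition tau :: "(real \<Rightarrow> real) \<Rightarrow> real measure \<Rightarrow> (nat \<Rightarrow> real poly) \<Rightarrow> nat \<Rightarrow> real" where
  "tau f \<mu> q l = 1 / norm_mu \<mu> f * (\<Sum>k. coeff_a f \<mu> q (k + l) * coeff_b \<mu> q (k + l) l)"

definition ell_star :: "(real \<Rightarrow> real) \<Rightarrow> real measure \<Rightarrow> (nat \<Rightarrow> real poly) \<Rightarrow> enat" where
  "ell_star f \<mu> q = Inf (enat ` {l. l \<ge> 1 \<and> tau f \<mu> q l \<noteq> 0})"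

text \<open>The real random variables \<open>W i\<close>, \<open>i \<in> I\<close>, are i.i.d. with law \<open>\<mu>\<close>.\<close>

definition iid_with_law ::
    "'a measure \<Rightarrow> real measure \<Rightarrow> 'i set \<Rightarrow> ('i \<Rightarrow> 'a \<Rightarrow> real) \<Rightarrow> bool" where
  "iid_with_law M \<mu> I W \<longleftrightarrow>
     prob_space.indep_vars M (\<lambda>_. borel) W I \<and> (\<forall>i\<in>I. distr M borel (W i) = \<mu>)"

text \<open>In both settings the sequences are indexed by \<open>n \<ge> 1\<close>, and no joint law of \<open>Z n\<close> for
  different \<open>n\<close> is prescribed.  The fixed nonzero singular values (eigenvalues) are given as a set,
  without multiplicities; this loses nothing for matrices of rank one.\<close>

definition asymmetric_setting ::
    "'a measure \<Rightarrow> real measure \<Rightarrow> (nat \<Rightarrow> nat) \<Rightarrow> real \<Rightarrow>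
     (nat \<Rightarrow> real Matrix.mat) \<Rightarrow> (nat \<Rightarrow> 'a \<Rightarrow> real Matrix.mat) \<Rightarrow> bool" where
  "asymmetric_setting M \<mu> p \<gamma> X Z \<longleftrightarrow>
     \<gamma> > 0 \<and> (\<lambda>n. real (p n) / real n) \<longlonglongrightarrow> \<gamma> \<and>
     (\<forall>n\<ge>1. X n \<in> carrier_mat n (p n)) \<and>
     (\<forall>n\<ge>1. \<forall>\<omega>\<in>space M. Z n \<omega> \<in> carrier_mat n (p n)) \<and>
     (\<exists>S. \<forall>n\<ge>1. singular_values (X n) - {0} = S) \<and>
     (\<forall>n\<ge>1. iid_with_law M \<mu> ({..<n} \<times> {..<p n}) (\<lambda>ij \<omega>. index_mat (Z n \<omega>) ij))"

definition symmetric_setting ::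
    "'a measure \<Rightarrow> real measure \<Rightarrow> (nat \<Rightarrow> nat) \<Rightarrow> real \<Rightarrow>
     (nat \<Rightarrow> real Matrix.mat) \<Rightarrow> (nat \<Rightarrow> 'a \<Rightarrow> real Matrix.mat) \<Rightarrow> bool" where
  "symmetric_setting M \<mu> p \<gamma> X Z \<longleftrightarrow>
     \<gamma> = 1 \<and> (\<forall>n\<ge>1. p n = n) \<and>
     (\<forall>n\<ge>1. X n \<in> carrier_mat n n \<and> transpose_mat (X n) = X n) \<and>
     (\<forall>n\<ge>1. \<forall>\<omega>\<in>space M. Z n \<omega> \<in> carrier_mat n n \<and> transpose_mat (Z n \<omega>) = Z n \<omega>) \<and>
     (\<exists>S. \<forall>n\<ge>1. {e. eigenvalue (X n) e} - {0} = S) \<and>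
     (\<forall>n\<ge>1. iid_with_law M \<mu> {(i, j). i \<le> j \<and> j < n} (\<lambda>ij \<omega>. index_mat (Z n \<omega>) ij))"

end

theory Submission imports Defs "HOL-Real_Asymp.Real_Asymp" begin

text \<open>Write \<open>B\<close> for \<open>n powr (1 - 1/(2 L)) X\<close>, whose entries tend to zero uniformly. Then
  \<open>f (B + Z) - f Z\<close> splits into its mean \<open>h B\<close>, with \<open>h b = \<integral> f (x + b) d\<mu>\<close>, and a centred array.

  The centred entries are independent (on each triangle in the symmetric setting), have bounded moments, and
  their variances tend to zero because \<open>f\<close> is almost everywhere continuous. Therefore the operator norm
  of the array is almost surely \<open>o (sqrt n)\<close>: after truncation this follows from Chernoff bounds
  for bilinear forms, unions over nets, and Borel-Cantelli.

  For the mean, translate the density instead of \<open>f\<close>: \<open>h\<close> has \<open>L\<close> continuous derivatives, and by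
  integration by parts and Parseval's identity (the polynomials are dense because exponential moments
  exist) the \<open>l\<close>-th derivative at \<open>0\<close> is \<open>tau l * norm f\<close>. So \<open>h b = tau L * norm f * b ^ L / L! + o (b ^ L)\<close>,
  and for \<open>X = s u v\<^sup>T\<close> the matrix of \<open>L\<close>-th powers again has rank one, with singular vectors the
  normalized Hadamard powers; the limits of the \<open>2 L\<close>-norms give its size.\<close>

section \<open>Bilinear forms of truncated random arrays\<close>

text \<open>The noise entries have all moments but, as \<open>f\<close> is only polynomially
  bounded, in general no exponential ones. After truncation a Chernoff bound for the form at
  \<open>x\<close>, \<open>y\<close> still requires small products \<open>x i * y j\<close>, and
  spiky vectors would spoil a union bound over one net of the whole ball; this forces the splitting
  of vectors by the size of their entries and two kinds of nets. Going below the usual order sqrt n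
  is paid by the variance s: against a net of size exp (C n) the Chernoff parameter is \<Lambda>
  sqrt n, and its quadratic cost \<Lambda>^2 s n stays below n for any fixed large \<Lambda> once s
  \<le> 1 / \<Lambda>^2. Arrays for different n may be coupled in any way, so almost sure
  convergence has to come from summable probabilities. Since \<open>f\<close> has no derivatives,
  smoothness must come from the density, whose last derivative is in turn only locally bounded;
  hence Taylor's formula is used in integral form. The error of the expansion is controlled entry by
  entry, and becomes an operator norm bound because its majorant, a multiple of \<bar>b\<bar> ^ L,
  is itself a matrix of rank one.\<close>

lemma exp_le_quadratic:
  fixes x :: real
  assumes "\<bar>x\<bar> \<le> 1"
  shows "exp x \<le> 1 + x + x\<^sup>2"
proof (cases "x \<ge> 0")
  case True
  then show ?thesis using assms exp_bound[of x] by auto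
next
  case False
  define y where "y = -x"
  have y: "0 \<le> y" "y \<le> 1" using False assms by (auto simp: y_def)
  have "exp (-y) * (1 + y) \<le> exp (-y) * exp y"
    by (intro mult_left_mono) (auto simp: exp_ge_add_one_self)
  also have "\<dots> = 1" by (simp add: exp_minus)
  also have "\<dots> \<le> (1 - y + y\<^sup>2) * (1 + y)"
  proof -
    have "(1 - y + y\<^sup>2) * (1 + y) = 1 + y ^ 3" by (simp add: power2_eq_square power3_eq_cube algebra_simps)
    then show ?thesis using y by simp
  qed
  finally have "exp (-y) \<le> 1 - y + y\<^sup>2" using y by (simp add: mult_le_cancel_right)
  then show ?thesis by (simp add: y_def)
qed

text \<open>Markov's inequality for \<open>exp (l * sum)\<close>: since
  \<open>l * \<bar>X i\<bar>\<close> is at most 1, the exponential lies below a quadratic, and each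
  factor of the product is at most \<open>exp (l * m i + l\<^sup>2 * v i)\<close>. The means stay in
  the exponent because truncation will destroy exact centring.\<close>

lemma (in prob_space) bounded_Chernoff:
  fixes X :: "'i \<Rightarrow> 'a \<Rightarrow> real"
  assumes fin: "finite I" and ind: "indep_vars (\<lambda>_. borel) X I"
    and l: "l > 0" and bd: "\<And>i \<omega>. i \<in> I \<Longrightarrow> \<omega> \<in> space M \<Longrightarrow> l * \<bar>X i \<omega>\<bar> \<le> 1"
    and m: "\<And>i. i \<in> I \<Longrightarrow> expectation (X i) \<le> m i"
    and v: "\<And>i. i \<in> I \<Longrightarrow> expectation (\<lambda>\<omega>. (X i \<omega>)\<^sup>2) \<le> v i"
  shows "prob {\<omega>\<in>space M. (\<Sum>i\<in>I. X i \<omega>) \<ge> t} \<le> exp (- l * t + l * (\<Sum>i\<in>I. m i) + l\<^sup>2 * (\<Sum>i\<in>I. v i))"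
proof -
  have meas [measurable]: "\<And>i. i \<in> I \<Longrightarrow> X i \<in> borel_measurable M"
    using ind by (auto simp: indep_vars_def)
  have bd': "\<bar>X i \<omega>\<bar> \<le> 1 / l" if "i \<in> I" "\<omega> \<in> space M" for i \<omega>
    using bd[OF that] l by (simp add: field_simps)
  have int1: "integrable M (X i)" if "i \<in> I" for i
    using that bd' by (intro integrable_const_bound[of _ "1/l"]) auto
  have int2: "integrable M (\<lambda>\<omega>. (X i \<omega>)\<^sup>2)" if "i \<in> I" for i
  proof (rule integrable_const_bound[of _ "(1/l)\<^sup>2"])
    show "AE x in M. norm ((X i x)\<^sup>2) \<le> (1/l)\<^sup>2"
      using bd'[OF that] l by (auto intro!: AE_I2 simp: abs_le_square_iff[symmetric] simp flip: power_one_over)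
  qed (use that in measurable)
  have int3: "integrable M (\<lambda>\<omega>. exp (l * X i \<omega>))" if "i \<in> I" for i
  proof (rule integrable_const_bound[of _ "exp 1"])
    show "AE x in M. norm (exp (l * X i x)) \<le> exp 1"
    proof (rule AE_I2)
      fix \<omega> assume w: "\<omega> \<in> space M"
      have "l * X i \<omega> \<le> l * \<bar>X i \<omega>\<bar>" using l by (intro mult_left_mono) auto
      then show "norm (exp (l * X i \<omega>)) \<le> exp 1" using bd[OF that w] by simp
    qed
  qed (use that in measurable)
  have indE: "indep_vars (\<lambda>_. borel) (\<lambda>i \<omega>. exp (l * X i \<omega>)) I"
    by (intro indep_vars_compose2[OF ind]) auto
  have eq: "(\<lambda>\<omega>. exp (l * (\<Sum>i\<in>I. X i \<omega>))) = (\<lambda>\<omega>. \<Prod>i\<in>I. exp (l * X i \<omega>))"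
    using fin by (auto simp: sum_distrib_left exp_sum)
  have intP: "integrable M (\<lambda>\<omega>. exp (l * (\<Sum>i\<in>I. X i \<omega>)))"
    unfolding eq by (rule indep_vars_integrable[OF fin indE int3])
  have each: "expectation (\<lambda>\<omega>. exp (l * X i \<omega>)) \<le> exp (l * m i + l\<^sup>2 * v i)" if i: "i \<in> I" for i
  proof -
    have "expectation (\<lambda>\<omega>. exp (l * X i \<omega>)) \<le> expectation (\<lambda>\<omega>. 1 + l * X i \<omega> + l\<^sup>2 * (X i \<omega>)\<^sup>2)"
    proof (rule integral_mono)
      fix \<omega> assume "\<omega> \<in> space M"
      then have "\<bar>l * X i \<omega>\<bar> \<le> 1" using bd[OF i] l by (simp add: abs_mult)
      from exp_le_quadratic[OF this]
      show "exp (l * X i \<omega>) \<le> 1 + l * X i \<omega> + l\<^sup>2 * (X i \<omega>)\<^sup>2" by (simp add: power_mult_distrib)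
    qed (use int1 int2 int3 i in auto)
    also have "\<dots> = 1 + l * expectation (X i) + l\<^sup>2 * expectation (\<lambda>\<omega>. (X i \<omega>)\<^sup>2)"
      using int1[OF i] int2[OF i] by (simp add: prob_space)
    also have "\<dots> \<le> 1 + (l * m i + l\<^sup>2 * v i)"
      using m[OF i] v[OF i] l by (auto intro!: add_mono mult_left_mono)
    also have "\<dots> \<le> exp (l * m i + l\<^sup>2 * v i)" by (rule exp_ge_add_one_self)
    finally show ?thesis .
  qed
  have "expectation (\<lambda>\<omega>. exp (l * (\<Sum>i\<in>I. X i \<omega>))) = (\<Prod>i\<in>I. expectation (\<lambda>\<omega>. exp (l * X i \<omega>)))"
    unfolding eq by (rule indep_vars_lebesgue_integral[OF fin indE int3])
  also have "\<dots> \<le> (\<Prod>i\<in>I. exp (l * m i + l\<^sup>2 * v i))"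
    by (intro prod_mono conjI each integral_nonneg) auto
  also have "\<dots> = exp (l * (\<Sum>i\<in>I. m i) + l\<^sup>2 * (\<Sum>i\<in>I. v i))"
    using fin by (simp add: exp_sum sum.distrib sum_distrib_left flip: exp_sum)
  finally have E: "expectation (\<lambda>\<omega>. exp (l * (\<Sum>i\<in>I. X i \<omega>))) \<le> exp (l * (\<Sum>i\<in>I. m i) + l\<^sup>2 * (\<Sum>i\<in>I. v i))" .
  have "{\<omega>\<in>space M. (\<Sum>i\<in>I. X i \<omega>) \<ge> t} = {\<omega>\<in>space M. exp (l * (\<Sum>i\<in>I. X i \<omega>)) \<ge> exp (l * t)}"
    using l by auto
  then have "prob {\<omega>\<in>space M. (\<Sum>i\<in>I. X i \<omega>) \<ge> t} \<le> expectation (\<lambda>\<omega>. exp (l * (\<Sum>i\<in>I. X i \<omega>))) / exp (l * t)"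
    using integral_Markov_inequality_measure[OF intP, of "{}" "exp (l * t)"] by simp
  also have "\<dots> \<le> exp (l * (\<Sum>i\<in>I. m i) + l\<^sup>2 * (\<Sum>i\<in>I. v i)) / exp (l * t)"
    by (intro divide_right_mono E) auto
  also have "\<dots> = exp (- l * t + l * (\<Sum>i\<in>I. m i) + l\<^sup>2 * (\<Sum>i\<in>I. v i))"
    by (simp add: exp_diff[symmetric] algebra_simps)
  finally show ?thesis .
qed

text \<open>The level \<open>K\<close> of truncation, the bias \<open>\<eta>\<close> that it causes
  in the means and a common bound \<open>s\<close> of the second moments are all that the tail
  bounds see. The entries may have different laws, since each one is shifted by its own signal
  entry.\<close>

locale truncated_array = prob_space M for M :: "'a measure" +
  fixes W :: "nat \<Rightarrow> nat \<Rightarrow> 'a \<Rightarrow> real" and n p :: nat and K \<eta> s :: real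
  assumes indep: "indep_vars (\<lambda>_. borel) (\<lambda>ij. W (fst ij) (snd ij)) ({..<n} \<times> {..<p})"
    and bounded: "i < n \<Longrightarrow> j < p \<Longrightarrow> \<omega> \<in> space M \<Longrightarrow> \<bar>W i j \<omega>\<bar> \<le> K"
    and mean: "i < n \<Longrightarrow> j < p \<Longrightarrow> \<bar>expectation (W i j)\<bar> \<le> \<eta>"
    and second_moment: "i < n \<Longrightarrow> j < p \<Longrightarrow> expectation (\<lambda>\<omega>. (W i j \<omega>)\<^sup>2) \<le> s"
    and K_pos: "K > 0" and eta_nonneg: "\<eta> \<ge> 0" and s_nonneg: "s \<ge> 0"
begin

lemma measurable_entry [measurable]: "i < n \<Longrightarrow> j < p \<Longrightarrow> W i j \<in> borel_measurable M"
  using indep unfolding indep_vars_def by force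

lemma sq_le_K: "i < n \<Longrightarrow> j < p \<Longrightarrow> \<omega> \<in> space M \<Longrightarrow> (W i j \<omega>)\<^sup>2 \<le> K\<^sup>2"
  using bounded K_pos by (intro power2_le_iff_abs_le[THEN iffD2]) auto

lemma integrable_entry: "i < n \<Longrightarrow> j < p \<Longrightarrow> integrable M (W i j)"
  using bounded by (intro integrable_const_bound[of _ K]) auto

lemma integrable_entry_sq: "i < n \<Longrightarrow> j < p \<Longrightarrow> integrable M (\<lambda>\<omega>. (W i j \<omega>)\<^sup>2)"
  using sq_le_K by (intro integrable_const_bound[of _ "K\<^sup>2"]) auto

text \<open>The weighted second moments add up to at most \<open>s\<close>, because both vectors
  have norm at most 1. The means are summed crudely, with weights at most 1: the later
  \<open>\<eta>\<close> is so small that the factor \<open>n * p\<close> is harmless.\<close>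

lemma bilinear_tail_upper:
  assumes x: "(\<Sum>i<n. (x i)\<^sup>2) \<le> 1" and y: "(\<Sum>j<p. (y j)\<^sup>2) \<le> 1"
    and l: "l > 0" and small: "\<And>i j. i < n \<Longrightarrow> j < p \<Longrightarrow> l * K * \<bar>x i * y j\<bar> \<le> 1"
  shows "prob {\<omega>\<in>space M. (\<Sum>i<n. \<Sum>j<p. x i * W i j \<omega> * y j) \<ge> t}
           \<le> exp (- l * t + l * (real n * real p * \<eta>) + l\<^sup>2 * s)"
proof -
  let ?X = "\<lambda>ij \<omega>. (x (fst ij) * y (snd ij)) * W (fst ij) (snd ij) \<omega>"
  have ind: "indep_vars (\<lambda>_. borel) ?X ({..<n} \<times> {..<p})"
    by (intro indep_vars_compose2[OF indep]) auto
  have le1: "\<bar>x i\<bar> \<le> 1" if "i < n" for i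
  proof -
    have "(x i)\<^sup>2 \<le> (\<Sum>i<n. (x i)\<^sup>2)" using that by (intro member_le_sum) auto
    then show ?thesis using x by (simp add: abs_le_square_iff[of _ 1, simplified])
  qed
  have le2: "\<bar>y i\<bar> \<le> 1" if "i < p" for i
  proof -
    have "(y i)\<^sup>2 \<le> (\<Sum>i<p. (y i)\<^sup>2)" using that by (intro member_le_sum) auto
    then show ?thesis using y by (simp add: abs_le_square_iff[of _ 1, simplified])
  qed
  have "prob {\<omega>\<in>space M. (\<Sum>ij\<in>{..<n} \<times> {..<p}. ?X ij \<omega>) \<ge> t}
     \<le> exp (- l * t + l * (\<Sum>ij\<in>{..<n} \<times> {..<p}. \<eta>) + l\<^sup>2 * (\<Sum>ij\<in>{..<n} \<times> {..<p}. (x (fst ij))\<^sup>2 * (y (snd ij))\<^sup>2 * s))"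
  proof (rule bounded_Chernoff[OF _ ind l])
    fix ij \<omega> assume ij: "ij \<in> {..<n} \<times> {..<p}" and w: "\<omega> \<in> space M"
    obtain i j where [simp]: "ij = (i, j)" by (cases ij)
    have lt: "i < n" "j < p" using ij by auto
    have "l * \<bar>?X ij \<omega>\<bar> = l * \<bar>x i * y j\<bar> * \<bar>W i j \<omega>\<bar>" by (simp add: abs_mult)
    also have "\<dots> \<le> l * \<bar>x i * y j\<bar> * K" using bounded[OF lt w] l by (intro mult_left_mono) auto
    also have "\<dots> \<le> 1" using small[OF lt] by (simp add: mult_ac)
    finally show "l * \<bar>?X ij \<omega>\<bar> \<le> 1" .
  next
    fix ij assume ij: "ij \<in> {..<n} \<times> {..<p}"
    obtain i j where [simp]: "ij = (i, j)" by (cases ij)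
    have lt: "i < n" "j < p" using ij by auto
    have "expectation (?X ij) \<le> \<bar>x i\<bar> * \<bar>y j\<bar> * \<bar>expectation (W i j)\<bar>"
      using abs_ge_self[of "x i * y j * expectation (W i j)"] by (simp add: abs_mult)
    also have "\<dots> \<le> 1 * 1 * \<eta>" using le1[OF lt(1)] le2[OF lt(2)] mean[OF lt] by (intro mult_mono) auto
    finally show "expectation (?X ij) \<le> \<eta>" by simp
    have "expectation (\<lambda>\<omega>. (?X ij \<omega>)\<^sup>2) = (x i)\<^sup>2 * (y j)\<^sup>2 * expectation (\<lambda>\<omega>. (W i j \<omega>)\<^sup>2)"
      by (simp add: power_mult_distrib)
    also have "\<dots> \<le> (x i)\<^sup>2 * (y j)\<^sup>2 * s" using second_moment[OF lt] by (intro mult_left_mono) auto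
    finally show "expectation (\<lambda>\<omega>. (?X ij \<omega>)\<^sup>2) \<le> (x (fst ij))\<^sup>2 * (y (snd ij))\<^sup>2 * s" by simp
  qed auto
  also have "(\<Sum>ij\<in>{..<n} \<times> {..<p}. (x (fst ij))\<^sup>2 * (y (snd ij))\<^sup>2 * s) = (\<Sum>i<n. (x i)\<^sup>2) * (\<Sum>j<p. (y j)\<^sup>2) * s"
    by (simp add: sum_product sum_distrib_right[of _ _ s] sum.cartesian_product case_prod_beta)
  also have "(\<Sum>ij\<in>{..<n} \<times> {..<p}. \<eta>) = real n * real p * \<eta>" by simp
  also have "exp (- l * t + l * (real n * real p * \<eta>) + l\<^sup>2 * ((\<Sum>i<n. (x i)\<^sup>2) * (\<Sum>j<p. (y j)\<^sup>2) * s))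
      \<le> exp (- l * t + l * (real n * real p * \<eta>) + l\<^sup>2 * (1 * 1 * s))"
    unfolding exp_le_cancel_iff
    by (intro add_left_mono mult_left_mono mult_right_mono mult_mono x y s_nonneg sum_nonneg) auto
  finally show ?thesis
    by (simp add: sum.cartesian_product case_prod_beta mult_ac)
qed

lemma bilinear_tail:
  assumes x: "(\<Sum>i<n. (x i)\<^sup>2) \<le> 1" and y: "(\<Sum>j<p. (y j)\<^sup>2) \<le> 1"
    and l: "l > 0" and small: "\<And>i j. i < n \<Longrightarrow> j < p \<Longrightarrow> l * K * \<bar>x i * y j\<bar> \<le> 1"
  shows "prob {\<omega>\<in>space M. \<bar>\<Sum>i<n. \<Sum>j<p. x i * W i j \<omega> * y j\<bar> \<ge> t}
           \<le> 2 * exp (- l * t + l * (real n * real p * \<eta>) + l\<^sup>2 * s)"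
proof -
  let ?A = "\<lambda>x. {\<omega>\<in>space M. (\<Sum>i<n. \<Sum>j<p. x i * W i j \<omega> * y j) \<ge> t}"
  have "{\<omega>\<in>space M. \<bar>\<Sum>i<n. \<Sum>j<p. x i * W i j \<omega> * y j\<bar> \<ge> t} \<subseteq> ?A x \<union> ?A (\<lambda>i. - x i)"
    by (auto simp: sum_negf)
  then have "prob {\<omega>\<in>space M. \<bar>\<Sum>i<n. \<Sum>j<p. x i * W i j \<omega> * y j\<bar> \<ge> t} \<le> prob (?A x \<union> ?A (\<lambda>i. - x i))"
    by (intro finite_measure_mono) measurable
  also have "\<dots> \<le> prob (?A x) + prob (?A (\<lambda>i. - x i))"
    by (intro measure_Un_le) measurable
  also have "\<dots> \<le> exp (- l * t + l * (real n * real p * \<eta>) + l\<^sup>2 * s) + exp (- l * t + l * (real n * real p * \<eta>) + l\<^sup>2 * s)"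
    using assms by (intro add_mono bilinear_tail_upper) auto
  finally show ?thesis by simp
qed

text \<open>The squares are at most \<open>K\<^sup>2\<close>, so the parameter
  \<open>1/K\<^sup>2\<close> is admissible. Their second moments are at most
  \<open>K\<^sup>2 * s\<close>, so that the quadratic term of the exponent costs as much as the mean
  term; this is the factor 2.\<close>

lemma row_tail:
  assumes i: "i < n"
  shows "prob {\<omega>\<in>space M. (\<Sum>j<p. (W i j \<omega>)\<^sup>2) \<ge> t} \<le> exp ((- t + 2 * real p * s) / K\<^sup>2)"
proof -
  have ind: "indep_vars (\<lambda>_. borel) (\<lambda>ij \<omega>. (W (fst ij) (snd ij) \<omega>)\<^sup>2) ({i} \<times> {..<p})"
    by (intro indep_vars_compose2[OF indep_vars_subset[OF indep]]) (use i in auto)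
  have "prob {\<omega>\<in>space M. (\<Sum>ij\<in>{i} \<times> {..<p}. (W (fst ij) (snd ij) \<omega>)\<^sup>2) \<ge> t}
     \<le> exp (- (1/K\<^sup>2) * t + (1/K\<^sup>2) * (\<Sum>ij\<in>{i} \<times> {..<p}. s) + (1/K\<^sup>2)\<^sup>2 * (\<Sum>ij\<in>{i} \<times> {..<p}. K\<^sup>2 * s))"
  proof (rule bounded_Chernoff[OF _ ind])
    fix ij assume ij: "ij \<in> {i} \<times> {..<p}"
    then obtain j where [simp]: "ij = (i, j)" and j: "j < p" by auto
    show "expectation (\<lambda>\<omega>. (W (fst ij) (snd ij) \<omega>)\<^sup>2) \<le> s" using second_moment[OF i j] by simp
    have "expectation (\<lambda>\<omega>. ((W i j \<omega>)\<^sup>2)\<^sup>2) \<le> expectation (\<lambda>\<omega>. K\<^sup>2 * (W i j \<omega>)\<^sup>2)"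
    proof (rule integral_mono_AE')
      show "AE \<omega> in M. ((W i j \<omega>)\<^sup>2)\<^sup>2 \<le> K\<^sup>2 * (W i j \<omega>)\<^sup>2"
      proof (rule AE_I2)
        fix \<omega> assume "\<omega> \<in> space M"
        from sq_le_K[OF i j this] show "((W i j \<omega>)\<^sup>2)\<^sup>2 \<le> K\<^sup>2 * (W i j \<omega>)\<^sup>2"
          by (subst power2_eq_square) (intro mult_right_mono, auto)
      qed
    qed (use integrable_entry_sq[OF i j] in auto)
    also have "\<dots> \<le> K\<^sup>2 * s" using second_moment[OF i j] by (auto intro!: mult_left_mono)
    finally show "expectation (\<lambda>\<omega>. ((W (fst ij) (snd ij) \<omega>)\<^sup>2)\<^sup>2) \<le> K\<^sup>2 * s" by simp
  qed (use K_pos i sq_le_K in auto)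
  also have "(\<Sum>ij\<in>{i} \<times> {..<p}. s) = p * s" by simp
  also have "(\<Sum>ij\<in>{i} \<times> {..<p}. K\<^sup>2 * s) = p * (K\<^sup>2 * s)" by simp
  also have "- (1/K\<^sup>2) * t + (1/K\<^sup>2) * (p * s) + (1/K\<^sup>2)\<^sup>2 * (p * (K\<^sup>2 * s)) = (- t + 2 * real p * s) / K\<^sup>2"
    using K_pos by (simp add: field_simps power2_eq_square)
  also have "(\<lambda>\<omega>. \<Sum>ij\<in>{i} \<times> {..<p}. (W (fst ij) (snd ij) \<omega>)\<^sup>2) = (\<lambda>\<omega>. \<Sum>j<p. (W i j \<omega>)\<^sup>2)"
    using sum.cartesian_product[of "\<lambda>i j. (W i j _)\<^sup>2" "{..<p}" "{i}"]
    by (auto simp: case_prod_beta intro!: ext)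
  finally show ?thesis .
qed

text \<open>For two different rows the products in different columns involve disjoint pairs of
  entries, so they are independent over \<open>j\<close>; the two factors of a product are
  independent as well, which gives mean at most \<open>\<eta>\<^sup>2\<close> and second moment at
  most \<open>s\<^sup>2\<close>. The sign \<open>c\<close> serves both tails.\<close>

lemma pair_tail_upper:
  assumes i: "i < n" and k: "k < n" and ik: "i \<noteq> k" and l: "l > 0" "l * K\<^sup>2 \<le> 1" and c: "c = 1 \<or> c = -1"
  shows "prob {\<omega>\<in>space M. (\<Sum>j<p. c * (W i j \<omega> * W k j \<omega>)) \<ge> t} \<le> exp (- l * t + l * (p * \<eta>\<^sup>2) + l\<^sup>2 * (p * s\<^sup>2))"
proof -
  let ?K = "\<lambda>j. {(i, j), (k, j)}"
  have ind0: "indep_vars (\<lambda>j. PiM (?K j) (\<lambda>_. borel)) (\<lambda>j \<omega>. restrict (\<lambda>ij. W (fst ij) (snd ij) \<omega>) (?K j)) {..<p}"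
    by (rule indep_vars_restrict[OF indep]) (use i k in \<open>auto simp: disjoint_family_on_def\<close>)
  have "indep_vars (\<lambda>_. borel) (\<lambda>j \<omega>. (\<lambda>g. c * (g (i, j) * g (k, j))) (restrict (\<lambda>ij. W (fst ij) (snd ij) \<omega>) (?K j))) {..<p}"
    by (rule indep_vars_compose2[OF ind0]) measurable
  then have ind: "indep_vars (\<lambda>_. borel) (\<lambda>j \<omega>. c * (W i j \<omega> * W k j \<omega>)) {..<p}" by simp
  have c2: "c\<^sup>2 = 1" "\<bar>c\<bar> = 1" using c by auto
  have "prob {\<omega>\<in>space M. (\<Sum>j<p. c * (W i j \<omega> * W k j \<omega>)) \<ge> t}
     \<le> exp (- l * t + l * (\<Sum>j<p. \<eta>\<^sup>2) + l\<^sup>2 * (\<Sum>j<p. s\<^sup>2))"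
  proof (rule bounded_Chernoff[OF _ ind l(1)])
    fix j \<omega> assume j: "j \<in> {..<p}" and w: "\<omega> \<in> space M"
    have "l * \<bar>c * (W i j \<omega> * W k j \<omega>)\<bar> = l * (\<bar>W i j \<omega>\<bar> * \<bar>W k j \<omega>\<bar>)" using c2 by (simp add: abs_mult)
    also have "\<dots> \<le> l * (K * K)" using bounded[of _ j \<omega>] i k j w l K_pos by (intro mult_left_mono mult_mono) auto
    also have "\<dots> \<le> 1" using l by (simp add: power2_eq_square)
    finally show "l * \<bar>c * (W i j \<omega> * W k j \<omega>)\<bar> \<le> 1" .
  next
    fix j assume "j \<in> {..<p}"
    then have j: "j < p" by simp
    have indp: "indep_vars (\<lambda>_. borel) (\<lambda>ij. W (fst ij) (snd ij)) (?K j)"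
      by (rule indep_vars_subset[OF indep]) (use i k j in auto)
    \<comment> \<open>A general \<open>g\<close> yields the first moments with the identity and the
      second moments with the square.\<close>
    have prod: "expectation (\<lambda>\<omega>. \<Prod>ij\<in>?K j. g (W (fst ij) (snd ij) \<omega>)) = (\<Prod>ij\<in>?K j. expectation (\<lambda>\<omega>. g (W (fst ij) (snd ij) \<omega>)))"
      if [measurable]: "g \<in> borel_measurable borel" and "\<And>ij. ij \<in> ?K j \<Longrightarrow> integrable M (\<lambda>\<omega>. g (W (fst ij) (snd ij) \<omega>))" for g :: "real \<Rightarrow> real"
      by (intro indep_vars_lebesgue_integral indep_vars_compose2[OF indp] that) auto
    have e1: "expectation (\<lambda>\<omega>. W i j \<omega> * W k j \<omega>) = expectation (W i j) * expectation (W k j)"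
    proof -
      have "\<And>ij. ij \<in> ?K j \<Longrightarrow> integrable M (\<lambda>\<omega>. W (fst ij) (snd ij) \<omega>)" using integrable_entry i k j by auto
      from prod[OF _ this] show ?thesis using ik by simp
    qed
    have e2: "expectation (\<lambda>\<omega>. (W i j \<omega>)\<^sup>2 * (W k j \<omega>)\<^sup>2) = expectation (\<lambda>\<omega>. (W i j \<omega>)\<^sup>2) * expectation (\<lambda>\<omega>. (W k j \<omega>)\<^sup>2)"
    proof -
      have "\<And>ij. ij \<in> ?K j \<Longrightarrow> integrable M (\<lambda>\<omega>. (W (fst ij) (snd ij) \<omega>)\<^sup>2)" using integrable_entry_sq i k j by auto
      from prod[OF _ this] show ?thesis using ik by simp
    qed
    have "expectation (\<lambda>\<omega>. c * (W i j \<omega> * W k j \<omega>)) \<le> \<bar>expectation (W i j)\<bar> * \<bar>expectation (W k j)\<bar>"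
      using e1 c abs_ge_self[of "expectation (W i j) * expectation (W k j)"]
        abs_ge_self[of "- (expectation (W i j) * expectation (W k j))"] by (auto simp: abs_mult[symmetric])
    also have "\<dots> \<le> \<eta> * \<eta>" using mean i k j by (intro mult_mono) (auto simp: eta_nonneg)
    finally show "expectation (\<lambda>\<omega>. c * (W i j \<omega> * W k j \<omega>)) \<le> \<eta>\<^sup>2" by (simp add: power2_eq_square)
    have "expectation (\<lambda>\<omega>. (c * (W i j \<omega> * W k j \<omega>))\<^sup>2) = expectation (\<lambda>\<omega>. (W i j \<omega>)\<^sup>2) * expectation (\<lambda>\<omega>. (W k j \<omega>)\<^sup>2)"
      unfolding e2[symmetric] using c2 by (simp add: power_mult_distrib)
    also have "\<dots> \<le> s * s" using second_moment i k j by (intro mult_mono) (auto simp: s_nonneg)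
    finally show "expectation (\<lambda>\<omega>. (c * (W i j \<omega> * W k j \<omega>))\<^sup>2) \<le> s\<^sup>2" by (simp add: power2_eq_square)
  qed auto
  then show ?thesis by simp
qed

lemma pair_tail:
  assumes i: "i < n" and k: "k < n" and ik: "i \<noteq> k" and l: "l > 0" "l * K\<^sup>2 \<le> 1"
  shows "prob {\<omega>\<in>space M. \<bar>\<Sum>j<p. W i j \<omega> * W k j \<omega>\<bar> \<ge> t} \<le> 2 * exp (- l * t + l * (p * \<eta>\<^sup>2) + l\<^sup>2 * (p * s\<^sup>2))"
proof -
  let ?A = "\<lambda>c. {\<omega>\<in>space M. (\<Sum>j<p. c * (W i j \<omega> * W k j \<omega>)) \<ge> t}"
  have "{\<omega>\<in>space M. \<bar>\<Sum>j<p. W i j \<omega> * W k j \<omega>\<bar> \<ge> t} \<subseteq> ?A 1 \<union> ?A (-1)"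
    by (auto simp: sum_negf)
  then have "prob {\<omega>\<in>space M. \<bar>\<Sum>j<p. W i j \<omega> * W k j \<omega>\<bar> \<ge> t} \<le> prob (?A 1 \<union> ?A (-1))"
    using i k by (intro finite_measure_mono) measurable
  also have "\<dots> \<le> prob (?A 1) + prob (?A (-1))"
    using i k by (intro measure_Un_le) measurable
  also have "\<dots> \<le> exp (- l * t + l * (p * \<eta>\<^sup>2) + l\<^sup>2 * (p * s\<^sup>2)) + exp (- l * t + l * (p * \<eta>\<^sup>2) + l\<^sup>2 * (p * s\<^sup>2))"
    using assms by (intro add_mono pair_tail_upper) auto
  finally show ?thesis by simp
qed

end

section \<open>Nets of vectors with bounded entries\<close>

definition bilin :: "nat \<Rightarrow> nat \<Rightarrow> (nat \<Rightarrow> nat \<Rightarrow> real) \<Rightarrow> (nat \<Rightarrow> real) \<Rightarrow> (nat \<Rightarrow> real) \<Rightarrow> real" where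
  "bilin n p W x y = (\<Sum>i<n. \<Sum>j<p. x i * W i j * y j)"

lemma bilin_add_left: "bilin n p W (\<lambda>i. x i + x' i) y = bilin n p W x y + bilin n p W x' y"
  by (simp add: bilin_def algebra_simps sum.distrib)

lemma bilin_add_right: "bilin n p W x (\<lambda>j. y j + y' j) = bilin n p W x y + bilin n p W x y'"
  by (simp add: bilin_def algebra_simps sum.distrib)

lemma bilin_scale_left: "bilin n p W (\<lambda>i. c * x i) y = c * bilin n p W x y"
  by (simp add: bilin_def sum_distrib_left mult_ac)

lemma bilin_scale_right: "bilin n p W x (\<lambda>j. c * y j) = c * bilin n p W x y"
  by (simp add: bilin_def sum_distrib_left mult_ac)

lemma bilin_cong:
  assumes "\<And>i. i < n \<Longrightarrow> x i = x' i" "\<And>j. j < p \<Longrightarrow> y j = y' j"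
  shows "bilin n p W x y = bilin n p W x' y'"
  using assms by (simp add: bilin_def)

lemma abs_le_one_of_sum_sq:
  fixes n :: nat
  assumes "(\<Sum>i<n. (x i)\<^sup>2) \<le> (1::real)" "i < n"
  shows "\<bar>x i\<bar> \<le> 1"
proof -
  have "(x i)\<^sup>2 \<le> (\<Sum>i<n. (x i)\<^sup>2)" using assms(2) by (intro member_le_sum) auto
  then show ?thesis using assms by (simp add: abs_le_square_iff[of _ 1, simplified])
qed

lemma bilin_le_sum_abs:
  assumes x: "(\<Sum>i<n. (x i)\<^sup>2) \<le> 1" and y: "(\<Sum>j<p. (y j)\<^sup>2) \<le> 1"
  shows "\<bar>bilin n p W x y\<bar> \<le> (\<Sum>i<n. \<Sum>j<p. \<bar>W i j\<bar>)"
proof -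
  have "\<bar>bilin n p W x y\<bar> \<le> (\<Sum>i<n. \<Sum>j<p. \<bar>x i * W i j * y j\<bar>)"
    unfolding bilin_def by (intro order.trans[OF sum_abs] sum_mono sum_abs)
  also have "\<dots> \<le> (\<Sum>i<n. \<Sum>j<p. \<bar>W i j\<bar>)"
  proof (intro sum_mono)
    fix i j assume "i \<in> {..<n}" "j \<in> {..<p}"
    then have "\<bar>x i\<bar> \<le> 1" "\<bar>y j\<bar> \<le> 1"
      using abs_le_one_of_sum_sq[OF x] abs_le_one_of_sum_sq[OF y] by auto
    then have "\<bar>x i\<bar> * \<bar>W i j\<bar> * \<bar>y j\<bar> \<le> 1 * \<bar>W i j\<bar> * 1" by (intro mult_mono) auto
    then show "\<bar>x i * W i j * y j\<bar> \<le> \<bar>W i j\<bar>" by (simp add: abs_mult)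
  qed
  finally show ?thesis .
qed

text \<open>Each constraint feeds one ingredient of the union bound: the norm bounds the variance of
  the form, the cap \<open>a\<close> makes the Chernoff parameter admissible, and the size
  \<open>m\<close> of the support limits the number of net points.\<close>

definition flat_ball :: "nat \<Rightarrow> real \<Rightarrow> nat \<Rightarrow> (nat \<Rightarrow> real) set" where
  "flat_ball N a m = {x. (\<Sum>i<N. (x i)\<^sup>2) \<le> 1 \<and> (\<forall>i<N. \<bar>x i\<bar> \<le> a) \<and> card {i\<in>{..<N}. x i \<noteq> 0} \<le> m}"

text \<open>The coordinates of a point are rounded towards zero to multiples of \<open>1 / (4 sqrt N)\<close>; this stays
  in the solid set \<open>flat_ball\<close> and leaves a remainder that is a quarter of another point of it, so
  that a bilinear form on the ball is at most twice its maximum over the net.\<close>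

definition flat_net :: "nat \<Rightarrow> real \<Rightarrow> nat \<Rightarrow> (nat \<Rightarrow> real) set" where
  "flat_net N a m = flat_ball N a m \<inter>
     (\<lambda>k i. of_int (k i) / (4 * sqrt N)) ` ({..<N} \<rightarrow>\<^sub>E (UNIV :: int set))"

lemma flat_ball_solid:
  assumes x: "x \<in> flat_ball N a m" and le: "\<And>i. i < N \<Longrightarrow> \<bar>x' i\<bar> \<le> \<bar>x i\<bar>"
  shows "x' \<in> flat_ball N a m"
proof -
  have "(\<Sum>i<N. (x' i)\<^sup>2) \<le> (\<Sum>i<N. (x i)\<^sup>2)"
    using le by (intro sum_mono) (auto simp: abs_le_square_iff)
  moreover have "card {i\<in>{..<N}. x' i \<noteq> 0} \<le> card {i\<in>{..<N}. x i \<noteq> 0}"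
  proof (intro card_mono)
    show "{i\<in>{..<N}. x' i \<noteq> 0} \<subseteq> {i\<in>{..<N}. x i \<noteq> 0}" using le by (auto dest: le)
  qed auto
  moreover have "\<bar>x' i\<bar> \<le> a" if "i < N" for i
    using le[OF that] x that by (auto simp: flat_ball_def intro: order_trans)
  ultimately show ?thesis using x unfolding flat_ball_def by auto
qed

lemma flat_ball_round:
  assumes N: "N > 0" and a: "1 / sqrt N \<le> a" and x: "x \<in> flat_ball N a m"
  obtains z r where "z \<in> flat_net N a m" "r \<in> flat_ball N a m" "\<And>i. i < N \<Longrightarrow> x i = z i + 1/4 * r i"
proof -
  define h where "h = 1 / (4 * sqrt N)"
  have h: "h > 0" using N by (simp add: h_def)
  define tr where "tr = (\<lambda>t::real. if t \<ge> 0 then \<lfloor>t\<rfloor> else \<lceil>t\<rceil>)"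
  have tr1: "\<bar>of_int (tr t)\<bar> \<le> \<bar>t\<bar>" "\<bar>t - of_int (tr t)\<bar> \<le> 1" "\<bar>t - of_int (tr t)\<bar> \<le> \<bar>t\<bar>" for t
    by (auto simp: tr_def) linarith+
  define k where "k = (\<lambda>i\<in>{..<N}. tr (x i / h))"
  define z where "z = (\<lambda>i. of_int (k i) / (4 * sqrt N))"
  define r where "r = (\<lambda>i. 4 * (x i - z i))"
  have zh: "z i = h * of_int (k i)" for i by (simp add: z_def h_def)
  have zi: "z i = h * of_int (tr (x i / h))" "x i = h * (x i / h)" if "i < N" for i
    using that h by (auto simp: zh k_def)
  have z1: "\<bar>z i\<bar> \<le> \<bar>x i\<bar>" if "i < N" for i
  proof -
    have "\<bar>z i\<bar> = h * \<bar>of_int (tr (x i / h))\<bar>" using zi[OF that] h by (simp add: abs_mult)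
    also have "\<dots> \<le> h * \<bar>x i / h\<bar>" using tr1(1)[of "x i / h"] h by (intro mult_left_mono) auto
    finally show ?thesis using h by simp
  qed
  have xz: "\<bar>x i - z i\<bar> = h * \<bar>x i / h - of_int (tr (x i / h))\<bar>" if "i < N" for i
  proof -
    have "x i - z i = h * (x i / h - of_int (tr (x i / h)))" using zi[OF that] h by (simp add: right_diff_distrib)
    then show ?thesis using h by (simp add: abs_mult)
  qed
  \<comment> \<open>The grid width is made for this bound: coordinates of \<open>r\<close> up to
    \<open>1 / sqrt N\<close> give norm at most 1, and the hypothesis on \<open>a\<close> turns the
    same bound into the cap.\<close>
  have r1: "\<bar>r i\<bar> \<le> 1 / sqrt N" if "i < N" for i
  proof -
    have "\<bar>x i - z i\<bar> \<le> h * 1" unfolding xz[OF that] using tr1 h by (intro mult_left_mono) auto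
    moreover have "\<bar>r i\<bar> = 4 * \<bar>x i - z i\<bar>" unfolding r_def by (subst abs_mult) simp
    ultimately show ?thesis using N by (simp add: h_def field_simps)
  qed
  have r0: "r i = 0" if "i < N" "x i = 0" for i
    using z1[OF that(1)] that by (simp add: r_def)
  have "(\<Sum>i<N. (r i)\<^sup>2) \<le> (\<Sum>i<N. (1 / sqrt N)\<^sup>2)"
    using r1 by (intro sum_mono) (subst abs_le_square_iff[symmetric], simp)
  also have "\<dots> = 1" using N by (simp add: power_divide)
  finally have rs: "(\<Sum>i<N. (r i)\<^sup>2) \<le> 1" .
  have "card {i\<in>{..<N}. r i \<noteq> 0} \<le> card {i\<in>{..<N}. x i \<noteq> 0}"
    using r0 by (intro card_mono) auto
  then have "r \<in> flat_ball N a m" using rs a x order_trans[OF r1 a] unfolding flat_ball_def by auto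
  moreover have "z \<in> flat_net N a m"
  proof -
    have "k \<in> {..<N} \<rightarrow>\<^sub>E UNIV" by (simp add: k_def)
    then have "z \<in> (\<lambda>k i. of_int (k i) / (4 * sqrt N)) ` ({..<N} \<rightarrow>\<^sub>E (UNIV :: int set))"
      unfolding z_def by (rule imageI)
    then show ?thesis using flat_ball_solid[OF x z1] by (simp add: flat_net_def)
  qed
  moreover have "x i = z i + 1/4 * r i" for i by (simp add: r_def field_simps)
  ultimately show thesis using that by blast
qed

text \<open>With \<open>S\<close> the set of values on the two balls, rounding both arguments gives
  \<open>Sup S \<le> t + Sup S / 4 + Sup S / 4\<close>, since each remainder is a quarter of a point
  of the same ball. Solving for \<open>Sup S\<close> gives \<open>2 * t\<close>.\<close>

lemma net_bilinear:
  assumes n: "n > 0" "1 / sqrt n \<le> a" and p: "p > 0" "1 / sqrt p \<le> b"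
    and net: "\<And>x y. x \<in> flat_net n a m \<Longrightarrow> y \<in> flat_net p b k \<Longrightarrow> \<bar>bilin n p W x y\<bar> \<le> t"
    and x: "x \<in> flat_ball n a m" and y: "y \<in> flat_ball p b k"
  shows "\<bar>bilin n p W x y\<bar> \<le> 2 * t"
proof -
  define S where "S = (\<lambda>(x, y). \<bar>bilin n p W x y\<bar>) ` (flat_ball n a m \<times> flat_ball p b k)"
  \<comment> \<open>Finiteness of the supremum is what allows it to be subtracted from both sides;
    the sum of all absolute entries is a bound good enough for that.\<close>
  have bdd: "bdd_above S"
  proof (rule bdd_aboveI)
    fix s assume "s \<in> S"
    then show "s \<le> (\<Sum>i<n. \<Sum>j<p. \<bar>W i j\<bar>)" unfolding S_def flat_ball_def by (auto intro: bilin_le_sum_abs)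
  qed
  have upper: "\<bar>bilin n p W x y\<bar> \<le> Sup S" if "x \<in> flat_ball n a m" "y \<in> flat_ball p b k" for x y
    by (rule cSup_upper[OF _ bdd]) (use that in \<open>auto simp: S_def\<close>)
  have ne: "S \<noteq> {}" using x y by (auto simp: S_def)
  have "Sup S \<le> t + Sup S / 2"
  proof (rule cSup_least[OF ne])
    fix s assume "s \<in> S"
    then obtain x y where x: "x \<in> flat_ball n a m" and y: "y \<in> flat_ball p b k" and s: "s = \<bar>bilin n p W x y\<bar>"
      by (auto simp: S_def)
    obtain z r where zr: "z \<in> flat_net n a m" "r \<in> flat_ball n a m" "\<And>i. i < n \<Longrightarrow> x i = z i + 1/4 * r i"
      by (rule flat_ball_round[OF n x]) blast
    obtain z' r' where zr': "z' \<in> flat_net p b k" "r' \<in> flat_ball p b k" "\<And>i. i < p \<Longrightarrow> y i = z' i + 1/4 * r' i"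
      by (rule flat_ball_round[OF p y]) blast
    have "bilin n p W x y = bilin n p W (\<lambda>i. z i + 1/4 * r i) y"
      by (rule bilin_cong) (use zr in auto)
    also have "\<dots> = bilin n p W z y + 1/4 * bilin n p W r y"
      by (simp only: bilin_add_left bilin_scale_left)
    also have "bilin n p W z y = bilin n p W z (\<lambda>j. z' j + 1/4 * r' j)"
      by (rule bilin_cong) (use zr' in auto)
    also have "\<dots> = bilin n p W z z' + 1/4 * bilin n p W z r'"
      by (simp only: bilin_add_right bilin_scale_right)
    finally have "s \<le> \<bar>bilin n p W z z'\<bar> + 1/4 * \<bar>bilin n p W z r'\<bar> + 1/4 * \<bar>bilin n p W r y\<bar>"
      unfolding s by linarith
    also have "\<dots> \<le> t + 1/4 * Sup S + 1/4 * Sup S"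
      using zr zr' y net upper by (intro add_mono mult_left_mono) (auto simp: flat_net_def)
    finally show "s \<le> t + Sup S / 2" by simp
  qed
  then show ?thesis using upper[OF x y] by linarith
qed

text \<open>Counting by exponential weights: every \<open>k\<close> in \<open>S\<close> has weight
  \<open>exp (R - (\<Sum>i<N. \<phi> (k i)))\<close> at least 1, and the sum of the weights over the
  whole box factorizes over the coordinates.\<close>

lemma card_PiE_int_weight:
  fixes \<phi> :: "int \<Rightarrow> real"
  assumes B: "finite B" and S: "S \<subseteq> {..<N} \<rightarrow>\<^sub>E B" and R: "\<And>k. k \<in> S \<Longrightarrow> (\<Sum>i<N. \<phi> (k i)) \<le> R"
  shows "card S \<le> exp R * (\<Sum>k\<in>B. exp (- \<phi> k)) ^ N"
proof -
  have fin: "finite ({..<N} \<rightarrow>\<^sub>E B)" using B by (intro finite_PiE) auto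
  have "real (card S) = (\<Sum>k\<in>S. 1)" by simp
  also have "\<dots> \<le> (\<Sum>k\<in>S. exp (R - (\<Sum>i<N. \<phi> (k i))))"
    using R by (intro sum_mono) auto
  also have "\<dots> \<le> (\<Sum>k\<in>{..<N} \<rightarrow>\<^sub>E B. exp (R - (\<Sum>i<N. \<phi> (k i))))"
    using S fin by (intro sum_mono2) auto
  also have "\<dots> = exp R * (\<Sum>k\<in>{..<N} \<rightarrow>\<^sub>E B. \<Prod>i<N. exp (- \<phi> (k i)))"
    by (simp add: sum_distrib_left sum_negf flip: exp_sum exp_add)
  also have "(\<Sum>k\<in>{..<N} \<rightarrow>\<^sub>E B. \<Prod>i<N. exp (- \<phi> (k i))) = (\<Prod>i<N. \<Sum>k\<in>B. exp (- \<phi> k))"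
    using B by (subst prod_sum_PiE) auto
  finally show ?thesis by simp
qed

text \<open>A net point is \<open>1 / (4 sqrt N)\<close> times an integer vector whose squares sum
  to at most \<open>16 N\<close>. Integers satisfy \<open>\<bar>k\<bar> \<le> k\<^sup>2\<close>, so
  \<open>16 N\<close> bounds the sum of absolute values too, and for these the weights
  \<open>exp (- \<bar>k\<bar>)\<close> form a geometric series.\<close>

lemma flat_net_coeffs:
  assumes N: "N > 0"
  obtains S where "S \<subseteq> {..<N} \<rightarrow>\<^sub>E {- (4 * int N)..4 * int N}" "\<And>k. k \<in> S \<Longrightarrow> (\<Sum>i<N. \<bar>real_of_int (k i)\<bar>) \<le> 16 * N"
    "\<And>k. k \<in> S \<Longrightarrow> card {i\<in>{..<N}. k i \<noteq> 0} \<le> m"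
    "flat_net N a m = (\<lambda>k i. of_int (k i) / (4 * sqrt N)) ` S"
proof -
  let ?f = "\<lambda>k i. of_int (k i) / (4 * sqrt N)"
  define S where "S = {k \<in> {..<N} \<rightarrow>\<^sub>E (UNIV :: int set). ?f k \<in> flat_ball N a m}"
  have sq: "(\<Sum>i<N. (real_of_int (k i))\<^sup>2) \<le> 16 * N" if "k \<in> S" for k
  proof -
    have "(\<Sum>i<N. (?f k i)\<^sup>2) \<le> 1" using that by (auto simp: S_def flat_ball_def)
    then have "(\<Sum>i<N. (real_of_int (k i))\<^sup>2) / (16 * N) \<le> 1"
      by (simp add: power_divide power_mult_distrib sum_divide_distrib)
    then show ?thesis using N by (simp add: field_simps)
  qed
  have sq_int: "\<bar>z\<bar> \<le> z\<^sup>2" for z :: int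
  proof -
    have "\<bar>z\<bar> * 1 \<le> \<bar>z\<bar> * \<bar>z\<bar>" by (cases "z = 0") (auto intro!: mult_left_mono simp del: abs_mult_self_eq)
    then show ?thesis by (simp only: power2_eq_square abs_mult_self_eq mult_1_right)
  qed
  have a1: "(\<Sum>i<N. \<bar>real_of_int (k i)\<bar>) \<le> 16 * N" if "k \<in> S" for k
  proof -
    have "\<bar>real_of_int (k i)\<bar> \<le> (real_of_int (k i))\<^sup>2" for i
      using sq_int[of "k i"] by (metis of_int_abs of_int_le_iff of_int_power)
    then have "(\<Sum>i<N. \<bar>real_of_int (k i)\<bar>) \<le> (\<Sum>i<N. (real_of_int (k i))\<^sup>2)" by (intro sum_mono)
    then show ?thesis using sq[OF that] by linarith
  qed
  have a2: "k i \<in> {- (4 * int N)..4 * int N}" if k: "k \<in> S" and i: "i < N" for k i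
  proof -
    have "(real_of_int (k i))\<^sup>2 \<le> (\<Sum>i<N. (real_of_int (k i))\<^sup>2)" using i by (intro member_le_sum) auto
    also have "\<dots> \<le> 16 * N" by (rule sq[OF k])
    also have "\<dots> \<le> 16 * (real N)\<^sup>2" using N by (simp add: power2_eq_square)
    also have "\<dots> = (4 * real N)\<^sup>2" by simp
    finally have "\<bar>real_of_int (k i)\<bar> \<le> 4 * real N" unfolding abs_le_square_iff[symmetric] by simp
    then show ?thesis by auto
  qed
  have a3: "card {i\<in>{..<N}. k i \<noteq> 0} \<le> m" if "k \<in> S" for k
  proof -
    have "{i\<in>{..<N}. k i \<noteq> 0} = {i\<in>{..<N}. ?f k i \<noteq> 0}" using N by auto
    then show ?thesis using that by (auto simp: S_def flat_ball_def)
  qed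
  show thesis
  proof (rule that[of S])
    show "S \<subseteq> {..<N} \<rightarrow>\<^sub>E {- (4 * int N)..4 * int N}"
      using a2 by (auto simp: S_def PiE_def Pi_def)
    show "flat_net N a m = ?f ` S" by (auto simp: flat_net_def S_def)
  qed (use a1 a3 in auto)
qed

lemma finite_flat_net: "N > 0 \<Longrightarrow> finite (flat_net N a m)"
proof -
  assume "N > 0"
  then obtain S where "S \<subseteq> {..<N} \<rightarrow>\<^sub>E {- (4 * int N)..4 * int N}" "flat_net N a m = (\<lambda>k i. of_int (k i) / (4 * sqrt N)) ` S"
    by (rule flat_net_coeffs[of N m a]) blast
  moreover have "finite ({..<N} \<rightarrow>\<^sub>E {- (4 * int N)..4 * int N})" by (intro finite_PiE) simp_all
  ultimately show ?thesis by (metis finite_imageI finite_subset)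
qed

text \<open>Subtracting \<open>4 * exp (- real M)\<close> makes the induction close: the two new
  terms are paid by the decrease of this correction, because \<open>exp 1 \<ge> 2\<close>.\<close>

lemma sum_exp_neg_abs_le: "(\<Sum>k\<in>{- int M..int M}. exp (- \<bar>real_of_int k\<bar>)) \<le> 7 - 4 * exp (- real M)"
proof (induction M)
  case (Suc M)
  have eq: "{- int (Suc M)..int (Suc M)} = insert (- int (Suc M)) (insert (int (Suc M)) {- int M..int M})" by auto
  have "(\<Sum>k\<in>{- int (Suc M)..int (Suc M)}. exp (- \<bar>real_of_int k\<bar>)) = 2 * exp (- real (Suc M)) + (\<Sum>k\<in>{- int M..int M}. exp (- \<bar>real_of_int k\<bar>))"
    unfolding eq by (subst sum.insert; simp)+
  also have "\<dots> \<le> 2 * exp (- real (Suc M)) + (7 - 4 * exp (- real M))" using Suc by simp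
  also have "\<dots> \<le> 7 - 4 * exp (- real (Suc M))"
  proof -
    have "exp (- real M) = exp 1 * exp (- real (Suc M))" by (simp flip: exp_add)
    moreover have "exp 1 \<ge> (2::real)" using exp_ge_add_one_self[of 1] by simp
    then have "exp 1 * exp (- real (Suc M)) \<ge> 2 * exp (- real (Suc M))" by (intro mult_right_mono) auto
    ultimately show ?thesis by (simp add: algebra_simps)
  qed
  finally show ?case .
qed auto

text \<open>The constant is 16 + 3: the sum of absolute coefficients contributes
  \<open>exp (16 N)\<close>, and the weight of one coordinate is at most
  \<open>7 \<le> exp 3\<close>.\<close>

lemma card_flat_net_full:
  assumes N: "N > 0"
  shows "real (card (flat_net N a m)) \<le> exp (19 * real N)"
proof -
  obtain S where S: "S \<subseteq> {..<N} \<rightarrow>\<^sub>E {- (4 * int N)..4 * int N}" "\<And>k. k \<in> S \<Longrightarrow> (\<Sum>i<N. \<bar>real_of_int (k i)\<bar>) \<le> 16 * N"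
    "flat_net N a m = (\<lambda>k i. of_int (k i) / (4 * sqrt N)) ` S"
    by (rule flat_net_coeffs[OF N, of m a]) blast
  have fin: "finite S" using S(1) by (rule finite_subset) (intro finite_PiE, simp_all)
  have "real (card (flat_net N a m)) \<le> real (card S)" unfolding S(3) using card_image_le[OF fin] by simp
  also have "\<dots> \<le> exp (16 * N) * (\<Sum>k\<in>{- (4 * int N)..4 * int N}. exp (- \<bar>real_of_int k\<bar>)) ^ N"
    by (rule card_PiE_int_weight) (use S in auto)
  also have "\<dots> \<le> exp (16 * N) * (exp 3) ^ N"
  proof (intro mult_left_mono power_mono)
    have "exp (3::real) \<ge> 7" using exp_lower_Taylor_quadratic[of 3] by simp
    then show "(\<Sum>k\<in>{- (4 * int N)..4 * int N}. exp (- \<bar>real_of_int k\<bar>)) \<le> exp 3"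
      using sum_exp_neg_abs_le[of "4 * N"] exp_gt_zero[of "- (4 * real N)"] by (simp del: exp_gt_zero)
  qed (auto intro: sum_nonneg)
  also have "\<dots> = exp (19 * real N)" by (simp add: exp_of_nat_mult[symmetric] exp_add[symmetric] algebra_simps)
  finally show ?thesis .
qed

text \<open>Each nonzero coefficient gets the weight \<open>exp (- L)\<close> with
  \<open>L = ln (8 N\<^sup>2)\<close>. The \<open>8 N\<close> nonzero integers in the range then
  weigh \<open>1 / N\<close> together, and \<open>(1 + 1 / N) ^ N \<le> exp 1\<close> gives the
  summand 1 in the exponent.\<close>

lemma card_flat_net_sparse:
  assumes N: "N > 0"
  shows "real (card (flat_net N a m)) \<le> exp (1 + m * ln (8 * (real N)\<^sup>2))"
proof -
  obtain S where S: "S \<subseteq> {..<N} \<rightarrow>\<^sub>E {- (4 * int N)..4 * int N}" "\<And>k. k \<in> S \<Longrightarrow> card {i\<in>{..<N}. k i \<noteq> 0} \<le> m"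
    "flat_net N a m = (\<lambda>k i. of_int (k i) / (4 * sqrt N)) ` S"
    by (rule flat_net_coeffs[OF N, of m a]) blast
  have fin: "finite S" using S(1) by (rule finite_subset) (intro finite_PiE, simp_all)
  define L where "L = ln (8 * (real N)\<^sup>2)"
  have "1 \<le> (real N)\<^sup>2" using N by (intro one_le_power) simp
  then have "1 \<le> 8 * (real N)\<^sup>2" by linarith
  then have L: "L \<ge> 0" "exp L = 8 * (real N)\<^sup>2" using N by (auto simp: L_def)
  let ?phi = "\<lambda>k::int. if k = 0 then 0 else L"
  have "real (card (flat_net N a m)) \<le> real (card S)" unfolding S(3) using card_image_le[OF fin] by simp
  also have "\<dots> \<le> exp (m * L) * (\<Sum>k\<in>{- (4 * int N)..4 * int N}. exp (- ?phi k)) ^ N"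
  proof (rule card_PiE_int_weight)
    fix k assume "k \<in> S"
    have "(\<Sum>i<N. ?phi (k i)) = (\<Sum>i\<in>{i\<in>{..<N}. k i \<noteq> 0}. L)"
      by (intro sum.mono_neutral_cong_right) auto
    also have "\<dots> \<le> m * L" using S(2)[OF \<open>k \<in> S\<close>] L by (simp add: mult_right_mono)
    finally show "(\<Sum>i<N. ?phi (k i)) \<le> m * L" .
  qed (use S in auto)
  also have "(\<Sum>k\<in>{- (4 * int N)..4 * int N}. exp (- ?phi k)) = 1 + 1 / N"
  proof -
    have "(\<Sum>k\<in>{- (4 * int N)..4 * int N}. exp (- ?phi k)) = 1 + (\<Sum>k\<in>{- (4 * int N)..4 * int N} - {0}. exp (- ?phi k))"
      by (subst sum.remove[of _ 0]) auto
    also have "(\<Sum>k\<in>{- (4 * int N)..4 * int N} - {0}. exp (- ?phi k)) = (\<Sum>k\<in>{- (4 * int N)..4 * int N} - {0}. exp (- L))"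
      by (intro sum.cong) auto
    also have "\<dots> = 8 * N * exp (- L)" by (simp add: card_Diff_singleton)
    also have "\<dots> = 1 / N" using N by (simp add: exp_minus L field_simps power2_eq_square)
    finally show ?thesis .
  qed
  also have "(1 + 1 / real N) ^ N \<le> exp (1 / N) ^ N"
    by (intro power_mono exp_ge_add_one_self) auto
  also have "exp (1 / real N) ^ N = exp 1" using N by (simp flip: exp_of_nat_mult)
  finally show ?thesis by (simp add: L_def exp_add mult.commute)
qed

section \<open>Norms of random arrays\<close>

text \<open>The variable with index \<open>j\<close> depends on the block \<open>{h j}\<close> or on
  the empty block, and functions of disjoint blocks are independent. With the constant 0 outside
  \<open>J'\<close>, one triangle of a symmetric array becomes an array with independent entries on
  the full square.\<close>

lemma (in prob_space) indep_vars_reindex_zero: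
  fixes X :: "'i \<Rightarrow> 'a \<Rightarrow> real" and F :: "'j \<Rightarrow> real \<Rightarrow> real"
  assumes ind: "indep_vars (\<lambda>_. borel) X I" and h: "inj_on h J'" "h ` J' \<subseteq> I"
    and F: "\<And>j. F j \<in> borel_measurable borel"
  shows "indep_vars (\<lambda>_. borel) (\<lambda>j \<omega>. if j \<in> J' then F j (X (h j) \<omega>) else 0) J"
proof -
  let ?K = "\<lambda>j. if j \<in> J' then {h j} else {}"
  have ind0: "indep_vars (\<lambda>j. PiM (?K j) (\<lambda>_. borel)) (\<lambda>j \<omega>. restrict (\<lambda>i. X i \<omega>) (?K j)) J"
    by (rule indep_vars_restrict[OF ind]) (use h in \<open>auto simp: disjoint_family_on_def inj_on_def\<close>)
  have "indep_vars (\<lambda>_. borel) (\<lambda>j \<omega>. (\<lambda>g. if j \<in> J' then F j (g (h j)) else 0) (restrict (\<lambda>i. X i \<omega>) (?K j))) J"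
  proof (rule indep_vars_compose2[OF ind0])
    fix j assume "j \<in> J"
    have "(\<lambda>g. F j (g (h j))) \<in> borel_measurable (PiM {h j} (\<lambda>_. borel))"
      using F[of j] by measurable
    then show "(\<lambda>g. if j \<in> J' then F j (g (h j)) else 0) \<in> borel_measurable (PiM (?K j) (\<lambda>_. borel))"
      by (cases "j \<in> J'") auto
  qed
  then show ?thesis by (rule indep_vars_cong[THEN iffD1, rotated -1]) auto
qed

lemma (in truncated_array) transposed: "truncated_array M (\<lambda>j i. W i j) p n K \<eta> s"
proof
  have "indep_vars (\<lambda>_. borel) (\<lambda>ji \<omega>. if ji \<in> {..<p} \<times> {..<n} then id (W (fst (prod.swap ji)) (snd (prod.swap ji)) \<omega>) else 0) ({..<p} \<times> {..<n})"
    by (rule indep_vars_reindex_zero[OF indep]) auto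
  then show "indep_vars (\<lambda>_. borel) (\<lambda>ij. W (snd ij) (fst ij)) ({..<p} \<times> {..<n})"
    by (rule indep_vars_cong[THEN iffD1, rotated -1]) auto
qed (use bounded mean second_moment K_pos eta_nonneg s_nonneg in auto)

lemma bilin_transpose: "bilin n p W x y = bilin p n (\<lambda>j i. W i j) y x"
  unfolding bilin_def by (subst sum.swap) (simp add: mult_ac)

text \<open>By Cauchy-Schwarz the form is at most the norm of the vector of the sums
  \<open>\<Sum>i<n. x i * W i j\<close>. Its square is a quadratic form in the Gram matrix of the
  rows, whose diagonal costs \<open>D\<close> and whose remaining entries cost \<open>Q\<close>
  times the squared \<open>l1\<close>-norm of \<open>x\<close>.\<close>

lemma bilin_le_Gram:
  assumes D: "\<And>i. i < n \<Longrightarrow> (\<Sum>j<p. (W i j)\<^sup>2) \<le> D"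
    and Q: "\<And>i k. i < n \<Longrightarrow> k < n \<Longrightarrow> i \<noteq> k \<Longrightarrow> \<bar>\<Sum>j<p. W i j * W k j\<bar> \<le> Q"
    and nn: "D \<ge> 0" "Q \<ge> 0"
    and x: "(\<Sum>i<n. (x i)\<^sup>2) \<le> 1" and y: "(\<Sum>j<p. (y j)\<^sup>2) \<le> 1"
    and c: "(\<Sum>i<n. \<bar>x i\<bar>) \<le> c"
  shows "\<bar>bilin n p W x y\<bar> \<le> sqrt (D + Q * c\<^sup>2)"
proof -
  let ?S = "\<lambda>j. \<Sum>i<n. x i * W i j"
  have "bilin n p W x y = (\<Sum>j<p. ?S j * y j)"
    unfolding bilin_def by (subst sum.swap) (simp add: sum_distrib_right)
  then have "(bilin n p W x y)\<^sup>2 \<le> (\<Sum>j<p. (?S j)\<^sup>2) * (\<Sum>j<p. (y j)\<^sup>2)"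
    by (simp add: Cauchy_Schwarz_ineq_sum)
  also have "\<dots> \<le> (\<Sum>j<p. (?S j)\<^sup>2) * 1"
    using y by (intro mult_left_mono sum_nonneg) auto
  also have "(\<Sum>j<p. (?S j)\<^sup>2) = (\<Sum>j<p. \<Sum>i<n. \<Sum>k<n. x i * x k * (W i j * W k j))"
    by (simp add: power2_eq_square sum_product mult_ac)
  also have "\<dots> = (\<Sum>i<n. \<Sum>k<n. x i * x k * (\<Sum>j<p. W i j * W k j))"
    by (subst sum.swap, rule sum.cong[OF refl], subst sum.swap) (simp add: sum_distrib_left)
  also have "\<dots> \<le> (\<Sum>i<n. \<Sum>k<n. (if k = i then D * (x i)\<^sup>2 else 0) + \<bar>x i\<bar> * \<bar>x k\<bar> * Q)"
  proof (intro sum_mono)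
    fix i k assume "i \<in> {..<n}" "k \<in> {..<n}"
    then have i: "i < n" and k: "k < n" by auto
    show "x i * x k * (\<Sum>j<p. W i j * W k j) \<le> (if k = i then D * (x i)\<^sup>2 else 0) + \<bar>x i\<bar> * \<bar>x k\<bar> * Q"
    proof (cases "k = i")
      case True
      have "(x i)\<^sup>2 * (\<Sum>j<p. (W i j)\<^sup>2) \<le> (x i)\<^sup>2 * D" using D[OF i] by (intro mult_left_mono) auto
      moreover have "0 \<le> \<bar>x i\<bar> * \<bar>x k\<bar> * Q" using nn by simp
      ultimately have "(x i)\<^sup>2 * (\<Sum>j<p. (W i j)\<^sup>2) \<le> (x i)\<^sup>2 * D + \<bar>x i\<bar> * \<bar>x k\<bar> * Q" by linarith
      then show ?thesis using True by (simp add: power2_eq_square mult_ac)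
    next
      case False
      have "x i * x k * (\<Sum>j<p. W i j * W k j) \<le> \<bar>x i * x k\<bar> * \<bar>\<Sum>j<p. W i j * W k j\<bar>"
        by (metis abs_ge_self abs_mult)
      also have "\<dots> \<le> \<bar>x i * x k\<bar> * Q" using Q[OF i k] False by (intro mult_left_mono) auto
      finally show ?thesis using False by (simp add: abs_mult)
    qed
  qed
  also have "\<dots> = D * (\<Sum>i<n. (x i)\<^sup>2) + (\<Sum>i<n. \<bar>x i\<bar>) * (\<Sum>i<n. \<bar>x i\<bar>) * Q"
  proof -
    have "(\<Sum>i<n. \<Sum>k<n. \<bar>x i\<bar> * \<bar>x k\<bar> * Q) = (\<Sum>i<n. \<bar>x i\<bar>) * (\<Sum>i<n. \<bar>x i\<bar>) * Q"
      unfolding sum_product by (simp add: sum_distrib_right)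
    then show ?thesis by (simp add: sum.distrib sum_distrib_left)
  qed
  also have "\<dots> \<le> D * 1 + c * c * Q"
    using c x nn by (intro add_mono mult_left_mono mult_right_mono mult_mono sum_nonneg) (auto intro: order_trans[OF sum_nonneg c])
  finally have "(bilin n p W x y)\<^sup>2 \<le> D + Q * c\<^sup>2" by (simp add: power2_eq_square mult_ac)
  then show ?thesis by (metis real_sqrt_abs real_sqrt_le_iff)
qed

text \<open>Both vectors are cut into entries of size at most \<open>a\<close>, between \<open>a\<close> and \<open>b\<close>, and above \<open>b\<close>.
  If one of the vectors has only entries up to \<open>a\<close>, the summands are small enough for a union bound
  over full nets. Two middle parts have at most \<open>m\<close> nonzero entries, hence much smaller nets. A
  vector of large entries has \<open>l1\<close>-norm at most \<open>1 / b\<close> and is handled by the Gram matrix.\<close>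

lemma bilin_three_levels:
  assumes a: "0 < a" "a \<le> b" and m: "1 / a\<^sup>2 \<le> real m"
    and H1: "\<And>x y. x \<in> flat_ball n a n \<Longrightarrow> y \<in> flat_ball p b p \<Longrightarrow> \<bar>bilin n p W x y\<bar> \<le> T"
    and H2: "\<And>x y. x \<in> flat_ball n b n \<Longrightarrow> y \<in> flat_ball p a p \<Longrightarrow> \<bar>bilin n p W x y\<bar> \<le> T"
    and H3: "\<And>x y. x \<in> flat_ball n b m \<Longrightarrow> y \<in> flat_ball p b m \<Longrightarrow> \<bar>bilin n p W x y\<bar> \<le> T"
    and D: "\<And>i. i < n \<Longrightarrow> (\<Sum>j<p. (W i j)\<^sup>2) \<le> D"
    and Q: "\<And>i k. i < n \<Longrightarrow> k < n \<Longrightarrow> i \<noteq> k \<Longrightarrow> \<bar>\<Sum>j<p. W i j * W k j\<bar> \<le> Q"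
    and D': "\<And>j. j < p \<Longrightarrow> (\<Sum>i<n. (W i j)\<^sup>2) \<le> D"
    and Q': "\<And>j k. j < p \<Longrightarrow> k < p \<Longrightarrow> j \<noteq> k \<Longrightarrow> \<bar>\<Sum>i<n. W i j * W i k\<bar> \<le> Q"
    and nn: "D \<ge> 0" "Q \<ge> 0"
    and x: "(\<Sum>i<n. (x i)\<^sup>2) \<le> 1" and y: "(\<Sum>j<p. (y j)\<^sup>2) \<le> 1"
  shows "\<bar>bilin n p W x y\<bar> \<le> 3 * T + 2 * sqrt (D + Q / b\<^sup>2)"
proof -
  have b: "b > 0" using a by simp
  define lo where "lo = (\<lambda>(z::nat \<Rightarrow> real) i. if \<bar>z i\<bar> \<le> a then z i else 0)"
  define mid where "mid = (\<lambda>(z::nat \<Rightarrow> real) i. if a < \<bar>z i\<bar> \<and> \<bar>z i\<bar> \<le> b then z i else 0)"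
  define hi where "hi = (\<lambda>(z::nat \<Rightarrow> real) i. if \<bar>z i\<bar> \<le> b then 0 else z i)"
  define lm where "lm = (\<lambda>(z::nat \<Rightarrow> real) i. lo z i + mid z i)"
  have split: "z = (\<lambda>i. lm z i + hi z i)" for z
    using a by (auto simp: lm_def lo_def mid_def hi_def)
  have le: "\<bar>lo z i\<bar> \<le> \<bar>z i\<bar>" "\<bar>mid z i\<bar> \<le> \<bar>z i\<bar>" "\<bar>hi z i\<bar> \<le> \<bar>z i\<bar>" "\<bar>lm z i\<bar> \<le> \<bar>z i\<bar>" for z i
    by (auto simp: lm_def lo_def mid_def hi_def)
  have sq: "(\<Sum>i<N. (g i)\<^sup>2) \<le> 1" if "\<And>i. \<bar>g i\<bar> \<le> \<bar>z i\<bar>" "(\<Sum>i<N. (z i)\<^sup>2) \<le> 1" for g z :: "nat \<Rightarrow> real" and N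
  proof -
    have "(\<Sum>i<N. (g i)\<^sup>2) \<le> (\<Sum>i<N. (z i)\<^sup>2)" using that by (intro sum_mono) (auto simp: abs_le_square_iff)
    then show ?thesis using that by linarith
  qed
  have sqs: "(\<Sum>i<N. (lo z i)\<^sup>2) \<le> 1" "(\<Sum>i<N. (mid z i)\<^sup>2) \<le> 1" "(\<Sum>i<N. (hi z i)\<^sup>2) \<le> 1" "(\<Sum>i<N. (lm z i)\<^sup>2) \<le> 1"
    if "(\<Sum>i<N. (z i)\<^sup>2) \<le> 1" for z N
    using sq[of "lo z" z N] sq[of "mid z" z N] sq[of "hi z" z N] sq[of "lm z" z N] le that by auto
  have cardN: "card {i \<in> {..<N}. P i} \<le> N" for N and P :: "nat \<Rightarrow> bool"
    by (rule order_trans[OF card_mono[of "{..<N}"]]) auto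
  have bds: "\<bar>lo z i\<bar> \<le> a" "\<bar>lm z i\<bar> \<le> b" for z i
    using a by (auto simp: lo_def lm_def mid_def)
  have lo: "lo z \<in> flat_ball N a N" if "(\<Sum>i<N. (z i)\<^sup>2) \<le> 1" for z N
    unfolding flat_ball_def by (intro CollectI conjI allI impI sqs(1)[OF that] bds cardN)
  have lm: "lm z \<in> flat_ball N b N" if "(\<Sum>i<N. (z i)\<^sup>2) \<le> 1" for z N
    unfolding flat_ball_def by (intro CollectI conjI allI impI sqs(4)[OF that] bds cardN)
  have mid: "mid z \<in> flat_ball N b m" if z: "(\<Sum>i<N. (z i)\<^sup>2) \<le> 1" for z N
  proof -
    let ?S = "{i \<in> {..<N}. mid z i \<noteq> 0}"
    have "card ?S * a\<^sup>2 = (\<Sum>i\<in>?S. a\<^sup>2)" by simp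
    also have "\<dots> \<le> (\<Sum>i\<in>?S. (z i)\<^sup>2)"
      using a by (intro sum_mono) (auto simp: mid_def abs_le_square_iff[symmetric] split: if_splits)
    also have "\<dots> \<le> (\<Sum>i<N. (z i)\<^sup>2)" by (intro sum_mono2) auto
    finally have "card ?S * a\<^sup>2 \<le> 1" using z by simp
    then have "real (card ?S) \<le> 1 / a\<^sup>2" using a by (simp add: field_simps)
    then have "card ?S \<le> m" using m by linarith
    then show ?thesis using sqs(2)[OF z] b by (auto simp: flat_ball_def) (auto simp: mid_def)
  qed
  have hi: "(\<Sum>i<N. \<bar>hi z i\<bar>) \<le> 1 / b" if z: "(\<Sum>i<N. (z i)\<^sup>2) \<le> 1" for z N
  proof -
    have "\<bar>hi z i\<bar> \<le> (z i)\<^sup>2 / b" for i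
    proof (cases "\<bar>z i\<bar> \<le> b")
      case False
      then have "b * \<bar>z i\<bar> \<le> \<bar>z i\<bar> * \<bar>z i\<bar>" by (intro mult_right_mono) auto
      then show ?thesis using False b by (simp add: hi_def field_simps power2_eq_square)
    qed (use b in \<open>simp add: hi_def\<close>)
    then have "(\<Sum>i<N. \<bar>hi z i\<bar>) \<le> (\<Sum>i<N. (z i)\<^sup>2 / b)" by (intro sum_mono)
    also have "\<dots> \<le> 1 / b" using z b by (simp add: sum_divide_distrib[symmetric] divide_right_mono)
    finally show ?thesis .
  qed
  \<comment> \<open>The nine pairs of levels are gathered into five forms: low against low or
    middle, middle against low, middle against middle, low or middle against high, and high against
    everything.\<close>
  have "bilin n p W x y = bilin n p W (\<lambda>i. lm x i + hi x i) y" using split[of x] by simp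
  also have "\<dots> = bilin n p W (lm x) y + bilin n p W (hi x) y" by (rule bilin_add_left)
  also have "bilin n p W (lm x) y = bilin n p W (lm x) (\<lambda>i. lm y i + hi y i)" using split[of y] by simp
  also have "\<dots> = bilin n p W (\<lambda>i. lo x i + mid x i) (lm y) + bilin n p W (lm x) (hi y)"
    unfolding bilin_add_right by (simp add: lm_def)
  also have "bilin n p W (\<lambda>i. lo x i + mid x i) (lm y) = bilin n p W (lo x) (lm y) + bilin n p W (mid x) (\<lambda>i. lo y i + mid y i)"
    unfolding bilin_add_left by (simp add: lm_def)
  also have "bilin n p W (mid x) (\<lambda>i. lo y i + mid y i) = bilin n p W (mid x) (lo y) + bilin n p W (mid x) (mid y)"
    by (rule bilin_add_right)
  finally have eq: "bilin n p W x y = bilin n p W (lo x) (lm y) + bilin n p W (mid x) (lo y) + bilin n p W (mid x) (mid y)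
      + bilin n p W (lm x) (hi y) + bilin n p W (hi x) y" by simp
  have "mid x \<in> flat_ball n b n" using mid[OF x] cardN by (auto simp: flat_ball_def)
  then have b1: "\<bar>bilin n p W (lo x) (lm y)\<bar> \<le> T" "\<bar>bilin n p W (mid x) (lo y)\<bar> \<le> T" "\<bar>bilin n p W (mid x) (mid y)\<bar> \<le> T"
    using H1 H2 H3 lo lm mid x y by auto
  have b2: "\<bar>bilin n p W (hi x) y\<bar> \<le> sqrt (D + Q * (1 / b)\<^sup>2)"
    by (rule bilin_le_Gram[OF D Q nn sqs(3)[OF x] y hi[OF x]])
  have b3: "\<bar>bilin n p W (lm x) (hi y)\<bar> \<le> sqrt (D + Q * (1 / b)\<^sup>2)"
    unfolding bilin_transpose[of n p W]
    by (rule bilin_le_Gram[OF D' Q' nn sqs(3)[OF y] sqs(4)[OF x] hi[OF y]])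
  show ?thesis unfolding eq using b1 b2 b3 by (simp add: power_divide)
qed

context truncated_array
begin

lemma measurable_bilin [measurable]: "(\<lambda>\<omega>. bilin n p (\<lambda>i j. W i j \<omega>) x y) \<in> borel_measurable M"
  unfolding bilin_def by measurable

text \<open>Union bound over the product of the nets, with \<open>R\<close> a bound for the
  logarithm of its size. Flatness enters only through \<open>a * b\<close>, the largest product of
  coordinates; passing from the nets to the balls doubles \<open>t\<close>.\<close>

lemma net_event:
  assumes np: "n > 0" "p > 0" "1 / sqrt n \<le> a" "1 / sqrt p \<le> b" and ab: "a \<ge> 0" "b \<ge> 0"
    and l: "l > 0" "l * K * (a * b) \<le> 1"
    and R: "real (card (flat_net n a m)) * real (card (flat_net p b k)) \<le> exp R"
  obtains B where "B \<in> events" "prob B \<le> 2 * exp (R - l * t + l * (real n * real p * \<eta>) + l\<^sup>2 * s)"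
    "\<And>\<omega> x y. \<omega> \<in> space M - B \<Longrightarrow> x \<in> flat_ball n a m \<Longrightarrow> y \<in> flat_ball p b k \<Longrightarrow> \<bar>bilin n p (\<lambda>i j. W i j \<omega>) x y\<bar> \<le> 2 * t"
proof
  let ?A = "\<lambda>x y. {\<omega>\<in>space M. \<bar>bilin n p (\<lambda>i j. W i j \<omega>) x y\<bar> \<ge> t}"
  let ?N = "flat_net n a m \<times> flat_net p b k"
  let ?B = "\<Union>xy\<in>?N. ?A (fst xy) (snd xy)"
  have fin: "finite ?N" using np by (intro finite_cartesian_product finite_flat_net)
  show ev: "?B \<in> events" using fin by (intro sets.finite_UN) (auto, measurable)
  have each: "prob (?A (fst xy) (snd xy)) \<le> 2 * exp (- l * t + l * (real n * real p * \<eta>) + l\<^sup>2 * s)" if xy: "xy \<in> ?N" for xy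
  proof -
    obtain x y where [simp]: "xy = (x, y)" by (cases xy)
    have x: "x \<in> flat_ball n a m" and y: "y \<in> flat_ball p b k" using xy by (auto simp: flat_net_def)
    have "prob {\<omega>\<in>space M. \<bar>\<Sum>i<n. \<Sum>j<p. x i * W i j \<omega> * y j\<bar> \<ge> t} \<le> 2 * exp (- l * t + l * (real n * real p * \<eta>) + l\<^sup>2 * s)"
    proof (rule bilinear_tail[OF _ _ l(1)])
      fix i j assume "i < n" "j < p"
      then have "\<bar>x i\<bar> * \<bar>y j\<bar> \<le> a * b" using x y ab by (intro mult_mono) (auto simp: flat_ball_def)
      then have "l * K * \<bar>x i * y j\<bar> \<le> l * K * (a * b)"
        using l K_pos by (intro mult_left_mono) (auto simp: abs_mult)
      then show "l * K * \<bar>x i * y j\<bar> \<le> 1" using l by linarith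
    qed (use x y in \<open>auto simp: flat_ball_def\<close>)
    then show ?thesis by (simp add: bilin_def)
  qed
  have "prob ?B \<le> (\<Sum>xy\<in>?N. prob (?A (fst xy) (snd xy)))"
    using fin by (intro measure_UNION_le) measurable
  also have "\<dots> \<le> (\<Sum>xy\<in>?N. 2 * exp (- l * t + l * (real n * real p * \<eta>) + l\<^sup>2 * s))"
    by (intro sum_mono each)
  also have "\<dots> = (real (card (flat_net n a m)) * real (card (flat_net p b k))) * (2 * exp (- l * t + l * (real n * real p * \<eta>) + l\<^sup>2 * s))"
    by (simp add: card_cartesian_product)
  also have "\<dots> \<le> exp R * (2 * exp (- l * t + l * (real n * real p * \<eta>) + l\<^sup>2 * s))"
    by (intro mult_right_mono R) auto
  also have "\<dots> = 2 * exp (R - l * t + l * (real n * real p * \<eta>) + l\<^sup>2 * s)"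
    by (simp add: exp_add[symmetric] algebra_simps)
  finally show "prob ?B \<le> 2 * exp (R - l * t + l * (real n * real p * \<eta>) + l\<^sup>2 * s)" .
  fix \<omega> x y assume w: "\<omega> \<in> space M - ?B" and "x \<in> flat_ball n a m" "y \<in> flat_ball p b k"
  then show "\<bar>bilin n p (\<lambda>i j. W i j \<omega>) x y\<bar> \<le> 2 * t"
  proof (intro net_bilinear[OF np(1,3,2,4)])
    fix x y assume "x \<in> flat_net n a m" "y \<in> flat_net p b k"
    then have "(x, y) \<in> ?N" by simp
    with w show "\<bar>bilin n p (\<lambda>i j. W i j \<omega>) x y\<bar> \<le> t" by force
  qed auto
qed

lemma Gram_event:
  assumes l: "l > 0" "l * K\<^sup>2 \<le> 1"
  obtains B where "B \<in> events"
    "prob B \<le> real n * exp ((- D + 2 * real p * s) / K\<^sup>2) + (real n)\<^sup>2 * (2 * exp (- l * Q + l * (real p * \<eta>\<^sup>2) + l\<^sup>2 * (real p * s\<^sup>2)))"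
    "\<And>\<omega> i. \<omega> \<in> space M - B \<Longrightarrow> i < n \<Longrightarrow> (\<Sum>j<p. (W i j \<omega>)\<^sup>2) \<le> D"
    "\<And>\<omega> i k. \<omega> \<in> space M - B \<Longrightarrow> i < n \<Longrightarrow> k < n \<Longrightarrow> i \<noteq> k \<Longrightarrow> \<bar>\<Sum>j<p. W i j \<omega> * W k j \<omega>\<bar> \<le> Q"
proof
  let ?A = "\<lambda>i. {\<omega>\<in>space M. (\<Sum>j<p. (W i j \<omega>)\<^sup>2) \<ge> D}"
  let ?C = "\<lambda>ik. {\<omega>\<in>space M. \<bar>\<Sum>j<p. W (fst ik) j \<omega> * W (snd ik) j \<omega>\<bar> \<ge> Q}"
  let ?I = "{ik\<in>{..<n} \<times> {..<n}. fst ik \<noteq> snd ik}"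
  let ?B1 = "\<Union>i\<in>{..<n}. ?A i" and ?B2 = "\<Union>ik\<in>?I. ?C ik"
  have m1: "?A i \<in> events" if "i < n" for i using that by measurable
  have m2: "?C ik \<in> events" if "ik \<in> ?I" for ik
  proof -
    have "fst ik < n" "snd ik < n" using that by auto
    then show ?thesis by measurable
  qed
  have B1: "?B1 \<in> events" using m1 by (intro sets.finite_UN) auto
  have fin: "finite ?I" by (rule finite_subset[of _ "{..<n} \<times> {..<n}"]) auto
  have B2: "?B2 \<in> events" by (rule sets.finite_UN[OF fin m2])
  show "?B1 \<union> ?B2 \<in> events" using B1 B2 by auto
  have cardI: "card ?I \<le> n\<^sup>2"
    using card_mono[of "{..<n} \<times> {..<n}" ?I] by (auto simp: power2_eq_square)
  have "prob (?B1 \<union> ?B2) \<le> prob ?B1 + prob ?B2" by (intro measure_Un_le B1 B2)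
  also have "prob ?B1 \<le> (\<Sum>i<n. prob (?A i))" using m1 by (intro measure_UNION_le) auto
  also have "\<dots> \<le> (\<Sum>i<n. exp ((- D + 2 * real p * s) / K\<^sup>2))" by (intro sum_mono row_tail) auto
  also have "prob ?B2 \<le> (\<Sum>ik\<in>?I. prob (?C ik))" by (rule measure_UNION_le[OF fin m2])
  also have "\<dots> \<le> (\<Sum>ik\<in>?I. 2 * exp (- l * Q + l * (real p * \<eta>\<^sup>2) + l\<^sup>2 * (real p * s\<^sup>2)))"
    by (intro sum_mono pair_tail l) auto
  also have "\<dots> \<le> (real n)\<^sup>2 * (2 * exp (- l * Q + l * (real p * \<eta>\<^sup>2) + l\<^sup>2 * (real p * s\<^sup>2)))"
    using cardI by (simp add: mult_right_mono flip: of_nat_power)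
  finally show "prob (?B1 \<union> ?B2) \<le> real n * exp ((- D + 2 * real p * s) / K\<^sup>2) + (real n)\<^sup>2 * (2 * exp (- l * Q + l * (real p * \<eta>\<^sup>2) + l\<^sup>2 * (real p * s\<^sup>2)))"
    by simp
  fix \<omega> i assume "\<omega> \<in> space M - (?B1 \<union> ?B2)" "i < n"
  then have "\<not> D \<le> (\<Sum>j<p. (W i j \<omega>)\<^sup>2)" by blast
  then show "(\<Sum>j<p. (W i j \<omega>)\<^sup>2) \<le> D" by simp
next
  let ?A = "\<lambda>i. {\<omega>\<in>space M. (\<Sum>j<p. (W i j \<omega>)\<^sup>2) \<ge> D}"
  let ?C = "\<lambda>ik. {\<omega>\<in>space M. \<bar>\<Sum>j<p. W (fst ik) j \<omega> * W (snd ik) j \<omega>\<bar> \<ge> Q}"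
  let ?I = "{ik\<in>{..<n} \<times> {..<n}. fst ik \<noteq> snd ik}"
  let ?B1 = "\<Union>i\<in>{..<n}. ?A i" and ?B2 = "\<Union>ik\<in>?I. ?C ik"
  fix \<omega> i k assume w: "\<omega> \<in> space M - (?B1 \<union> ?B2)" and ik: "i < n" "k < n" "i \<noteq> k"
  have "(i, k) \<in> ?I" using ik by simp
  then have "\<omega> \<notin> ?C (i, k)" using w by blast
  then show "\<bar>\<Sum>j<p. W i j \<omega> * W k j \<omega>\<bar> \<le> Q" using w by auto
qed

text \<open>Each Chernoff parameter is limited by its own part: \<open>l1\<close> by products of a
  flat vector with one capped by \<open>b\<close> (full nets), \<open>l2\<close> by products of two
  middle parts (sparse nets), \<open>l3\<close> by products of two entries of the array. The three
  bounds \<open>2 * t\<close> from the nets add up to \<open>6 * t\<close>.\<close>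

lemma norm_event:
  assumes np: "n > 0" "p > 0" and a: "1 / sqrt n \<le> a" "1 / sqrt p \<le> a" "a \<le> b" and m: "1 / a\<^sup>2 \<le> real m"
    and l1: "l1 > 0" "l1 * K * (a * b) \<le> 1" and l2: "l2 > 0" "l2 * K * (b * b) \<le> 1"
    and l3: "l3 > 0" "l3 * K\<^sup>2 \<le> 1" and nn: "D \<ge> 0" "Q \<ge> 0"
  obtains B where "B \<in> events"
    "prob B \<le> 4 * exp (19 * real n + 19 * real p - l1 * t + l1 * (real n * real p * \<eta>) + l1\<^sup>2 * s)
      + 2 * exp ((1 + real m * ln (8 * (real n)\<^sup>2)) + (1 + real m * ln (8 * (real p)\<^sup>2)) - l2 * t + l2 * (real n * real p * \<eta>) + l2\<^sup>2 * s)
      + (real n * exp ((- D + 2 * real p * s) / K\<^sup>2) + (real n)\<^sup>2 * (2 * exp (- l3 * Q + l3 * (real p * \<eta>\<^sup>2) + l3\<^sup>2 * (real p * s\<^sup>2))))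
      + (real p * exp ((- D + 2 * real n * s) / K\<^sup>2) + (real p)\<^sup>2 * (2 * exp (- l3 * Q + l3 * (real n * \<eta>\<^sup>2) + l3\<^sup>2 * (real n * s\<^sup>2))))"
    "\<And>\<omega> x y. \<omega> \<in> space M - B \<Longrightarrow> (\<Sum>i<n. (x i)\<^sup>2) \<le> (1::real) \<Longrightarrow> (\<Sum>j<p. (y j)\<^sup>2) \<le> (1::real) \<Longrightarrow>
       \<bar>bilin n p (\<lambda>i j. W i j \<omega>) x y\<bar> \<le> 6 * t + 2 * sqrt (D + Q / b\<^sup>2)"
proof -
  interpret T: truncated_array M "\<lambda>j i. W i j" p n K \<eta> s by (rule transposed)
  have a0: "a > 0" using a(1) np(1) by (intro less_le_trans[OF _ a(1)]) simp
  have b: "1 / sqrt n \<le> b" "1 / sqrt p \<le> b" "a \<ge> 0" "b \<ge> 0" using a a0 by auto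
  have full: "real (card (flat_net n a' n)) * real (card (flat_net p b' p)) \<le> exp (19 * real n + 19 * real p)" for a' b'
    unfolding exp_add by (intro mult_mono card_flat_net_full np) auto
  have sparse: "real (card (flat_net n a' m)) * real (card (flat_net p b' m)) \<le> exp ((1 + real m * ln (8 * (real n)\<^sup>2)) + (1 + real m * ln (8 * (real p)\<^sup>2)))" for a' b'
    unfolding exp_add[of "1 + real m * ln (8 * (real n)\<^sup>2)"] by (intro mult_mono card_flat_net_sparse np) auto
  have l1': "l1 * K * (b * a) \<le> 1" using l1(2) by (simp add: mult_ac)
  obtain B1 where B1: "B1 \<in> events" "prob B1 \<le> 2 * exp (19 * real n + 19 * real p - l1 * t + l1 * (real n * real p * \<eta>) + l1\<^sup>2 * s)"
    "\<And>\<omega> x y. \<omega> \<in> space M - B1 \<Longrightarrow> x \<in> flat_ball n a n \<Longrightarrow> y \<in> flat_ball p b p \<Longrightarrow> \<bar>bilin n p (\<lambda>i j. W i j \<omega>) x y\<bar> \<le> 2 * t"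
    by (rule net_event[OF np a(1) b(2) b(3,4) l1 full]) blast
  obtain B2 where B2: "B2 \<in> events" "prob B2 \<le> 2 * exp (19 * real n + 19 * real p - l1 * t + l1 * (real n * real p * \<eta>) + l1\<^sup>2 * s)"
    "\<And>\<omega> x y. \<omega> \<in> space M - B2 \<Longrightarrow> x \<in> flat_ball n b n \<Longrightarrow> y \<in> flat_ball p a p \<Longrightarrow> \<bar>bilin n p (\<lambda>i j. W i j \<omega>) x y\<bar> \<le> 2 * t"
    by (rule net_event[OF np b(1) a(2) b(4,3) l1(1) l1' full]) blast
  obtain B3 where B3: "B3 \<in> events" "prob B3 \<le> 2 * exp ((1 + real m * ln (8 * (real n)\<^sup>2)) + (1 + real m * ln (8 * (real p)\<^sup>2)) - l2 * t + l2 * (real n * real p * \<eta>) + l2\<^sup>2 * s)"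
    "\<And>\<omega> x y. \<omega> \<in> space M - B3 \<Longrightarrow> x \<in> flat_ball n b m \<Longrightarrow> y \<in> flat_ball p b m \<Longrightarrow> \<bar>bilin n p (\<lambda>i j. W i j \<omega>) x y\<bar> \<le> 2 * t"
    by (rule net_event[OF np b(1,2) b(4,4) l2 sparse]) blast
  obtain B4 where B4: "B4 \<in> events"
    "prob B4 \<le> real n * exp ((- D + 2 * real p * s) / K\<^sup>2) + (real n)\<^sup>2 * (2 * exp (- l3 * Q + l3 * (real p * \<eta>\<^sup>2) + l3\<^sup>2 * (real p * s\<^sup>2)))"
    "\<And>\<omega> i. \<omega> \<in> space M - B4 \<Longrightarrow> i < n \<Longrightarrow> (\<Sum>j<p. (W i j \<omega>)\<^sup>2) \<le> D"
    "\<And>\<omega> i k. \<omega> \<in> space M - B4 \<Longrightarrow> i < n \<Longrightarrow> k < n \<Longrightarrow> i \<noteq> k \<Longrightarrow> \<bar>\<Sum>j<p. W i j \<omega> * W k j \<omega>\<bar> \<le> Q"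
    by (rule Gram_event[OF l3]) blast
  obtain B5 where B5: "B5 \<in> events"
    "prob B5 \<le> real p * exp ((- D + 2 * real n * s) / K\<^sup>2) + (real p)\<^sup>2 * (2 * exp (- l3 * Q + l3 * (real n * \<eta>\<^sup>2) + l3\<^sup>2 * (real n * s\<^sup>2)))"
    "\<And>\<omega> j. \<omega> \<in> space M - B5 \<Longrightarrow> j < p \<Longrightarrow> (\<Sum>i<n. (W i j \<omega>)\<^sup>2) \<le> D"
    "\<And>\<omega> j k. \<omega> \<in> space M - B5 \<Longrightarrow> j < p \<Longrightarrow> k < p \<Longrightarrow> j \<noteq> k \<Longrightarrow> \<bar>\<Sum>i<n. W i j \<omega> * W i k \<omega>\<bar> \<le> Q"
    by (rule T.Gram_event[OF l3]) blast
  let ?B = "B1 \<union> B2 \<union> B3 \<union> B4 \<union> B5"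
  have ev: "?B \<in> events" using B1 B2 B3 B4 B5 by auto
  have "prob ?B \<le> prob B1 + prob B2 + prob B3 + prob B4 + prob B5"
    by (intro order_trans[OF measure_Un_le] add_right_mono sets.Un B1 B2 B3 B4 B5 order_refl)
  note P = order_trans[OF this add_mono[OF add_mono[OF add_mono[OF add_mono[OF B1(2) B2(2)] B3(2)] B4(2)] B5(2)]]
  have bd: "\<bar>bilin n p (\<lambda>i j. W i j \<omega>) x y\<bar> \<le> 6 * t + 2 * sqrt (D + Q / b\<^sup>2)"
    if w: "\<omega> \<in> space M - ?B" and xy: "(\<Sum>i<n. (x i)\<^sup>2) \<le> 1" "(\<Sum>j<p. (y j)\<^sup>2) \<le> 1" for \<omega> x y
  proof -
    have "\<bar>bilin n p (\<lambda>i j. W i j \<omega>) x y\<bar> \<le> 3 * (2 * t) + 2 * sqrt (D + Q / b\<^sup>2)"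
      by (rule bilin_three_levels[OF a0 a(3) m B1(3) B2(3) B3(3) B4(3) B4(4) B5(3) B5(4) nn xy]) (use w in auto)
    then show ?thesis by simp
  qed
  show thesis
    by (rule that[OF ev _ bd], rule order_trans[OF P], linarith)
qed

end

section \<open>Truncation and almost sure bounds along the sequence of arrays\<close>

lemma power_le_one_plus_power:
  fixes x :: real
  assumes "0 \<le> x" "k \<le> m"
  shows "x ^ k \<le> 1 + x ^ m"
proof (cases "x \<le> 1")
  case True
  have "x ^ k \<le> 1" using assms(1) True by (rule power_le_one)
  moreover have "0 \<le> x ^ m" using assms(1) by (rule zero_le_power)
  ultimately show ?thesis by linarith
next
  case False
  then have "x ^ k \<le> x ^ m" using assms(2) by (intro power_increasing) auto
  then show ?thesis by linarith
qed

text \<open>Where \<open>\<bar>W\<bar>\<close> exceeds \<open>K\<close>, it is at most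
  \<open>\<bar>W\<bar> ^ Suc N / K ^ N\<close>; as the mean of \<open>W\<close> is zero, this bounds
  the mean after truncation. The probability that any entry is changed is bounded by Markov's
  inequality for the same moment, which gains one more factor \<open>1 / K\<close>.\<close>

lemma (in prob_space) truncation:
  fixes W :: "nat \<Rightarrow> nat \<Rightarrow> 'a \<Rightarrow> real"
  assumes ind: "indep_vars (\<lambda>_. borel) (\<lambda>ij. W (fst ij) (snd ij)) ({..<n} \<times> {..<p})"
    and mean: "\<And>i j. i < n \<Longrightarrow> j < p \<Longrightarrow> expectation (W i j) = 0"
    and mom: "\<And>i j. i < n \<Longrightarrow> j < p \<Longrightarrow> integrable M (\<lambda>\<omega>. \<bar>W i j \<omega>\<bar> ^ (Suc N))"
      "\<And>i j. i < n \<Longrightarrow> j < p \<Longrightarrow> expectation (\<lambda>\<omega>. \<bar>W i j \<omega>\<bar> ^ (Suc N)) \<le> C"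
    and var: "\<And>i j. i < n \<Longrightarrow> j < p \<Longrightarrow> expectation (\<lambda>\<omega>. (W i j \<omega>)\<^sup>2) \<le> s"
    and N: "N \<ge> 1" and K: "K > 0" and C: "C \<ge> 0" and s: "s \<ge> 0"
  defines "W' \<equiv> \<lambda>i j \<omega>. if \<bar>W i j \<omega>\<bar> \<le> K then W i j \<omega> else 0"
  shows "truncated_array M W' n p K (C / K ^ N) s"
    and "\<exists>B. B \<in> events \<and> prob B \<le> real n * real p * (C / K ^ (Suc N)) \<and>
      (\<forall>\<omega>\<in>space M - B. \<forall>i<n. \<forall>j<p. W' i j \<omega> = W i j \<omega>)"
proof -
  note power_Suc [simp del]
  have meas [measurable]: "W i j \<in> borel_measurable M" if "i < n" "j < p" for i j
    using ind that unfolding indep_vars_def by force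
  have int1: "integrable M (W i j)" if "i < n" "j < p" for i j
  proof (rule Bochner_Integration.integrable_bound[of M "\<lambda>\<omega>. 1 + \<bar>W i j \<omega>\<bar> ^ (Suc N)"])
    show "AE \<omega> in M. norm (W i j \<omega>) \<le> norm (1 + \<bar>W i j \<omega>\<bar> ^ (Suc N))"
    proof (rule AE_I2)
      fix \<omega>
      have "\<bar>W i j \<omega>\<bar> ^ 1 \<le> 1 + \<bar>W i j \<omega>\<bar> ^ (Suc N)" by (rule power_le_one_plus_power) simp_all
      then show "norm (W i j \<omega>) \<le> norm (1 + \<bar>W i j \<omega>\<bar> ^ (Suc N))"
        unfolding real_norm_def power_one_right by (rule order_trans[OF _ abs_ge_self])
    qed
    show "integrable M (\<lambda>\<omega>. 1 + \<bar>W i j \<omega>\<bar> ^ (Suc N))" using mom(1)[OF that] by (intro Bochner_Integration.integrable_add) auto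
    show "W i j \<in> borel_measurable M" by (rule meas[OF that])
  qed
  have int2: "integrable M (\<lambda>\<omega>. (W i j \<omega>)\<^sup>2)" if "i < n" "j < p" for i j
  proof (rule Bochner_Integration.integrable_bound[of M "\<lambda>\<omega>. 1 + \<bar>W i j \<omega>\<bar> ^ (Suc N)"])
    show "AE \<omega> in M. norm ((W i j \<omega>)\<^sup>2) \<le> norm (1 + \<bar>W i j \<omega>\<bar> ^ (Suc N))"
    proof (rule AE_I2)
      fix \<omega>
      have "\<bar>W i j \<omega>\<bar> ^ 2 \<le> 1 + \<bar>W i j \<omega>\<bar> ^ (Suc N)" by (rule power_le_one_plus_power) (use N in simp_all)
      then show "norm ((W i j \<omega>)\<^sup>2) \<le> norm (1 + \<bar>W i j \<omega>\<bar> ^ (Suc N))"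
        unfolding real_norm_def power_abs by (rule order_trans[OF _ abs_ge_self])
    qed
    show "integrable M (\<lambda>\<omega>. 1 + \<bar>W i j \<omega>\<bar> ^ (Suc N))" using mom(1)[OF that] by (intro Bochner_Integration.integrable_add) auto
    show "(\<lambda>\<omega>. (W i j \<omega>)\<^sup>2) \<in> borel_measurable M" using meas[OF that] by (rule borel_measurable_power)
  qed
  have bW: "\<bar>W' i j \<omega>\<bar> \<le> K" for i j \<omega> using K by (auto simp: W'_def)
  have meas' [measurable]: "W' i j \<in> borel_measurable M" if "i < n" "j < p" for i j
    using meas[OF that] unfolding W'_def by measurable
  have int1': "integrable M (W' i j)" if "i < n" "j < p" for i j
    using bW that by (intro integrable_const_bound[of _ K]) auto
  show "truncated_array M W' n p K (C / K ^ N) s"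
  proof
    have "indep_vars (\<lambda>_. borel) (\<lambda>ij \<omega>. (\<lambda>x. if \<bar>x\<bar> \<le> K then x else 0) (W (fst ij) (snd ij) \<omega>)) ({..<n} \<times> {..<p})"
      by (rule indep_vars_compose2[OF ind]) measurable
    then show "indep_vars (\<lambda>_. borel) (\<lambda>ij. W' (fst ij) (snd ij)) ({..<n} \<times> {..<p})"
      by (simp add: W'_def)
  next
    fix i j assume ij: "i < n" "j < p"
    have "\<bar>expectation (W' i j)\<bar> = \<bar>expectation (\<lambda>\<omega>. W' i j \<omega> - W i j \<omega>)\<bar>"
      using int1[OF ij] int1'[OF ij] mean[OF ij] by simp
    also have "\<dots> \<le> expectation (\<lambda>\<omega>. \<bar>W' i j \<omega> - W i j \<omega>\<bar>)" by (rule integral_abs_bound)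
    also have "\<dots> \<le> expectation (\<lambda>\<omega>. \<bar>W i j \<omega>\<bar> ^ (Suc N) / K ^ N)"
    proof (rule integral_mono)
      fix \<omega>
      show "\<bar>W' i j \<omega> - W i j \<omega>\<bar> \<le> \<bar>W i j \<omega>\<bar> ^ (Suc N) / K ^ N"
      proof (cases "\<bar>W i j \<omega>\<bar> \<le> K")
        case False
        then have "\<bar>W i j \<omega>\<bar> * K ^ N \<le> \<bar>W i j \<omega>\<bar> * \<bar>W i j \<omega>\<bar> ^ N"
          using K by (intro mult_left_mono power_mono) auto
        also have "\<dots> = \<bar>W i j \<omega>\<bar> ^ (Suc N)" by (rule power_Suc[symmetric])
        finally have "\<bar>W i j \<omega>\<bar> \<le> \<bar>W i j \<omega>\<bar> ^ (Suc N) / K ^ N" using K by (subst pos_le_divide_eq) (simp_all del: power_Suc)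
        then show ?thesis using False by (simp add: W'_def del: power_Suc)
      qed (use K in \<open>simp add: W'_def\<close>)
    qed (use int1[OF ij] int1'[OF ij] mom(1)[OF ij] in \<open>auto simp del: power_Suc\<close>)
    also have "\<dots> \<le> C / K ^ N" using mom(2)[OF ij] K by (simp add: divide_right_mono del: power_Suc)
    finally show "\<bar>expectation (W' i j)\<bar> \<le> C / K ^ N" .
    have "expectation (\<lambda>\<omega>. (W' i j \<omega>)\<^sup>2) \<le> expectation (\<lambda>\<omega>. (W i j \<omega>)\<^sup>2)"
      by (rule integral_mono_AE') (use int2[OF ij] in \<open>auto simp: W'_def\<close>)
    also have "\<dots> \<le> s" by (rule var[OF ij])
    finally show "expectation (\<lambda>\<omega>. (W' i j \<omega>)\<^sup>2) \<le> s" .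
  qed (use bW K C s in auto)
  let ?A = "\<lambda>ij. {\<omega>\<in>space M. \<bar>W (fst ij) (snd ij) \<omega>\<bar> ^ (Suc N) \<ge> K ^ (Suc N)}"
  let ?I = "{..<n} \<times> {..<p}"
  have ev: "?A ij \<in> events" if "ij \<in> ?I" for ij
  proof -
    have "fst ij < n" "snd ij < p" using that by auto
    then show ?thesis by measurable
  qed
  have "prob (\<Union>ij\<in>?I. ?A ij) \<le> (\<Sum>ij\<in>?I. prob (?A ij))"
    by (intro measure_UNION_le ev) auto
  also have "\<dots> \<le> (\<Sum>ij\<in>?I. C / K ^ (Suc N))"
  proof (rule sum_mono)
    fix ij assume "ij \<in> ?I"
    then have ij: "fst ij < n" "snd ij < p" by auto
    have "prob (?A ij) \<le> expectation (\<lambda>\<omega>. \<bar>W (fst ij) (snd ij) \<omega>\<bar> ^ (Suc N)) / K ^ (Suc N)"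
      using integral_Markov_inequality_measure[OF mom(1)[OF ij], of "{}" "K ^ (Suc N)"] K by (simp del: power_Suc)
    also have "\<dots> \<le> C / K ^ (Suc N)" using mom(2)[OF ij] K by (intro divide_right_mono) (auto simp del: power_Suc)
    finally show "prob (?A ij) \<le> C / K ^ (Suc N)" .
  qed
  also have "\<dots> = real n * real p * (C / K ^ (Suc N))" by simp
  finally have P: "prob (\<Union>ij\<in>?I. ?A ij) \<le> real n * real p * (C / K ^ (Suc N))" .
  show "\<exists>B. B \<in> events \<and> prob B \<le> real n * real p * (C / K ^ (Suc N)) \<and>
      (\<forall>\<omega>\<in>space M - B. \<forall>i<n. \<forall>j<p. W' i j \<omega> = W i j \<omega>)"
  proof (intro exI conjI ballI allI impI)
    show "(\<Union>ij\<in>?I. ?A ij) \<in> events" using ev by (intro sets.finite_UN) auto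
    show "prob (\<Union>ij\<in>?I. ?A ij) \<le> real n * real p * (C / K ^ (Suc N))" by (rule P)
    fix \<omega> i j assume w: "\<omega> \<in> space M - (\<Union>ij\<in>?I. ?A ij)" and ij: "i < n" "j < p"
    then have "(i, j) \<in> ?I" by simp
    then have "\<omega> \<notin> ?A (i, j)" and wM: "\<omega> \<in> space M" using w by blast+
    then have "\<not> K ^ (Suc N) \<le> \<bar>W i j \<omega>\<bar> ^ (Suc N)" by simp
    then have "\<not> K \<le> \<bar>W i j \<omega>\<bar>" using K power_mono[of K "\<bar>W i j \<omega>\<bar>" "Suc N"] by (auto simp del: power_Suc)
    then show "W' i j \<omega> = W i j \<omega>" by (simp add: W'_def)
  qed
qed

text \<open>The truncation level is \<open>K = n powr 0.05\<close>, so that \<open>80\<close> moments make the truncation error summable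
  and the truncated means are of order \<open>n powr (-3.95)\<close>; the cuts of \<open>bilin_three_levels\<close> are
  \<open>a = n powr (-0.4)\<close> and \<open>b = n powr (-0.2)\<close>, and \<open>n powr 0.55\<close> bounds the off-diagonal Gram entries.\<close>

lemma norm_tail_asymptotics:
  fixes g C \<tau> \<Lambda> \<delta> s :: real
  assumes "g \<ge> 1" "C > 0" "\<tau> > 0" "\<Lambda> > 0" "\<delta> > 0" "s > 0"
  shows "\<forall>\<^sub>F n in sequentially. sqrt g / sqrt (real n) \<le> real n powr (-0.4)"
    and "\<forall>\<^sub>F n in sequentially. \<Lambda> * sqrt n * real n powr 0.05 * (real n powr (-0.4) * real n powr (-0.2)) \<le> 1"
    and "\<forall>\<^sub>F n in sequentially. \<Lambda> * sqrt n * (n * (g * n) * (C * real n powr (-3.95))) \<le> n"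
    and "\<forall>\<^sub>F n in sequentially. 4 * exp (- real n) \<le> real n powr (-1.5) / 8"
    and "\<forall>\<^sub>F n in sequentially. 2 * exp (2 + (real n powr 0.8 + 1) * (ln (8 * (real n)\<^sup>2) + ln (8 * (g * real n)\<^sup>2))
       - real n powr 0.35 * (\<tau> * sqrt n) + real n powr 0.35 * (n * (g * n) * (C * real n powr (-3.95))) + (real n powr 0.35)\<^sup>2 * s) \<le> real n powr (-1.5) / 8"
    and "\<forall>\<^sub>F n in sequentially. g * n * exp (- (\<delta> / 2 * n) / (real n powr 0.05)\<^sup>2) \<le> real n powr (-1.5) / 8"
    and "\<forall>\<^sub>F n in sequentially. (g * n)\<^sup>2 * (2 * exp (- (real n powr (-0.5) * real n powr 0.55) + real n powr (-0.5) * (g * n * (C * real n powr (-3.95))\<^sup>2) + (real n powr (-0.5))\<^sup>2 * (g * n * s\<^sup>2))) \<le> real n powr (-1.5) / 8"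
    and "\<forall>\<^sub>F n in sequentially. n * (g * n) * (C * real n powr (-4)) \<le> real n powr (-1.5) / 8"
    and "\<forall>\<^sub>F n in sequentially. real n powr (-0.5) * (real n powr 0.05)\<^sup>2 \<le> 1"
    and "\<forall>\<^sub>F n in sequentially. real n powr 0.55 / (real n powr (-0.2))\<^sup>2 \<le> \<delta> * n"
  subgoal using assms by real_asymp
  subgoal using assms by real_asymp
  subgoal using assms by real_asymp
  subgoal using assms by real_asymp
  subgoal using assms by real_asymp
  subgoal using assms by real_asymp
  subgoal using assms by real_asymp
  subgoal using assms by real_asymp
  subgoal using assms by real_asymp
  subgoal using assms by real_asymp
  done

lemma (in prob_space) bilin_tail:
  fixes W :: "nat \<Rightarrow> nat \<Rightarrow> nat \<Rightarrow> 'a \<Rightarrow> real" and p :: "nat \<Rightarrow> nat"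
  assumes g: "g \<ge> 1" "\<forall>\<^sub>F n in sequentially. 0 < p n \<and> real (p n) \<le> g * real n \<and> real n \<le> g * real (p n)"
    and ind: "\<And>n. n \<ge> 1 \<Longrightarrow> indep_vars (\<lambda>_. borel) (\<lambda>ij. W n (fst ij) (snd ij)) ({..<n} \<times> {..<p n})"
    and mean: "\<And>n i j. n \<ge> 1 \<Longrightarrow> i < n \<Longrightarrow> j < p n \<Longrightarrow> expectation (W n i j) = 0"
    and mom: "\<forall>\<^sub>F n in sequentially. \<forall>i<n. \<forall>j<p n. integrable M (\<lambda>\<omega>. \<bar>W n i j \<omega>\<bar> ^ 80) \<and> expectation (\<lambda>\<omega>. \<bar>W n i j \<omega>\<bar> ^ 80) \<le> C"
    and var: "\<And>\<epsilon>. \<epsilon> > 0 \<Longrightarrow> \<forall>\<^sub>F n in sequentially. \<forall>i<n. \<forall>j<p n. expectation (\<lambda>\<omega>. (W n i j \<omega>)\<^sup>2) \<le> \<epsilon>"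
    and C: "C > 0" and \<epsilon>: "\<epsilon> > 0"
  shows "\<forall>\<^sub>F n in sequentially. \<exists>B\<in>events. prob B \<le> real n powr (-1.5) \<and>
    (\<forall>\<omega>\<in>space M - B. \<forall>x y. (\<Sum>i<n. (x i)\<^sup>2) \<le> 1 \<longrightarrow> (\<Sum>j<p n. (y j)\<^sup>2) \<le> 1 \<longrightarrow>
      \<bar>bilin n (p n) (\<lambda>i j. W n i j \<omega>) x y\<bar> \<le> \<epsilon> * sqrt n)"
proof -
  \<comment> \<open>The final bound \<open>6 * \<tau> * sqrt n + 2 * sqrt (2 * \<delta> * n)\<close>
    is to be \<epsilon> sqrt n: \<open>\<tau>\<close> and \<open>\<delta>\<close> give each summand
    exactly half of it.\<close>
  define \<tau> where "\<tau> = \<epsilon> / 12"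
  define \<delta> where "\<delta> = \<epsilon>\<^sup>2 / 32"
  \<comment> \<open>The logarithm of the full nets is at most \<open>(19 + 19 * g) * n\<close>. Of
    the remaining \<open>3 * n\<close>, one \<open>n\<close> pays for the biased means, one for the
    variance term, and one is left as the exponent of the decay.\<close>
  define \<Lambda> where "\<Lambda> = (22 + 19 * g) / \<tau>"
  \<comment> \<open>The first bound keeps the quadratic Chernoff term
    \<open>\<Lambda>\<^sup>2 * s * n\<close> below \<open>n\<close>; the second keeps the expected
    sum of squares of a row or column so far below \<open>\<delta> * n\<close> that half of this
    threshold remains.\<close>
  define s where "s = min (1 / \<Lambda>\<^sup>2) (\<delta> / (4 * g))"
  have pos: "\<tau> > 0" "\<delta> > 0" using \<epsilon> by (auto simp: \<tau>_def \<delta>_def)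
  then have L0: "\<Lambda> > 0" using g by (simp add: \<Lambda>_def)
  then have s0: "s > 0" using pos g by (simp add: s_def)
  have L\<tau>: "\<Lambda> * \<tau> = 22 + 19 * g" using pos by (simp add: \<Lambda>_def)
  have "s \<le> 1 / \<Lambda>\<^sup>2" "s \<le> \<delta> / (4 * g)" by (auto simp: s_def)
  then have s1: "\<Lambda>\<^sup>2 * s \<le> 1" and s2: "4 * g * s \<le> \<delta>" using L0 g by (auto simp: field_simps)
  note asym = norm_tail_asymptotics[OF g(1) C pos(1) L0 pos(2) s0]
  show ?thesis
    using g(2) mom var[OF s0] eventually_ge_at_top[of 1] asym
  proof eventually_elim
    case (elim n)
    define x where "x = real n"
    have n: "n > 0" "x \<ge> 1" using elim(4) by (auto simp: x_def)
    have p: "p n > 0" "real (p n) \<le> g * x" "x \<le> g * real (p n)" using elim(1) by (auto simp: x_def)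
    have xg: "x \<le> g * x" using g n by simp
    define K where "K = x powr 0.05"
    define a where "a = x powr (-0.4)"
    define b where "b = x powr (-0.2)"
    define m where "m = nat \<lceil>x powr 0.8\<rceil>"
    define \<eta> where "\<eta> = C * x powr (-3.95)"
    have K0: "K > 0" using n by (simp add: K_def)
    have ab0: "a > 0" "b > 0" using n by (simp_all add: a_def b_def)
    have pw: "(x powr e) ^ k = x powr (e * real k)" for e k using n by (subst powr_power) (auto simp: mult.commute)
    have inv: "c / x powr e = c * x powr (- e)" for c e by (simp only: powr_minus divide_inverse)
    have "K ^ 79 = x powr 3.95" unfolding K_def pw by simp
    then have K79: "C / K ^ 79 = \<eta>" unfolding \<eta>_def by (simp only: inv)
    have "K ^ 80 = x powr 4" unfolding K_def pw by simp
    then have K80: "C / K ^ 80 = C * x powr (-4)" by (simp only: inv)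
    have \<eta>0: "\<eta> > 0" using C n by (simp add: \<eta>_def)
    define W' where "W' = (\<lambda>i j \<omega>. if \<bar>W n i j \<omega>\<bar> \<le> K then W n i j \<omega> else 0)"
    have mom1: "integrable M (\<lambda>\<omega>. \<bar>W n i j \<omega>\<bar> ^ Suc 79)" "expectation (\<lambda>\<omega>. \<bar>W n i j \<omega>\<bar> ^ Suc 79) \<le> C"
      if "i < n" "j < p n" for i j
      using elim(2) that by simp_all

    have var1: "expectation (\<lambda>\<omega>. (W n i j \<omega>)\<^sup>2) \<le> s" if "i < n" "j < p n" for i j
      using elim(3) that by blast
    have N: "(1::nat) \<le> 79" by simp
    note trunc = truncation[of "W n" n "p n", OF ind[OF elim(4)] mean[OF elim(4)] mom1 var1 N K0 less_imp_le[OF C] less_imp_le[OF s0], folded W'_def]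
    from trunc(1) have tr: "truncated_array M W' n (p n) K (C / K ^ 79) s" by blast
    have S79: "Suc 79 = 80" by simp
    interpret T: truncated_array M W' n "p n" K \<eta> s using tr unfolding K79 .
    have "\<exists>B0. B0 \<in> events \<and> prob B0 \<le> real n * real (p n) * (C * x powr (-4)) \<and>
      (\<forall>\<omega>\<in>space M - B0. \<forall>i<n. \<forall>j<p n. W' i j \<omega> = W n i j \<omega>)"
      unfolding W'_def by (rule trunc(2)[unfolded S79 K80])
    then obtain B0 where B0_all: "B0 \<in> events \<and> prob B0 \<le> real n * real (p n) * (C * x powr (-4)) \<and>
      (\<forall>\<omega>\<in>space M - B0. \<forall>i<n. \<forall>j<p n. W' i j \<omega> = W n i j \<omega>)" by (elim exE) (rule that)
    note B0 = B0_all[THEN conjunct1] B0_all[THEN conjunct2, THEN conjunct1] B0_all[THEN conjunct2, THEN conjunct2]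
    have sp: "1 / sqrt (p n) \<le> a"
    proof -
      have "sqrt x \<le> sqrt g * sqrt (p n)" using p(3) unfolding real_sqrt_mult[symmetric] by (rule real_sqrt_le_mono)
      then have "sqrt x / (sqrt x * sqrt (p n)) \<le> (sqrt g * sqrt (p n)) / (sqrt x * sqrt (p n))"
        using n by (intro divide_right_mono) simp_all
      then have "1 / sqrt (p n) \<le> sqrt g / sqrt x" using p(1) n by simp
      also have "\<dots> \<le> a" using elim(5) unfolding a_def x_def .
      finally show ?thesis .
    qed
    have sn: "1 / sqrt n \<le> a"
    proof -
      have "1 / sqrt n \<le> sqrt g / sqrt n" using g(1) by (intro divide_right_mono) simp_all
      also have "\<dots> \<le> a" using elim(5) unfolding a_def x_def .
      finally show ?thesis .
    qed
    have ab: "a \<le> b" unfolding a_def b_def by (rule powr_mono) (use n in simp_all)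
    have mono: "c * exp A \<le> c * exp B" if "A \<le> B" "c \<ge> 0" for A B c :: real
      using that by (intro mult_left_mono) simp_all
    have m1: "1 / a\<^sup>2 \<le> real m"
    proof -
      have "a\<^sup>2 = x powr (-0.8)" unfolding a_def pw by simp
      then have "1 / a\<^sup>2 = x powr 0.8" by (simp only: inv) simp
      then show ?thesis by (simp add: m_def real_nat_ceiling_ge)
    qed
    have m2: "real m \<le> x powr 0.8 + 1" unfolding m_def by (simp add: of_nat_nat)
    \<comment> \<open>The product is \<open>\<Lambda> * n powr (0.5 + 0.05 - 0.4 - 0.2)\<close>, a
      negative power of \<open>n\<close>.\<close>
    have l1: "\<Lambda> * sqrt x > 0" "\<Lambda> * sqrt x * K * (a * b) \<le> 1"
      using elim(6) L0 n by (simp_all add: x_def K_def a_def b_def)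
    \<comment> \<open>The exponents cancel exactly: 0.35 + 0.05 - 0.4 = 0. The gain
      \<open>n powr 0.35 * (\<tau> * sqrt n)\<close> has order \<open>n powr 0.85\<close> and beats
      the logarithm of the sparse nets, which has order \<open>n powr 0.8\<close> times
      \<open>ln n\<close> because \<open>m\<close> is about \<open>1 / a\<^sup>2\<close>.\<close>
    have l2: "x powr 0.35 > 0" "x powr 0.35 * K * (b * b) \<le> 1"
    proof -
      have "x powr 0.35 * K * (b * b) = x powr (0.35 + 0.05 + (-0.2 + -0.2))" unfolding K_def b_def powr_add by (simp only: mult_ac)
      also have "\<dots> = x powr 0" by simp
      finally show "x powr 0.35 * K * (b * b) \<le> 1" using n by simp
      show "x powr 0.35 > 0" using n by simp
    qed
    \<comment> \<open>With \<open>n powr 0.55\<close> for the off-diagonal Gram entries this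
      parameter gives the decay \<open>exp (- (n powr 0.05))\<close>, stronger than any power of
      \<open>n\<close>, while the quadratic term stays bounded. After division by
      \<open>b\<^sup>2\<close> these entries contribute \<open>n powr 0.95\<close>, which is below
      \<open>\<delta> * n\<close>.\<close>
    have l3: "x powr (-0.5) > 0" "x powr (-0.5) * K\<^sup>2 \<le> 1" using elim(13) n by (simp_all add: x_def K_def)
    have nn: "\<delta> * x \<ge> 0" "x powr 0.55 \<ge> 0" using pos n by auto
    obtain B1 where B1: "B1 \<in> events"
      "prob B1 \<le> 4 * exp (19 * real n + 19 * real (p n) - (\<Lambda> * sqrt x) * (\<tau> * sqrt x) + (\<Lambda> * sqrt x) * (real n * real (p n) * \<eta>) + (\<Lambda> * sqrt x)\<^sup>2 * s)
      + 2 * exp ((1 + real m * ln (8 * (real n)\<^sup>2)) + (1 + real m * ln (8 * (real (p n))\<^sup>2)) - x powr 0.35 * (\<tau> * sqrt x) + x powr 0.35 * (real n * real (p n) * \<eta>) + (x powr 0.35)\<^sup>2 * s)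
      + (real n * exp ((- (\<delta> * x) + 2 * real (p n) * s) / K\<^sup>2) + (real n)\<^sup>2 * (2 * exp (- (x powr (-0.5)) * x powr 0.55 + x powr (-0.5) * (real (p n) * \<eta>\<^sup>2) + (x powr (-0.5))\<^sup>2 * (real (p n) * s\<^sup>2))))
      + (real (p n) * exp ((- (\<delta> * x) + 2 * real n * s) / K\<^sup>2) + (real (p n))\<^sup>2 * (2 * exp (- (x powr (-0.5)) * x powr 0.55 + x powr (-0.5) * (real n * \<eta>\<^sup>2) + (x powr (-0.5))\<^sup>2 * (real n * s\<^sup>2))))"
      and B1': "\<And>\<omega> x' y. \<omega> \<in> space M - B1 \<Longrightarrow> (\<Sum>i<n. (x' i)\<^sup>2) \<le> 1 \<Longrightarrow> (\<Sum>j<p n. (y j)\<^sup>2) \<le> 1 \<Longrightarrow>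
       \<bar>bilin n (p n) (\<lambda>i j. W' i j \<omega>) x' y\<bar> \<le> 6 * (\<tau> * sqrt x) + 2 * sqrt (\<delta> * x + x powr 0.55 / b\<^sup>2)"
      by (rule T.norm_event[OF n(1) p(1) sn sp ab m1 l1 l2 l3 nn]) (rule that, assumption, assumption, blast)
    have npe: "real n * real (p n) * e \<le> x * (g * x) * e" if "e \<ge> 0" for e
      unfolding x_def[symmetric] using p n that by (intro mult_right_mono mult_left_mono) auto
    have t0: "prob B0 \<le> x powr (-1.5) / 8"
    proof -
      have "prob B0 \<le> x * (g * x) * (C * x powr (-4))" by (rule order_trans[OF B0(2)], rule npe) (use C in auto)
      also have "\<dots> \<le> x powr (-1.5) / 8" using elim(12) by (simp add: x_def)
      finally show ?thesis .
    qed
    have t1: "4 * exp (19 * real n + 19 * real (p n) - (\<Lambda> * sqrt x) * (\<tau> * sqrt x) + (\<Lambda> * sqrt x) * (real n * real (p n) * \<eta>) + (\<Lambda> * sqrt x)\<^sup>2 * s) \<le> x powr (-1.5) / 8"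
    proof -
      have "(\<Lambda> * sqrt x) * (real n * real (p n) * \<eta>) \<le> (\<Lambda> * sqrt x) * (x * (g * x) * \<eta>)"
        using l1 \<eta>0 by (intro mult_left_mono npe) auto
      also have "\<dots> \<le> x" using elim(7) by (simp add: x_def \<eta>_def)
      finally have 1: "(\<Lambda> * sqrt x) * (real n * real (p n) * \<eta>) \<le> x" .
      have "(\<Lambda> * sqrt x)\<^sup>2 * s = (\<Lambda>\<^sup>2 * s) * x" using n by (simp add: power_mult_distrib)
      also have "\<dots> \<le> 1 * x" using s1 n by (intro mult_right_mono) auto
      finally have 2: "(\<Lambda> * sqrt x)\<^sup>2 * s \<le> x" by simp
      have "(\<Lambda> * sqrt x) * (\<tau> * sqrt x) = (\<Lambda> * \<tau>) * (sqrt x * sqrt x)" by (simp only: mult_ac)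
      also have "\<dots> = 22 * x + 19 * (g * x)" using n by (simp add: L\<tau> algebra_simps)
      finally have 3: "(\<Lambda> * sqrt x) * (\<tau> * sqrt x) = 22 * x + 19 * (g * x)" .
      have "19 * real n + 19 * real (p n) - (\<Lambda> * sqrt x) * (\<tau> * sqrt x) + (\<Lambda> * sqrt x) * (real n * real (p n) * \<eta>) + (\<Lambda> * sqrt x)\<^sup>2 * s \<le> - x"
        using 1 2 p(2) unfolding 3 x_def[symmetric] by linarith
      then have "4 * exp (19 * real n + 19 * real (p n) - (\<Lambda> * sqrt x) * (\<tau> * sqrt x) + (\<Lambda> * sqrt x) * (real n * real (p n) * \<eta>) + (\<Lambda> * sqrt x)\<^sup>2 * s) \<le> 4 * exp (- x)" by (rule mono) simp
      also have "\<dots> \<le> x powr (-1.5) / 8" using elim(8) by (simp add: x_def)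
      finally show ?thesis .
    qed
    have t2: "2 * exp ((1 + real m * ln (8 * (real n)\<^sup>2)) + (1 + real m * ln (8 * (real (p n))\<^sup>2)) - x powr 0.35 * (\<tau> * sqrt x) + x powr 0.35 * (real n * real (p n) * \<eta>) + (x powr 0.35)\<^sup>2 * s) \<le> x powr (-1.5) / 8"
    proof -
      have 1: "x powr 0.35 * (real n * real (p n) * \<eta>) \<le> x powr 0.35 * (x * (g * x) * \<eta>)"
        using \<eta>0 by (intro mult_left_mono npe) auto
      have "1 \<le> x\<^sup>2" using n by (intro one_le_power) auto
      then have ln1: "0 \<le> ln (8 * x\<^sup>2)" by simp
      have "(real (p n))\<^sup>2 \<le> (g * x)\<^sup>2" using p by (intro power_mono) auto
      moreover have "1 \<le> (real (p n))\<^sup>2" using p by (intro one_le_power) auto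
      ultimately have ln2: "0 \<le> ln (8 * (real (p n))\<^sup>2)" "ln (8 * (real (p n))\<^sup>2) \<le> ln (8 * (g * x)\<^sup>2)"
        by (simp, intro ln_mono) linarith+
      have "real m * (ln (8 * x\<^sup>2) + ln (8 * (real (p n))\<^sup>2)) \<le> (x powr 0.8 + 1) * (ln (8 * x\<^sup>2) + ln (8 * (g * x)\<^sup>2))"
        using m2 ln1 ln2 by (intro mult_mono) auto
      then have "(1 + real m * ln (8 * (real n)\<^sup>2)) + (1 + real m * ln (8 * (real (p n))\<^sup>2)) - x powr 0.35 * (\<tau> * sqrt x) + x powr 0.35 * (real n * real (p n) * \<eta>) + (x powr 0.35)\<^sup>2 * s
        \<le> 2 + (x powr 0.8 + 1) * (ln (8 * x\<^sup>2) + ln (8 * (g * x)\<^sup>2)) - x powr 0.35 * (\<tau> * sqrt x) + x powr 0.35 * (x * (g * x) * \<eta>) + (x powr 0.35)\<^sup>2 * s"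
        using 1 unfolding x_def[symmetric] distrib_left by linarith
      then have "2 * exp ((1 + real m * ln (8 * (real n)\<^sup>2)) + (1 + real m * ln (8 * (real (p n))\<^sup>2)) - x powr 0.35 * (\<tau> * sqrt x) + x powr 0.35 * (real n * real (p n) * \<eta>) + (x powr 0.35)\<^sup>2 * s)
        \<le> 2 * exp (2 + (x powr 0.8 + 1) * (ln (8 * x\<^sup>2) + ln (8 * (g * x)\<^sup>2)) - x powr 0.35 * (\<tau> * sqrt x) + x powr 0.35 * (x * (g * x) * \<eta>) + (x powr 0.35)\<^sup>2 * s)"
        by (rule mono) simp
      also have "\<dots> \<le> x powr (-1.5) / 8" using elim(9) by (simp add: x_def \<eta>_def)
      finally show ?thesis .
    qed
    have row: "real N * exp ((- (\<delta> * x) + 2 * real N' * s) / K\<^sup>2) \<le> x powr (-1.5) / 8"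
      if N: "real N \<le> g * x" "real N' \<le> g * x" for N N'
    proof -
      have "2 * real N' * s \<le> 2 * (g * x) * s" using N s0 by (intro mult_right_mono mult_left_mono) auto
      also have "\<dots> = (4 * g * s) * (x / 2)" by simp
      also have "\<dots> \<le> \<delta> * (x / 2)" using s2 n by (intro mult_right_mono) auto
      finally have "- (\<delta> * x) + 2 * real N' * s \<le> - (\<delta> / 2 * x)" by simp
      then have "(- (\<delta> * x) + 2 * real N' * s) / K\<^sup>2 \<le> - (\<delta> / 2 * x) / K\<^sup>2" by (intro divide_right_mono) auto
      then have "real N * exp ((- (\<delta> * x) + 2 * real N' * s) / K\<^sup>2) \<le> (g * x) * exp (- (\<delta> / 2 * x) / K\<^sup>2)"
        using N n g by (intro mult_mono) auto
      also have "\<dots> \<le> x powr (-1.5) / 8" using elim(10) by (simp add: x_def K_def)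
      finally show ?thesis .
    qed
    have pair: "(real N)\<^sup>2 * (2 * exp (- (x powr (-0.5)) * x powr 0.55 + x powr (-0.5) * (real N' * \<eta>\<^sup>2) + (x powr (-0.5))\<^sup>2 * (real N' * s\<^sup>2))) \<le> x powr (-1.5) / 8"
      if N: "real N \<le> g * x" "real N' \<le> g * x" for N N'
    proof -
      have "x powr (-0.5) * (real N' * \<eta>\<^sup>2) \<le> x powr (-0.5) * (g * x * \<eta>\<^sup>2)" "(x powr (-0.5))\<^sup>2 * (real N' * s\<^sup>2) \<le> (x powr (-0.5))\<^sup>2 * (g * x * s\<^sup>2)"
        using N by (intro mult_left_mono mult_right_mono; simp)+
      then have "- (x powr (-0.5)) * x powr 0.55 + x powr (-0.5) * (real N' * \<eta>\<^sup>2) + (x powr (-0.5))\<^sup>2 * (real N' * s\<^sup>2)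
         \<le> - (x powr (-0.5) * x powr 0.55) + x powr (-0.5) * (g * x * \<eta>\<^sup>2) + (x powr (-0.5))\<^sup>2 * (g * x * s\<^sup>2)"
        by (simp only: mult_minus_left)
      then have "(real N)\<^sup>2 * (2 * exp (- (x powr (-0.5)) * x powr 0.55 + x powr (-0.5) * (real N' * \<eta>\<^sup>2) + (x powr (-0.5))\<^sup>2 * (real N' * s\<^sup>2)))
         \<le> (g * x)\<^sup>2 * (2 * exp (- (x powr (-0.5) * x powr 0.55) + x powr (-0.5) * (g * x * \<eta>\<^sup>2) + (x powr (-0.5))\<^sup>2 * (g * x * s\<^sup>2)))"
        by (intro mult_mono[OF power_mono mono] N(1)) simp_all
      also have "\<dots> \<le> x powr (-1.5) / 8" using elim(11) by (simp add: x_def \<eta>_def)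
      finally show ?thesis .
    qed
    have nx: "real n \<le> g * x" using xg by (simp add: x_def)
    note parts = t1 t2 row[OF nx p(2)] pair[OF nx p(2)] row[OF p(2) nx] pair[OF p(2) nx]
    have P1: "prob B1 \<le> 6 * (x powr (-1.5) / 8)" using B1(2) parts by linarith
    show ?case
    proof (intro bexI[of _ "B0 \<union> B1"] conjI ballI allI impI)
      have "prob (B0 \<union> B1) \<le> prob B0 + prob B1" by (intro measure_Un_le B0 B1)
      \<comment> \<open>Seven terms of at most an eighth each: one from truncation and six from the
        event for the truncated array.\<close>
      also have "\<dots> \<le> x powr (-1.5)" using t0 P1 powr_ge_zero[of x "-1.5"] by linarith
      finally show "prob (B0 \<union> B1) \<le> real n powr (-1.5)" by (simp add: x_def)
    next
      fix \<omega> and x' y :: "nat \<Rightarrow> real"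
      assume w: "\<omega> \<in> space M - (B0 \<union> B1)" and xy: "(\<Sum>i<n. (x' i)\<^sup>2) \<le> 1" "(\<Sum>j<p n. (y j)\<^sup>2) \<le> 1"
      have "bilin n (p n) (\<lambda>i j. W n i j \<omega>) x' y = bilin n (p n) (\<lambda>i j. W' i j \<omega>) x' y"
        unfolding bilin_def using B0(3) w by (intro sum.cong refl) auto
      then have "\<bar>bilin n (p n) (\<lambda>i j. W n i j \<omega>) x' y\<bar> \<le> 6 * (\<tau> * sqrt x) + 2 * sqrt (\<delta> * x + x powr 0.55 / b\<^sup>2)"
        using B1'[OF _ xy, of \<omega>] w by (simp only:) blast
      also have "sqrt (\<delta> * x + x powr 0.55 / b\<^sup>2) \<le> sqrt (\<delta> * x + \<delta> * x)"
        using elim(14) by (simp add: x_def b_def)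
      also have "\<delta> * x + \<delta> * x = (\<epsilon> / 4)\<^sup>2 * x" by (simp add: \<delta>_def power2_eq_square)
      also have "sqrt ((\<epsilon> / 4)\<^sup>2 * x) = \<epsilon> / 4 * sqrt x" using \<epsilon> by (simp add: real_sqrt_mult)
      finally show "\<bar>bilin n (p n) (\<lambda>i j. W n i j \<omega>) x' y\<bar> \<le> \<epsilon> * sqrt n" by (simp add: \<tau>_def x_def)
    qed (use B0 B1 in auto)
  qed
qed

text \<open>The exceptional probabilities \<open>n powr (-1.5)\<close> are summable, and the first
  Borel-Cantelli lemma accepts any joint law of the arrays. It is applied to the countably many
  bounds \<open>1 / Suc k\<close>, which makes the null set independent of
  \<open>\<epsilon>\<close>.\<close>

lemma (in prob_space) bilin_small_AE:
  fixes W :: "nat \<Rightarrow> nat \<Rightarrow> nat \<Rightarrow> 'a \<Rightarrow> real" and p :: "nat \<Rightarrow> nat"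
  assumes p: "(\<lambda>n. real (p n) / real n) \<longlonglongrightarrow> \<gamma>" "\<gamma> > 0"
    and ind: "\<And>n. n \<ge> 1 \<Longrightarrow> indep_vars (\<lambda>_. borel) (\<lambda>ij. W n (fst ij) (snd ij)) ({..<n} \<times> {..<p n})"
    and mean: "\<And>n i j. n \<ge> 1 \<Longrightarrow> i < n \<Longrightarrow> j < p n \<Longrightarrow> expectation (W n i j) = 0"
    and mom: "\<forall>\<^sub>F n in sequentially. \<forall>i<n. \<forall>j<p n. integrable M (\<lambda>\<omega>. \<bar>W n i j \<omega>\<bar> ^ 80) \<and> expectation (\<lambda>\<omega>. \<bar>W n i j \<omega>\<bar> ^ 80) \<le> C"
    and var: "\<And>\<epsilon>. \<epsilon> > 0 \<Longrightarrow> \<forall>\<^sub>F n in sequentially. \<forall>i<n. \<forall>j<p n. expectation (\<lambda>\<omega>. (W n i j \<omega>)\<^sup>2) \<le> \<epsilon>"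
  shows "AE \<omega> in M. \<forall>\<epsilon>>0. \<forall>\<^sub>F n in sequentially. \<forall>x y. (\<Sum>i<n. (x i)\<^sup>2) \<le> 1 \<longrightarrow> (\<Sum>j<p n. (y j)\<^sup>2) \<le> 1 \<longrightarrow>
      \<bar>bilin n (p n) (\<lambda>i j. W n i j \<omega>) x y\<bar> \<le> \<epsilon> * sqrt n"
proof -
  \<comment> \<open>Eventually \<open>p n\<close> lies between \<open>\<gamma> / 2 * n\<close> and
    \<open>2 * \<gamma> * n\<close>, so this \<open>g\<close> compares \<open>n\<close> and
    \<open>p n\<close> in both directions.\<close>
  define g where "g = max 1 (max (2 * \<gamma>) (2 / \<gamma>))"
  have g: "g \<ge> 1" "2 * \<gamma> \<le> g" "2 / \<gamma> \<le> g" by (auto simp: g_def)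
  have "\<forall>\<^sub>F n in sequentially. real (p n) / real n \<in> {\<gamma> / 2<..<2 * \<gamma>}"
    using p by (intro topological_tendstoD[OF p(1)]) auto
  then have ev: "\<forall>\<^sub>F n in sequentially. 0 < p n \<and> real (p n) \<le> g * real n \<and> real n \<le> g * real (p n)"
    using eventually_ge_at_top[of 1]
  proof eventually_elim
    case (elim n)
    then have n: "real n > 0" by simp
    have 1: "real (p n) < 2 * \<gamma> * real n" "\<gamma> / 2 * real n < real (p n)" using elim n by (auto simp: field_simps)
    have "2 * \<gamma> * real n \<le> g * real n" using g n by (intro mult_right_mono) auto
    moreover have "0 < \<gamma> / 2 * real n" using p n by simp
    moreover have "(2 / \<gamma>) * (\<gamma> / 2 * real n) \<le> g * (\<gamma> / 2 * real n)"
      using g p n by (intro mult_right_mono) auto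
    then have "real n \<le> g * (\<gamma> / 2 * real n)" using p by simp
    moreover have "g * (\<gamma> / 2 * real n) \<le> g * real (p n)" using 1 g by (intro mult_left_mono) auto
    ultimately have "0 < real (p n)" "real (p n) \<le> g * real n" "real n \<le> g * real (p n)" using 1 by linarith+
    then show ?case by simp
  qed
  have C': "\<forall>\<^sub>F n in sequentially. \<forall>i<n. \<forall>j<p n. integrable M (\<lambda>\<omega>. \<bar>W n i j \<omega>\<bar> ^ 80) \<and> expectation (\<lambda>\<omega>. \<bar>W n i j \<omega>\<bar> ^ 80) \<le> max C 1"
    using mom by eventually_elim (auto simp: le_max_iff_disj)
  have each: "AE \<omega> in M. \<forall>\<^sub>F n in sequentially. \<forall>x y. (\<Sum>i<n. (x i)\<^sup>2) \<le> 1 \<longrightarrow> (\<Sum>j<p n. (y j)\<^sup>2) \<le> 1 \<longrightarrow>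
      \<bar>bilin n (p n) (\<lambda>i j. W n i j \<omega>) x y\<bar> \<le> \<epsilon> * sqrt n" if \<epsilon>: "\<epsilon> > 0" for \<epsilon>
  proof -
    define good where "good = (\<lambda>n B. prob B \<le> real n powr (-1.5) \<and>
      (\<forall>\<omega>\<in>space M - B. \<forall>x y. (\<Sum>i<n. (x i)\<^sup>2) \<le> 1 \<longrightarrow> (\<Sum>j<p n. (y j)\<^sup>2) \<le> 1 \<longrightarrow>
        \<bar>bilin n (p n) (\<lambda>i j. W n i j \<omega>) x y\<bar> \<le> \<epsilon> * sqrt n))"
    \<comment> \<open>For the finitely many \<open>n\<close> without a suitable event the empty set
      is taken, so that \<open>B n\<close> is always measurable. The set where the norm is large is
      only covered by \<open>B n\<close>; its own measurability, a matter of a supremum over all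
      vectors, never arises.\<close>
    define B where "B = (\<lambda>n. if \<exists>B\<in>events. good n B then SOME B. B \<in> events \<and> good n B else {})"
    have B: "B n \<in> events \<and> good n (B n)" if "\<exists>B\<in>events. good n B" for n
    proof -
      have "\<exists>B. B \<in> events \<and> good n B" using that by blast
      from someI_ex[OF this] show ?thesis unfolding B_def if_P[OF that] .
    qed
    have ev': "\<forall>\<^sub>F n in sequentially. \<exists>B\<in>events. good n B"
      unfolding good_def by (rule bilin_tail[OF g(1) ev ind mean C' var _ \<epsilon>]) auto
    have sets: "B n \<in> events" for n
    proof (cases "\<exists>B\<in>events. good n B")
      case False
      then have "B n = {}" unfolding B_def by (rule if_not_P)
      then show ?thesis by simp
    qed (use B in blast)
    have "summable (\<lambda>n. prob (B n))"
    proof (rule summable_comparison_test_ev)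
      show "\<forall>\<^sub>F n in sequentially. norm (prob (B n)) \<le> real n powr (-1.5)"
        using ev'
      proof eventually_elim
        case (elim n)
        then have "good n (B n)" using B by blast
        then show ?case by (simp add: good_def)
      qed
      show "summable (\<lambda>n. real n powr (-1.5))" by (simp add: summable_real_powr_iff)
    qed
    then have "AE \<omega> in M. \<forall>\<^sub>F n in sequentially. \<omega> \<in> space M - B n"
      by (intro borel_cantelli_AE1 sets) (auto simp: emeasure_eq_measure)
    then show ?thesis
    proof eventually_elim
      case (elim \<omega>)
      show ?case using elim ev'
      proof eventually_elim
        case (elim n)
        then have "good n (B n)" "\<omega> \<in> space M - B n" using B by blast+
        then show ?case unfolding good_def by blast
      qed
    qed
  qed
  have "AE \<omega> in M. \<forall>k::nat. \<forall>\<^sub>F n in sequentially. \<forall>x y. (\<Sum>i<n. (x i)\<^sup>2) \<le> 1 \<longrightarrow> (\<Sum>j<p n. (y j)\<^sup>2) \<le> 1 \<longrightarrow>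
      \<bar>bilin n (p n) (\<lambda>i j. W n i j \<omega>) x y\<bar> \<le> (1 / real (Suc k)) * sqrt n"
    unfolding AE_all_countable by (intro allI each) simp
  then show ?thesis
  proof eventually_elim
    case (elim \<omega>)
    show ?case
    proof (intro allI impI)
      fix \<epsilon> :: real assume "\<epsilon> > 0"
      then obtain k where k: "1 / real (Suc k) < \<epsilon>" by (rule nat_approx_posE)
      from elim[rule_format, of k]
      show "\<forall>\<^sub>F n in sequentially. \<forall>x y. (\<Sum>i<n. (x i)\<^sup>2) \<le> 1 \<longrightarrow> (\<Sum>j<p n. (y j)\<^sup>2) \<le> 1 \<longrightarrow>
        \<bar>bilin n (p n) (\<lambda>i j. W n i j \<omega>) x y\<bar> \<le> \<epsilon> * sqrt n"
      proof eventually_elim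
        case (elim n)
        have "(1 / real (Suc k)) * sqrt n \<le> \<epsilon> * sqrt n" using k by (intro mult_right_mono) auto
        then show ?case using elim by (meson order_trans)
      qed
    qed
  qed
qed

section \<open>Density of the polynomials\<close>

lemma poly_boundedE:
  assumes "poly_bounded g"
  obtains C k where "C > 0" "\<And>x. \<bar>g x\<bar> \<le> C * (1 + \<bar>x\<bar>) ^ k"
proof -
  obtain C k where C: "\<And>x. \<bar>g x\<bar> \<le> C * (1 + \<bar>x\<bar>) ^ k" using assms unfolding poly_bounded_def by blast
  have "\<bar>g x\<bar> \<le> max C 1 * (1 + \<bar>x\<bar>) ^ k" for x
    by (rule order_trans[OF C], rule mult_right_mono) simp_all
  then show thesis by (rule that[rotated]) simp
qed

lemma poly_bounded_mult:
  assumes "poly_bounded g" "poly_bounded h"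
  shows "poly_bounded (\<lambda>x. g x * h x)"
proof -
  obtain C k where C: "C > 0" "\<And>x. \<bar>g x\<bar> \<le> C * (1 + \<bar>x\<bar>) ^ k" using assms(1) by (rule poly_boundedE) blast
  obtain D m where D: "D > 0" "\<And>x. \<bar>h x\<bar> \<le> D * (1 + \<bar>x\<bar>) ^ m" using assms(2) by (rule poly_boundedE) blast
  have "\<bar>g x * h x\<bar> \<le> (C * D) * (1 + \<bar>x\<bar>) ^ (k + m)" for x
  proof -
    have "\<bar>g x\<bar> * \<bar>h x\<bar> \<le> (C * (1 + \<bar>x\<bar>) ^ k) * (D * (1 + \<bar>x\<bar>) ^ m)"
      by (intro mult_mono C D) (use C in auto)
    then show ?thesis by (simp add: abs_mult power_add mult_ac)
  qed
  then show ?thesis unfolding poly_bounded_def by blast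
qed

lemma poly_bounded_add:
  assumes "poly_bounded g" "poly_bounded h"
  shows "poly_bounded (\<lambda>x. g x + h x)"
proof -
  obtain C k where C: "C > 0" "\<And>x. \<bar>g x\<bar> \<le> C * (1 + \<bar>x\<bar>) ^ k" using assms(1) by (rule poly_boundedE) blast
  obtain D m where D: "D > 0" "\<And>x. \<bar>h x\<bar> \<le> D * (1 + \<bar>x\<bar>) ^ m" using assms(2) by (rule poly_boundedE) blast
  have "\<bar>g x + h x\<bar> \<le> (C + D) * (1 + \<bar>x\<bar>) ^ (max k m)" for x
  proof -
    have "\<bar>g x\<bar> \<le> C * (1 + \<bar>x\<bar>) ^ (max k m)"
      by (rule order_trans[OF C(2)], intro mult_left_mono power_increasing) (use C in auto)
    moreover have "\<bar>h x\<bar> \<le> D * (1 + \<bar>x\<bar>) ^ (max k m)"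
      by (rule order_trans[OF D(2)], intro mult_left_mono power_increasing) (use D in auto)
    ultimately show ?thesis unfolding distrib_right by linarith
  qed
  then show ?thesis unfolding poly_bounded_def by blast
qed

lemma poly_bounded_const: "poly_bounded (\<lambda>_. c)"
  unfolding poly_bounded_def by (rule exI[of _ "\<bar>c\<bar>"], rule exI[of _ 0]) simp

lemma poly_bounded_ident: "poly_bounded (\<lambda>x. x)"
  unfolding poly_bounded_def by (rule exI[of _ 1], rule exI[of _ 1]) simp

lemma poly_bounded_poly: "poly_bounded (poly P)"
proof (induction P)
  case 0
  then show ?case using poly_bounded_const[of 0] by simp
next
  case (pCons a P)
  have "poly_bounded (\<lambda>x. a + x * poly P x)"
    by (intro poly_bounded_add poly_bounded_mult poly_bounded_const poly_bounded_ident pCons)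
  moreover have "poly (pCons a P) = (\<lambda>x. a + x * poly P x)" by (rule ext) simp
  ultimately show ?case by simp
qed

lemma power_le_fact_exp:
  fixes y d :: real
  assumes "y \<ge> 0" "d > 0"
  shows "y ^ k \<le> fact k / d ^ k * exp (d * y)"
proof -
  have "(\<Sum>n\<in>{k}. (d * y) ^ n /\<^sub>R fact n) \<le> (\<Sum>n. (d * y) ^ n /\<^sub>R fact n)"
    using assms by (intro sum_le_suminf summable_exp_generic) auto
  then have "(d * y) ^ k / fact k \<le> exp (d * y)" by (simp add: exp_def divide_inverse mult.commute)
  then show ?thesis using assms by (simp add: field_simps power_mult_distrib)
qed

lemma square_add_le: "(a + b)\<^sup>2 \<le> 2 * a\<^sup>2 + 2 * (b::real)\<^sup>2"
  using zero_le_power2[of "a - b"] by (simp add: power2_eq_square algebra_simps)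

lemma integrable_le:
  fixes f g :: "'a \<Rightarrow> real"
  assumes "integrable M g" "f \<in> borel_measurable M" "\<And>x. x \<in> space M \<Longrightarrow> \<bar>f x\<bar> \<le> g x"
  shows "integrable M f"
proof (rule Bochner_Integration.integrable_bound[OF assms(1,2)])
  show "AE x in M. norm (f x) \<le> norm (g x)"
    unfolding real_norm_def by (rule AE_I2, rule order_trans[OF assms(3) abs_ge_self])
qed

locale exponential_moments = prob_space M for M :: "real measure" +
  fixes r :: real
  assumes sets_M: "sets M = sets borel" and r_pos: "r > 0"
    and exp_integrable: "\<bar>t\<bar> < r \<Longrightarrow> integrable M (\<lambda>x. exp (t * x))"
begin

lemma measurable_M: "borel_measurable M = borel_measurable borel"
  by (rule measurable_cong_sets) (simp_all add: sets_M)

lemma exp_abs_integrable: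
  assumes "0 \<le> t" "t < r"
  shows "integrable M (\<lambda>x. exp (t * \<bar>x\<bar>))"
proof (rule integrable_le)
  show "integrable M (\<lambda>x. exp (t * x) + exp (- t * x))" using assms by (intro Bochner_Integration.integrable_add exp_integrable) auto
  have "exp (t * \<bar>x\<bar>) \<le> exp (t * x) + exp (- t * x)" for x
    by (cases "x \<ge> 0") (auto intro: add_increasing add_increasing2)
  then show "\<bar>exp (t * \<bar>x\<bar>)\<bar> \<le> exp (t * x) + exp (- t * x)" for x unfolding abs_exp_cancel .
qed (simp add: measurable_M)

lemma power_exp_integrable:
  assumes "0 \<le> t" "t < r"
  shows "integrable M (\<lambda>x. (1 + \<bar>x\<bar>) ^ k * exp (t * \<bar>x\<bar>))"
proof (rule integrable_le)
  define d where "d = (r - t) / 2"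
  have d: "d > 0" "t + d < r" "0 \<le> t + d" using assms by (auto simp: d_def field_simps)
  show "integrable M (\<lambda>x. (fact k / d ^ k * exp d) * exp ((t + d) * \<bar>x\<bar>))"
    using exp_abs_integrable[OF d(3,2)] by simp
  have "(1 + \<bar>x\<bar>) ^ k * exp (t * \<bar>x\<bar>) \<le> (fact k / d ^ k * exp d) * exp ((t + d) * \<bar>x\<bar>)" for x
  proof -
    have "(1 + \<bar>x\<bar>) ^ k * exp (t * \<bar>x\<bar>) \<le> (fact k / d ^ k * exp (d * (1 + \<bar>x\<bar>))) * exp (t * \<bar>x\<bar>)"
      using power_le_fact_exp[of "1 + \<bar>x\<bar>" d k] d by (intro mult_right_mono) auto
    also have "\<dots> = (fact k / d ^ k * exp d) * exp ((t + d) * \<bar>x\<bar>)"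
      by (simp add: exp_add algebra_simps)
    finally show ?thesis .
  qed
  then show "\<bar>(1 + \<bar>x\<bar>) ^ k * exp (t * \<bar>x\<bar>)\<bar> \<le> (fact k / d ^ k * exp d) * exp ((t + d) * \<bar>x\<bar>)" for x
    by (subst abs_of_nonneg) simp_all
qed (simp add: measurable_M)

lemma poly_bounded_integrable:
  assumes g: "poly_bounded g" and [measurable]: "g \<in> borel_measurable borel" and t: "0 \<le> t" "t < r"
  shows "integrable M (\<lambda>x. g x * exp (t * \<bar>x\<bar>))"
proof -
  obtain C k where C: "C > 0" "\<And>x. \<bar>g x\<bar> \<le> C * (1 + \<bar>x\<bar>) ^ k" using g by (rule poly_boundedE) blast
  show ?thesis
  proof (rule integrable_le)
    show "integrable M (\<lambda>x. C * ((1 + \<bar>x\<bar>) ^ k * exp (t * \<bar>x\<bar>)))" using power_exp_integrable[OF t] by simp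
    have "\<bar>g x * exp (t * \<bar>x\<bar>)\<bar> \<le> C * ((1 + \<bar>x\<bar>) ^ k * exp (t * \<bar>x\<bar>))" for x
    proof -
      have "\<bar>g x\<bar> * exp (t * \<bar>x\<bar>) \<le> (C * (1 + \<bar>x\<bar>) ^ k) * exp (t * \<bar>x\<bar>)" by (intro mult_right_mono C) auto
      then show ?thesis by (simp add: abs_mult)
    qed
    then show "\<bar>g x * exp (t * \<bar>x\<bar>)\<bar> \<le> C * ((1 + \<bar>x\<bar>) ^ k * exp (t * \<bar>x\<bar>))" for x .
  qed (simp add: measurable_M)
qed

lemma poly_bounded_integrable0:
  "poly_bounded g \<Longrightarrow> g \<in> borel_measurable borel \<Longrightarrow> integrable M g"
  using poly_bounded_integrable[of g 0] r_pos by simp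

definition L2 :: "(real \<Rightarrow> real) set" where
  "L2 = {g \<in> borel_measurable borel. integrable M (\<lambda>x. (g x)\<^sup>2)}"

text \<open>The closure of the polynomials in L2, kept as a set of functions instead of classes
  modulo null sets, so that pointwise dominated limits can be taken inside it.\<close>

definition poly_closure :: "(real \<Rightarrow> real) set" where
  "poly_closure = {g \<in> L2. \<forall>\<epsilon>>0. \<exists>P. expectation (\<lambda>x. (g x - poly P x)\<^sup>2) < \<epsilon>}"

lemma L2_measurable: "g \<in> L2 \<Longrightarrow> g \<in> borel_measurable borel" by (simp add: L2_def)

lemma L2_measurable' [measurable_dest]: "g \<in> L2 \<Longrightarrow> g \<in> borel_measurable M" by (simp add: L2_def measurable_M)

lemma poly_bounded_L2: "poly_bounded g \<Longrightarrow> g \<in> borel_measurable borel \<Longrightarrow> g \<in> L2"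
  using poly_bounded_mult[of g g] by (auto simp: L2_def power2_eq_square intro!: poly_bounded_integrable0)

lemma poly_L2: "poly P \<in> L2"
  by (intro poly_bounded_L2 poly_bounded_poly borel_measurable_continuous_onI) (auto intro!: continuous_intros)

lemma L2_mono:
  assumes "g \<in> L2" "h \<in> borel_measurable borel" "\<And>x. \<bar>h x\<bar> \<le> \<bar>g x\<bar>"
  shows "h \<in> L2"
proof -
  have "integrable M (\<lambda>x. (h x)\<^sup>2)"
    by (rule integrable_le[of M "\<lambda>x. (g x)\<^sup>2"]) (use assms in \<open>auto simp: L2_def measurable_M abs_le_square_iff\<close>)
  then show ?thesis using assms by (simp add: L2_def)
qed

lemma L2_integrable_mult:
  assumes g: "g \<in> L2" and h: "h \<in> L2"
  shows "integrable M (\<lambda>x. g x * h x)"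
proof (rule integrable_le[of M "\<lambda>x. (g x)\<^sup>2 + (h x)\<^sup>2"])
  show "integrable M (\<lambda>x. (g x)\<^sup>2 + (h x)\<^sup>2)" using g h by (auto simp: L2_def)
  have "\<bar>g x * h x\<bar> \<le> (g x)\<^sup>2 + (h x)\<^sup>2" for x
  proof -
    have "2 * \<bar>g x\<bar> * \<bar>h x\<bar> \<le> (g x)\<^sup>2 + (h x)\<^sup>2" using sum_squares_bound[of "\<bar>g x\<bar>" "\<bar>h x\<bar>"] by simp
    moreover have "0 \<le> \<bar>g x\<bar> * \<bar>h x\<bar>" by simp
    ultimately show ?thesis unfolding abs_mult by linarith
  qed
  then show "\<bar>g x * h x\<bar> \<le> (g x)\<^sup>2 + (h x)\<^sup>2" for x .
  show "(\<lambda>x. g x * h x) \<in> borel_measurable M" using g h by measurable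
qed

lemma L2_add:
  assumes "g \<in> L2" "h \<in> L2"
  shows "(\<lambda>x. g x + h x) \<in> L2"
proof -
  have "integrable M (\<lambda>x. (g x)\<^sup>2 + (h x)\<^sup>2 + 2 * (g x * h x))"
    using assms L2_integrable_mult[OF assms] by (auto simp: L2_def)
  moreover have "(\<lambda>x. g x + h x) \<in> borel_measurable borel" using assms by (auto simp: L2_def)
  ultimately show ?thesis by (simp add: L2_def power2_sum mult.assoc)
qed

lemma L2_scale: "g \<in> L2 \<Longrightarrow> (\<lambda>x. c * g x) \<in> L2"
  unfolding L2_def by (auto simp: power_mult_distrib)

lemma L2_diff: "g \<in> L2 \<Longrightarrow> h \<in> L2 \<Longrightarrow> (\<lambda>x. g x - h x) \<in> L2"
  using L2_add[of g "\<lambda>x. (-1) * h x"] L2_scale[of h "-1"] by simp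

lemma L2_sq_integrable: "g \<in> L2 \<Longrightarrow> integrable M (\<lambda>x. (g x)\<^sup>2)" by (simp add: L2_def)

lemma dist_triangle_sq:
  assumes "g \<in> L2" "h \<in> L2" "k \<in> L2"
  shows "expectation (\<lambda>x. (g x - k x)\<^sup>2) \<le> 2 * expectation (\<lambda>x. (g x - h x)\<^sup>2) + 2 * expectation (\<lambda>x. (h x - k x)\<^sup>2)"
proof -
  note int = L2_sq_integrable[OF L2_diff[OF assms(1,3)]] L2_sq_integrable[OF L2_diff[OF assms(1,2)]] L2_sq_integrable[OF L2_diff[OF assms(2,3)]]
  have "expectation (\<lambda>x. (g x - k x)\<^sup>2) \<le> expectation (\<lambda>x. 2 * (g x - h x)\<^sup>2 + 2 * (h x - k x)\<^sup>2)"
  proof (rule integral_mono)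
    fix x show "(g x - k x)\<^sup>2 \<le> 2 * (g x - h x)\<^sup>2 + 2 * (h x - k x)\<^sup>2"
      using square_add_le[of "g x - h x" "h x - k x"] by simp
  qed (use int in auto)
  also have "\<dots> = 2 * expectation (\<lambda>x. (g x - h x)\<^sup>2) + 2 * expectation (\<lambda>x. (h x - k x)\<^sup>2)"
    using int by simp
  finally show ?thesis .
qed

lemma poly_in_closure: "poly P \<in> poly_closure"
  unfolding poly_closure_def using poly_L2 by (auto intro!: exI[of _ P])

lemma zero_in_closure: "(\<lambda>_. 0) \<in> poly_closure"
proof -
  have "poly 0 = (\<lambda>_. 0 :: real)" by (rule ext) simp
  then show ?thesis using poly_in_closure[of 0] by simp
qed

lemma closure_L2: "g \<in> poly_closure \<Longrightarrow> g \<in> L2" by (simp add: poly_closure_def)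

lemma poly_closure_limit:
  assumes "g \<in> L2" "\<And>\<epsilon>. \<epsilon> > 0 \<Longrightarrow> \<exists>h\<in>poly_closure. expectation (\<lambda>x. (g x - h x)\<^sup>2) < \<epsilon>"
  shows "g \<in> poly_closure"
  unfolding poly_closure_def
proof (intro CollectI conjI allI impI assms(1))
  fix \<epsilon> :: real assume "\<epsilon> > 0"
  then obtain h where h: "h \<in> poly_closure" "expectation (\<lambda>x. (g x - h x)\<^sup>2) < \<epsilon> / 4" using assms(2)[of "\<epsilon> / 4"] by auto
  then obtain P where P: "expectation (\<lambda>x. (h x - poly P x)\<^sup>2) < \<epsilon> / 4" using \<open>\<epsilon> > 0\<close> unfolding poly_closure_def by (auto dest!: spec[of _ "\<epsilon> / 4"])
  have "expectation (\<lambda>x. (g x - poly P x)\<^sup>2) < \<epsilon>"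
    using dist_triangle_sq[OF assms(1) closure_L2[OF h(1)] poly_L2[of P]] h P by linarith
  then show "\<exists>P. expectation (\<lambda>x. (g x - poly P x)\<^sup>2) < \<epsilon>" ..
qed

text \<open>Both \<open>h n\<close> and the limit are dominated by \<open>d\<close>, hence the
  squared differences by \<open>4 * d\<^sup>2\<close>, and dominated convergence turns the pointwise
  limit into one in L2.\<close>

lemma poly_closure_dominated:
  assumes h: "\<And>n. h n \<in> poly_closure" and lim: "\<And>x. (\<lambda>n. h n x) \<longlonglongrightarrow> g x"
    and d: "d \<in> L2" "\<And>n x. \<bar>h n x\<bar> \<le> \<bar>d x\<bar>"
  shows "g \<in> poly_closure"
proof -
  have gm: "g \<in> borel_measurable borel"
    by (rule borel_measurable_LIMSEQ_real[OF lim]) (use h closure_L2 L2_measurable in blast)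
  have gd: "\<bar>g x\<bar> \<le> \<bar>d x\<bar>" for x
    by (rule LIMSEQ_le_const2[OF tendsto_rabs[OF lim]]) (use d in auto)
  have gL: "g \<in> L2" by (rule L2_mono[OF d(1) gm gd])
  have hm: "h n \<in> borel_measurable M" for n using closure_L2[OF h] by (rule L2_measurable')
  have "(\<lambda>n. expectation (\<lambda>x. (g x - h n x)\<^sup>2)) \<longlonglongrightarrow> expectation (\<lambda>x. 0)"
  proof (rule integral_dominated_convergence[where w = "\<lambda>x. 4 * (d x)\<^sup>2"])
    show "AE x in M. (\<lambda>n. (g x - h n x)\<^sup>2) \<longlonglongrightarrow> 0"
    proof (rule AE_I2)
      fix x
      have "(\<lambda>n. (g x - h n x)\<^sup>2) \<longlonglongrightarrow> (g x - g x)\<^sup>2" by (intro tendsto_intros lim)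
      then show "(\<lambda>n. (g x - h n x)\<^sup>2) \<longlonglongrightarrow> 0" by simp
    qed
    show "AE x in M. norm ((g x - h n x)\<^sup>2) \<le> 4 * (d x)\<^sup>2" for n
    proof (rule AE_I2)
      fix x
      have "\<bar>g x - h n x\<bar> \<le> \<bar>2 * d x\<bar>" using gd[of x] d(2)[of n x] by linarith
      then have "(g x - h n x)\<^sup>2 \<le> (2 * d x)\<^sup>2" by (simp only: abs_le_square_iff)
      then show "norm ((g x - h n x)\<^sup>2) \<le> 4 * (d x)\<^sup>2" by (simp add: power_mult_distrib)
    qed
  qed (use gL d hm L2_measurable' in \<open>auto simp: L2_sq_integrable\<close>)
  then have lim0: "(\<lambda>n. expectation (\<lambda>x. (g x - h n x)\<^sup>2)) \<longlonglongrightarrow> 0" by simp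
  show ?thesis
  proof (rule poly_closure_limit[OF gL])
    fix \<epsilon> :: real assume "\<epsilon> > 0"
    from order_tendstoD(2)[OF lim0 this] obtain n where "expectation (\<lambda>x. (g x - h n x)\<^sup>2) < \<epsilon>"
      by (auto simp: eventually_sequentially)
    then show "\<exists>h\<in>poly_closure. expectation (\<lambda>x. (g x - h x)\<^sup>2) < \<epsilon>" using h by blast
  qed
qed

lemma poly_closure_add:
  assumes g: "g \<in> poly_closure" and h: "h \<in> poly_closure"
  shows "(\<lambda>x. g x + h x) \<in> poly_closure"
  unfolding poly_closure_def
proof (intro CollectI conjI allI impI L2_add closure_L2 g h)
  fix \<epsilon> :: real assume "\<epsilon> > 0"
  then obtain P Q where P: "expectation (\<lambda>x. (g x - poly P x)\<^sup>2) < \<epsilon> / 4" and Q: "expectation (\<lambda>x. (h x - poly Q x)\<^sup>2) < \<epsilon> / 4"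
    using g h unfolding poly_closure_def by (auto dest!: spec[of _ "\<epsilon> / 4"])
  have 1: "(\<lambda>x. poly P x + h x) \<in> L2" "(\<lambda>x. g x + h x) \<in> L2"
    using L2_add poly_L2 closure_L2 g h by auto
  have "expectation (\<lambda>x. ((g x + h x) - poly (P + Q) x)\<^sup>2) < \<epsilon>"
    using dist_triangle_sq[OF 1(2) 1(1) poly_L2[of "P + Q"]] P Q by (simp add: algebra_simps)
  then show "\<exists>P. expectation (\<lambda>x. ((g x + h x) - poly P x)\<^sup>2) < \<epsilon>" ..
qed

lemma poly_closure_scale:
  assumes g: "g \<in> poly_closure"
  shows "(\<lambda>x. c * g x) \<in> poly_closure"
proof (cases "c = 0")
  case True
  then show ?thesis using zero_in_closure by simp
next
  case False
  show ?thesis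
    unfolding poly_closure_def
  proof (intro CollectI conjI allI impI L2_scale closure_L2 g)
    fix \<epsilon> :: real assume "\<epsilon> > 0"
    then have "\<epsilon> / c\<^sup>2 > 0" using False by simp
    then obtain P where P: "expectation (\<lambda>x. (g x - poly P x)\<^sup>2) < \<epsilon> / c\<^sup>2"
      using g unfolding poly_closure_def by blast
    have "expectation (\<lambda>x. (c * g x - poly (Polynomial.smult c P) x)\<^sup>2) = c\<^sup>2 * expectation (\<lambda>x. (g x - poly P x)\<^sup>2)"
      by (simp add: power_mult_distrib flip: right_diff_distrib)
    also have "\<dots> < \<epsilon>" using P False by (simp add: pos_less_divide_eq mult.commute)
    finally show "\<exists>P. expectation (\<lambda>x. (c * g x - poly P x)\<^sup>2) < \<epsilon>" ..
  qed
qed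

text \<open>Density of the polynomials: the multipliers of their closure form an algebra closed under bounded
  pointwise limits. It contains \<open>sin (t * x)\<close> for small \<open>t\<close>, whose Taylor series is dominated by an
  exponential moment, hence all indicators of half-lines and finally of all Borel sets.\<close>

definition multipliers :: "(real \<Rightarrow> real) set" where
  "multipliers = {m \<in> borel_measurable borel. (\<exists>B. \<forall>x. \<bar>m x\<bar> \<le> B) \<and> (\<forall>P. (\<lambda>x. m x * poly P x) \<in> poly_closure)}"

text \<open>The definition tests a multiplier on polynomials only. Multiplication by a bounded
  function is continuous in L2, so the property passes to the closure; this is what makes products
  of multipliers multipliers.\<close>

lemma multiplier_mult_closure:
  assumes m: "m \<in> multipliers" and g: "g \<in> poly_closure"
  shows "(\<lambda>x. m x * g x) \<in> poly_closure"
proof -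
  obtain B where B: "\<And>x. \<bar>m x\<bar> \<le> B" using m by (auto simp: multipliers_def)
  have B0: "B \<ge> 0" using B[of 0] by linarith
  have bd: "\<bar>m x * y\<bar> \<le> \<bar>B * y\<bar>" for x y
    using B[of x] B0 by (auto simp: abs_mult intro: mult_right_mono)
  have mm: "m \<in> borel_measurable borel" using m by (simp add: multipliers_def)
  have L: "(\<lambda>x. m x * h x) \<in> L2" if "h \<in> L2" for h
  proof (rule L2_mono[OF L2_scale[OF that, of B]])
    show "(\<lambda>x. m x * h x) \<in> borel_measurable borel" using mm L2_measurable[OF that] by (rule borel_measurable_times)
  qed (rule bd)
  show ?thesis
  proof (rule poly_closure_limit[OF L[OF closure_L2[OF g]]])
    fix \<epsilon> :: real assume e: "\<epsilon> > 0"
    \<comment> \<open>Adding 1 avoids a separate case for the bound \<open>B = 0\<close>.\<close>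
    then have "\<epsilon> / (B\<^sup>2 + 1) > 0" by (auto intro!: divide_pos_pos add_nonneg_pos)
    then obtain P where P: "expectation (\<lambda>x. (g x - poly P x)\<^sup>2) < \<epsilon> / (B\<^sup>2 + 1)"
      using g unfolding poly_closure_def by blast
    have gP: "(\<lambda>x. g x - poly P x) \<in> L2" by (rule L2_diff[OF closure_L2[OF g] poly_L2])
    have "expectation (\<lambda>x. (m x * g x - m x * poly P x)\<^sup>2) \<le> expectation (\<lambda>x. (B\<^sup>2 + 1) * (g x - poly P x)\<^sup>2)"
    proof (rule integral_mono)
      show "integrable M (\<lambda>x. (m x * g x - m x * poly P x)\<^sup>2)"
        using L2_sq_integrable[OF L[OF gP]] by (simp add: right_diff_distrib)
      fix x
      have "(m x * (g x - poly P x))\<^sup>2 \<le> (B * (g x - poly P x))\<^sup>2" using bd by (simp only: abs_le_square_iff)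
      also have "\<dots> \<le> (B\<^sup>2 + 1) * (g x - poly P x)\<^sup>2" by (simp add: power_mult_distrib distrib_right)
      finally show "(m x * g x - m x * poly P x)\<^sup>2 \<le> (B\<^sup>2 + 1) * (g x - poly P x)\<^sup>2" by (simp add: right_diff_distrib)
    qed (use L2_sq_integrable[OF gP] in auto)
    also have "\<dots> = (B\<^sup>2 + 1) * expectation (\<lambda>x. (g x - poly P x)\<^sup>2)" by simp
    also have "\<dots> < \<epsilon>"
    proof -
      have "B\<^sup>2 + 1 > 0" by (simp add: add_nonneg_pos)
      then show ?thesis using P by (simp add: pos_less_divide_eq mult.commute)
    qed
    finally have "expectation (\<lambda>x. (m x * g x - m x * poly P x)\<^sup>2) < \<epsilon>" .
    then show "\<exists>h\<in>poly_closure. expectation (\<lambda>x. (m x * g x - h x)\<^sup>2) < \<epsilon>"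
      using m by (auto simp: multipliers_def)
  qed
qed

lemma multiplier_measurable: "m \<in> multipliers \<Longrightarrow> m \<in> borel_measurable borel" by (simp add: multipliers_def)

lemma multiplier_mult:
  assumes m: "m \<in> multipliers" and k: "k \<in> multipliers"
  shows "(\<lambda>x. m x * k x) \<in> multipliers"
proof -
  obtain B where B: "\<And>x. \<bar>m x\<bar> \<le> B" using m by (auto simp: multipliers_def)
  obtain D where D: "\<And>x. \<bar>k x\<bar> \<le> D" using k by (auto simp: multipliers_def)
  have "B \<ge> 0" using B[of 0] by linarith
  then have "\<bar>m x * k x\<bar> \<le> B * D" for x unfolding abs_mult using B D by (intro mult_mono) auto
  moreover have "(\<lambda>x. m x * k x * poly P x) \<in> poly_closure" for P
    using multiplier_mult_closure[OF m, of "\<lambda>x. k x * poly P x"] k by (simp add: multipliers_def mult.assoc)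
  ultimately show ?thesis using multiplier_measurable[OF m] multiplier_measurable[OF k] by (auto simp: multipliers_def)
qed

lemma multiplier_const: "(\<lambda>_. c) \<in> multipliers"
  using poly_closure_scale[OF poly_in_closure] by (auto simp: multipliers_def)

lemma multiplier_add:
  assumes m: "m \<in> multipliers" and k: "k \<in> multipliers"
  shows "(\<lambda>x. m x + k x) \<in> multipliers"
proof -
  obtain B where B: "\<And>x. \<bar>m x\<bar> \<le> B" using m by (auto simp: multipliers_def)
  obtain D where D: "\<And>x. \<bar>k x\<bar> \<le> D" using k by (auto simp: multipliers_def)
  have "\<bar>m x + k x\<bar> \<le> B + D" for x using B[of x] D[of x] by linarith
  moreover have "(\<lambda>x. (m x + k x) * poly P x) \<in> poly_closure" for P
    using poly_closure_add[of "\<lambda>x. m x * poly P x" "\<lambda>x. k x * poly P x"] m k by (simp add: multipliers_def distrib_right)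
  ultimately show ?thesis using multiplier_measurable[OF m] multiplier_measurable[OF k] by (auto simp: multipliers_def)
qed

lemma multiplier_diff: "m \<in> multipliers \<Longrightarrow> k \<in> multipliers \<Longrightarrow> (\<lambda>x. m x - k x) \<in> multipliers"
  using multiplier_add[OF _ multiplier_mult[OF multiplier_const[of "-1"]], of m k] by simp

lemma multiplier_power: "m \<in> multipliers \<Longrightarrow> (\<lambda>x. m x ^ k) \<in> multipliers"
  by (induction k) (auto intro: multiplier_const multiplier_mult)

lemma multiplier_sum: "finite I \<Longrightarrow> (\<And>i. i \<in> I \<Longrightarrow> m i \<in> multipliers) \<Longrightarrow> (\<lambda>x. \<Sum>i\<in>I. m i x) \<in> multipliers"
  by (induction I rule: finite_induct) (auto intro: multiplier_const multiplier_add)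

lemma multiplier_limit:
  assumes m: "\<And>n. m n \<in> multipliers" and B: "\<And>n x. \<bar>m n x\<bar> \<le> B" and lim: "\<And>x. (\<lambda>n. m n x) \<longlonglongrightarrow> k x"
  shows "k \<in> multipliers"
proof -
  have "\<bar>k x\<bar> \<le> B" for x by (rule LIMSEQ_le_const2[OF tendsto_rabs[OF lim]]) (use B in auto)
  moreover have "k \<in> borel_measurable borel"
    by (rule borel_measurable_LIMSEQ_real[OF lim]) (use m multiplier_measurable in blast)
  moreover have "(\<lambda>x. k x * poly P x) \<in> poly_closure" for P
  proof (rule poly_closure_dominated)
    show "(\<lambda>x. m n x * poly P x) \<in> poly_closure" for n using m by (simp add: multipliers_def)
    show "(\<lambda>n. m n x * poly P x) \<longlonglongrightarrow> k x * poly P x" for x by (intro tendsto_intros lim)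
    show "(\<lambda>x. B * poly P x) \<in> L2" by (rule L2_scale[OF poly_L2])
    show "\<bar>m n x * poly P x\<bar> \<le> \<bar>B * poly P x\<bar>" for n x
      using B[of n x] by (auto simp: abs_mult intro: mult_right_mono)
  qed
  ultimately show ?thesis by (auto simp: multipliers_def)
qed

text \<open>The Taylor polynomials of the sine are dominated by
  \<open>exp (t * \<bar>a\<bar>) * exp (t * \<bar>x\<bar>)\<close>. For this majorant times a
  polynomial to be square integrable, the exponential moment of order \<open>2 * t\<close> must
  exist; hence the condition \<open>2 * t < r\<close>.\<close>

lemma multiplier_sin:
  assumes t: "0 \<le> t" "2 * t < r"
  shows "(\<lambda>x. sin (t * (x - a))) \<in> multipliers"
proof -
  have 1: "(\<lambda>x. sin (t * (x - a)) * poly P x) \<in> poly_closure" for P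
  proof (rule poly_closure_dominated)
    let ?S = "\<lambda>N. \<Sum>k<N. Polynomial.smult (sin_coeff k) ([:- (t * a), t:] ^ k)"
    have "poly [:- (t * a), t:] x = t * (x - a)" for x by (simp add: algebra_simps)
    then have S: "poly (?S N) x = (\<Sum>k<N. sin_coeff k * (t * (x - a)) ^ k)" for N x
      by (simp add: poly_sum poly_power del: poly_pCons)
    show "(\<lambda>x. poly (?S N) x * poly P x) \<in> poly_closure" for N
      using poly_in_closure[of "?S N * P"] unfolding poly_mult .
    show "(\<lambda>N. poly (?S N) x * poly P x) \<longlonglongrightarrow> sin (t * (x - a)) * poly P x" for x
      unfolding S using sin_converges[of "t * (x - a)"] by (intro tendsto_intros) (simp add: sums_def)
    show "(\<lambda>x. exp (t * \<bar>a\<bar>) * (exp (t * \<bar>x\<bar>) * poly P x)) \<in> L2"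
    proof (rule L2_scale)
      have Pm: "poly P \<in> borel_measurable borel" by (rule L2_measurable[OF poly_L2])
      have "integrable M (\<lambda>x. (poly P x * poly P x) * exp ((2 * t) * \<bar>x\<bar>))"
        by (intro poly_bounded_integrable poly_bounded_mult poly_bounded_poly) (use t Pm in auto)
      also have "(\<lambda>x. (poly P x * poly P x) * exp ((2 * t) * \<bar>x\<bar>)) = (\<lambda>x. (exp (t * \<bar>x\<bar>) * poly P x)\<^sup>2)"
      proof (rule ext)
        fix x
        have "exp ((2 * t) * \<bar>x\<bar>) = (exp (t * \<bar>x\<bar>))\<^sup>2" by (simp flip: exp_double add: mult.assoc)
        then show "(poly P x * poly P x) * exp ((2 * t) * \<bar>x\<bar>) = (exp (t * \<bar>x\<bar>) * poly P x)\<^sup>2"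
          by (simp add: power_mult_distrib power2_eq_square)
      qed
      finally show "(\<lambda>x. exp (t * \<bar>x\<bar>) * poly P x) \<in> L2" using Pm by (simp add: L2_def)
    qed
    show "\<bar>poly (?S N) x * poly P x\<bar> \<le> \<bar>exp (t * \<bar>a\<bar>) * (exp (t * \<bar>x\<bar>) * poly P x)\<bar>" for N x
    proof -
      let ?y = "\<bar>t * (x - a)\<bar>"
      have "\<bar>poly (?S N) x\<bar> \<le> (\<Sum>k<N. \<bar>sin_coeff k * (t * (x - a)) ^ k\<bar>)" unfolding S by (rule sum_abs)
      also have "\<dots> \<le> (\<Sum>k<N. ?y ^ k /\<^sub>R fact k)"
      proof (rule sum_mono)
        fix k
        have "\<bar>sin_coeff k\<bar> \<le> inverse (fact k)" by (auto simp: sin_coeff_def divide_inverse abs_mult power_abs)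
        then have "\<bar>sin_coeff k\<bar> * ?y ^ k \<le> inverse (fact k) * ?y ^ k" by (intro mult_right_mono) auto
        then show "\<bar>sin_coeff k * (t * (x - a)) ^ k\<bar> \<le> ?y ^ k /\<^sub>R fact k" by (simp add: abs_mult power_abs)
      qed
      also have "\<dots> \<le> (\<Sum>k. ?y ^ k /\<^sub>R fact k)" by (intro sum_le_suminf summable_exp_generic) auto
      also have "\<dots> = exp ?y" by (simp add: exp_def)
      also have "\<dots> \<le> exp (t * \<bar>a\<bar> + t * \<bar>x\<bar>)"
      proof -
        have "?y = t * \<bar>x - a\<bar>" using t by (simp add: abs_mult)
        also have "\<dots> \<le> t * (\<bar>a\<bar> + \<bar>x\<bar>)" using t by (intro mult_left_mono) auto
        finally show ?thesis by (simp add: distrib_left)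
      qed
      finally have "\<bar>poly (?S N) x\<bar> \<le> exp (t * \<bar>a\<bar>) * exp (t * \<bar>x\<bar>)" by (simp add: exp_add)
      then have "\<bar>poly (?S N) x\<bar> * \<bar>poly P x\<bar> \<le> (exp (t * \<bar>a\<bar>) * exp (t * \<bar>x\<bar>)) * \<bar>poly P x\<bar>" by (rule mult_right_mono) simp
      then show ?thesis by (simp only: abs_mult abs_exp_cancel mult.assoc)
    qed
  qed
  show ?thesis
    unfolding multipliers_def
  proof (intro CollectI conjI allI 1)
    show "\<exists>B. \<forall>x. \<bar>sin (t * (x - a))\<bar> \<le> B" by (rule exI[of _ 1]) simp
  qed measurable
qed

text \<open>The Bernstein polynomials of \<open>\<psi>\<close> are algebraic expressions in
  \<open>m\<close>, hence multipliers, and converge uniformly. From some \<open>N\<close> on they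
  differ from \<open>\<psi>\<close> by less than 1, which bounds them by 2; dropping the initial
  segment provides the uniform bound for the limit.\<close>

lemma multiplier_continuous:
  assumes m: "m \<in> multipliers" and m01: "\<And>x. m x \<in> {0..1}" and \<psi>: "continuous_on {0..1} \<psi>" "\<And>y. \<bar>\<psi> y\<bar> \<le> 1"
  shows "(\<lambda>x. \<psi> (m x)) \<in> multipliers"
proof -
  define b where "b = (\<lambda>n y. \<Sum>k\<le>n. \<psi> (real k / real n) * Bernstein n k y)"
  have near: "\<exists>N. \<forall>n\<ge>N. \<forall>y\<in>{0..1}. \<bar>\<psi> y - b n y\<bar> < e" if "e > 0" for e
  proof -
    from Bernstein_Weierstrass[OF \<psi>(1) that] obtain N where
      N: "\<forall>n y. N \<le> n \<and> y \<in> {0..1} \<longrightarrow> \<bar>\<psi> y - (\<Sum>k\<le>n. \<psi> (real k / real n) * Bernstein n k y)\<bar> < e" ..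
    then show ?thesis unfolding b_def by (intro exI[of _ N]) simp
  qed
  have bm: "(\<lambda>x. b n (m x)) \<in> multipliers" for n
    unfolding b_def Bernstein_def
    by (intro multiplier_sum finite_atMost multiplier_mult[OF multiplier_const]
          multiplier_mult[OF multiplier_mult[OF multiplier_const multiplier_power[OF m]] multiplier_power[OF multiplier_diff[OF multiplier_const m]]])
  have "\<exists>N. \<forall>n\<ge>N. \<forall>y\<in>{0..1}. \<bar>\<psi> y - b n y\<bar> < 1" by (rule near) simp
  then obtain N where "\<forall>n\<ge>N. \<forall>y\<in>{0..1}. \<bar>\<psi> y - b n y\<bar> < 1" ..
  then have N: "\<And>n y. n \<ge> N \<Longrightarrow> y \<in> {0..1} \<Longrightarrow> \<bar>\<psi> y - b n y\<bar> < 1" by blast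
  show ?thesis
  proof (rule multiplier_limit)
    show "(\<lambda>x. b (n + N) (m x)) \<in> multipliers" for n by (rule bm)
    show "\<bar>b (n + N) (m x)\<bar> \<le> 2" for n x using N[of "n + N" "m x"] m01[of x] \<psi>(2)[of "m x"] by simp
    show "(\<lambda>n. b (n + N) (m x)) \<longlonglongrightarrow> \<psi> (m x)" for x
    proof (rule LIMSEQ_ignore_initial_segment, rule LIMSEQ_I)
      fix e :: real assume "e > 0"
      from near[OF this] obtain no where no: "\<forall>n\<ge>no. \<forall>y\<in>{0..1}. \<bar>\<psi> y - b n y\<bar> < e" ..
      have "norm (b n (m x) - \<psi> (m x)) < e" if "n \<ge> no" for n
        unfolding real_norm_def abs_minus_commute[of "b n (m x)"] using no that m01[of x] by blast
      then show "\<exists>no. \<forall>n\<ge>no. norm (b n (m x) - \<psi> (m x)) < e" by blast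
    qed
  qed
qed

lemma multiplier_greaterThan: "indicator {a<..} \<in> multipliers"
proof -
  obtain n0 where n0: "2 / r < real n0" using reals_Archimedean2 by blast
  \<comment> \<open>With \<open>y = (1 + sin ((x - a) / N)) / 2\<close>, which lies in
    \<open>{0..1}\<close> as the Bernstein approximation requires, \<open>2 * y - 1\<close> is the
    sine again. Since \<open>N\<^sup>2 * sin ((x - a) / N)\<close> behaves like
    \<open>N * (x - a)\<close>, clamping it to \<open>{0..1}\<close> gives 1 for
    \<open>x > a\<close> and 0 for \<open>x \<le> a\<close> eventually. The shift by
    \<open>n0\<close> keeps the frequency \<open>1 / N\<close> below \<open>r / 2\<close>.\<close>
  define \<psi> where "\<psi> = (\<lambda>n::nat. \<lambda>y::real. max 0 (min 1 ((real n)\<^sup>2 * (2 * y - 1))))"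
  define m where "m = (\<lambda>n::nat. \<lambda>x. \<psi> (n + n0 + 1) ((1 + sin (1 / real (n + n0 + 1) * (x - a))) / 2))"
  have s: "(\<lambda>x. (1 + sin (1 / real (n + n0 + 1) * (x - a))) / 2) \<in> multipliers" for n
  proof -
    define c where "c = real (n + n0 + 1)"
    have c: "c > 0" "2 / r < c" using n0 by (simp_all add: c_def)
    have "2 < c * r" using c(2) r_pos by (simp only: pos_divide_less_eq)
    then have "2 / c < r" using c(1) by (simp only: pos_divide_less_eq mult.commute[of r])
    then have "2 * (1 / c) < r" by simp
    then have "(\<lambda>x. sin (1 / c * (x - a))) \<in> multipliers" using c(1) by (intro multiplier_sin) simp_all
    then have "(\<lambda>x. 1 / 2 * (1 + sin (1 / c * (x - a)))) \<in> multipliers"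
      by (rule multiplier_mult[OF multiplier_const multiplier_add[OF multiplier_const]])
    moreover have "1 / 2 * (1 + y) = (1 + y) / 2" for y :: real by simp
    ultimately show ?thesis unfolding c_def by simp
  qed
  show ?thesis
  proof (rule multiplier_limit)
  show "m n \<in> multipliers" for n
    unfolding m_def
  proof (rule multiplier_continuous[OF s])
    fix x
    show "(1 + sin (1 / real (n + n0 + 1) * (x - a))) / 2 \<in> {0..1}"
    proof -
      have "0 \<le> (1 + sin y) / 2 \<and> (1 + sin y) / 2 \<le> 1" for y :: real
      proof -
        have "0 \<le> 1 + sin y" using sin_ge_minus_one[of y] by linarith
        moreover have "1 + sin y \<le> 2" using sin_le_one[of y] by linarith
        ultimately show ?thesis by simp
      qed
      then show ?thesis unfolding atLeastAtMost_iff .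
    qed
  next
    show "continuous_on {0..1} (\<psi> (n + n0 + 1))" unfolding \<psi>_def by (intro continuous_intros)
  qed (auto simp: \<psi>_def)
  show "\<bar>m n x\<bar> \<le> 1" for n x by (auto simp: m_def \<psi>_def)
  show "(\<lambda>n. m n x) \<longlonglongrightarrow> indicator {a<..} x" for x
  proof -
    have m_eq: "m n x = max 0 (min 1 ((real (n + n0 + 1))\<^sup>2 * sin ((x - a) / real (n + n0 + 1))))" for n
    proof -
      have e1: "2 * ((1 + t) / 2) - 1 = t" for t :: real by (simp add: field_simps)
      have e2: "1 / c * (x - a) = (x - a) / c" for c by simp
      show ?thesis unfolding m_def \<psi>_def e1 e2 ..
    qed
    have "eventually (\<lambda>N. max 0 (min 1 ((real N)\<^sup>2 * sin ((x - a) / real N))) = indicator {a<..} x) sequentially"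
    proof (cases "x > a")
      case True
      define z where "z = x - a"
      have "z > 0" using True by (simp add: z_def)
      then have "eventually (\<lambda>N. (real N)\<^sup>2 * sin (z / real N) \<ge> 1) sequentially" by real_asymp
      then show ?thesis
      proof eventually_elim
        case (elim N)
        then show ?case using True by (simp add: z_def)
      qed
    next
      case False
      define z where "z = a - x"
      have "z \<ge> 0" using False by (simp add: z_def)
      have "eventually (\<lambda>N. 0 \<le> (real N)\<^sup>2 * sin (z / real N)) sequentially"
      proof (cases "z = 0")
        case False
        then have "z > 0" using \<open>z \<ge> 0\<close> by simp
        then have "eventually (\<lambda>N. (real N)\<^sup>2 * sin (z / real N) \<ge> 1) sequentially" by real_asymp
        then show ?thesis
        proof eventually_elim
          case (elim N)
          then show ?case by linarith
        qed
      qed simp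
      then show ?thesis
      proof eventually_elim
        case (elim N)
        have "(x - a) / real N = - (z / real N)" by (simp add: z_def diff_divide_distrib)
        then have "(real N)\<^sup>2 * sin ((x - a) / real N) \<le> 0" using elim by simp
        then show ?case using False by (simp add: max_def min_def)
      qed
    qed
    then have "(\<lambda>N. max 0 (min 1 ((real N)\<^sup>2 * sin ((x - a) / real N)))) \<longlonglongrightarrow> indicator {a<..} x"
      by (rule tendsto_eventually)
    from LIMSEQ_ignore_initial_segment[OF this, of "n0 + 1"] show ?thesis
      unfolding m_eq by (simp add: add.assoc)
  qed
  qed
qed

text \<open>Induction over the sigma algebra generated by the open half-lines. Countable unions are
  pointwise limits of finite ones, and the indicator of a finite union is built from sums,
  differences and products, under which the multipliers are closed.\<close>

lemma multiplier_indicator: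
  assumes "A \<in> sets borel"
  shows "indicator A \<in> multipliers"
proof -
  have "A \<in> sigma_sets UNIV (range (\<lambda>a::real. {a<..}))"
    using assms by (subst (asm) borel_Ioi) simp
  then show ?thesis
  proof induction
    case (Basic A)
    then show ?case using multiplier_greaterThan by auto
  next
    case Empty
    then show ?case using multiplier_const[of 0] by (simp add: indicator_def)
  next
    case (Compl A)
    have "(\<lambda>x. 1 - indicator A x :: real) = indicator (UNIV - A)" by (auto simp: indicator_def)
    then show ?case using multiplier_diff[OF multiplier_const[of 1] Compl.IH] by simp
  next
    case (Union A)
    have fin: "indicator (\<Union>i<n. A i) \<in> multipliers" for n :: nat
    proof (induction n)
      case 0
      then show ?case using multiplier_const[of 0] by (simp add: indicator_def)
    next
      case (Suc n)
      have "(\<lambda>x. indicator (\<Union>i<n. A i) x + indicator (A n) x - indicator (\<Union>i<n. A i) x * indicator (A n) x :: real) = indicator (\<Union>i<Suc n. A i)"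
        by (auto simp: indicator_def lessThan_Suc)
      then show ?case
        using multiplier_diff[OF multiplier_add[OF Suc Union.IH[of n]] multiplier_mult[OF Suc Union.IH[of n]]] by simp
    qed
    show ?case
    proof (rule multiplier_limit[OF fin])
      show "\<bar>indicator (\<Union>i<n. A i) x :: real\<bar> \<le> 1" for n x by (simp add: indicator_def)
      show "(\<lambda>n. indicator (\<Union>i<n. A i) x :: real) \<longlonglongrightarrow> indicator (\<Union>i. A i) x" for x
        by (rule LIMSEQ_indicator_UN)
    qed
  qed
qed

text \<open>Square integrability is a premise inside the induction statement, since the induction
  runs over all nonnegative Borel functions. Summands and increasing approximants inherit it by
  domination from the function that they build.\<close>

lemma nonneg_L2_in_closure:
  assumes "u \<in> borel_measurable borel" "\<And>x. 0 \<le> u x"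
  shows "integrable M (\<lambda>x. (u x)\<^sup>2) \<longrightarrow> u \<in> poly_closure"
  using assms
proof (induction u rule: borel_measurable_induct_real)
  case (set A)
  then show ?case using multiplier_mult_closure[OF multiplier_indicator[of A] poly_in_closure[of 1]] by simp
next
  case (mult u c)
  show ?case
  proof (cases "c = 0")
    case True
    then show ?thesis using zero_in_closure by simp
  next
    case False
    have IH: "integrable M (\<lambda>x. (u x)\<^sup>2) \<longrightarrow> u \<in> poly_closure" by fact
    show ?thesis using False poly_closure_scale[of u c] IH by (simp add: power_mult_distrib)
  qed
next
  case (add u v)
  show ?case
  proof
    assume i: "integrable M (\<lambda>x. (v x + u x)\<^sup>2)"
    have m: "u \<in> borel_measurable borel" "v \<in> borel_measurable borel" by fact+
    have nn: "0 \<le> u x" "0 \<le> v x" for x by fact+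
    have IH: "integrable M (\<lambda>x. (u x)\<^sup>2) \<longrightarrow> u \<in> poly_closure" "integrable M (\<lambda>x. (v x)\<^sup>2) \<longrightarrow> v \<in> poly_closure" by fact+
    have L: "(\<lambda>x. v x + u x) \<in> L2" using i m by (simp add: L2_def)
    have le: "\<bar>u x\<bar> \<le> \<bar>v x + u x\<bar>" "\<bar>v x\<bar> \<le> \<bar>v x + u x\<bar>" for x using nn[of x] by simp_all
    have "u \<in> L2" "v \<in> L2" by (rule L2_mono[OF L m(1) le(1)], rule L2_mono[OF L m(2) le(2)])
    then show "(\<lambda>x. v x + u x) \<in> poly_closure" using IH by (intro poly_closure_add) (simp_all add: L2_def)
  qed
next
  case (seq U)
  show ?case
  proof
    assume i: "integrable M (\<lambda>x. (u x)\<^sup>2)"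
    have inc: "incseq U" and lim: "\<And>x. (\<lambda>i. U i x) \<longlonglongrightarrow> u x" and nn: "\<And>i x. 0 \<le> U i x"
      and Um: "\<And>i. U i \<in> borel_measurable borel" and P: "\<And>i. integrable M (\<lambda>x. (U i x)\<^sup>2) \<longrightarrow> U i \<in> poly_closure"
      by (fact, use seq in simp, fact+)
    have "incseq (\<lambda>i. U i x)" for x using inc by (simp add: incseq_def le_fun_def)
    then have le: "U i x \<le> u x" for i x using lim by (rule incseq_le)
    have le': "\<bar>U i x\<bar> \<le> \<bar>u x\<bar>" for i x using le[of i x] nn[of i x] by linarith
    have um: "u \<in> borel_measurable borel" by (rule borel_measurable_LIMSEQ_real[OF lim Um])
    have uL: "u \<in> L2" using i um by (simp add: L2_def)
    have "U i \<in> L2" for i by (rule L2_mono[OF uL Um le'])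
    then have UP: "U i \<in> poly_closure" for i using P by (simp add: L2_def)
    show "u \<in> poly_closure"
      by (rule poly_closure_dominated[OF UP lim uL le'])
  qed
qed

theorem polynomials_dense: "g \<in> L2 \<Longrightarrow> g \<in> poly_closure"
proof -
  assume g: "g \<in> L2"
  have m: "(\<lambda>x. max 0 (g x)) \<in> borel_measurable borel" "(\<lambda>x. max 0 (- g x)) \<in> borel_measurable borel"
    using L2_measurable[OF g] by auto
  have "(\<lambda>x. max 0 (g x)) \<in> L2" "(\<lambda>x. max 0 (- g x)) \<in> L2"
    by (auto intro!: L2_mono[OF g] m)
  then have "(\<lambda>x. max 0 (g x)) \<in> poly_closure" "(\<lambda>x. max 0 (- g x)) \<in> poly_closure"
    using nonneg_L2_in_closure[OF m(1)] nonneg_L2_in_closure[OF m(2)] by (auto simp: L2_def)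
  then have "(\<lambda>x. max 0 (g x) + (-1) * max 0 (- g x)) \<in> poly_closure"
    by (intro poly_closure_add poly_closure_scale)
  also have "(\<lambda>x. max 0 (g x) + (-1) * max 0 (- g x)) = g" by (auto simp: max_def)
  finally show ?thesis .
qed

end

section \<open>Expansion in orthonormal polynomials and Parseval's identity\<close>

lemma poly_expansion:
  fixes q :: "nat \<Rightarrow> real poly"
  assumes q: "\<And>k. degree (q k) = k" "\<And>k. q k \<noteq> 0"
  shows "degree P \<le> n \<Longrightarrow> \<exists>c. \<forall>x. poly P x = (\<Sum>k<Suc n. c k * poly (q k) x)"
proof (induction n arbitrary: P)
  case 0
  obtain a where a: "P = [:a:]" using 0 by (auto elim: degree_eq_zeroE)
  obtain b where b: "q 0 = [:b:]" using q(1)[of 0] by (auto elim: degree_eq_zeroE)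
  have "b \<noteq> 0" using q(2)[of 0] b by auto
  then show ?case using a b by (intro exI[of _ "\<lambda>_. a / b"]) simp
next
  case (Suc n)
  define c where "c = coeff P (Suc n) / coeff (q (Suc n)) (Suc n)"
  have nz: "coeff (q (Suc n)) (Suc n) \<noteq> 0" using q(1)[of "Suc n"] q(2)[of "Suc n"] leading_coeff_0_iff[of "q (Suc n)"] by simp
  define R where "R = P - Polynomial.smult c (q (Suc n))"
  have "coeff R (Suc n) = 0" using nz by (simp add: R_def c_def)
  moreover have "degree R \<le> Suc n" unfolding R_def using Suc.prems q(1)[of "Suc n"]
    by (intro degree_diff_le) (auto intro: order_trans[OF degree_smult_le])
  ultimately have "degree R \<le> n"
    by (metis le_Suc_eq leading_coeff_0_iff degree_0 zero_le)
  from Suc.IH[OF this] obtain d where d: "\<forall>x. poly R x = (\<Sum>k<Suc n. d k * poly (q k) x)" ..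
  have P: "poly P x = poly R x + c * poly (q (Suc n)) x" for x by (simp add: R_def)
  have "poly P x = (\<Sum>k<Suc (Suc n). (if k = Suc n then c else d k) * poly (q k) x)" for x
    unfolding P d[rule_format] by (subst (2) sum.lessThan_Suc) simp
  then show ?case by (intro exI[of _ "\<lambda>k. if k = Suc n then c else d k"]) blast
qed

text \<open>The identity is exact for polynomials as soon as \<open>K\<close> exceeds the degree. By
  density \<open>f\<close> is a polynomial plus a small remainder \<open>e\<close>, and Bessel's
  inequality bounds the contribution of \<open>e\<close> to the integral and to the partial sums
  alike, uniformly in \<open>K\<close>.\<close>

lemma (in exponential_moments) Parseval:
  fixes q :: "nat \<Rightarrow> real poly"
  assumes q: "\<And>k. degree (q k) = k" "\<And>k. q k \<noteq> 0"
    and orth: "\<And>k l. expectation (\<lambda>x. poly (q k) x * poly (q l) x) = (if k = l then 1 else 0)"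
    and f: "f \<in> L2" and g: "g \<in> L2"
  shows "(\<lambda>K. \<Sum>k<K. expectation (\<lambda>x. f x * poly (q k) x) * expectation (\<lambda>x. g x * poly (q k) x))
    \<longlonglongrightarrow> expectation (\<lambda>x. f x * g x)"
proof -
  define c where "c = (\<lambda>h k. expectation (\<lambda>x. h x * poly (q k) x))"
  have int: "integrable M (\<lambda>x. h x * poly (q k) x)" if "h \<in> L2" for h k
    by (rule L2_integrable_mult[OF that poly_L2])
  have Bessel: "(\<Sum>k<K. (c h k)\<^sup>2) \<le> expectation (\<lambda>x. (h x)\<^sup>2)" if h: "h \<in> L2" for h K
  proof -
    let ?S = "\<lambda>x. \<Sum>k<K. c h k * poly (q k) x"
    have SL: "?S \<in> L2"
    proof -
      have "?S = poly (\<Sum>k<K. Polynomial.smult (c h k) (q k))" by (rule ext) (simp add: poly_sum)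
      then show ?thesis using poly_L2 by simp
    qed
    have 1: "expectation (\<lambda>x. h x * ?S x) = (\<Sum>k<K. (c h k)\<^sup>2)"
    proof -
      have "expectation (\<lambda>x. h x * ?S x) = expectation (\<lambda>x. \<Sum>k<K. c h k * (h x * poly (q k) x))"
        by (simp add: sum_distrib_left mult.left_commute)
      also have "\<dots> = (\<Sum>k<K. c h k * expectation (\<lambda>x. h x * poly (q k) x))"
        using int[OF h] by (subst Bochner_Integration.integral_sum) simp_all
      finally show ?thesis by (simp add: c_def power2_eq_square)
    qed
    have 2: "expectation (\<lambda>x. ?S x * ?S x) = (\<Sum>k<K. (c h k)\<^sup>2)"
    proof -
      have i: "integrable M (\<lambda>x. poly (q k) x * poly (q l) x)" for k l by (rule int[OF poly_L2])
      have "expectation (\<lambda>x. ?S x * ?S x) = expectation (\<lambda>x. \<Sum>k<K. \<Sum>l<K. (c h k * c h l) * (poly (q k) x * poly (q l) x))"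
        by (simp add: sum_product mult_ac)
      also have "\<dots> = (\<Sum>k<K. \<Sum>l<K. (c h k * c h l) * expectation (\<lambda>x. poly (q k) x * poly (q l) x))"
        using i by (simp add: Bochner_Integration.integral_sum)
      also have "\<dots> = (\<Sum>k<K. \<Sum>l<K. if l = k then (c h k * c h l) else 0)"
        unfolding orth by (intro sum.cong refl) simp
      also have "\<dots> = (\<Sum>k<K. (c h k)\<^sup>2)" by (simp add: power2_eq_square)
      finally show ?thesis .
    qed
    have "0 \<le> expectation (\<lambda>x. (h x - ?S x)\<^sup>2)" by (rule Bochner_Integration.integral_nonneg) simp
    also have "(\<lambda>x. (h x - ?S x)\<^sup>2) = (\<lambda>x. (h x)\<^sup>2 - 2 * (h x * ?S x) + ?S x * ?S x)"
      by (rule ext) (simp add: power2_eq_square algebra_simps)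
    also have "expectation \<dots> = expectation (\<lambda>x. (h x)\<^sup>2) - 2 * expectation (\<lambda>x. h x * ?S x) + expectation (\<lambda>x. ?S x * ?S x)"
      using L2_sq_integrable[OF h] L2_integrable_mult[OF h SL] L2_integrable_mult[OF SL SL] by simp
    finally show ?thesis using 1 2 by linarith
  qed
  have amgm: "\<bar>a * b\<bar> \<le> a\<^sup>2 / (2 * t) + t / 2 * b\<^sup>2" if "t > 0" for a b t :: real
  proof -
    have "2 * (\<bar>a\<bar> * (t * \<bar>b\<bar>)) \<le> a\<^sup>2 + (t * b)\<^sup>2"
      using sum_squares_bound[of "\<bar>a\<bar>" "t * \<bar>b\<bar>"] by (simp add: power_mult_distrib)
    then have "2 * (\<bar>a\<bar> * (t * \<bar>b\<bar>)) / (2 * t) \<le> (a\<^sup>2 + (t * b)\<^sup>2) / (2 * t)"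
      using that by (intro divide_right_mono) simp_all
    moreover have "2 * (\<bar>a\<bar> * (t * \<bar>b\<bar>)) / (2 * t) = \<bar>a * b\<bar>" using that by (simp add: abs_mult)
    moreover have "(a\<^sup>2 + (t * b)\<^sup>2) / (2 * t) = a\<^sup>2 / (2 * t) + t / 2 * b\<^sup>2" using that by (simp add: add_divide_distrib power2_eq_square)
    ultimately show ?thesis by simp
  qed
  \<comment> \<open>The weighted inequality between arithmetic and geometric mean takes the place of
    Cauchy-Schwarz: a small \<open>t\<close> makes the term with \<open>g\<close> small, and a still
    smaller \<open>e\<close> then makes the other term small.\<close>
  have approx: "\<bar>expectation (\<lambda>x. e x * g x) - (\<Sum>k<K. c e k * c g k)\<bar> \<le> expectation (\<lambda>x. (e x)\<^sup>2) / t + t * expectation (\<lambda>x. (g x)\<^sup>2)"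
    if e: "e \<in> L2" and t: "t > 0" for e K t
  proof -
    have "\<bar>expectation (\<lambda>x. e x * g x)\<bar> \<le> expectation (\<lambda>x. \<bar>e x * g x\<bar>)" by (rule integral_abs_bound)
    also have "\<dots> \<le> expectation (\<lambda>x. (e x)\<^sup>2 / (2 * t) + t / 2 * (g x)\<^sup>2)"
      by (rule integral_mono) (use L2_integrable_mult[OF e g] L2_sq_integrable[OF e] L2_sq_integrable[OF g] amgm[OF t] in simp_all)
    also have "\<dots> = expectation (\<lambda>x. (e x)\<^sup>2) / (2 * t) + t / 2 * expectation (\<lambda>x. (g x)\<^sup>2)"
      using L2_sq_integrable[OF e] L2_sq_integrable[OF g] by simp
    finally have 1: "\<bar>expectation (\<lambda>x. e x * g x)\<bar> \<le> expectation (\<lambda>x. (e x)\<^sup>2) / (2 * t) + t / 2 * expectation (\<lambda>x. (g x)\<^sup>2)" .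
    have "\<bar>\<Sum>k<K. c e k * c g k\<bar> \<le> (\<Sum>k<K. \<bar>c e k * c g k\<bar>)" by (rule sum_abs)
    also have "\<dots> \<le> (\<Sum>k<K. (c e k)\<^sup>2 / (2 * t) + t / 2 * (c g k)\<^sup>2)" by (intro sum_mono amgm t)
    also have "\<dots> = (\<Sum>k<K. (c e k)\<^sup>2) / (2 * t) + t / 2 * (\<Sum>k<K. (c g k)\<^sup>2)"
      by (simp add: sum.distrib sum_divide_distrib sum_distrib_left)
    also have "\<dots> \<le> expectation (\<lambda>x. (e x)\<^sup>2) / (2 * t) + t / 2 * expectation (\<lambda>x. (g x)\<^sup>2)"
      using t by (intro add_mono divide_right_mono mult_left_mono Bessel e g) simp_all
    finally have 2: "\<bar>\<Sum>k<K. c e k * c g k\<bar> \<le> expectation (\<lambda>x. (e x)\<^sup>2) / (2 * t) + t / 2 * expectation (\<lambda>x. (g x)\<^sup>2)" .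
    have h: "2 * (a / (2 * t)) = a / t" for a using t by (simp add: field_simps)
    have "\<bar>expectation (\<lambda>x. e x * g x) - (\<Sum>k<K. c e k * c g k)\<bar> \<le> 2 * (expectation (\<lambda>x. (e x)\<^sup>2) / (2 * t)) + t * expectation (\<lambda>x. (g x)\<^sup>2)"
      using 1 2 by linarith
    then show ?thesis unfolding h .
  qed
  show ?thesis
    unfolding c_def[symmetric, THEN fun_cong, THEN fun_cong]
  proof (rule LIMSEQ_I)
    fix \<epsilon> :: real assume \<epsilon>: "\<epsilon> > 0"
    define G where "G = expectation (\<lambda>x. (g x)\<^sup>2)"
    have G: "G \<ge> 0" unfolding G_def by (rule Bochner_Integration.integral_nonneg) simp
    define t where "t = (\<epsilon> / 2) / (G + 1)"
    have t: "t > 0" using \<epsilon> G by (simp add: t_def)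
    have tG: "t * G \<le> \<epsilon> / 2"
    proof -
      have "t * G \<le> t * (G + 1)" using t by (intro mult_left_mono) simp_all
      also have "\<dots> = \<epsilon> / 2"
      proof -
        have "G + 1 \<noteq> 0" using G by linarith
        then show ?thesis unfolding t_def by (metis nonzero_mult_div_cancel_right times_divide_eq_left)
      qed
      finally show ?thesis .
    qed
    have "t * \<epsilon> / 2 > 0" using t \<epsilon> by simp
    then obtain P where P: "expectation (\<lambda>x. (f x - poly P x)\<^sup>2) < t * \<epsilon> / 2"
      using polynomials_dense[OF f] unfolding poly_closure_def by blast
    define e where "e = (\<lambda>x. f x - poly P x)"
    have e: "e \<in> L2" unfolding e_def by (rule L2_diff[OF f poly_L2])
    obtain d where d: "\<forall>x. poly P x = (\<Sum>k<Suc (degree P). d k * poly (q k) x)"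
      using poly_expansion[OF q order_refl] by blast
    have cP: "c (poly P) k = (if k < Suc (degree P) then d k else 0)" for k
    proof -
      have "c (poly P) k = expectation (\<lambda>x. \<Sum>l<Suc (degree P). d l * (poly (q l) x * poly (q k) x))"
        unfolding c_def d[rule_format] by (simp only: sum_distrib_right mult.assoc)
      also have "\<dots> = (\<Sum>l<Suc (degree P). d l * expectation (\<lambda>x. poly (q l) x * poly (q k) x))"
        using int[OF poly_L2] by (subst Bochner_Integration.integral_sum) simp_all
      also have "\<dots> = (\<Sum>l<Suc (degree P). if l = k then d l else 0)" unfolding orth by (intro sum.cong refl) simp
      also have "\<dots> = (if k < Suc (degree P) then d k else 0)" by (subst sum.delta) simp_all
      finally show ?thesis .
    qed
    have exact: "(\<Sum>k<K. c (poly P) k * c g k) = expectation (\<lambda>x. poly P x * g x)" if K: "K \<ge> Suc (degree P)" for K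
    proof -
      have "(\<Sum>k<K. c (poly P) k * c g k) = (\<Sum>k<Suc (degree P). d k * c g k)"
        unfolding cP using K by (intro sum.mono_neutral_cong_right) auto
      also have "\<dots> = expectation (\<lambda>x. \<Sum>k<Suc (degree P). d k * (g x * poly (q k) x))"
        using int[OF g] by (subst Bochner_Integration.integral_sum) (simp_all add: c_def)
      also have "\<dots> = expectation (\<lambda>x. poly P x * g x)"
        unfolding d[rule_format] sum_distrib_right by (simp only: mult_ac)
      finally show ?thesis .
    qed
    have "norm ((\<Sum>k<K. c f k * c g k) - expectation (\<lambda>x. f x * g x)) < \<epsilon>" if K: "K \<ge> Suc (degree P)" for K
    proof -
      have ce: "c f k = c e k + c (poly P) k" for k
      proof -
        have "c e k = expectation (\<lambda>x. f x * poly (q k) x - poly P x * poly (q k) x)"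
          unfolding c_def e_def by (simp only: left_diff_distrib)
        also have "\<dots> = c f k - c (poly P) k" unfolding c_def by (rule Bochner_Integration.integral_diff[OF int[OF f] int[OF poly_L2]])
        finally show ?thesis by simp
      qed
      have "expectation (\<lambda>x. e x * g x) = expectation (\<lambda>x. f x * g x - poly P x * g x)"
        unfolding e_def by (simp only: left_diff_distrib)
      also have "\<dots> = expectation (\<lambda>x. f x * g x) - expectation (\<lambda>x. poly P x * g x)"
        by (rule Bochner_Integration.integral_diff[OF L2_integrable_mult[OF f g] L2_integrable_mult[OF poly_L2 g]])
      finally have ef: "expectation (\<lambda>x. f x * g x) = expectation (\<lambda>x. e x * g x) + expectation (\<lambda>x. poly P x * g x)" by simp
      have "(\<Sum>k<K. c f k * c g k) = (\<Sum>k<K. c e k * c g k) + (\<Sum>k<K. c (poly P) k * c g k)"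
        unfolding ce distrib_right sum.distrib ..
      then have "norm ((\<Sum>k<K. c f k * c g k) - expectation (\<lambda>x. f x * g x)) = \<bar>expectation (\<lambda>x. e x * g x) - (\<Sum>k<K. c e k * c g k)\<bar>"
        unfolding ef exact[OF K] by (simp add: abs_minus_commute)
      also have "\<dots> \<le> expectation (\<lambda>x. (e x)\<^sup>2) / t + t * expectation (\<lambda>x. (g x)\<^sup>2)" by (rule approx[OF e t])
      also have "\<dots> < \<epsilon>"
      proof -
        have "expectation (\<lambda>x. (e x)\<^sup>2) / t < (t * \<epsilon> / 2) / t" using P t unfolding e_def by (intro divide_strict_right_mono)
        also have "\<dots> = \<epsilon> / 2" using t by simp
        finally show ?thesis using tG unfolding G_def by linarith
      qed
      finally show ?thesis .
    qed
    then show "\<exists>no. \<forall>K\<ge>no. norm ((\<Sum>k<K. c f k * c g k) - expectation (\<lambda>x. f x * g x)) < \<epsilon>" by blast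
  qed
qed

section \<open>Translates of a smooth density\<close>

text \<open>For \<open>h = w\<close> this is the mean of \<open>g\<close> shifted by
  \<open>b\<close> under the density \<open>w\<close>. A substitution moves the shift to
  \<open>h (x - b)\<close>, which is how derivatives in \<open>b\<close> fall on the
  density.\<close>

definition translate_integral :: "(real \<Rightarrow> real) \<Rightarrow> (real \<Rightarrow> real) \<Rightarrow> real \<Rightarrow> real" where
  "translate_integral g h b = (\<integral>x. g (x + b) * h x \<partial>lborel)"

text \<open>\<open>V\<close> is a majorant for the kernels paired with \<open>g\<close>. Its
  integrability against every power absorbs the growth of the translates of \<open>g\<close>,
  uniformly for bounded shifts.\<close>

locale translation_setup =
  fixes g V :: "real \<Rightarrow> real" and A :: real and k :: nat
  assumes g_meas [measurable]: "g \<in> borel_measurable borel" and g_bound: "\<And>x. \<bar>g x\<bar> \<le> A * (1 + \<bar>x\<bar>) ^ k"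
    and A_pos: "A > 0" and V_int: "\<And>k. integrable lborel (\<lambda>x. (1 + \<bar>x\<bar>) ^ k * V x)"
begin

lemma g_translate_bound: "\<bar>g (x + b)\<bar> \<le> A * (1 + \<bar>b\<bar>) ^ k * (1 + \<bar>x\<bar>) ^ k"
proof -
  have "1 + \<bar>x + b\<bar> \<le> (1 + \<bar>b\<bar>) * (1 + \<bar>x\<bar>)"
  proof -
    have "\<bar>x + b\<bar> \<le> \<bar>x\<bar> + \<bar>b\<bar>" by (rule abs_triangle_ineq)
    moreover have "0 \<le> \<bar>b\<bar> * \<bar>x\<bar>" by simp
    moreover have "(1 + \<bar>b\<bar>) * (1 + \<bar>x\<bar>) = 1 + \<bar>b\<bar> + \<bar>x\<bar> + \<bar>b\<bar> * \<bar>x\<bar>" by (simp add: algebra_simps)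
    ultimately show ?thesis by linarith
  qed
  then have "(1 + \<bar>x + b\<bar>) ^ k \<le> ((1 + \<bar>b\<bar>) * (1 + \<bar>x\<bar>)) ^ k" by (intro power_mono) simp_all
  then have "A * (1 + \<bar>x + b\<bar>) ^ k \<le> A * ((1 + \<bar>b\<bar>) * (1 + \<bar>x\<bar>)) ^ k" using A_pos by (intro mult_left_mono) simp_all
  with g_bound[of "x + b"] show ?thesis by (simp add: power_mult_distrib mult.assoc)
qed

lemma integrable_translate:
  assumes [measurable]: "h \<in> borel_measurable borel" and h: "\<And>x. \<bar>h x\<bar> \<le> V x"
  shows "integrable lborel (\<lambda>x. g (x + b) * h x)"
proof (rule integrable_le)
  show "integrable lborel (\<lambda>x. (A * (1 + \<bar>b\<bar>) ^ k) * ((1 + \<bar>x\<bar>) ^ k * V x))" using V_int by simp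
  fix x
  have "\<bar>g (x + b)\<bar> * \<bar>h x\<bar> \<le> (A * (1 + \<bar>b\<bar>) ^ k * (1 + \<bar>x\<bar>) ^ k) * V x"
    by (intro mult_mono g_translate_bound h) (use A_pos in simp_all)
  then show "\<bar>g (x + b) * h x\<bar> \<le> (A * (1 + \<bar>b\<bar>) ^ k) * ((1 + \<bar>x\<bar>) ^ k * V x)" by (simp add: abs_mult mult.assoc)
qed measurable

lemma translate_integral_shift:
  "translate_integral g h b = (\<integral>x. g x * h (x - b) \<partial>lborel)"
proof -
  have "(\<integral>x. g x * h (x - b) \<partial>lborel) = \<bar>1\<bar> *\<^sub>R (\<integral>x. g (b + 1 * x) * h (b + 1 * x - b) \<partial>lborel)"
    by (rule lborel_integral_real_affine) simp
  then show ?thesis by (simp add: translate_integral_def add.commute)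
qed

lemma integrable_shift:
  assumes [measurable]: "h \<in> borel_measurable borel" and h: "\<And>x. \<bar>h x\<bar> \<le> V x"
  shows "integrable lborel (\<lambda>x. g x * h (x - b))"
proof -
  have "integrable lborel (\<lambda>x. g (- b + 1 * x + b) * h (- b + 1 * x))"
    by (rule lborel_integrable_real_affine[OF integrable_translate[OF assms]]) simp
  then show ?thesis by simp
qed

lemma integral_abs_shift_le:
  assumes [measurable]: "h \<in> borel_measurable borel" and h: "\<And>x. \<bar>h x\<bar> \<le> V x"
  shows "(\<integral>x. \<bar>g x * h (x - b)\<bar> \<partial>lborel) \<le> A * (1 + \<bar>b\<bar>) ^ k * (\<integral>x. (1 + \<bar>x\<bar>) ^ k * V x \<partial>lborel)"
proof -
  have "(\<integral>x. \<bar>g x * h (x - b)\<bar> \<partial>lborel) = \<bar>1\<bar> *\<^sub>R (\<integral>x. \<bar>g (b + 1 * x) * h (b + 1 * x - b)\<bar> \<partial>lborel)"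
    by (rule lborel_integral_real_affine) simp
  also have "\<dots> = (\<integral>x. \<bar>g (x + b) * h x\<bar> \<partial>lborel)" by (simp add: add.commute)
  also have "\<dots> \<le> (\<integral>x. (A * (1 + \<bar>b\<bar>) ^ k) * ((1 + \<bar>x\<bar>) ^ k * V x) \<partial>lborel)"
  proof (rule integral_mono)
    show "integrable lborel (\<lambda>x. \<bar>g (x + b) * h x\<bar>)" by (rule integrable_abs[OF integrable_translate[OF assms]])
    show "integrable lborel (\<lambda>x. (A * (1 + \<bar>b\<bar>) ^ k) * ((1 + \<bar>x\<bar>) ^ k * V x))" using V_int by simp
    fix x
    have "\<bar>g (x + b)\<bar> * \<bar>h x\<bar> \<le> (A * (1 + \<bar>b\<bar>) ^ k * (1 + \<bar>x\<bar>) ^ k) * V x"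
      by (intro mult_mono g_translate_bound h) (use A_pos in simp_all)
    then show "\<bar>g (x + b) * h x\<bar> \<le> (A * (1 + \<bar>b\<bar>) ^ k) * ((1 + \<bar>x\<bar>) ^ k * V x)" by (simp add: abs_mult mult.assoc)
  qed
  also have "\<dots> = A * (1 + \<bar>b\<bar>) ^ k * (\<integral>x. (1 + \<bar>x\<bar>) ^ k * V x \<partial>lborel)" by simp
  finally show ?thesis .
qed

text \<open>Pointwise, \<open>G (x - b) - G x\<close> is \<open>- b\<close> times the integral of
  \<open>h (x - s * b)\<close> over \<open>s\<close> in \<open>{0..1}\<close>; multiplying by
  \<open>g x\<close> and exchanging the integrals gives the claim. The integral form asks for no
  continuity of \<open>h\<close>, which will be the last derivative of the density.\<close>

lemma translate_integral_FTC:
  assumes [measurable]: "h \<in> borel_measurable borel" "G \<in> borel_measurable borel"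
    and h: "\<And>x. \<bar>h x\<bar> \<le> V x" and G: "\<And>x. \<bar>G x\<bar> \<le> V x"
    and deriv: "\<And>x. (G has_real_derivative h x) (at x)"
    and loc: "\<And>R. \<exists>B. \<forall>x. \<bar>x\<bar> \<le> R \<longrightarrow> \<bar>h x\<bar> \<le> B"
  shows "integrable lborel (\<lambda>s. indicator {0..1} s * translate_integral g h (s * b))"
    and "translate_integral g G b - translate_integral g G 0 = - b * (\<integral>s. indicator {0..1} s * translate_integral g h (s * b) \<partial>lborel)"
proof -
  let ?f = "\<lambda>s x. indicator {0..1} s * (g x * h (x - s * b)) :: real"
  define C where "C = A * (1 + \<bar>b\<bar>) ^ k * (\<integral>x. (1 + \<bar>x\<bar>) ^ k * V x \<partial>lborel)"
  have Vnn: "0 \<le> V x" for x using h[of x] by (rule order_trans[OF abs_ge_zero])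
  have I0: "0 \<le> (\<integral>x. (1 + \<bar>x\<bar>) ^ k * V x \<partial>lborel)" using Vnn by (intro Bochner_Integration.integral_nonneg) simp
  have inner: "(\<integral>x. norm (?f s x) \<partial>lborel) \<le> indicator {0..1} s * C" for s
  proof (cases "s \<in> {0..1}")
    case True
    have "(\<integral>x. norm (?f s x) \<partial>lborel) = (\<integral>x. \<bar>g x * h (x - s * b)\<bar> \<partial>lborel)" using True by simp
    also have "\<dots> \<le> A * (1 + \<bar>s * b\<bar>) ^ k * (\<integral>x. (1 + \<bar>x\<bar>) ^ k * V x \<partial>lborel)"
      by (rule integral_abs_shift_le) (simp, rule h)
    also have "\<dots> \<le> C"
    proof -
      have "\<bar>s * b\<bar> \<le> \<bar>b\<bar>" using True by (simp add: abs_mult mult_left_le_one_le)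
      then show ?thesis unfolding C_def using A_pos I0 by (intro mult_right_mono mult_left_mono power_mono) simp_all
    qed
    finally show ?thesis using True by simp
  qed simp
  have pair: "integrable (lborel \<Otimes>\<^sub>M lborel) (\<lambda>(s, x). ?f s x)"
  proof (rule lborel_pair.Fubini_integrable)
    show "(\<lambda>(s, x). ?f s x) \<in> borel_measurable (lborel \<Otimes>\<^sub>M lborel)" by measurable
    show "integrable lborel (\<lambda>s. \<integral>x. norm (case (s, x) of (s, x) \<Rightarrow> ?f s x) \<partial>lborel)"
    proof (rule integrable_le)
      show "integrable lborel (\<lambda>s. indicator {0..1::real} s * C)" by simp
      show "(\<lambda>s. \<integral>x. norm (case (s, x) of (s, x) \<Rightarrow> ?f s x) \<partial>lborel) \<in> borel_measurable lborel" by measurable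
      fix s :: real
      have "0 \<le> (\<integral>x. norm (?f s x) \<partial>lborel)" by (intro Bochner_Integration.integral_nonneg) simp
      then show "\<bar>\<integral>x. norm (case (s, x) of (s, x) \<Rightarrow> ?f s x) \<partial>lborel\<bar> \<le> indicator {0..1} s * C"
        using inner[of s] by (simp only: prod.case abs_of_nonneg)
    qed
    show "AE s in lborel. integrable lborel (\<lambda>x. case (s, x) of (s, x) \<Rightarrow> ?f s x)"
      unfolding prod.case by (intro AE_I2 integrable_mult_right integrable_shift h) simp
  qed
  have eq: "(\<integral>x. ?f s x \<partial>lborel) = indicator {0..1} s * translate_integral g h (s * b)" for s
    unfolding translate_integral_shift by simp
  show "integrable lborel (\<lambda>s. indicator {0..1} s * translate_integral g h (s * b))"
    using lborel_pair.integrable_fst[OF pair] unfolding eq .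
  have FTC: "- b * (\<integral>s. indicator {0..1} s * h (x - s * b) \<partial>lborel) = G (x - b) - G x" for x
  proof -
    have "((\<lambda>s. - b * h (x - s * b)) has_integral (G (x - 1 * b) - G (x - 0 * b))) {0..1}"
    proof (rule fundamental_theorem_of_calculus)
      fix s :: real
      have "((\<lambda>s. G (x - s * b)) has_real_derivative (h (x - s * b) * (0 - 1 * b))) (at s within {0..1})"
        by (rule DERIV_chain2[OF deriv]) (auto intro!: derivative_eq_intros)
      then show "((\<lambda>s. G (x - s * b)) has_vector_derivative - b * h (x - s * b)) (at s within {0..1})"
        by (simp add: has_real_derivative_iff_has_vector_derivative mult.commute)
    qed simp
    from integral_unique[OF this] have hi: "integral {0..1} (\<lambda>s. - b * h (x - s * b)) = G (x - b) - G x"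
      by (simp only: mult_1_left mult_zero_left diff_zero)
    obtain B where B: "\<forall>y. \<bar>y\<bar> \<le> \<bar>x\<bar> + \<bar>b\<bar> \<longrightarrow> \<bar>h y\<bar> \<le> B" using loc by blast
    \<comment> \<open>Every derivative is integrable in the gauge sense; the local bound on
      \<open>h\<close> is what makes it Lebesgue integrable, so that the two integrals
      agree.\<close>
    have si: "set_integrable lborel {0..1} (\<lambda>s. - b * h (x - s * b))"
      unfolding set_integrable_def
    proof (rule integrable_le)
      show "integrable lborel (\<lambda>s. indicator {0..1::real} s * (\<bar>b\<bar> * B))" by simp
      fix s :: real
      show "\<bar>indicator {0..1} s *\<^sub>R (- b * h (x - s * b))\<bar> \<le> indicator {0..1} s * (\<bar>b\<bar> * B)"
      proof (cases "s \<in> {0..1}")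
        case True
        have "\<bar>s * b\<bar> \<le> \<bar>b\<bar>" using True by (simp add: abs_mult mult_left_le_one_le)
        then have "\<bar>x - s * b\<bar> \<le> \<bar>x\<bar> + \<bar>b\<bar>" using abs_triangle_ineq4[of x "s * b"] by linarith
        then have "\<bar>h (x - s * b)\<bar> \<le> B" using B by blast
        then have "\<bar>b\<bar> * \<bar>h (x - s * b)\<bar> \<le> \<bar>b\<bar> * B" by (rule mult_left_mono) simp
        then show ?thesis using True by (simp add: abs_mult)
      qed simp
    qed measurable
    have "(LINT s:{0..1}|lborel. - b * h (x - s * b)) = G (x - b) - G x"
      using set_borel_integral_eq_integral(2)[OF si] hi by simp
    also have "(LINT s:{0..1}|lborel. - b * h (x - s * b)) = (\<integral>s. - b * (indicator {0..1} s * h (x - s * b)) \<partial>lborel)"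
      unfolding set_lebesgue_integral_def by (simp add: mult.left_commute)
    finally show ?thesis by simp
  qed
  have "- b * (\<integral>s. indicator {0..1} s * translate_integral g h (s * b) \<partial>lborel) = - b * (\<integral>s. (\<integral>x. ?f s x \<partial>lborel) \<partial>lborel)"
    unfolding eq ..
  also have "(\<integral>s. (\<integral>x. ?f s x \<partial>lborel) \<partial>lborel) = (\<integral>x. (\<integral>s. ?f s x \<partial>lborel) \<partial>lborel)"
    using lborel_pair.Fubini_integral[OF pair] by simp
  also have "- b * \<dots> = (\<integral>x. - b * (\<integral>s. ?f s x \<partial>lborel) \<partial>lborel)" by simp
  also have "\<dots> = (\<integral>x. g x * (G (x - b) - G x) \<partial>lborel)"
  proof (rule Bochner_Integration.integral_cong[OF refl])
    fix x
    have "(\<integral>s. ?f s x \<partial>lborel) = g x * (\<integral>s. indicator {0..1} s * h (x - s * b) \<partial>lborel)"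
      by (simp add: mult.left_commute)
    then show "- b * (\<integral>s. ?f s x \<partial>lborel) = g x * (G (x - b) - G x)" unfolding FTC[symmetric] by simp
  qed
  also have "\<dots> = (\<integral>x. g x * G (x - b) - g x * G (x - 0) \<partial>lborel)" by (simp add: right_diff_distrib)
  also have "\<dots> = translate_integral g G b - translate_integral g G 0"
    unfolding translate_integral_shift by (rule Bochner_Integration.integral_diff) (intro integrable_shift G; simp)+
  finally show "translate_integral g G b - translate_integral g G 0 = - b * (\<integral>s. indicator {0..1} s * translate_integral g h (s * b) \<partial>lborel)"
    by simp
qed

text \<open>The kernel stays fixed and \<open>g\<close> is translated, so almost everywhere
  convergence of the translates is enough and \<open>h\<close> may be discontinuous. A convergent
  sequence of shifts is bounded, which yields one integrable majorant.\<close>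

lemma tendsto_translate_integral:
  assumes [measurable]: "h \<in> borel_measurable borel" and h: "\<And>x. \<bar>h x\<bar> \<le> V x"
    and lim: "b \<longlonglongrightarrow> 0" and cont: "AE x in lborel. (\<lambda>n. g (x + b n)) \<longlonglongrightarrow> g x"
  shows "(\<lambda>n. translate_integral g h (b n)) \<longlonglongrightarrow> translate_integral g h 0"
proof -
  obtain B where B: "\<And>n. \<bar>b n\<bar> \<le> B" using convergent_imp_Bseq[OF convergentI[OF lim]] unfolding Bseq_def real_norm_def by blast
  have B0: "0 \<le> B" using B[of 0] by (rule order_trans[OF abs_ge_zero])
  show ?thesis
    unfolding translate_integral_def
  proof (rule integral_dominated_convergence[where w = "\<lambda>x. (A * (1 + B) ^ k) * ((1 + \<bar>x\<bar>) ^ k * V x)"])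
    show "integrable lborel (\<lambda>x. (A * (1 + B) ^ k) * ((1 + \<bar>x\<bar>) ^ k * V x))" using V_int by simp
    show "AE x in lborel. (\<lambda>n. g (x + b n) * h x) \<longlonglongrightarrow> g (x + 0) * h x"
      using cont by eventually_elim (auto intro: tendsto_intros)
    show "AE x in lborel. norm (g (x + b n) * h x) \<le> (A * (1 + B) ^ k) * ((1 + \<bar>x\<bar>) ^ k * V x)" for n
    proof (rule AE_I2)
      fix x
      have Vx: "0 \<le> V x" using h[of x] by (rule order_trans[OF abs_ge_zero])
      have "\<bar>g (x + b n)\<bar> * \<bar>h x\<bar> \<le> (A * (1 + \<bar>b n\<bar>) ^ k * (1 + \<bar>x\<bar>) ^ k) * V x"
        by (intro mult_mono g_translate_bound h) (use A_pos in simp_all)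
      also have "\<dots> \<le> (A * (1 + B) ^ k * (1 + \<bar>x\<bar>) ^ k) * V x"
        using A_pos B[of n] Vx by (intro mult_right_mono mult_left_mono power_mono) simp_all
      finally show "norm (g (x + b n) * h x) \<le> (A * (1 + B) ^ k) * ((1 + \<bar>x\<bar>) ^ k * V x)"
        by (simp add: abs_mult mult.assoc)
    qed
  qed measurable
qed

end

section \<open>Taylor expansion from integral identities\<close>

lemma integral_unit_power: "(\<integral>s. indicator {0..1} s * s ^ m \<partial>lborel) = 1 / (real m + 1)"
proof -
  have "(\<integral>s. indicator {0..1} s * s ^ m \<partial>lborel) = (\<integral>s. s ^ m * indicator {0..1::real} s \<partial>lborel)"
    by (simp only: mult.commute)
  also have "\<dots> = (1 ^ Suc m - 0 ^ Suc m) / Suc m" by (rule integral_power) simp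
  finally show ?thesis by (simp add: add.commute)
qed

text \<open>Continuity of \<open>H L\<close> at 0 gives the estimate of order 0, and one integration
  raises the order by 1: the integral of \<open>s ^ j\<close> over \<open>{0..1}\<close> supplies
  \<open>1 / (j + 1)\<close>, hence the factorial, and each factor \<open>- b\<close> supplies a
  sign. The constant \<epsilon> survives unchanged, as \<bar>s * b\<bar> \<le>
  \<bar>b\<bar>.\<close>

lemma Taylor_from_integrals:
  fixes H :: "nat \<Rightarrow> real \<Rightarrow> real"
  assumes int: "\<And>l b. l < L \<Longrightarrow> integrable lborel (\<lambda>s. indicator {0..1} s * H (Suc l) (s * b))"
    and FTC: "\<And>l b. l < L \<Longrightarrow> H l b - H l 0 = - b * (\<integral>s. indicator {0..1} s * H (Suc l) (s * b) \<partial>lborel)"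
    and zero: "\<And>l. l < L \<Longrightarrow> H l 0 = 0" and cont: "isCont (H L) 0" and \<epsilon>: "\<epsilon> > 0"
  obtains \<delta> where "\<delta> > 0" "\<And>b. \<bar>b\<bar> \<le> \<delta> \<Longrightarrow> \<bar>H 0 b - (- 1) ^ L * H L 0 * b ^ L / fact L\<bar> \<le> \<epsilon> * \<bar>b\<bar> ^ L"
proof -
  obtain d where d: "d > 0" "\<And>b. \<bar>b\<bar> < d \<Longrightarrow> \<bar>H L b - H L 0\<bar> < \<epsilon>"
    using cont \<epsilon> unfolding continuous_at_real_range by (auto simp: dist_real_def)
  define \<delta> where "\<delta> = d / 2"
  have \<delta>: "\<delta> > 0" "\<delta> < d" using d by (auto simp: \<delta>_def)
  define T where "T = H L 0"
  \<comment> \<open>The induction runs downwards from the top derivative: \<open>j\<close> counts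
    the integrations already done.\<close>
  have "\<forall>b. \<bar>b\<bar> \<le> \<delta> \<longrightarrow> \<bar>H (L - j) b - (- 1) ^ j * T * b ^ j / fact j\<bar> \<le> \<epsilon> * \<bar>b\<bar> ^ j" if "j \<le> L" for j
    using that
  proof (induction j)
    case 0
    show ?case
    proof (intro allI impI)
      fix b :: real assume "\<bar>b\<bar> \<le> \<delta>"
      then have "\<bar>b\<bar> < d" using \<delta> by linarith
      from d(2)[OF this] show "\<bar>H (L - 0) b - (- 1) ^ 0 * T * b ^ 0 / fact 0\<bar> \<le> \<epsilon> * \<bar>b\<bar> ^ 0" by (simp add: T_def)
    qed
  next
    case (Suc j)
    define l where "l = L - Suc j"
    have l: "l < L" "Suc l = L - j" using Suc.prems by (auto simp: l_def)
    show ?case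
    proof (intro allI impI)
      fix b :: real assume b: "\<bar>b\<bar> \<le> \<delta>"
      define c where "c = (- 1) ^ j * T * b ^ j / fact j"
      let ?I = "\<lambda>s. indicator {0..1::real} s :: real"
      have i1: "integrable lborel (\<lambda>s. ?I s * H (Suc l) (s * b))" by (rule int[OF l(1)])
      have i2: "integrable lborel (\<lambda>s. ?I s * s ^ j)"
      proof (rule integrable_le[of _ ?I])
        show "\<bar>?I s * s ^ j\<bar> \<le> ?I s" for s by (auto simp: indicator_def power_le_one abs_mult)
      qed simp_all
      have H: "H l b = - b * (\<integral>s. ?I s * H (Suc l) (s * b) \<partial>lborel)" using FTC[OF l(1)] zero[OF l(1)] by simp
      have T: "(- 1) ^ Suc j * T * b ^ Suc j / fact (Suc j) = - b * (\<integral>s. c * (?I s * s ^ j) \<partial>lborel)"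
      proof -
        have "(\<integral>s. c * (?I s * s ^ j) \<partial>lborel) = c * (1 / (real j + 1))" by (simp only: integral_mult_right_zero integral_unit_power)
        then show ?thesis unfolding c_def fact_Suc power_Suc by (simp add: mult_ac add.commute)
      qed
      have "H l b - (- 1) ^ Suc j * T * b ^ Suc j / fact (Suc j) = - b * (\<integral>s. ?I s * H (Suc l) (s * b) - c * (?I s * s ^ j) \<partial>lborel)"
        unfolding H T using i1 i2 by (simp add: right_diff_distrib)
      then have "\<bar>H l b - (- 1) ^ Suc j * T * b ^ Suc j / fact (Suc j)\<bar> = \<bar>b\<bar> * \<bar>\<integral>s. ?I s * H (Suc l) (s * b) - c * (?I s * s ^ j) \<partial>lborel\<bar>"
        by (simp add: abs_mult)
      also have "\<dots> \<le> \<bar>b\<bar> * (\<epsilon> * \<bar>b\<bar> ^ j)"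
      proof (rule mult_left_mono)
        have "\<bar>\<integral>s. ?I s * H (Suc l) (s * b) - c * (?I s * s ^ j) \<partial>lborel\<bar> \<le> (\<integral>s. \<bar>?I s * H (Suc l) (s * b) - c * (?I s * s ^ j)\<bar> \<partial>lborel)"
          by (rule integral_abs_bound)
        also have "\<dots> \<le> (\<integral>s. ?I s * (\<epsilon> * \<bar>b\<bar> ^ j) \<partial>lborel)"
        proof (rule integral_mono)
          fix s :: real
          show "\<bar>?I s * H (Suc l) (s * b) - c * (?I s * s ^ j)\<bar> \<le> ?I s * (\<epsilon> * \<bar>b\<bar> ^ j)"
          proof (cases "s \<in> {0..1}")
            case True
            have sb: "\<bar>s * b\<bar> \<le> \<bar>b\<bar>" using True by (simp add: abs_mult mult_left_le_one_le)
            have "\<bar>H (L - j) (s * b) - (- 1) ^ j * T * (s * b) ^ j / fact j\<bar> \<le> \<epsilon> * \<bar>s * b\<bar> ^ j"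
              using Suc.IH Suc.prems sb b by (meson Suc_leD order_trans)
            also have "\<dots> \<le> \<epsilon> * \<bar>b\<bar> ^ j" using sb \<epsilon> by (intro mult_left_mono power_mono) simp_all
            finally show ?thesis using True l(2) by (simp add: c_def power_mult_distrib mult_ac)
          qed simp
        qed (use i1 i2 in simp_all)
        also have "\<dots> = \<epsilon> * \<bar>b\<bar> ^ j" by simp
        finally show "\<bar>\<integral>s. ?I s * H (Suc l) (s * b) - c * (?I s * s ^ j) \<partial>lborel\<bar> \<le> \<epsilon> * \<bar>b\<bar> ^ j" .
      qed simp
      finally show "\<bar>H (L - Suc j) b - (- 1) ^ Suc j * T * b ^ Suc j / fact (Suc j)\<bar> \<le> \<epsilon> * \<bar>b\<bar> ^ Suc j"
        by (simp add: l_def mult.left_commute)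
    qed
  qed
  from this[of L] show thesis by (intro that[OF \<delta>(1)]) (simp add: T_def)
qed

section \<open>Densities whose derivatives are dominated by the density times a polynomial\<close>

locale smooth_density =
  fixes w :: "real \<Rightarrow> real" and L :: nat
  assumes w_meas [measurable]: "w \<in> borel_measurable borel" and w_nonneg: "\<And>x. w x \<ge> 0"
    and prob: "prob_space (density lborel (\<lambda>x. ennreal (w x)))"
    and supp: "closure {x. w x \<noteq> 0} = UNIV"
    and mgf: "\<exists>r>0. \<forall>t. \<bar>t\<bar> < r \<longrightarrow> integrable (density lborel (\<lambda>x. ennreal (w x))) (\<lambda>x. exp (t * x))"
    and deriv_w: "\<And>l x. l < L \<Longrightarrow> (deriv ^^ l) w field_differentiable (at x)"
    and bounded_w: "\<And>l. l \<le> L \<Longrightarrow> poly_bounded (\<lambda>x. (deriv ^^ l) w x / w x)"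
    and L_pos: "L \<ge> 1"
begin

abbreviation "\<mu> \<equiv> density lborel (\<lambda>x. ennreal (w x))"

abbreviation D :: "nat \<Rightarrow> real \<Rightarrow> real" where "D l \<equiv> (deriv ^^ l) w"

lemma D_deriv: "l < L \<Longrightarrow> (D l has_real_derivative D (Suc l) x) (at x)"
  using deriv_w[of l x] by (simp add: DERIV_deriv_iff_field_differentiable)

lemma w_deriv: "(w has_real_derivative D 1 x) (at x)"
  using D_deriv[of 0 x] L_pos by simp

lemma w_zero_deriv:
  assumes "w x = 0"
  shows "D 1 x = 0"
  by (rule DERIV_local_min[OF w_deriv, of 1]) (use assms w_nonneg in auto)

text \<open>At a zero of \<open>w\<close> the quotient \<open>w'/w\<close> is the junk value \<open>0\<close>, but \<open>w'\<close> vanishes there as well because \<open>w\<close>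
  is minimal. Hence \<open>\<bar>w'\<bar> \<le> K w\<close> locally, and by Gronwall's argument \<open>w\<close> would vanish on a neighbourhood of a zero.\<close>

lemma w_pos: "w x > 0"
proof (rule ccontr)
  assume "\<not> w x > 0"
  then have x0: "w x = 0" using w_nonneg[of x] by simp
  obtain C k where C: "C > 0" "\<And>y. \<bar>D 1 y / w y\<bar> \<le> C * (1 + \<bar>y\<bar>) ^ k"
    using bounded_w[OF L_pos] by (rule poly_boundedE) blast
  define K where "K = C * (2 + \<bar>x\<bar>) ^ k"
  have bound: "\<bar>D 1 y\<bar> \<le> K * w y" if y: "\<bar>y - x\<bar> \<le> 1" for y
  proof (cases "w y = 0")
    case True
    then show ?thesis using w_zero_deriv[OF True] by simp
  next
    case False
    then have wy: "w y > 0" using w_nonneg[of y] by simp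
    have "1 + \<bar>y\<bar> \<le> 2 + \<bar>x\<bar>" using y by linarith
    then have "(1 + \<bar>y\<bar>) ^ k \<le> (2 + \<bar>x\<bar>) ^ k" by (intro power_mono) simp_all
    then have "C * (1 + \<bar>y\<bar>) ^ k \<le> K" unfolding K_def using C(1) by (intro mult_left_mono) simp_all
    then have "\<bar>D 1 y / w y\<bar> \<le> K" using C(2)[of y] by linarith
    then have "\<bar>D 1 y\<bar> / w y \<le> K" using wy by (simp add: abs_divide)
    then show ?thesis using wy by (simp only: pos_divide_le_eq)
  qed
  have zero: "w y = 0" if y: "\<bar>y - x\<bar> < 1" for y
  proof (cases "y \<ge> x")
    case True
    have "w y * exp (- K * y) \<le> w x * exp (- K * x)"
    proof (rule DERIV_nonpos_imp_nonincreasing[OF True])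
      fix z assume z: "x \<le> z" "z \<le> y"
      then have "\<bar>z - x\<bar> \<le> 1" using y by linarith
      then have "D 1 z \<le> K * w z" using bound[of z] by linarith
      then have pre: "D 1 z - K * w z \<le> 0" by simp
      have "((\<lambda>z. w z * exp (- K * z)) has_real_derivative (D 1 z * exp (- K * z) + (exp (- K * z) * (- K)) * w z)) (at z)"
        by (auto intro!: derivative_eq_intros w_deriv)
      then have "((\<lambda>z. w z * exp (- K * z)) has_real_derivative (D 1 z - K * w z) * exp (- K * z)) (at z)"
        by (rule DERIV_cong) (simp add: algebra_simps)
      moreover have "(D 1 z - K * w z) * exp (- K * z) \<le> 0" by (rule mult_nonpos_nonneg[OF pre]) simp
      ultimately show "\<exists>d. ((\<lambda>z. w z * exp (- K * z)) has_real_derivative d) (at z) \<and> d \<le> 0" by blast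
    qed
    then have "w y * exp (- K * y) \<le> 0" using x0 by simp
    then have "w y \<le> 0" by (simp add: mult_le_0_iff)
    then show ?thesis using w_nonneg[of y] by simp
  next
    case False
    then have yx: "y \<le> x" by simp
    have "w y * exp (K * y) \<le> w x * exp (K * x)"
    proof (rule DERIV_nonneg_imp_nondecreasing[OF yx])
      fix z assume z: "y \<le> z" "z \<le> x"
      then have "\<bar>z - x\<bar> \<le> 1" using y by linarith
      then have "0 \<le> D 1 z + K * w z" using bound[of z] by linarith
      then have pre: "0 \<le> D 1 z + K * w z" by simp
      have "((\<lambda>z. w z * exp (K * z)) has_real_derivative (D 1 z * exp (K * z) + (exp (K * z) * (K)) * w z)) (at z)"
        by (auto intro!: derivative_eq_intros w_deriv)
      then have "((\<lambda>z. w z * exp (K * z)) has_real_derivative (D 1 z + K * w z) * exp (K * z)) (at z)"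
        by (rule DERIV_cong) (simp add: algebra_simps)
      moreover have "0 \<le> (D 1 z + K * w z) * exp (K * z)" by (rule mult_nonneg_nonneg[OF pre]) simp
      ultimately show "\<exists>d. ((\<lambda>z. w z * exp (K * z)) has_real_derivative d) (at z) \<and> 0 \<le> d" by blast
    qed
    then have "w y * exp (K * y) \<le> 0" using x0 by simp
    then have "w y \<le> 0" by (simp add: mult_le_0_iff)
    then show ?thesis using w_nonneg[of y] by simp
  qed
  have "x \<in> closure {x. w x \<noteq> 0}" using supp by simp
  then have "\<forall>e>0. \<exists>y\<in>{x. w x \<noteq> 0}. dist y x < e" by (simp only: closure_approachable)
  from this[rule_format, of 1] obtain y where "w y \<noteq> 0" "dist y x < 1" by auto
  then show False using zero[of y] by (simp add: dist_real_def)
qed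

lemma D_bound: "l \<le> L \<Longrightarrow> \<exists>C k. C > 0 \<and> (\<forall>x. \<bar>D l x\<bar> \<le> C * (1 + \<bar>x\<bar>) ^ k * w x)"
proof -
  assume l: "l \<le> L"
  from bounded_w[OF l] obtain C k where C: "C > 0" "\<And>y. \<bar>D l y / w y\<bar> \<le> C * (1 + \<bar>y\<bar>) ^ k"
    by (rule poly_boundedE) blast
  have "\<bar>D l x\<bar> \<le> C * (1 + \<bar>x\<bar>) ^ k * w x" for x
  proof -
    have "\<bar>D l x\<bar> / w x \<le> C * (1 + \<bar>x\<bar>) ^ k" using C(2)[of x] w_pos[of x] by (simp add: abs_divide)
    then show ?thesis using w_pos[of x] by (simp only: pos_divide_le_eq)
  qed
  then show ?thesis using C(1) by blast
qed

lemma D_cont: "l < L \<Longrightarrow> isCont (D l) x"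
  using D_deriv by (rule DERIV_isCont)

text \<open>All derivatives below order \<open>L\<close> are continuous. The last one need not be,
  but it is a pointwise limit of continuous difference quotients.\<close>

lemma D_meas: "l \<le> L \<Longrightarrow> D l \<in> borel_measurable borel"
proof -
  assume l: "l \<le> L"
  have cont: "D m \<in> borel_measurable borel" if "m < L" for m
    by (intro borel_measurable_continuous_onI continuous_at_imp_continuous_on ballI D_cont that)
  show ?thesis
  proof (cases l)
    case 0
    then show ?thesis by simp
  next
    case (Suc m)
    then have m: "m < L" using l by simp
    have "(\<lambda>n. (D m (x + 1 / real (Suc n)) - D m x) / (1 / real (Suc n))) \<longlonglongrightarrow> D (Suc m) x" for x
    proof -
      have "(\<lambda>h. (D m (x + h) - D m x) / h) \<midarrow>0\<rightarrow> D (Suc m) x" using D_deriv[OF m, of x] by (simp add: DERIV_def)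
      moreover have "filterlim (\<lambda>n. 1 / real (Suc n)) (at 0) sequentially"
      proof -
        have "(\<lambda>n. 1 / real (Suc n)) \<longlonglongrightarrow> 0" by real_asymp
        then show ?thesis by (rule filterlim_atI) simp
      qed
      ultimately show ?thesis by (rule filterlim_compose)
    qed
    then show ?thesis unfolding Suc
    proof (rule borel_measurable_LIMSEQ_real)
      have "(\<lambda>x. D m (x + c)) \<in> borel_measurable borel" for c
        by (rule measurable_compose[OF _ cont[OF m]]) measurable
      then show "(\<lambda>x. (D m (x + 1 / real (Suc n)) - D m x) / (1 / real (Suc n))) \<in> borel_measurable borel" for n
        using cont[OF m] by (intro borel_measurable_divide borel_measurable_diff) simp_all
    qed
  qed
qed

text \<open>The last derivative may be discontinuous, but it is dominated by a polynomial times
  \<open>w\<close>, and this majorant is continuous, hence bounded on compact intervals.\<close>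

lemma D_loc:
  assumes l: "l \<le> L"
  shows "\<exists>B. \<forall>x. \<bar>x\<bar> \<le> R \<longrightarrow> \<bar>D l x\<bar> \<le> B"
proof -
  obtain C k where C: "C > 0" "\<And>x. \<bar>D l x\<bar> \<le> C * (1 + \<bar>x\<bar>) ^ k * w x" using D_bound[OF l] by blast
  have "isCont w x" for x using w_deriv by (rule DERIV_isCont)
  then have "continuous_on {-R..R} (\<lambda>x. C * (1 + \<bar>x\<bar>) ^ k * w x)"
    by (intro continuous_intros continuous_at_imp_continuous_on) simp
  then have "bounded ((\<lambda>x. C * (1 + \<bar>x\<bar>) ^ k * w x) ` {-R..R})"
    by (intro compact_imp_bounded compact_continuous_image) simp_all
  then obtain B where B: "\<forall>y\<in>(\<lambda>x. C * (1 + \<bar>x\<bar>) ^ k * w x) ` {-R..R}. \<bar>y\<bar> \<le> B"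
    unfolding bounded_iff real_norm_def by blast
  have "\<bar>D l x\<bar> \<le> B" if "\<bar>x\<bar> \<le> R" for x
  proof -
    have "x \<in> {-R..R}" using that by (simp add: abs_le_iff)
    then have "C * (1 + \<bar>x\<bar>) ^ k * w x \<in> (\<lambda>x. C * (1 + \<bar>x\<bar>) ^ k * w x) ` {-R..R}" by (rule imageI)
    then have "\<bar>C * (1 + \<bar>x\<bar>) ^ k * w x\<bar> \<le> B" using B by blast
    with C(2)[of x] show ?thesis by linarith
  qed
  then show ?thesis by blast
qed

lemma exponential: "\<exists>r. exponential_moments \<mu> r"
proof -
  obtain r where r: "r > 0" "\<forall>t. \<bar>t\<bar> < r \<longrightarrow> integrable \<mu> (\<lambda>x. exp (t * x))" using mgf by blast
  interpret prob_space \<mu> by (rule prob)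
  have "exponential_moments \<mu> r" by unfold_locales (use r in auto)
  then show ?thesis ..
qed

lemma integral_\<mu>: "g \<in> borel_measurable borel \<Longrightarrow> (\<integral>x. g x \<partial>\<mu>) = (\<integral>x. g x * w x \<partial>lborel)"
  by (subst integral_real_density) (simp_all add: w_nonneg mult.commute)

lemma integrable_\<mu>: "g \<in> borel_measurable borel \<Longrightarrow> integrable \<mu> g \<longleftrightarrow> integrable lborel (\<lambda>x. g x * w x)"
  by (subst integrable_real_density) (simp_all add: w_nonneg mult.commute)

lemma poly_bounded_integrable_\<mu>: "poly_bounded g \<Longrightarrow> g \<in> borel_measurable borel \<Longrightarrow> integrable \<mu> g"
proof -
  obtain r where "exponential_moments \<mu> r" using exponential by blast
  then interpret exponential_moments \<mu> r .
  assume "poly_bounded g" "g \<in> borel_measurable borel"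
  then show ?thesis by (rule poly_bounded_integrable0)
qed

lemma poly_bounded_integrable_w: "poly_bounded g \<Longrightarrow> g \<in> borel_measurable borel \<Longrightarrow> integrable lborel (\<lambda>x. g x * w x)"
  using poly_bounded_integrable_\<mu> integrable_\<mu> by blast

lemma poly_bounded_power_abs: "poly_bounded (\<lambda>x. c * (1 + \<bar>x\<bar>) ^ k)"
  unfolding poly_bounded_def
proof (intro exI allI)
  show "\<bar>c * (1 + \<bar>x\<bar>) ^ k\<bar> \<le> \<bar>c\<bar> * (1 + \<bar>x\<bar>) ^ k" for x by (simp add: abs_mult)
qed

lemma translation:
  assumes g: "poly_bounded g" "g \<in> borel_measurable borel"
  obtains A k where "\<And>c m. c > 0 \<Longrightarrow> translation_setup g (\<lambda>x. c * (1 + \<bar>x\<bar>) ^ m * w x) A k" "A > 0" "\<And>x. \<bar>g x\<bar> \<le> A * (1 + \<bar>x\<bar>) ^ k"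
proof -
  obtain A k where A: "A > 0" "\<And>x. \<bar>g x\<bar> \<le> A * (1 + \<bar>x\<bar>) ^ k" using g(1) by (rule poly_boundedE) blast
  have "translation_setup g (\<lambda>x. c * (1 + \<bar>x\<bar>) ^ m * w x) A k" for c m
  proof
    fix j
    have "integrable lborel (\<lambda>x. (c * (1 + \<bar>x\<bar>) ^ (j + m)) * w x)"
      by (rule poly_bounded_integrable_w[OF poly_bounded_power_abs]) measurable
    then show "integrable lborel (\<lambda>x. (1 + \<bar>x\<bar>) ^ j * (c * (1 + \<bar>x\<bar>) ^ m * w x))"
      by (simp add: power_add mult_ac)
  qed (fact g(2), fact A(2), fact A(1))
  then show thesis by (intro that[OF _ A])
qed

lemma D_common_bound:
  assumes l: "l < L"
  obtains c m where "c > 0" "\<And>x. \<bar>D l x\<bar> \<le> c * (1 + \<bar>x\<bar>) ^ m * w x" "\<And>x. \<bar>D (Suc l) x\<bar> \<le> c * (1 + \<bar>x\<bar>) ^ m * w x"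
proof -
  obtain C k where C: "C > 0" "\<And>x. \<bar>D l x\<bar> \<le> C * (1 + \<bar>x\<bar>) ^ k * w x" using D_bound[OF less_imp_le[OF l]] by blast
  obtain C' k' where C': "C' > 0" "\<And>x. \<bar>D (Suc l) x\<bar> \<le> C' * (1 + \<bar>x\<bar>) ^ k' * w x" using D_bound[OF Suc_leI[OF l]] by blast
  have mono: "a * (1 + \<bar>x\<bar>) ^ i * w x \<le> max C C' * (1 + \<bar>x\<bar>) ^ max k k' * w x" if "0 \<le> a" "a \<le> max C C'" "i \<le> max k k'" for a i x
    using that by (intro mult_right_mono mult_mono power_increasing w_nonneg) simp_all
  show thesis
  proof (rule that[of "max C C'" "max k k'"])
    show "max C C' > 0" using C(1) by simp
    show "\<bar>D l x\<bar> \<le> max C C' * (1 + \<bar>x\<bar>) ^ max k k' * w x" for x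
      by (rule order_trans[OF C(2) mono]) (use C(1) in simp_all)
    show "\<bar>D (Suc l) x\<bar> \<le> max C C' * (1 + \<bar>x\<bar>) ^ max k k' * w x" for x
      by (rule order_trans[OF C'(2) mono]) (use C'(1) in simp_all)
  qed
qed

lemma D_FTC:
  assumes g: "poly_bounded g" "g \<in> borel_measurable borel" and l: "l < L"
  shows "integrable lborel (\<lambda>s. indicator {0..1} s * translate_integral g (D (Suc l)) (s * b))"
    and "translate_integral g (D l) b - translate_integral g (D l) 0 = - b * (\<integral>s. indicator {0..1} s * translate_integral g (D (Suc l)) (s * b) \<partial>lborel)"
proof -
  obtain c m where c: "c > 0" "\<And>x. \<bar>D l x\<bar> \<le> c * (1 + \<bar>x\<bar>) ^ m * w x" "\<And>x. \<bar>D (Suc l) x\<bar> \<le> c * (1 + \<bar>x\<bar>) ^ m * w x"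
    by (rule D_common_bound[OF l]) blast
  obtain A k where "translation_setup g (\<lambda>x. c * (1 + \<bar>x\<bar>) ^ m * w x) A k"
    by (rule translation[OF g]) (use c(1) in blast)
  then interpret translation_setup g "\<lambda>x. c * (1 + \<bar>x\<bar>) ^ m * w x" A k .
  have m: "D (Suc l) \<in> borel_measurable borel" "D l \<in> borel_measurable borel" by (rule D_meas, use l in simp)+
  have loc: "\<exists>B. \<forall>x. \<bar>x\<bar> \<le> R \<longrightarrow> \<bar>D (Suc l) x\<bar> \<le> B" for R by (rule D_loc) (use l in simp)
  note F = translate_integral_FTC[OF m c(3) c(2) D_deriv[OF l] loc]
  show "integrable lborel (\<lambda>s. indicator {0..1} s * translate_integral g (D (Suc l)) (s * b))" by (rule F(1))
  show "translate_integral g (D l) b - translate_integral g (D l) 0 = - b * (\<integral>s. indicator {0..1} s * translate_integral g (D (Suc l)) (s * b) \<partial>lborel)" by (rule F(2))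
qed

lemma D_tendsto:
  assumes g: "poly_bounded g" "g \<in> borel_measurable borel" and l: "l \<le> L"
    and lim: "b \<longlonglongrightarrow> 0" "AE x in lborel. (\<lambda>n. g (x + b n)) \<longlonglongrightarrow> g x"
  shows "(\<lambda>n. translate_integral g (D l) (b n)) \<longlonglongrightarrow> translate_integral g (D l) 0"
proof -
  obtain c m where c: "c > 0" "\<And>x. \<bar>D l x\<bar> \<le> c * (1 + \<bar>x\<bar>) ^ m * w x" using D_bound[OF l] by blast
  obtain A k where "translation_setup g (\<lambda>x. c * (1 + \<bar>x\<bar>) ^ m * w x) A k"
    by (rule translation[OF g]) (use c(1) in blast)
  then interpret translation_setup g "\<lambda>x. c * (1 + \<bar>x\<bar>) ^ m * w x" A k .
  show ?thesis by (rule tendsto_translate_integral[OF D_meas[OF l] c(2) lim])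
qed

text \<open>No boundary terms at infinity have to be discussed: the fundamental theorem for
  translates is applied with the constant 1 in place of \<open>g\<close> to the product of
  \<open>P\<close> and \<open>D l\<close>. The integral of this product does not change under
  translation, so the integral of its derivative vanishes.\<close>

lemma integration_by_parts:
  assumes l: "l < L"
  shows "(\<integral>x. poly P x * D (Suc l) x \<partial>lborel) = - (\<integral>x. poly (pderiv P) x * D l x \<partial>lborel)"
proof -
  obtain c m where c: "c > 0" "\<And>x. \<bar>D l x\<bar> \<le> c * (1 + \<bar>x\<bar>) ^ m * w x" "\<And>x. \<bar>D (Suc l) x\<bar> \<le> c * (1 + \<bar>x\<bar>) ^ m * w x"
    by (rule D_common_bound[OF l]) blast
  obtain P1 k1 where P1: "P1 > 0" "\<And>x. \<bar>poly P x\<bar> \<le> P1 * (1 + \<bar>x\<bar>) ^ k1" using poly_bounded_poly[of P] by (rule poly_boundedE) blast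
  obtain P2 k2 where P2: "P2 > 0" "\<And>x. \<bar>poly (pderiv P) x\<bar> \<le> P2 * (1 + \<bar>x\<bar>) ^ k2" using poly_bounded_poly[of "pderiv P"] by (rule poly_boundedE) blast
  define j where "j = max k1 k2"
  have up1: "P1 * (1 + \<bar>x\<bar>) ^ k1 \<le> P1 * (1 + \<bar>x\<bar>) ^ j" for x using P1(1) by (intro mult_left_mono power_increasing) (simp_all add: j_def)
  have up2: "P2 * (1 + \<bar>x\<bar>) ^ k2 \<le> P2 * (1 + \<bar>x\<bar>) ^ j" for x using P2(1) by (intro mult_left_mono power_increasing) (simp_all add: j_def)
  define V where "V = (\<lambda>x. ((P1 + P2) * c) * (1 + \<bar>x\<bar>) ^ (j + m) * w x)"
  have prod: "\<bar>a * d\<bar> \<le> (Q * c) * (1 + \<bar>x\<bar>) ^ (j + m) * w x"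
    if "\<bar>a\<bar> \<le> Q * (1 + \<bar>x\<bar>) ^ j" "\<bar>d\<bar> \<le> c * (1 + \<bar>x\<bar>) ^ m * w x" "Q > 0" for a d x Q
  proof -
    have "\<bar>a\<bar> * \<bar>d\<bar> \<le> (Q * (1 + \<bar>x\<bar>) ^ j) * (c * (1 + \<bar>x\<bar>) ^ m * w x)"
      using that by (intro mult_mono) simp_all
    then show ?thesis by (simp add: abs_mult power_add mult_ac)
  qed
  have b1: "\<bar>poly P x * D l x\<bar> \<le> (P1 * c) * (1 + \<bar>x\<bar>) ^ (j + m) * w x" for x
    by (rule prod[OF order_trans[OF P1(2) up1] c(2) P1(1)])
  have b2: "\<bar>poly P x * D (Suc l) x\<bar> \<le> (P1 * c) * (1 + \<bar>x\<bar>) ^ (j + m) * w x" for x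
    by (rule prod[OF order_trans[OF P1(2) up1] c(3) P1(1)])
  have b3: "\<bar>poly (pderiv P) x * D l x\<bar> \<le> (P2 * c) * (1 + \<bar>x\<bar>) ^ (j + m) * w x" for x
    by (rule prod[OF order_trans[OF P2(2) up2] c(2) P2(1)])
  have nn: "0 \<le> (Q * c) * (1 + \<bar>x\<bar>) ^ (j + m) * w x" if "Q > 0" for Q x using that c(1) w_nonneg[of x] by simp
  have V_eq: "V x = (P1 * c) * (1 + \<bar>x\<bar>) ^ (j + m) * w x + (P2 * c) * (1 + \<bar>x\<bar>) ^ (j + m) * w x" for x
    by (simp add: V_def algebra_simps)
  have V1: "\<bar>poly P x * D l x\<bar> \<le> V x" for x unfolding V_eq using b1[of x] nn[OF P2(1), of x] by linarith
  have V2: "\<bar>poly (pderiv P) x * D l x + poly P x * D (Suc l) x\<bar> \<le> V x" for x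
    unfolding V_eq using b2[of x] b3[of x] by linarith
  have Pc: "(P1 + P2) * c > 0" using P1(1) P2(1) c(1) by simp
  have one: "poly_bounded (\<lambda>_. 1)" "(\<lambda>_::real. 1::real) \<in> borel_measurable borel" by (rule poly_bounded_const) simp
  have T: "\<exists>A k. translation_setup (\<lambda>_. 1) V A k"
    unfolding V_def by (rule translation[OF one]) (use Pc in blast)
  then obtain A k where "translation_setup (\<lambda>_. 1) V A k" by blast
  then interpret translation_setup "\<lambda>_. 1" V A k .
  have m: "D (Suc l) \<in> borel_measurable borel" "D l \<in> borel_measurable borel" by (rule D_meas, use l in simp)+
  have pm: "poly Q \<in> borel_measurable borel" for Q :: "real poly"
    by (intro borel_measurable_continuous_onI continuous_intros)
  let ?h = "\<lambda>x. poly (pderiv P) x * D l x + poly P x * D (Suc l) x"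
  have hm: "?h \<in> borel_measurable borel" using m pm by (intro borel_measurable_add borel_measurable_times)
  have Gm: "(\<lambda>x. poly P x * D l x) \<in> borel_measurable borel" using m pm by (intro borel_measurable_times)
  have der: "((\<lambda>x. poly P x * D l x) has_real_derivative ?h x) (at x)" for x
  proof -
    have "((\<lambda>x. poly P x * D l x) has_real_derivative (poly (pderiv P) x * D l x + D (Suc l) x * poly P x)) (at x)"
      by (rule DERIV_mult[OF poly_DERIV D_deriv[OF l]])
    then show ?thesis by (simp only: mult.commute)
  qed
  have loc: "\<exists>B. \<forall>x. \<bar>x\<bar> \<le> R \<longrightarrow> \<bar>?h x\<bar> \<le> B" for R
  proof -
    obtain B1 where B1: "\<forall>x. \<bar>x\<bar> \<le> R \<longrightarrow> \<bar>D l x\<bar> \<le> B1" using D_loc[OF less_imp_le[OF l], of R] by blast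
    obtain B2 where B2: "\<forall>x. \<bar>x\<bar> \<le> R \<longrightarrow> \<bar>D (Suc l) x\<bar> \<le> B2" using D_loc[OF Suc_leI[OF l], of R] by blast
    have "\<bar>?h x\<bar> \<le> (P2 * (1 + R) ^ k2) * B1 + (P1 * (1 + R) ^ k1) * B2" if x: "\<bar>x\<bar> \<le> R" for x
    proof -
      have R: "P2 * (1 + \<bar>x\<bar>) ^ k2 \<le> P2 * (1 + R) ^ k2" "P1 * (1 + \<bar>x\<bar>) ^ k1 \<le> P1 * (1 + R) ^ k1"
        using P1(1) P2(1) x by (intro mult_left_mono power_mono; simp)+
      have R0: "0 \<le> P2 * (1 + R) ^ k2" "0 \<le> P1 * (1 + R) ^ k1"
        by (rule order_trans[OF abs_ge_zero order_trans[OF P2(2) R(1)]], rule order_trans[OF abs_ge_zero order_trans[OF P1(2) R(2)]])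
      have "\<bar>poly (pderiv P) x\<bar> * \<bar>D l x\<bar> \<le> (P2 * (1 + R) ^ k2) * B1"
        using B1 x by (intro mult_mono order_trans[OF P2(2) R(1)] R0) simp_all
      moreover have "\<bar>poly P x\<bar> * \<bar>D (Suc l) x\<bar> \<le> (P1 * (1 + R) ^ k1) * B2"
        using B2 x by (intro mult_mono order_trans[OF P1(2) R(2)] R0) (simp_all del: funpow.simps)
      ultimately show ?thesis using abs_triangle_ineq[of "poly (pderiv P) x * D l x" "poly P x * D (Suc l) x"]
        unfolding abs_mult by linarith
    qed
    then show ?thesis by blast
  qed
  have const: "translate_integral (\<lambda>_. 1) F b = (\<integral>x. F x \<partial>lborel)" for F b by (simp add: translate_integral_def)
  \<comment> \<open>The shift is 1. Against the constant function all translates have the same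
    integral, so the left-hand side is 0 and the integrand on the right does not depend on
    \<open>s\<close>.\<close>
  have "0 = - 1 * (\<integral>s. indicator {0..1::real} s * (\<integral>x. ?h x \<partial>lborel) \<partial>lborel)"
    using translate_integral_FTC(2)[OF hm Gm V2 V1 der loc, of 1] unfolding const by simp
  then have z: "(\<integral>x. ?h x \<partial>lborel) = 0" by simp
  have i: "integrable lborel (\<lambda>x. poly (pderiv P) x * D l x)" "integrable lborel (\<lambda>x. poly P x * D (Suc l) x)"
  proof -
    have Vi: "integrable lborel V" using V_int[of 0] by simp
    show "integrable lborel (\<lambda>x. poly (pderiv P) x * D l x)"
    proof (rule integrable_le[OF Vi])
      show "\<bar>poly (pderiv P) x * D l x\<bar> \<le> V x" for x unfolding V_eq using b3[of x] nn[OF P1(1), of x] by linarith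
    qed (use m pm in \<open>simp add: borel_measurable_times\<close>)
    show "integrable lborel (\<lambda>x. poly P x * D (Suc l) x)"
    proof (rule integrable_le[OF Vi])
      show "\<bar>poly P x * D (Suc l) x\<bar> \<le> V x" for x unfolding V_eq using b2[of x] nn[OF P2(1), of x] by linarith
    qed (use m pm in \<open>simp add: borel_measurable_times del: funpow.simps\<close>)
  qed
  have "(\<integral>x. ?h x \<partial>lborel) = (\<integral>x. poly (pderiv P) x * D l x \<partial>lborel) + (\<integral>x. poly P x * D (Suc l) x \<partial>lborel)"
    by (rule Bochner_Integration.integral_add[OF i])
  with z show ?thesis by linarith
qed

lemma repeated_parts:
  "l \<le> L \<Longrightarrow> (\<integral>x. poly P x * D l x \<partial>lborel) = (- 1) ^ l * (\<integral>x. poly ((pderiv ^^ l) P) x * w x \<partial>lborel)"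
proof (induction l arbitrary: P)
  case (Suc l)
  have "(\<integral>x. poly P x * D (Suc l) x \<partial>lborel) = - (\<integral>x. poly (pderiv P) x * D l x \<partial>lborel)"
    by (rule integration_by_parts) (use Suc.prems in simp)
  also have "\<dots> = - ((- 1) ^ l * (\<integral>x. poly ((pderiv ^^ l) (pderiv P)) x * w x \<partial>lborel))"
    using Suc.IH[of "pderiv P"] Suc.prems by simp
  finally show ?case by (simp add: funpow_swap1)
qed simp

end

section \<open>Expansion of the mean under translation\<close>

lemma measurable_completion_AE_eq:
  fixes f g :: "'a \<Rightarrow> real"
  assumes g: "g \<in> borel_measurable M" and ae: "AE x in M. f x = g x"
  shows "f \<in> borel_measurable (completion M)"
proof (rule measurableI)
  fix S :: "real set" assume S: "S \<in> sets borel"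
  show "f -` S \<inter> space (completion M) \<in> sets (completion M)"
  proof (rule completion.in_sets_AE)
    have "AE x in M. (x \<in> g -` S \<inter> space M) = (x \<in> f -` S \<inter> space M)" using ae by eventually_elim simp
    then show "AE x in completion M. (x \<in> g -` S \<inter> space (completion M)) = (x \<in> f -` S \<inter> space (completion M))"
      by (simp add: AE_completion_iff)
    have "g -` S \<inter> space M \<in> sets M" using g S by (rule measurable_sets)
    then show "g -` S \<inter> space (completion M) \<in> sets (completion M)" by simp
  qed simp
qed simp

lemma integral_completion_AE_eq:
  fixes f g :: "'a \<Rightarrow> real"
  assumes g: "g \<in> borel_measurable M" and ae: "AE x in M. f x = g x"
  shows "(\<integral>x. f x \<partial>completion M) = (\<integral>x. g x \<partial>M)"
proof -
  have "(\<integral>x. f x \<partial>completion M) = (\<integral>x. g x \<partial>completion M)"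
  proof (rule integral_cong_AE)
    show "f \<in> borel_measurable (completion M)" by (rule measurable_completion_AE_eq[OF g ae])
    show "g \<in> borel_measurable (completion M)" using g by (rule measurable_completion)
    show "AE x in completion M. f x = g x" using ae by (simp add: AE_completion_iff)
  qed
  then show ?thesis using integral_completion[OF g] by simp
qed

text \<open>A Borel representative of \<open>f\<close>, which itself need not be Borel measurable.\<close>

definition continuous_part :: "(real \<Rightarrow> real) \<Rightarrow> real \<Rightarrow> real" where
  "continuous_part f x = (if isCont f x then f x else 0)"

lemma floor_approx: "(\<lambda>n. real_of_int \<lfloor>real n * x\<rfloor> / real n) \<longlonglongrightarrow> x"
proof (rule tendsto_sandwich)
  show "(\<lambda>n. x - 1 / real n) \<longlonglongrightarrow> x" by real_asymp
  show "\<forall>\<^sub>F n in sequentially. x - 1 / real n \<le> real_of_int \<lfloor>real n * x\<rfloor> / real n"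
    using eventually_gt_at_top[of 0]
  proof eventually_elim
    case (elim n)
    have "real n * x - 1 \<le> real_of_int \<lfloor>real n * x\<rfloor>" by linarith
    then have "(real n * x - 1) / real n \<le> real_of_int \<lfloor>real n * x\<rfloor> / real n" by (intro divide_right_mono) simp_all
    then show ?case using elim by (simp add: diff_divide_distrib)
  qed
  show "\<forall>\<^sub>F n in sequentially. real_of_int \<lfloor>real n * x\<rfloor> / real n \<le> x"
    using eventually_gt_at_top[of 0]
  proof eventually_elim
    case (elim n)
    have "real_of_int \<lfloor>real n * x\<rfloor> \<le> real n * x" by linarith
    then have "real_of_int \<lfloor>real n * x\<rfloor> / real n \<le> (real n * x) / real n" by (intro divide_right_mono) simp_all
    then show ?case using elim by simp
  qed
qed simp

text \<open>Sampling \<open>f\<close> at \<open>\<lfloor>n x\<rfloor> / n\<close> gives a function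
  of an integer, which is Borel whatever \<open>f\<close> is. At continuity points the samples
  converge to \<open>f x\<close>, and the set of continuity points is Borel.\<close>

lemma continuous_part_measurable [measurable]: "continuous_part f \<in> borel_measurable borel"
proof (rule borel_measurable_LIMSEQ_real)
  fix x
  show "(\<lambda>n. if isCont f x then f (real_of_int \<lfloor>real n * x\<rfloor> / real n) else 0) \<longlonglongrightarrow> continuous_part f x"
    using isCont_tendsto_compose[OF _ floor_approx[of x], of f] by (simp add: continuous_part_def)
next
  fix n :: nat
  have "(\<lambda>z::int. f (real_of_int z / real n)) \<in> measurable (count_space UNIV) borel" by simp
  moreover have "(\<lambda>x::real. \<lfloor>real n * x\<rfloor>) \<in> measurable borel (count_space UNIV)" by measurable
  ultimately have "(\<lambda>x. f (real_of_int \<lfloor>real n * x\<rfloor> / real n)) \<in> borel_measurable borel"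
    by (rule measurable_compose[rotated])
  then show "(\<lambda>x. if isCont f x then f (real_of_int \<lfloor>real n * x\<rfloor> / real n) else 0) \<in> borel_measurable borel"
    by (intro measurable_If) (simp_all add: isCont_borel pred_def)
qed

lemma AE_lborel_translate:
  fixes P :: "real \<Rightarrow> bool"
  assumes "AE x in lborel. P x" and [measurable]: "Measurable.pred borel P"
  shows "AE x in lborel. P (x + c)"
proof -
  have "AE x in distr lborel borel ((+) c). P x" unfolding lborel_distr_plus by (rule assms(1))
  then have "AE x in lborel. P (c + x)" by (subst (asm) AE_distr_iff) simp_all
  then show ?thesis by (simp add: add.commute)
qed

context smooth_density
begin

context
  fixes f :: "real \<Rightarrow> real" and q :: "nat \<Rightarrow> real poly"
  assumes f_bounded: "poly_bounded f" and f_cont: "AE x in lebesgue. isCont f x"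
begin

abbreviation "g \<equiv> continuous_part f"

lemma isCont_AE: "AE x in lborel. isCont f x" using f_cont by (simp add: AE_completion_iff)

lemma isCont_AE_\<mu>: "AE x in \<mu>. isCont f x"
  using isCont_AE by (subst AE_density) (auto elim: eventually_mono)

lemma g_bounded: "poly_bounded g"
proof -
  obtain C k where C: "C > 0" "\<And>x. \<bar>f x\<bar> \<le> C * (1 + \<bar>x\<bar>) ^ k" using f_bounded by (rule poly_boundedE) blast
  have "\<bar>g x\<bar> \<le> C * (1 + \<bar>x\<bar>) ^ k" for x
  proof (cases "isCont f x")
    case True
    then show ?thesis using C(2)[of x] by (simp add: continuous_part_def)
  next
    case False
    then show ?thesis using order_trans[OF abs_ge_zero C(2)[of x]] by (simp add: continuous_part_def)
  qed
  then show ?thesis unfolding poly_bounded_def by blast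
qed

text \<open>Off a null set \<open>x\<close> and all the countably many points \<open>x + b n\<close>
  are continuity points of \<open>f\<close>. The latter are needed too: at a discontinuity
  \<open>g\<close> is 0 by definition and need not be close to \<open>f x\<close>.\<close>

lemma g_translate_AE:
  assumes "b \<longlonglongrightarrow> 0"
  shows "AE x in lborel. (\<lambda>n. g (x + b n)) \<longlonglongrightarrow> g x"
proof -
  have "AE x in lborel. \<forall>n. isCont f (x + b n)"
    unfolding AE_all_countable by (intro allI AE_lborel_translate isCont_AE isCont_borel_pred)
  then show ?thesis using isCont_AE
  proof eventually_elim
    case (elim x)
    have "(\<lambda>n. x + b n) \<longlonglongrightarrow> x + 0" by (intro tendsto_intros assms)
    then have "(\<lambda>n. f (x + b n)) \<longlonglongrightarrow> f x" using isCont_tendsto_compose[OF elim(2)] by simp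
    then show ?case using elim by (simp add: continuous_part_def)
  qed
qed

lemma inner_f:
  assumes [measurable]: "h \<in> borel_measurable borel"
  shows "inner_mu \<mu> f h = (\<integral>x. g x * h x \<partial>\<mu>)"
  unfolding inner_mu_def
proof (rule integral_completion_AE_eq)
  show "AE x in \<mu>. f x * h x = g x * h x" using isCont_AE_\<mu> by eventually_elim (simp add: continuous_part_def)
qed simp

lemma inner_borel:
  assumes [measurable]: "h \<in> borel_measurable borel" "h' \<in> borel_measurable borel"
  shows "inner_mu \<mu> h h' = (\<integral>x. h x * h' x \<partial>\<mu>)"
  unfolding inner_mu_def by (rule integral_completion) simp

lemma poly_measurable: "poly (P :: real poly) \<in> borel_measurable borel"
  by (intro borel_measurable_continuous_onI continuous_intros)

context
  assumes q: "orthonormal_polys \<mu> q"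
begin

lemma q_degree: "degree (q k) = k" and q_nonzero: "q k \<noteq> 0"
  using q unfolding orthonormal_polys_def by (auto simp del: leading_coeff_0_iff) (metis leading_coeff_0_iff less_irrefl)

lemma q_orthonormal: "(\<integral>x. poly (q k) x * poly (q l) x \<partial>\<mu>) = (if k = l then 1 else 0)"
  using q inner_borel[OF poly_measurable poly_measurable, of "q k" "q l"] unfolding orthonormal_polys_def by simp

lemma coeff_a_eq: "coeff_a f \<mu> q k = (\<integral>x. g x * poly (q k) x \<partial>\<mu>)"
  unfolding coeff_a_def by (rule inner_f[OF poly_measurable])

text \<open>Integrating by parts \<open>l\<close> times moves the derivatives from
  \<open>q k\<close> to the density. The coefficient is thus, up to sign, the Fourier coefficient of
  the quotient \<open>D l / w\<close>, which is polynomially bounded and therefore in L2; the sum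
  defining \<open>tau\<close> becomes an inner product.\<close>

lemma coeff_b_eq:
  assumes l: "l \<le> L"
  shows "coeff_b \<mu> q k l = (- 1) ^ l * (\<integral>x. (D l x / w x) * poly (q k) x \<partial>\<mu>)"
proof -
  have Dm: "D l \<in> borel_measurable borel" by (rule D_meas[OF l])
  have "coeff_b \<mu> q k l = (\<integral>x. poly ((pderiv ^^ l) (q k)) x * 1 \<partial>\<mu>)"
    unfolding coeff_b_def by (rule inner_borel[OF poly_measurable]) simp
  also have "\<dots> = (\<integral>x. poly ((pderiv ^^ l) (q k)) x * w x \<partial>lborel)"
    using integral_\<mu>[OF poly_measurable] by simp
  finally have 1: "coeff_b \<mu> q k l = (\<integral>x. poly ((pderiv ^^ l) (q k)) x * w x \<partial>lborel)" .
  have "(\<integral>x. (D l x / w x) * poly (q k) x \<partial>\<mu>) = (\<integral>x. (D l x / w x) * poly (q k) x * w x \<partial>lborel)"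
    by (rule integral_\<mu>) (use Dm poly_measurable in \<open>auto intro!: borel_measurable_times borel_measurable_divide\<close>)
  also have "\<dots> = (\<integral>x. poly (q k) x * D l x \<partial>lborel)"
  proof (rule Bochner_Integration.integral_cong[OF refl])
    fix x show "(D l x / w x) * poly (q k) x * w x = poly (q k) x * D l x" using w_pos[of x] by simp
  qed
  also have "\<dots> = (- 1) ^ l * coeff_b \<mu> q k l" unfolding 1 by (rule repeated_parts[OF l])
  finally show ?thesis by (simp flip: power_mult_distrib add: mult.assoc[symmetric])
qed

text \<open>The \<open>l\<close>-th derivative at \<open>b = 0\<close> of the mean of
  \<open>g (x + b)\<close>: written with \<open>w (x - b)\<close>, each differentiation in
  \<open>b\<close> produces a factor -1.\<close>

definition taylor_coeff :: "nat \<Rightarrow> real" where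
  "taylor_coeff l = (- 1) ^ l * translate_integral g (D l) 0"

lemma translate_zero:
  assumes l: "l \<le> L"
  shows "translate_integral g (D l) 0 = (\<integral>x. g x * (D l x / w x) \<partial>\<mu>)"
proof -
  have "(\<integral>x. g x * (D l x / w x) \<partial>\<mu>) = (\<integral>x. g x * (D l x / w x) * w x \<partial>lborel)"
    by (rule integral_\<mu>) (use D_meas[OF l] in \<open>auto intro!: borel_measurable_times borel_measurable_divide\<close>)
  also have "\<dots> = (\<integral>x. g (x + 0) * D l x \<partial>lborel)"
  proof (rule Bochner_Integration.integral_cong[OF refl])
    fix x show "g x * (D l x / w x) * w x = g (x + 0) * D l x" using w_pos[of x] by simp
  qed
  finally show ?thesis by (simp add: translate_integral_def)
qed

text \<open>Parseval's identity for \<open>g\<close> and \<open>D l / w\<close>. It provides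
  convergence of the series together with its value, for every \<open>l\<close> up to
  \<open>L\<close>.\<close>

lemma coefficient_sums:
  assumes l: "l \<le> L"
  shows "(\<lambda>K. \<Sum>k<K. coeff_a f \<mu> q k * coeff_b \<mu> q k l) \<longlonglongrightarrow> taylor_coeff l"
proof -
  obtain r where "exponential_moments \<mu> r" using exponential by blast
  then interpret E: exponential_moments \<mu> r .
  have Dm: "(\<lambda>x. D l x / w x) \<in> borel_measurable borel"
    using D_meas[OF l] w_meas by (intro borel_measurable_divide)
  have 1: "g \<in> E.L2" by (rule E.poly_bounded_L2[OF g_bounded]) simp
  have 2: "(\<lambda>x. D l x / w x) \<in> E.L2" by (rule E.poly_bounded_L2[OF bounded_w[OF l] Dm])
  have "(\<lambda>K. \<Sum>k<K. (\<integral>x. g x * poly (q k) x \<partial>\<mu>) * (\<integral>x. (D l x / w x) * poly (q k) x \<partial>\<mu>)) \<longlonglongrightarrow> (\<integral>x. g x * (D l x / w x) \<partial>\<mu>)"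
    by (rule E.Parseval[OF q_degree q_nonzero q_orthonormal 1 2])
  then have "(\<lambda>K. (- 1) ^ l * (\<Sum>k<K. (\<integral>x. g x * poly (q k) x \<partial>\<mu>) * (\<integral>x. (D l x / w x) * poly (q k) x \<partial>\<mu>))) \<longlonglongrightarrow> (- 1) ^ l * (\<integral>x. g x * (D l x / w x) \<partial>\<mu>)"
    by (intro tendsto_intros)
  then show ?thesis
    unfolding coeff_a_eq coeff_b_eq[OF l] taylor_coeff_def translate_zero[OF l] sum_distrib_left mult.left_commute[of "(- 1) ^ l"] .
qed

lemma coeff_b_zero:
  assumes "k < l"
  shows "coeff_b \<mu> q k l = 0"
proof -
  have "degree ((pderiv ^^ j) (q k)) \<le> k - j" for j
    by (induction j) (auto simp: q_degree degree_pderiv intro: order_trans[OF diff_le_mono])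
  from this[of k] have "degree ((pderiv ^^ k) (q k)) = 0" by simp
  then have z: "pderiv ((pderiv ^^ k) (q k)) = 0" by (simp add: pderiv_eq_0_iff)
  have "(pderiv ^^ (Suc k + i)) (q k) = 0" for i
    by (induction i) (use z in simp_all)
  from this[of "l - Suc k"] have "(pderiv ^^ l) (q k) = 0" using assms by simp
  then show ?thesis by (simp add: coeff_b_def inner_mu_def)
qed

text \<open>In \<open>tau\<close> the series starts at \<open>k = l\<close>. Starting at 0 changes
  nothing, because the \<open>l\<close>-th derivative of a polynomial of degree below
  \<open>l\<close> is zero.\<close>

lemma shifted_sums:
  assumes l: "l \<le> L"
  shows "(\<lambda>k. coeff_a f \<mu> q (k + l) * coeff_b \<mu> q (k + l) l) sums taylor_coeff l"
proof -
  have "(\<lambda>k. coeff_a f \<mu> q k * coeff_b \<mu> q k l) sums taylor_coeff l"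
    unfolding sums_def by (rule coefficient_sums[OF l])
  then have "(\<lambda>k. coeff_a f \<mu> q (k + l) * coeff_b \<mu> q (k + l) l) sums (taylor_coeff l - (\<Sum>k<l. coeff_a f \<mu> q k * coeff_b \<mu> q k l))"
    by (rule sums_split_initial_segment)
  moreover have "(\<Sum>k<l. coeff_a f \<mu> q k * coeff_b \<mu> q k l) = 0"
    by (intro sum.neutral ballI) (simp add: coeff_b_zero)
  ultimately show ?thesis by simp
qed

lemma tau_eq: "l \<le> L \<Longrightarrow> norm_mu \<mu> f > 0 \<Longrightarrow> tau f \<mu> q l * norm_mu \<mu> f = taylor_coeff l"
  unfolding tau_def using sums_unique[OF shifted_sums[of l]] by simp

lemma taylor_coeff_zero:
  assumes l: "1 \<le> l" "l < L"
    and ev: "\<forall>\<^sub>F K in sequentially. (\<Sum>k=l..K. coeff_a f \<mu> q k * coeff_b \<mu> q k l) = 0"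
  shows "taylor_coeff l = 0"
proof -
  have eq: "(\<Sum>k<Suc K. coeff_a f \<mu> q k * coeff_b \<mu> q k l) = (\<Sum>k=l..K. coeff_a f \<mu> q k * coeff_b \<mu> q k l)" for K
    by (rule sum.mono_neutral_right) (auto simp: coeff_b_zero)
  have "(\<lambda>K. \<Sum>k<Suc K. coeff_a f \<mu> q k * coeff_b \<mu> q k l) \<longlonglongrightarrow> taylor_coeff l"
    by (rule LIMSEQ_Suc[OF coefficient_sums]) (use l in simp)
  then have "(\<lambda>K. \<Sum>k=l..K. coeff_a f \<mu> q k * coeff_b \<mu> q k l) \<longlonglongrightarrow> taylor_coeff l" unfolding eq .
  moreover have "(\<lambda>K. \<Sum>k=l..K. coeff_a f \<mu> q k * coeff_b \<mu> q k l) \<longlonglongrightarrow> 0" using ev by (rule tendsto_eventually)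
  ultimately show ?thesis by (rule LIMSEQ_unique)
qed

lemma mean_zero:
  assumes "coeff_a f \<mu> q 0 = 0"
  shows "(\<integral>x. g x \<partial>\<mu>) = 0"
proof -
  obtain c where c: "q 0 = [:c:]" using q_degree[of 0] by (auto elim: degree_eq_zeroE)
  then have "c \<noteq> 0" using q_nonzero[of 0] by auto
  moreover have "c * (\<integral>x. g x \<partial>\<mu>) = 0" using assms unfolding coeff_a_eq c by (simp add: mult.commute)
  ultimately show ?thesis by simp
qed

lemma mean_expansion:
  assumes a0: "coeff_a f \<mu> q 0 = 0"
    and sums: "\<And>l. 1 \<le> l \<Longrightarrow> l < L \<Longrightarrow> \<forall>\<^sub>F K in sequentially. (\<Sum>k=l..K. coeff_a f \<mu> q k * coeff_b \<mu> q k l) = 0"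
    and norm: "norm_mu \<mu> f > 0" and \<epsilon>: "\<epsilon> > 0"
  obtains \<delta> where "\<delta> > 0"
    "\<And>b. \<bar>b\<bar> \<le> \<delta> \<Longrightarrow> \<bar>(\<integral>x. g (x + b) \<partial>\<mu>) - tau f \<mu> q L * norm_mu \<mu> f * b ^ L / fact L\<bar> \<le> \<epsilon> * \<bar>b\<bar> ^ L"
proof -
  have gm: "(\<lambda>x. g (x + b)) \<in> borel_measurable borel" for b by measurable
  have H0: "translate_integral g (D 0) b = (\<integral>x. g (x + b) \<partial>\<mu>)" for b
    using integral_\<mu>[OF gm] by (simp add: translate_integral_def)
  \<comment> \<open>Order 0 is the mean of \<open>f\<close>, which vanishes because the coefficient
    with respect to the constant polynomial does; the orders from 1 to \<open>L - 1\<close> vanish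
    because their partial sums are eventually zero.\<close>
  have zero: "translate_integral g (D l) 0 = 0" if l: "l < L" for l
  proof (cases "l = 0")
    case True
    then show ?thesis unfolding True H0 using mean_zero[OF a0] by simp
  next
    case False
    then have "taylor_coeff l = 0" using l by (intro taylor_coeff_zero sums) simp_all
    then show ?thesis by (simp add: taylor_coeff_def)
  qed
  \<comment> \<open>Continuity is tested on sequences, since the exceptional null set of the almost
    everywhere convergence depends on the sequence of shifts.\<close>
  have cont: "isCont (translate_integral g (D L)) 0"
    unfolding continuous_at_sequentially comp_def
    by (intro allI impI D_tendsto[OF g_bounded continuous_part_measurable order_refl] g_translate_AE)
  obtain \<delta> where \<delta>: "\<delta> > 0" "\<And>b. \<bar>b\<bar> \<le> \<delta> \<Longrightarrow> \<bar>translate_integral g (D 0) b - (- 1) ^ L * translate_integral g (D L) 0 * b ^ L / fact L\<bar> \<le> \<epsilon> * \<bar>b\<bar> ^ L"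
    by (rule Taylor_from_integrals[of L "\<lambda>l. translate_integral g (D l)",
          OF D_FTC[OF g_bounded continuous_part_measurable] zero cont \<epsilon>]) (assumption, assumption, assumption, rule that, assumption, simp)
  show thesis
  proof (rule that[OF \<delta>(1)])
    fix b :: real assume "\<bar>b\<bar> \<le> \<delta>"
    from \<delta>(2)[OF this] show "\<bar>(\<integral>x. g (x + b) \<partial>\<mu>) - tau f \<mu> q L * norm_mu \<mu> f * b ^ L / fact L\<bar> \<le> \<epsilon> * \<bar>b\<bar> ^ L"
      unfolding H0 tau_eq[OF order_refl norm] taylor_coeff_def .
  qed
qed

end

section \<open>Moments of the differences \<open>g (x + b) - g x\<close>\<close>

lemma difference_bound:
  obtains A k where "A > 0" "\<And>x b. \<bar>b\<bar> \<le> 1 \<Longrightarrow> \<bar>g (x + b) - g x\<bar> \<le> A * (1 + \<bar>x\<bar>) ^ k"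
proof -
  obtain A k where T: "\<And>c m. c > 0 \<Longrightarrow> translation_setup g (\<lambda>x. c * (1 + \<bar>x\<bar>) ^ m * w x) A k" and A: "A > 0" "\<And>x. \<bar>g x\<bar> \<le> A * (1 + \<bar>x\<bar>) ^ k"
    by (rule translation[OF g_bounded continuous_part_measurable]) blast
  interpret translation_setup g "\<lambda>x. 1 * (1 + \<bar>x\<bar>) ^ 0 * w x" A k by (rule T) simp
  have "\<bar>g (x + b) - g x\<bar> \<le> (A * 2 ^ k + A) * (1 + \<bar>x\<bar>) ^ k" if b: "\<bar>b\<bar> \<le> 1" for x b
  proof -
    have "(1 + \<bar>b\<bar>) ^ k \<le> 2 ^ k" using b by (intro power_mono) simp_all
    then have "A * (1 + \<bar>b\<bar>) ^ k * (1 + \<bar>x\<bar>) ^ k \<le> A * 2 ^ k * (1 + \<bar>x\<bar>) ^ k"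
      using A(1) by (intro mult_right_mono mult_left_mono) simp_all
    then show ?thesis using g_translate_bound[of x b] A(2)[of x] unfolding distrib_right by linarith
  qed
  moreover have "A * 2 ^ k + A > 0" using A(1) by (simp add: add_pos_pos)
  ultimately show thesis using that by blast
qed

lemma difference_moments:
  "\<exists>C. \<forall>b. \<bar>b\<bar> \<le> 1 \<longrightarrow> integrable \<mu> (\<lambda>x. \<bar>g (x + b) - g x\<bar> ^ N) \<and> (\<integral>x. \<bar>g (x + b) - g x\<bar> ^ N \<partial>\<mu>) \<le> C"
proof -
  obtain A k where A: "A > 0" "\<And>x b. \<bar>b\<bar> \<le> 1 \<Longrightarrow> \<bar>g (x + b) - g x\<bar> \<le> A * (1 + \<bar>x\<bar>) ^ k"
    by (rule difference_bound) blast
  have int: "integrable \<mu> (\<lambda>x. A ^ N * (1 + \<bar>x\<bar>) ^ (k * N))"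
    by (rule poly_bounded_integrable_\<mu>[OF poly_bounded_power_abs]) measurable
  have le: "\<bar>g (x + b) - g x\<bar> ^ N \<le> A ^ N * (1 + \<bar>x\<bar>) ^ (k * N)" if "\<bar>b\<bar> \<le> 1" for x b
  proof -
    have "\<bar>g (x + b) - g x\<bar> ^ N \<le> (A * (1 + \<bar>x\<bar>) ^ k) ^ N" by (intro power_mono A(2) that) simp
    then show ?thesis by (simp only: power_mult_distrib power_mult)
  qed
  have i2: "integrable \<mu> (\<lambda>x. \<bar>g (x + b) - g x\<bar> ^ N)" if "\<bar>b\<bar> \<le> 1" for b
  proof (rule integrable_le[OF int])
    show "\<bar>\<bar>g (x + b) - g x\<bar> ^ N\<bar> \<le> A ^ N * (1 + \<bar>x\<bar>) ^ (k * N)" for x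
      using le[OF that, of x] by (simp only: power_abs abs_idempotent)
  qed simp
  have "(\<integral>x. \<bar>g (x + b) - g x\<bar> ^ N \<partial>\<mu>) \<le> (\<integral>x. A ^ N * (1 + \<bar>x\<bar>) ^ (k * N) \<partial>\<mu>)" if "\<bar>b\<bar> \<le> 1" for b
    by (rule integral_mono[OF i2[OF that] int le[OF that]])
  then show ?thesis using i2 by blast
qed

text \<open>Otherwise there are shifts tending to zero whose second moments stay above \<epsilon>.
  Along this one sequence the translates converge almost everywhere under a common majorant, and
  dominated convergence gives a contradiction.\<close>

lemma difference_second_moment:
  assumes \<epsilon>: "\<epsilon> > 0"
  obtains \<delta> where "\<delta> > 0" "\<And>b. \<bar>b\<bar> \<le> \<delta> \<Longrightarrow> (\<integral>x. (g (x + b) - g x)\<^sup>2 \<partial>\<mu>) \<le> \<epsilon>"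
proof -
  obtain A k where A: "A > 0" "\<And>x b. \<bar>b\<bar> \<le> 1 \<Longrightarrow> \<bar>g (x + b) - g x\<bar> \<le> A * (1 + \<bar>x\<bar>) ^ k"
    by (rule difference_bound) blast
  have int: "integrable \<mu> (\<lambda>x. A\<^sup>2 * (1 + \<bar>x\<bar>) ^ (k * 2))"
    by (rule poly_bounded_integrable_\<mu>[OF poly_bounded_power_abs]) measurable
  show thesis
  proof (rule ccontr)
    assume neg: "\<not> thesis"
    have "\<exists>b. \<bar>b\<bar> \<le> 1 / real (Suc n) \<and> (\<integral>x. (g (x + b) - g x)\<^sup>2 \<partial>\<mu>) > \<epsilon>" for n
    proof (rule ccontr)
      assume "\<not> (\<exists>b. \<bar>b\<bar> \<le> 1 / real (Suc n) \<and> (\<integral>x. (g (x + b) - g x)\<^sup>2 \<partial>\<mu>) > \<epsilon>)"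
      then have "\<And>b. \<bar>b\<bar> \<le> 1 / real (Suc n) \<Longrightarrow> (\<integral>x. (g (x + b) - g x)\<^sup>2 \<partial>\<mu>) \<le> \<epsilon>" using not_less by blast
      moreover have "0 < 1 / real (Suc n)" by (rule divide_pos_pos) simp_all
      ultimately have thesis by (rule that[rotated])
      with neg show False ..
    qed
    then obtain b where b: "\<And>n. \<bar>b n\<bar> \<le> 1 / real (Suc n)" "\<And>n. (\<integral>x. (g (x + b n) - g x)\<^sup>2 \<partial>\<mu>) > \<epsilon>" by metis
    have b1: "\<bar>b n\<bar> \<le> 1" for n by (rule order_trans[OF b(1)]) simp
    have "(\<lambda>n. 1 / real (Suc n)) \<longlonglongrightarrow> 0" by real_asymp
    then have "b \<longlonglongrightarrow> 0" by (rule Lim_null_comparison[rotated]) (use b(1) in simp)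
    then have "AE x in lborel. (\<lambda>n. g (x + b n)) \<longlonglongrightarrow> g x" by (rule g_translate_AE)
    then have ae: "AE x in \<mu>. (\<lambda>n. g (x + b n)) \<longlonglongrightarrow> g x" by (subst AE_density) (auto elim: eventually_mono)
    have "(\<lambda>n. \<integral>x. (g (x + b n) - g x)\<^sup>2 \<partial>\<mu>) \<longlonglongrightarrow> (\<integral>x. 0 \<partial>\<mu>)"
    proof (rule integral_dominated_convergence[OF _ _ int])
      show "AE x in \<mu>. (\<lambda>n. (g (x + b n) - g x)\<^sup>2) \<longlonglongrightarrow> 0"
        using ae
      proof eventually_elim
        case (elim x)
        have "(\<lambda>n. (g (x + b n) - g x)\<^sup>2) \<longlonglongrightarrow> (g x - g x)\<^sup>2" by (intro tendsto_intros elim)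
        then show ?case by simp
      qed
      show "AE x in \<mu>. norm ((g (x + b n) - g x)\<^sup>2) \<le> A\<^sup>2 * (1 + \<bar>x\<bar>) ^ (k * 2)" for n
      proof (rule AE_I2)
        fix x
        have "\<bar>g (x + b n) - g x\<bar>\<^sup>2 \<le> (A * (1 + \<bar>x\<bar>) ^ k)\<^sup>2" by (intro power_mono A(2) b1) simp
        then show "norm ((g (x + b n) - g x)\<^sup>2) \<le> A\<^sup>2 * (1 + \<bar>x\<bar>) ^ (k * 2)"
          by (simp add: power_mult_distrib power_mult)
      qed
    qed simp_all
    then have "(\<lambda>n. \<integral>x. (g (x + b n) - g x)\<^sup>2 \<partial>\<mu>) \<longlonglongrightarrow> 0" by simp
    from order_tendstoD(2)[OF this \<epsilon>] obtain n where "(\<integral>x. (g (x + b n) - g x)\<^sup>2 \<partial>\<mu>) < \<epsilon>"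
      by (auto simp: eventually_sequentially)
    then show False using b(2)[of n] by simp
  qed
qed

end

end

section \<open>Matrices of rank one\<close>

text \<open>Rank one means that some column \<open>c\<close> is nonzero and that every other column
  is linearly dependent on it, hence a multiple of it, since \<open>{c}\<close> alone is
  independent. The multiples are the second factor.\<close>

lemma rank_one_factorization:
  fixes X :: "real Matrix.mat"
  assumes X: "X \<in> carrier_mat n p" and rank: "mat_rank X = 1"
  obtains a b where "\<forall>i<n. \<forall>j<p. index_mat X (i, j) = a i * b j"
    "(\<Sum>i<n. (a i)\<^sup>2) > 0" "(\<Sum>j<p. (b j)\<^sup>2) > 0"
proof -
  interpret V: vec_space "TYPE(real)" n .
  have rk: "V.rank X = 1" using rank X by (simp add: mat_rank_def)
  have colsub: "set (cols X) \<subseteq> carrier_vec n" using cols_dim[of X] X by simp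
  have "\<exists>c\<in>set (cols X). c \<noteq> 0\<^sub>v n"
  proof (rule ccontr)
    assume "\<not> (\<exists>c\<in>set (cols X). c \<noteq> 0\<^sub>v n)"
    then have z: "c = 0\<^sub>v n" if "c \<in> set (cols X)" for c using that by blast
    have "X = 0\<^sub>m n p"
    proof (rule eq_matI)
      fix i j assume "i < dim_row (0\<^sub>m n p :: real mat)" "j < dim_col (0\<^sub>m n p :: real mat)"
      then have ij: "i < n" "j < p" by simp_all
      have "col X j \<in> set (cols X)" using ij X by (auto simp: cols_def)
      from z[OF this] have "vec_index (col X j) i = vec_index (0\<^sub>v n) i" by simp
      then show "X $$ (i, j) = 0\<^sub>m n p $$ (i, j)" using ij X by simp
    qed (use X in simp_all)
    then show False using rk V.rank_0I by simp
  qed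
  then obtain c where c: "c \<in> set (cols X)" "c \<noteq> 0\<^sub>v n" by blast
  have cc: "c \<in> carrier_vec n" using c colsub by blast
  have empty: "V.lin_indpt {}" by (simp add: V.lin_dep_def)
  have "c \<in> V.span {} \<longleftrightarrow> V.lin_dep ({} \<union> {c})"
    by (rule V.lin_dep_iff_in_span[OF _ empty]) (use cc in simp_all)
  then have indc: "V.lin_indpt {c}" using c(2) by (simp add: V.span_empty)
  have mult: "\<exists>t. \<forall>i<n. vec_index d i = t * vec_index c i" if d: "d \<in> set (cols X)" for d
  proof (cases "d = c")
    case True
    then show ?thesis by (intro exI[of _ 1]) simp
  next
    case False
    have dc: "d \<in> carrier_vec n" using d colsub by blast
    have "V.lin_dep {c, d}"
    proof (rule ccontr)
      assume "\<not> V.lin_dep {c, d}"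
      then have "card {c, d} \<le> V.rank X"
        by (intro V.rank_ge_card_indpt[OF X]) (use c d in auto)
      then show False using rk False by simp
    qed
    moreover have "d \<in> V.span {c} \<longleftrightarrow> V.lin_dep ({c} \<union> {d})"
      by (rule V.lin_dep_iff_in_span[OF _ indc]) (use cc dc False in simp_all)
    ultimately have "d \<in> V.span {c}" by (simp add: insert_commute)
    then obtain t where t: "d = V.lincomb t {c}" using V.finite_span[of "{c}"] cc by auto
    have "vec_index d i = t c * vec_index c i" if "i < n" for i
      unfolding t using V.lincomb_index[OF that, of "{c}" t] cc by simp
    then show ?thesis by blast
  qed
  have "\<exists>t. \<forall>i<n. index_mat X (i, j) = t * vec_index c i" if j: "j < p" for j
  proof -
    have "col X j \<in> set (cols X)" using j X by (auto simp: cols_def)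
    from mult[OF this] show ?thesis using j X by auto
  qed
  then obtain t where t: "\<And>j i. j < p \<Longrightarrow> i < n \<Longrightarrow> index_mat X (i, j) = t j * vec_index c i" by metis
  have "\<exists>i<n. vec_index c i \<noteq> 0"
  proof (rule ccontr)
    assume "\<not> (\<exists>i<n. vec_index c i \<noteq> 0)"
    then have "c = 0\<^sub>v n" using cc by (intro eq_vecI) auto
    then show False using c(2) by simp
  qed
  then obtain i0 where i0: "i0 < n" "vec_index c i0 \<noteq> 0" by blast
  obtain j0 where j0: "j0 < p" "c = col X j0" using c(1) X by (auto simp: cols_def)
  have "index_mat X (i0, j0) \<noteq> 0" using i0 j0 X by simp
  then have tj0: "t j0 \<noteq> 0" using t[OF j0(1) i0(1)] by auto
  show thesis
  proof (rule that[of "\<lambda>i. vec_index c i" t])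
    show "\<forall>i<n. \<forall>j<p. index_mat X (i, j) = vec_index c i * t j" using t by (simp add: mult.commute)
    show "(\<Sum>i<n. (vec_index c i)\<^sup>2) > 0" by (rule sum_pos2[of _ i0]) (use i0 in auto)
    show "(\<Sum>j<p. (t j)\<^sup>2) > 0" by (rule sum_pos2[of _ j0]) (use j0 tj0 in auto)
  qed
qed

lemma vec_norm2_eq_1: "v \<in> carrier_vec n \<Longrightarrow> vec_norm2 v = 1 \<longleftrightarrow> (\<Sum>i<n. (vec_index v i)\<^sup>2) = 1"
  by (auto simp: vec_norm2_def)

lemma mult_mat_vec_index_sum:
  fixes X :: "real Matrix.mat"
  assumes "X \<in> carrier_mat n p" "v \<in> carrier_vec p" "i < n"
  shows "vec_index (X *\<^sub>v v) i = (\<Sum>j<p. index_mat X (i, j) * vec_index v j)"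
  using assms by (simp add: scalar_prod_def lessThan_atLeast0 row_def)

lemma singular_triple_factor:
  fixes X :: "real Matrix.mat"
  assumes X: "X \<in> carrier_mat n p" and ab: "\<forall>i<n. \<forall>j<p. index_mat X (i, j) = a i * b j"
  shows "singular_triple X s u v \<longleftrightarrow> s \<ge> 0 \<and> u \<in> carrier_vec n \<and> v \<in> carrier_vec p \<and>
     (\<Sum>i<n. (vec_index u i)\<^sup>2) = 1 \<and> (\<Sum>j<p. (vec_index v j)\<^sup>2) = 1 \<and>
     (\<forall>i<n. a i * (\<Sum>j<p. b j * vec_index v j) = s * vec_index u i) \<and>
     (\<forall>j<p. b j * (\<Sum>i<n. a i * vec_index u i) = s * vec_index v j)"
proof (cases "u \<in> carrier_vec n \<and> v \<in> carrier_vec p")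
  case True
  then have u: "u \<in> carrier_vec n" and v: "v \<in> carrier_vec p" by auto
  have 1: "X *\<^sub>v v = s \<cdot>\<^sub>v u \<longleftrightarrow> (\<forall>i<n. a i * (\<Sum>j<p. b j * vec_index v j) = s * vec_index u i)"
  proof -
    have "vec_index (X *\<^sub>v v) i = a i * (\<Sum>j<p. b j * vec_index v j)" if "i < n" for i
      unfolding mult_mat_vec_index_sum[OF X v that] using that by (simp add: ab sum_distrib_left mult.assoc)
    then show ?thesis using X u by (auto simp: vec_eq_iff)
  qed
  have 2: "transpose_mat X *\<^sub>v u = s \<cdot>\<^sub>v v \<longleftrightarrow> (\<forall>j<p. b j * (\<Sum>i<n. a i * vec_index u i) = s * vec_index v j)"
  proof -
    have "vec_index (transpose_mat X *\<^sub>v u) j = b j * (\<Sum>i<n. a i * vec_index u i)" if j: "j < p" for j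
    proof -
      have T: "transpose_mat X \<in> carrier_mat p n" using X by simp
      show ?thesis unfolding mult_mat_vec_index_sum[OF T u j] using X j by (simp add: ab sum_distrib_left mult_ac)
    qed
    then show ?thesis using X v by (auto simp: vec_eq_iff)
  qed
  show ?thesis unfolding singular_triple_def 1 2 using X u v by (simp add: vec_norm2_eq_1)
next
  case False
  then show ?thesis using X by (auto simp: singular_triple_def)
qed

text \<open>Write \<open>\<alpha>\<close> and \<open>\<beta>\<close> for the products of
  \<open>a\<close> with \<open>u\<close> and of \<open>b\<close> with \<open>v\<close>. The
  equations of the triple say that \<open>\<beta>\<close> times \<open>a\<close> is \<open>s\<close>
  times \<open>u\<close> and \<open>\<alpha>\<close> times \<open>b\<close> is \<open>s\<close>
  times \<open>v\<close>, and they force \<open>\<alpha> * \<beta> = s\<close>. This works for every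
  triple with \<open>s > 0\<close>, so the given singular vectors can be used as they are, whatever
  their sign.\<close>

lemma rank_one_singular_value:
  fixes X :: "real Matrix.mat"
  assumes X: "X \<in> carrier_mat n p" and ab: "\<forall>i<n. \<forall>j<p. index_mat X (i, j) = a i * b j"
    and tr: "singular_triple X s u v" and s: "s > 0"
  shows "s = sqrt (\<Sum>i<n. (a i)\<^sup>2) * sqrt (\<Sum>j<p. (b j)\<^sup>2)"
    and "\<And>i j. i < n \<Longrightarrow> j < p \<Longrightarrow> index_mat X (i, j) = s * vec_index u i * vec_index v j"
proof -
  define \<beta> where "\<beta> = (\<Sum>j<p. b j * vec_index v j)"
  define \<alpha> where "\<alpha> = (\<Sum>i<n. a i * vec_index u i)"
  define Na where "Na = (\<Sum>i<n. (a i)\<^sup>2)"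
  define Nb where "Nb = (\<Sum>j<p. (b j)\<^sup>2)"
  have T: "(\<Sum>i<n. (vec_index u i)\<^sup>2) = 1" "(\<Sum>j<p. (vec_index v j)\<^sup>2) = 1"
    "\<And>i. i < n \<Longrightarrow> a i * \<beta> = s * vec_index u i" "\<And>j. j < p \<Longrightarrow> b j * \<alpha> = s * vec_index v j"
    using tr unfolding singular_triple_factor[OF X ab] \<alpha>_def \<beta>_def by auto
  have 1: "Na * \<beta>\<^sup>2 = s\<^sup>2"
  proof -
    have "Na * \<beta>\<^sup>2 = (\<Sum>i<n. (a i * \<beta>)\<^sup>2)" by (simp add: Na_def sum_distrib_right power_mult_distrib)
    also have "\<dots> = (\<Sum>i<n. (s * vec_index u i)\<^sup>2)" by (intro sum.cong refl) (simp add: T)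
    also have "\<dots> = s\<^sup>2" using T(1) by (simp add: power_mult_distrib flip: sum_distrib_left)
    finally show ?thesis .
  qed
  have 2: "Nb * \<alpha>\<^sup>2 = s\<^sup>2"
  proof -
    have "Nb * \<alpha>\<^sup>2 = (\<Sum>j<p. (b j * \<alpha>)\<^sup>2)" by (simp add: Nb_def sum_distrib_right power_mult_distrib)
    also have "\<dots> = (\<Sum>j<p. (s * vec_index v j)\<^sup>2)" by (intro sum.cong refl) (simp add: T)
    also have "\<dots> = s\<^sup>2" using T(2) by (simp add: power_mult_distrib flip: sum_distrib_left)
    finally show ?thesis .
  qed
  have 3: "s * \<alpha> = Na * \<beta>"
  proof -
    have "s * \<alpha> = (\<Sum>i<n. a i * (s * vec_index u i))" by (simp add: \<alpha>_def sum_distrib_left mult_ac)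
    also have "\<dots> = (\<Sum>i<n. a i * (a i * \<beta>))" by (intro sum.cong refl) (simp add: T)
    also have "\<dots> = Na * \<beta>" by (simp add: Na_def sum_distrib_right power2_eq_square mult.assoc)
    finally show ?thesis .
  qed
  have ab_s: "\<alpha> * \<beta> = s"
  proof -
    have "s * (\<alpha> * \<beta>) = s * s" using 1 3 by (simp add: power2_eq_square mult.assoc[symmetric])
    then show ?thesis using s by simp
  qed
  have nn: "Na \<ge> 0" "Nb \<ge> 0" by (simp_all add: Na_def Nb_def sum_nonneg)
  have "(Na * Nb) * s\<^sup>2 = s\<^sup>2 * s\<^sup>2"
  proof -
    have "(Na * \<beta>\<^sup>2) * (Nb * \<alpha>\<^sup>2) = s\<^sup>2 * s\<^sup>2" unfolding 1 2 ..
    moreover have "(Na * \<beta>\<^sup>2) * (Nb * \<alpha>\<^sup>2) = (Na * Nb) * (\<alpha> * \<beta>)\<^sup>2" by (simp add: power_mult_distrib mult_ac)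
    ultimately show ?thesis unfolding ab_s by simp
  qed
  then have "Na * Nb = s\<^sup>2" by (subst (asm) mult_right_cancel) (use s in simp_all)
  then have "sqrt Na * sqrt Nb = s" using s by (simp flip: real_sqrt_mult)
  then show "s = sqrt (\<Sum>i<n. (a i)\<^sup>2) * sqrt (\<Sum>j<p. (b j)\<^sup>2)" unfolding Na_def Nb_def ..
  fix i j assume ij: "i < n" "j < p"
  have "s * (s * vec_index u i * vec_index v j) = (s * vec_index u i) * (s * vec_index v j)" by simp
  also have "\<dots> = (a i * \<beta>) * (b j * \<alpha>)" using T ij by simp
  also have "\<dots> = s * (a i * b j)" using ab_s by (simp add: mult_ac)
  finally have "s * vec_index u i * vec_index v j = a i * b j" using s by simp
  then show "index_mat X (i, j) = s * vec_index u i * vec_index v j" using ab ij by simp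
qed

text \<open>\<open>sigma1\<close> is the maximum of a set, meaningful once the set is finite: all
  singular values lie in \<open>{0, s}\<close>, and the normalized factors form a triple for
  \<open>s\<close>.\<close>

lemma sigma1_rank_one:
  fixes X :: "real Matrix.mat"
  assumes X: "X \<in> carrier_mat n p" and ab: "\<forall>i<n. \<forall>j<p. index_mat X (i, j) = a i * b j"
    and pos: "(\<Sum>i<n. (a i)\<^sup>2) > 0" "(\<Sum>j<p. (b j)\<^sup>2) > 0"
  shows "sigma1 X > 0"
proof -
  define Na where "Na = (\<Sum>i<n. (a i)\<^sup>2)"
  define Nb where "Nb = (\<Sum>j<p. (b j)\<^sup>2)"
  define s where "s = sqrt Na * sqrt Nb"
  have nn: "Na > 0" "Nb > 0" using pos by (simp_all add: Na_def Nb_def)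
  have s: "s > 0" using nn by (simp add: s_def)
  have sub: "singular_values X \<subseteq> {0, s}"
  proof
    fix t assume "t \<in> singular_values X"
    then obtain u v where tr: "singular_triple X t u v" by (auto simp: singular_values_def)
    then have "t \<ge> 0" by (simp add: singular_triple_def)
    show "t \<in> {0, s}"
    proof (cases "t = 0")
      case False
      then have "t > 0" using \<open>t \<ge> 0\<close> by simp
      from rank_one_singular_value(1)[OF X ab tr this] show ?thesis by (simp add: s_def Na_def Nb_def)
    qed simp
  qed
  define u where "u = Matrix.vec n (\<lambda>i. a i / sqrt Na)"
  define v where "v = Matrix.vec p (\<lambda>j. b j / sqrt Nb)"
  have bv: "(\<Sum>j<p. b j * vec_index v j) = sqrt Nb"
  proof -
    have "(\<Sum>j<p. b j * vec_index v j) = (\<Sum>j<p. (b j)\<^sup>2 / sqrt Nb)"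
      by (intro sum.cong refl) (simp add: v_def power2_eq_square)
    also have "\<dots> = Nb / sqrt Nb" by (simp add: Nb_def sum_divide_distrib)
    finally show ?thesis using nn by (simp add: real_div_sqrt)
  qed
  have au: "(\<Sum>i<n. a i * vec_index u i) = sqrt Na"
  proof -
    have "(\<Sum>i<n. a i * vec_index u i) = (\<Sum>i<n. (a i)\<^sup>2 / sqrt Na)"
      by (intro sum.cong refl) (simp add: u_def power2_eq_square)
    also have "\<dots> = Na / sqrt Na" by (simp add: Na_def sum_divide_distrib)
    finally show ?thesis using nn by (simp add: real_div_sqrt)
  qed
  have uu: "(\<Sum>i<n. (vec_index u i)\<^sup>2) = 1"
  proof -
    have "(\<Sum>i<n. (vec_index u i)\<^sup>2) = (\<Sum>i<n. (a i)\<^sup>2 / Na)"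
      by (intro sum.cong refl) (use nn in \<open>simp add: u_def power_divide\<close>)
    also have "\<dots> = Na / Na" unfolding sum_divide_distrib[symmetric] Na_def ..
    finally show ?thesis using nn by simp
  qed
  have vv: "(\<Sum>j<p. (vec_index v j)\<^sup>2) = 1"
  proof -
    have "(\<Sum>j<p. (vec_index v j)\<^sup>2) = (\<Sum>j<p. (b j)\<^sup>2 / Nb)"
      by (intro sum.cong refl) (use nn in \<open>simp add: v_def power_divide\<close>)
    also have "\<dots> = Nb / Nb" unfolding sum_divide_distrib[symmetric] Nb_def ..
    finally show ?thesis using nn by simp
  qed
  have ui: "a i = sqrt Na * vec_index u i" if "i < n" for i using that nn by (simp add: u_def)
  have vj: "b j = sqrt Nb * vec_index v j" if "j < p" for j using that nn by (simp add: v_def)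
  have "singular_triple X s u v"
    unfolding singular_triple_factor[OF X ab] bv au uu vv
  proof (intro conjI allI impI)
    show "a i * sqrt Nb = s * vec_index u i" if "i < n" for i using ui[OF that] by (simp add: s_def mult_ac)
    show "b j * sqrt Na = s * vec_index v j" if "j < p" for j using vj[OF that] by (simp add: s_def mult_ac)
  qed (use s in \<open>simp_all add: u_def v_def\<close>)
  then have "s \<in> singular_values X" unfolding singular_values_def by blast
  moreover have "finite (singular_values X)" using sub by (rule finite_subset) simp
  ultimately have "s \<le> sigma1 X" unfolding sigma1_def by simp
  then show ?thesis using s by simp
qed

lemma rank_one_eigenvalue_le:
  fixes X :: "real Matrix.mat"
  assumes X: "X \<in> carrier_mat n n" and ab: "\<forall>i<n. \<forall>j<n. index_mat X (i, j) = a i * b j"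
    and e: "eigenvalue X e"
  shows "\<bar>e\<bar> \<le> sqrt (\<Sum>i<n. (a i)\<^sup>2) * sqrt (\<Sum>j<n. (b j)\<^sup>2)"
proof -
  obtain x where x: "x \<in> carrier_vec n" "x \<noteq> 0\<^sub>v n" "X *\<^sub>v x = e \<cdot>\<^sub>v x"
    using e X unfolding eigenvalue_def eigenvector_def by auto
  define \<beta> where "\<beta> = (\<Sum>j<n. b j * vec_index x j)"
  define N where "N = (\<Sum>j<n. (vec_index x j)\<^sup>2)"
  have N0: "N > 0"
  proof -
    have "\<exists>i<n. vec_index x i \<noteq> 0"
    proof (rule ccontr)
      assume "\<not> (\<exists>i<n. vec_index x i \<noteq> 0)"
      then have "x = 0\<^sub>v n" using x(1) by (intro eq_vecI) auto
      then show False using x(2) by simp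
    qed
    then obtain i where "i < n" "vec_index x i \<noteq> 0" by blast
    then show ?thesis unfolding N_def by (intro sum_pos2[of _ i]) auto
  qed
  have ev: "e * vec_index x i = a i * \<beta>" if i: "i < n" for i
  proof -
    have "vec_index (X *\<^sub>v x) i = (\<Sum>j<n. index_mat X (i, j) * vec_index x j)" by (rule mult_mat_vec_index_sum[OF X x(1) i])
    also have "\<dots> = a i * \<beta>" using i by (simp add: ab \<beta>_def sum_distrib_left mult.assoc)
    finally show ?thesis unfolding x(3) using i x(1) by simp
  qed
  have "e\<^sup>2 * N = (\<Sum>i<n. (e * vec_index x i)\<^sup>2)" by (simp add: N_def sum_distrib_left power_mult_distrib)
  also have "\<dots> = (\<Sum>i<n. (a i * \<beta>)\<^sup>2)" by (intro sum.cong refl) (simp add: ev)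
  also have "\<dots> = (\<Sum>i<n. (a i)\<^sup>2) * \<beta>\<^sup>2" by (simp add: sum_distrib_right power_mult_distrib)
  also have "\<dots> \<le> (\<Sum>i<n. (a i)\<^sup>2) * ((\<Sum>j<n. (b j)\<^sup>2) * N)"
    unfolding \<beta>_def N_def by (intro mult_left_mono Cauchy_Schwarz_ineq_sum sum_nonneg) simp
  finally have "e\<^sup>2 * N \<le> ((\<Sum>i<n. (a i)\<^sup>2) * (\<Sum>j<n. (b j)\<^sup>2)) * N" by (simp add: mult.assoc)
  then have "e\<^sup>2 \<le> (\<Sum>i<n. (a i)\<^sup>2) * (\<Sum>j<n. (b j)\<^sup>2)" using N0 by simp
  then have "sqrt (e\<^sup>2) \<le> sqrt ((\<Sum>i<n. (a i)\<^sup>2) * (\<Sum>j<n. (b j)\<^sup>2))" by (rule real_sqrt_le_mono)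
  then show ?thesis by (simp add: real_sqrt_mult)
qed

text \<open>For a vector \<open>v\<close> in the unit ball, testing the form with the normalized
  image of \<open>v\<close> gives the norm of that image. The bound also shows that the supremum is
  taken over a bounded set, which is needed before the zero vector can witness that it is
  nonnegative.\<close>

lemma op_norm_le:
  fixes A :: "real Matrix.mat"
  assumes A: "A \<in> carrier_mat n p"
    and le: "\<And>x y. (\<Sum>i<n. (x i)\<^sup>2) \<le> 1 \<Longrightarrow> (\<Sum>j<p. (y j)\<^sup>2) \<le> 1 \<Longrightarrow> \<bar>bilin n p (\<lambda>i j. index_mat A (i, j)) x y\<bar> \<le> c"
  shows "0 \<le> op_norm A" "op_norm A \<le> c"
proof -
  let ?U = "{x \<in> carrier_vec (dim_col A). vec_norm2 x \<le> 1}"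
  have c0: "0 \<le> c" using le[of "\<lambda>_. 0" "\<lambda>_. 0"] by (simp add: bilin_def)
  have bound: "vec_norm2 (A *\<^sub>v v) \<le> c" if v: "v \<in> ?U" for v
  proof -
    have vc: "v \<in> carrier_vec p" using v A by simp
    have v1: "(\<Sum>j<p. (vec_index v j)\<^sup>2) \<le> 1"
      using v vc by (simp add: vec_norm2_def)
    define z where "z = (\<lambda>i. vec_index (A *\<^sub>v v) i)"
    define N where "N = vec_norm2 (A *\<^sub>v v)"
    have N: "N = sqrt (\<Sum>i<n. (z i)\<^sup>2)" using A by (simp add: N_def vec_norm2_def z_def)
    have N2: "N\<^sup>2 = (\<Sum>i<n. (z i)\<^sup>2)" unfolding N by (simp add: sum_nonneg)
    have N0: "N \<ge> 0" unfolding N by (simp add: sum_nonneg)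
    show ?thesis
    proof (cases "N = 0")
      case True
      then show ?thesis using c0 by (simp add: N_def)
    next
      case False
      then have Np: "N > 0" using N0 by simp
      have x1: "(\<Sum>i<n. (z i / N)\<^sup>2) \<le> 1"
      proof -
        have "(\<Sum>i<n. (z i / N)\<^sup>2) = (\<Sum>i<n. (z i)\<^sup>2) / N\<^sup>2" by (simp add: power_divide sum_divide_distrib)
        then show ?thesis using N2 Np by simp
      qed
      have "bilin n p (\<lambda>i j. index_mat A (i, j)) (\<lambda>i. z i / N) (\<lambda>j. vec_index v j) = (\<Sum>i<n. z i / N * z i)"
        unfolding bilin_def
      proof (intro sum.cong refl)
        fix i assume "i \<in> {..<n}"
        then have "z i = (\<Sum>j<p. index_mat A (i, j) * vec_index v j)"
          unfolding z_def by (intro mult_mat_vec_index_sum[OF A vc]) simp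
        then show "(\<Sum>j<p. z i / N * index_mat A (i, j) * vec_index v j) = z i / N * z i"
          by (simp add: sum_distrib_left mult.assoc)
      qed
      also have "\<dots> = (\<Sum>i<n. (z i)\<^sup>2) / N" by (simp add: sum_divide_distrib power2_eq_square)
      also have "\<dots> = N" unfolding N2[symmetric] using Np by (simp add: power2_eq_square)
      finally have "bilin n p (\<lambda>i j. index_mat A (i, j)) (\<lambda>i. z i / N) (\<lambda>j. vec_index v j) = N" .
      with le[OF x1 v1] have "N \<le> c" by linarith
      then show ?thesis by (simp add: N_def)
    qed
  qed
  have z: "0\<^sub>v p \<in> ?U" using A by (simp add: vec_norm2_def)
  have zv: "vec_norm2 (A *\<^sub>v 0\<^sub>v p) = 0"
  proof -
    have "A *\<^sub>v 0\<^sub>v p = 0\<^sub>v n" using A by (intro eq_vecI) (simp_all add: scalar_prod_def)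
    then show ?thesis by (simp add: vec_norm2_def)
  qed
  show "op_norm A \<le> c" unfolding op_norm_def by (rule cSUP_least) (use z bound in auto)
  have "bdd_above ((\<lambda>v. vec_norm2 (A *\<^sub>v v)) ` ?U)" using bound by (intro bdd_aboveI2)
  from cSUP_upper[OF z this] show "0 \<le> op_norm A" unfolding op_norm_def zv .
qed

text \<open>The factor \<open>n ^ (L - 1)\<close> is the product of \<open>n powr (-1/2)\<close> and the \<open>L\<close>-th power of \<open>n powr (1 - 1/(2 L))\<close>.\<close>

lemma hadamard_norms_limit:
  fixes u v :: "nat \<Rightarrow> real Matrix.vec" and p :: "nat \<Rightarrow> nat"
  assumes dims: "\<And>n. n \<ge> 1 \<Longrightarrow> u n \<in> carrier_vec n" "\<And>n. n \<ge> 1 \<Longrightarrow> v n \<in> carrier_vec (p n)"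
    and p: "(\<lambda>n. real (p n) / real n) \<longlonglongrightarrow> \<gamma>" "\<gamma> > 0" and L: "L \<ge> 1"
    and mu: "(\<lambda>n. 1 / real n * lnorm_pow (2 * L) (sqrt (real n) \<cdot>\<^sub>v u n)) \<longlonglongrightarrow> \<alpha>"
    and mv: "(\<lambda>n. 1 / real (p n) * lnorm_pow (2 * L) (sqrt (real (p n)) \<cdot>\<^sub>v v n)) \<longlonglongrightarrow> \<beta>"
  shows "(\<lambda>n. real n ^ (L - 1) * (vec_norm2 (hadamard_power_vec L (u n)) * vec_norm2 (hadamard_power_vec L (v n))))
    \<longlonglongrightarrow> sqrt (\<alpha> * \<beta>) / \<gamma> powr ((real L - 1) / 2)"
proof -
  define a where "a = (\<lambda>n. 1 / real n * lnorm_pow (2 * L) (sqrt (real n) \<cdot>\<^sub>v u n))"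
  define b where "b = (\<lambda>n. 1 / real (p n) * lnorm_pow (2 * L) (sqrt (real (p n)) \<cdot>\<^sub>v v n))"
  have norm: "vec_norm2 (hadamard_power_vec L x) = sqrt (\<Sum>i<N. (vec_index x i) ^ (2 * L))"
    if "x \<in> carrier_vec N" for x N
    using that by (auto simp: vec_norm2_def hadamard_power_vec_def power_mult[symmetric] mult.commute)
  have lnorm: "lnorm_pow (2 * L) (sqrt (real N) \<cdot>\<^sub>v x) = real N ^ L * (\<Sum>i<N. (vec_index x i) ^ (2 * L))"
    if x: "x \<in> carrier_vec N" for x N
  proof -
    have "\<bar>sqrt (real N) * vec_index x i\<bar> ^ (2 * L) = real N ^ L * (vec_index x i) ^ (2 * L)" for i
    proof -
      have "\<bar>sqrt (real N) * vec_index x i\<bar> ^ (2 * L) = (\<bar>sqrt (real N) * vec_index x i\<bar>\<^sup>2) ^ L" by (simp only: power_mult)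
      also have "\<dots> = (real N * (vec_index x i)\<^sup>2) ^ L" by (simp add: power_mult_distrib)
      finally show ?thesis by (simp only: power_mult_distrib power_mult)
    qed
    then show ?thesis using x by (simp add: lnorm_pow_def sum_distrib_left)
  qed
  have "\<forall>\<^sub>F n in sequentially. real (p n) / real n > 0" by (rule order_tendstoD(1)[OF p])
  then have ev: "\<forall>\<^sub>F n in sequentially. sqrt (a n * b n / (real (p n) / real n) ^ (L - 1)) =
      real n ^ (L - 1) * (vec_norm2 (hadamard_power_vec L (u n)) * vec_norm2 (hadamard_power_vec L (v n)))"
    using eventually_ge_at_top[of 1]
  proof eventually_elim
    case (elim n)
    then have n: "real n > 0" and pn: "real (p n) > 0" by (auto simp: zero_less_divide_iff)
    define U where "U = (\<Sum>i<n. (vec_index (u n) i) ^ (2 * L))"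
    define V where "V = (\<Sum>i<p n. (vec_index (v n) i) ^ (2 * L))"
    have UV: "U \<ge> 0" "V \<ge> 0" by (simp_all add: U_def V_def sum_nonneg)
    obtain m where m: "L = Suc m" using L by (cases L) auto
    \<comment> \<open>The factors \<open>n ^ L / n\<close> and \<open>p ^ L / p\<close> leave
      \<open>(n * p) ^ (L - 1)\<close>; dividing by \<open>(p / n) ^ (L - 1)\<close> removes
      \<open>p\<close> and squares the power of \<open>n\<close>. The exponent of \<gamma> in the
      limit comes from this division.\<close>
    have "a n * b n / (real (p n) / real n) ^ (L - 1) = (real n ^ (L - 1))\<^sup>2 * (U * V)"
      unfolding a_def b_def lnorm[OF dims(1)[OF elim(2)]] lnorm[OF dims(2)[OF elim(2)]] U_def[symmetric] V_def[symmetric]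
      unfolding m using n pn by (simp add: power_divide field_simps power2_eq_square)
    then have "sqrt (a n * b n / (real (p n) / real n) ^ (L - 1)) = real n ^ (L - 1) * (sqrt U * sqrt V)"
      by (simp add: real_sqrt_mult)
    then show ?case unfolding norm[OF dims(1)[OF elim(2)]] norm[OF dims(2)[OF elim(2)]] U_def V_def .
  qed
  have "(\<lambda>n. sqrt (a n * b n / (real (p n) / real n) ^ (L - 1))) \<longlonglongrightarrow> sqrt (\<alpha> * \<beta> / \<gamma> ^ (L - 1))"
    unfolding a_def b_def using p(2) by (intro tendsto_intros mu mv p(1)) simp
  moreover have "sqrt (\<alpha> * \<beta> / \<gamma> ^ (L - 1)) = sqrt (\<alpha> * \<beta>) / \<gamma> powr ((real L - 1) / 2)"
  proof -
    have "\<gamma> ^ (L - 1) = \<gamma> powr (real L - 1)" using p(2) L by (simp add: of_nat_diff flip: powr_realpow)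
    also have "\<dots> = (\<gamma> powr ((real L - 1) / 2))\<^sup>2" by (simp add: power2_eq_square flip: powr_add)
    finally show ?thesis by (simp add: real_sqrt_divide)
  qed
  ultimately show ?thesis using tendsto_cong[OF ev] by simp
qed

section \<open>The noise and the signal\<close>

lemma abs_diff_power_le: "\<bar>a - c\<bar> ^ N \<le> 2 ^ N * (\<bar>a\<bar> ^ N + \<bar>c\<bar> ^ N)" for a c :: real
proof -
  have "\<bar>a - c\<bar> ^ N \<le> (2 * max \<bar>a\<bar> \<bar>c\<bar>) ^ N" by (intro power_mono) (auto simp: max_def)
  also have "\<dots> = 2 ^ N * (max \<bar>a\<bar> \<bar>c\<bar>) ^ N" by (simp add: power_mult_distrib)
  also have "(max \<bar>a\<bar> \<bar>c\<bar>) ^ N \<le> \<bar>a\<bar> ^ N + \<bar>c\<bar> ^ N" by (simp add: max_def)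
  finally show ?thesis by simp
qed

context smooth_density
begin

context
  fixes f :: "real \<Rightarrow> real"
  assumes f_bounded: "poly_bounded f" and f_cont: "AE x in lebesgue. isCont f x"
begin

abbreviation "gc \<equiv> continuous_part f"

lemma translate_integrable_\<mu>: "integrable \<mu> (\<lambda>x. gc (x + b))"
proof -
  have gb: "poly_bounded gc" by (rule g_bounded[OF f_bounded f_cont])
  obtain A k where T: "\<And>c m. c > 0 \<Longrightarrow> translation_setup gc (\<lambda>x. c * (1 + \<bar>x\<bar>) ^ m * w x) A k"
    by (rule translation[OF gb continuous_part_measurable]) blast
  interpret translation_setup gc "\<lambda>x. 1 * (1 + \<bar>x\<bar>) ^ 0 * w x" A k by (rule T) simp
  show ?thesis
  proof (rule integrable_le)
    show "integrable \<mu> (\<lambda>x. A * (1 + \<bar>b\<bar>) ^ k * (1 + \<bar>x\<bar>) ^ k)"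
      by (rule poly_bounded_integrable_\<mu>[OF poly_bounded_power_abs]) measurable
    show "\<bar>gc (x + b)\<bar> \<le> A * (1 + \<bar>b\<bar>) ^ k * (1 + \<bar>x\<bar>) ^ k" for x by (rule g_translate_bound)
  qed simp
qed

definition centred_difference :: "real \<Rightarrow> real \<Rightarrow> real" where
  "centred_difference b x = gc (x + b) - gc x - ((\<integral>x. gc (x + b) \<partial>\<mu>) - (\<integral>x. gc x \<partial>\<mu>))"

lemma centred_difference_measurable [measurable]: "centred_difference b \<in> borel_measurable borel"
  unfolding centred_difference_def by measurable

lemma centred_difference_eq:
  "centred_difference b x = (gc (x + b) - gc x) - (\<integral>x. gc (x + b) - gc x \<partial>\<mu>)"
  unfolding centred_difference_def
  using translate_integrable_\<mu>[of b] translate_integrable_\<mu>[of 0] by simp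

lemma centred_difference_mean: "(\<integral>x. centred_difference b x \<partial>\<mu>) = 0"
proof -
  interpret P: prob_space \<mu> by (rule prob)
  show ?thesis unfolding centred_difference_eq
    using translate_integrable_\<mu>[of b] translate_integrable_\<mu>[of 0] P.prob_space by simp
qed

lemma centred_difference_moments:
  "\<exists>C. \<forall>b. \<bar>b\<bar> \<le> 1 \<longrightarrow> integrable \<mu> (\<lambda>x. \<bar>centred_difference b x\<bar> ^ N) \<and> (\<integral>x. \<bar>centred_difference b x\<bar> ^ N \<partial>\<mu>) \<le> C"
proof -
  interpret P: prob_space \<mu> by (rule prob)
  obtain C where C: "\<forall>b. \<bar>b\<bar> \<le> 1 \<longrightarrow> integrable \<mu> (\<lambda>x. \<bar>gc (x + b) - gc x\<bar> ^ N) \<and> (\<integral>x. \<bar>gc (x + b) - gc x\<bar> ^ N \<partial>\<mu>) \<le> C"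
    using difference_moments[OF f_bounded f_cont, of N] by blast
  obtain C1 where C1: "\<forall>b. \<bar>b\<bar> \<le> 1 \<longrightarrow> integrable \<mu> (\<lambda>x. \<bar>gc (x + b) - gc x\<bar> ^ 1) \<and> (\<integral>x. \<bar>gc (x + b) - gc x\<bar> ^ 1 \<partial>\<mu>) \<le> C1"
    using difference_moments[OF f_bounded f_cont, of 1] by blast
  have "integrable \<mu> (\<lambda>x. \<bar>centred_difference b x\<bar> ^ N) \<and> (\<integral>x. \<bar>centred_difference b x\<bar> ^ N \<partial>\<mu>) \<le> 2 ^ N * (C + C1 ^ N)"
    if b: "\<bar>b\<bar> \<le> 1" for b
  proof -
    define d where "d = (\<lambda>x. gc (x + b) - gc x)"
    define m where "m = (\<integral>x. d x \<partial>\<mu>)"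
    have [measurable]: "d \<in> borel_measurable borel" unfolding d_def by measurable
    have iN: "integrable \<mu> (\<lambda>x. \<bar>d x\<bar> ^ N)" and leN: "(\<integral>x. \<bar>d x\<bar> ^ N \<partial>\<mu>) \<le> C"
      using C b by (simp_all add: d_def)
    have "\<bar>m\<bar> \<le> (\<integral>x. \<bar>d x\<bar> \<partial>\<mu>)" unfolding m_def by (rule integral_abs_bound)
    also have "\<dots> \<le> C1" using C1 b by (simp add: d_def)
    finally have m: "\<bar>m\<bar> ^ N \<le> C1 ^ N" by (intro power_mono) simp_all
    have eq: "centred_difference b x = d x - m" for x unfolding centred_difference_eq m_def d_def ..
    have i2: "integrable \<mu> (\<lambda>x. 2 ^ N * (\<bar>d x\<bar> ^ N + \<bar>m\<bar> ^ N))" using iN by simp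
    have i1: "integrable \<mu> (\<lambda>x. \<bar>d x - m\<bar> ^ N)"
    proof (rule integrable_le[OF i2])
      fix x
      have "0 \<le> \<bar>d x - m\<bar> ^ N" by simp
      then show "\<bar>\<bar>d x - m\<bar> ^ N\<bar> \<le> 2 ^ N * (\<bar>d x\<bar> ^ N + \<bar>m\<bar> ^ N)" using abs_diff_power_le[of "d x" m N] by linarith
    qed simp
    have "(\<integral>x. \<bar>d x - m\<bar> ^ N \<partial>\<mu>) \<le> (\<integral>x. 2 ^ N * (\<bar>d x\<bar> ^ N + \<bar>m\<bar> ^ N) \<partial>\<mu>)"
      by (rule integral_mono[OF i1 i2 abs_diff_power_le])
    also have "\<dots> = 2 ^ N * ((\<integral>x. \<bar>d x\<bar> ^ N \<partial>\<mu>) + \<bar>m\<bar> ^ N)" using iN P.prob_space by simp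
    also have "\<dots> \<le> 2 ^ N * (C + C1 ^ N)" using leN m by (intro mult_left_mono) simp_all
    finally show ?thesis unfolding eq using i1 by blast
  qed
  then show ?thesis by blast
qed

lemma centred_difference_variance:
  assumes "\<bar>b\<bar> \<le> 1"
  shows "(\<integral>x. (centred_difference b x)\<^sup>2 \<partial>\<mu>) \<le> (\<integral>x. (gc (x + b) - gc x)\<^sup>2 \<partial>\<mu>)"
proof -
  interpret P: prob_space \<mu> by (rule prob)
  have 1: "integrable \<mu> (\<lambda>x. gc (x + b) - gc x)"
    using translate_integrable_\<mu>[of b] translate_integrable_\<mu>[of 0] by simp
  have "integrable \<mu> (\<lambda>x. \<bar>gc (x + b) - gc x\<bar> ^ 2)"
    using difference_moments[OF f_bounded f_cont, of 2] assms by blast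
  then have 2: "integrable \<mu> (\<lambda>x. (gc (x + b) - gc x)\<^sup>2)" by simp
  show ?thesis unfolding centred_difference_eq P.variance_eq[OF 1 2] by simp
qed

text \<open>The index map \<open>h\<close> serves the symmetric setting: there the strictly lower triangular entries are the
  transposed upper ones, and the two triangles are treated separately to have independent entries.\<close>

lemma noise_difference_small:
  fixes N :: "'a measure" and \<zeta> :: "nat \<Rightarrow> nat \<times> nat \<Rightarrow> 'a \<Rightarrow> real" and p :: "nat \<Rightarrow> nat"
  assumes N: "prob_space N" and p: "(\<lambda>n. real (p n) / real n) \<longlonglongrightarrow> \<gamma>" "\<gamma> > 0"
    and iid: "\<And>n. n \<ge> 1 \<Longrightarrow> iid_with_law N \<mu> (I n) (\<zeta> n)"
    and h: "\<And>n. n \<ge> 1 \<Longrightarrow> inj_on h (J n)" "\<And>n. n \<ge> 1 \<Longrightarrow> h ` J n \<subseteq> I n"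
    and B: "\<And>\<delta>. \<delta> > 0 \<Longrightarrow> \<forall>\<^sub>F n in sequentially. \<forall>i<n. \<forall>j<p n. \<bar>B n i j\<bar> < \<delta>"
  shows "AE \<omega> in N. \<forall>\<epsilon>>0. \<forall>\<^sub>F n in sequentially. \<forall>x y. (\<Sum>i<n. (x i)\<^sup>2) \<le> 1 \<longrightarrow> (\<Sum>j<p n. (y j)\<^sup>2) \<le> 1 \<longrightarrow>
      \<bar>bilin n (p n) (\<lambda>i j. if (i, j) \<in> J n then centred_difference (B n i j) (\<zeta> n (h (i, j)) \<omega>) else 0) x y\<bar> \<le> \<epsilon> * sqrt n"
proof -
  interpret N: prob_space N by (rule N)
  obtain C0 where C0: "\<forall>b. \<bar>b\<bar> \<le> 1 \<longrightarrow> integrable \<mu> (\<lambda>x. \<bar>centred_difference b x\<bar> ^ 80) \<and> (\<integral>x. \<bar>centred_difference b x\<bar> ^ 80 \<partial>\<mu>) \<le> C0"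
    using centred_difference_moments[of 80] by blast
  \<comment> \<open>The maximum with 0 covers the entries outside \<open>J n\<close>, which are
    identically zero.\<close>
  define C where "C = max 0 C0"
  have ind: "N.indep_vars (\<lambda>_. borel) (\<zeta> n) (I n)" if "n \<ge> 1" for n
    using iid[OF that] by (simp add: iid_with_law_def)
  have law: "distr N borel (\<zeta> n k) = \<mu>" and rv: "\<zeta> n k \<in> borel_measurable N" if "n \<ge> 1" "k \<in> I n" for n k
    using iid[OF that(1)] that(2) by (auto simp: iid_with_law_def N.indep_vars_def2)
  have tr: "(\<integral>\<omega>. F (\<zeta> n k \<omega>) \<partial>N) = (\<integral>x. F x \<partial>\<mu>)" "integrable N (\<lambda>\<omega>. F (\<zeta> n k \<omega>)) \<longleftrightarrow> integrable \<mu> F"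
    if "n \<ge> 1" "k \<in> I n" and F: "F \<in> borel_measurable borel" for F :: "real \<Rightarrow> real" and n k
    unfolding law[OF that(1,2), symmetric] using integral_distr[OF rv[OF that(1,2)] F] integrable_distr_eq[OF rv[OF that(1,2)] F] by simp_all
  have hI: "h ij \<in> I n" if "n \<ge> 1" "ij \<in> J n" for n ij using h(2)[OF that(1)] that(2) by blast
  let ?W = "\<lambda>n i j \<omega>. if (i, j) \<in> J n then centred_difference (B n i j) (\<zeta> n (h (i, j)) \<omega>) else 0"
  have small: "\<forall>\<^sub>F n in sequentially. n \<ge> 1 \<and> (\<forall>i<n. \<forall>j<p n. \<bar>B n i j\<bar> < \<delta>)" if "\<delta> > 0" for \<delta>
    using eventually_ge_at_top[of 1] B[OF that] by eventually_elim blast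
  show ?thesis
  proof (rule N.bilin_small_AE[OF p, where W = ?W and C = C])
    fix n :: nat assume n: "n \<ge> 1"
    have "N.indep_vars (\<lambda>_. borel) (\<lambda>ij \<omega>. if ij \<in> J n then centred_difference (B n (fst ij) (snd ij)) (\<zeta> n (h ij) \<omega>) else 0) ({..<n} \<times> {..<p n})"
      by (rule N.indep_vars_reindex_zero[OF ind[OF n] h(1)[OF n] h(2)[OF n] centred_difference_measurable])
    then show "N.indep_vars (\<lambda>_. borel) (\<lambda>ij. ?W n (fst ij) (snd ij)) ({..<n} \<times> {..<p n})" by (simp only: prod.collapse)
    fix i j assume "i < n" "j < p n"
    show "N.expectation (?W n i j) = 0"
    proof (cases "(i, j) \<in> J n")
      case True
      then show ?thesis
        using tr(1)[OF n hI[OF n True] centred_difference_measurable, of "B n i j"] centred_difference_mean[of "B n i j"] by simp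
    qed simp
  next
    show "\<forall>\<^sub>F n in sequentially. \<forall>i<n. \<forall>j<p n. integrable N (\<lambda>\<omega>. \<bar>?W n i j \<omega>\<bar> ^ 80) \<and> N.expectation (\<lambda>\<omega>. \<bar>?W n i j \<omega>\<bar> ^ 80) \<le> C"
      using small[of 1, simplified]
    proof (rule eventually_mono, intro allI impI)
      fix n i j assume n: "Suc 0 \<le> n \<and> (\<forall>i<n. \<forall>j<p n. \<bar>B n i j\<bar> < 1)" and ij: "i < n" "j < p n"
      then have b: "\<bar>B n i j\<bar> \<le> 1" and n1: "n \<ge> 1" by (auto intro: less_imp_le)
      show "integrable N (\<lambda>\<omega>. \<bar>?W n i j \<omega>\<bar> ^ 80) \<and> N.expectation (\<lambda>\<omega>. \<bar>?W n i j \<omega>\<bar> ^ 80) \<le> C"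
      proof (cases "(i, j) \<in> J n")
        case True
        have m: "(\<lambda>x. \<bar>centred_difference (B n i j) x\<bar> ^ 80) \<in> borel_measurable borel" by measurable
        show ?thesis using tr[OF n1 hI[OF n1 True] m] C0 b True by (auto simp: C_def)
      qed (simp add: C_def)
    qed
  next
    fix \<epsilon> :: real assume \<epsilon>: "\<epsilon> > 0"
    obtain \<delta> where \<delta>: "\<delta> > 0" "\<And>b. \<bar>b\<bar> \<le> \<delta> \<Longrightarrow> (\<integral>x. (gc (x + b) - gc x)\<^sup>2 \<partial>\<mu>) \<le> \<epsilon>"
      by (rule difference_second_moment[OF f_bounded f_cont \<epsilon>]) (rule that, assumption, blast)
    have "min 1 \<delta> > 0" using \<delta>(1) by simp
    from small[OF this]
    show "\<forall>\<^sub>F n in sequentially. \<forall>i<n. \<forall>j<p n. N.expectation (\<lambda>\<omega>. (?W n i j \<omega>)\<^sup>2) \<le> \<epsilon>"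
    proof (rule eventually_mono, intro allI impI)
      fix n i j assume n: "n \<ge> 1 \<and> (\<forall>i<n. \<forall>j<p n. \<bar>B n i j\<bar> < min 1 \<delta>)" and ij: "i < n" "j < p n"
      then have b: "\<bar>B n i j\<bar> < min 1 \<delta>" by blast
      then have b: "\<bar>B n i j\<bar> \<le> 1" "\<bar>B n i j\<bar> \<le> \<delta>" and n1: "n \<ge> 1" using n by simp_all
      show "N.expectation (\<lambda>\<omega>. (?W n i j \<omega>)\<^sup>2) \<le> \<epsilon>"
      proof (cases "(i, j) \<in> J n")
        case True
        have m: "(\<lambda>x. (centred_difference (B n i j) x)\<^sup>2) \<in> borel_measurable borel" by measurable
        show ?thesis
          using tr(1)[OF n1 hI[OF n1 True] m] centred_difference_variance[OF b(1)] \<delta>(2)[OF b(2)] True by simp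
      qed (use \<epsilon> in simp)
    qed
  qed
qed

end

end

section \<open>The mean part: from entrywise errors to the operator norm\<close>

lemma bilin_linear:
  assumes "\<And>i j. i < n \<Longrightarrow> j < p \<Longrightarrow> W i j = c * (W1 i j + W2 i j)"
  shows "bilin n p W x y = c * (bilin n p W1 x y + bilin n p W2 x y)"
proof -
  have "bilin n p W x y = (\<Sum>i<n. \<Sum>j<p. c * (x i * W1 i j * y j + x i * W2 i j * y j))"
    unfolding bilin_def by (intro sum.cong refl) (simp add: assms algebra_simps)
  then show ?thesis by (simp add: bilin_def sum.distrib sum_distrib_left distrib_left)
qed

text \<open>Absolute values are taken everywhere and Cauchy-Schwarz is applied to each factor.
  Nothing is lost against a majorant of rank one, so an entrywise relative error of the signal
  becomes the same relative error of its norm.\<close>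

lemma bilin_le_norms:
  assumes W: "\<And>i j. i < n \<Longrightarrow> j < p \<Longrightarrow> \<bar>W i j\<bar> \<le> \<bar>a i\<bar> * \<bar>b j\<bar>"
    and x: "(\<Sum>i<n. (x i)\<^sup>2) \<le> 1" and y: "(\<Sum>j<p. (y j)\<^sup>2) \<le> 1"
  shows "\<bar>bilin n p W x y\<bar> \<le> sqrt (\<Sum>i<n. (a i)\<^sup>2) * sqrt (\<Sum>j<p. (b j)\<^sup>2)"
proof -
  have "\<bar>bilin n p W x y\<bar> \<le> (\<Sum>i<n. \<bar>\<Sum>j<p. x i * W i j * y j\<bar>)" unfolding bilin_def by (rule sum_abs)
  also have "\<dots> \<le> (\<Sum>i<n. \<Sum>j<p. \<bar>x i * W i j * y j\<bar>)" by (intro sum_mono sum_abs)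
  also have "\<dots> \<le> (\<Sum>i<n. \<Sum>j<p. (\<bar>x i\<bar> * \<bar>a i\<bar>) * (\<bar>b j\<bar> * \<bar>y j\<bar>))"
  proof (intro sum_mono)
    fix i j assume "i \<in> {..<n}" "j \<in> {..<p}"
    then have "\<bar>W i j\<bar> \<le> \<bar>a i\<bar> * \<bar>b j\<bar>" by (intro W) simp_all
    then have "\<bar>x i\<bar> * \<bar>W i j\<bar> * \<bar>y j\<bar> \<le> \<bar>x i\<bar> * (\<bar>a i\<bar> * \<bar>b j\<bar>) * \<bar>y j\<bar>"
      by (intro mult_right_mono mult_left_mono) simp_all
    then show "\<bar>x i * W i j * y j\<bar> \<le> (\<bar>x i\<bar> * \<bar>a i\<bar>) * (\<bar>b j\<bar> * \<bar>y j\<bar>)" by (simp add: abs_mult mult.assoc)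
  qed
  also have "\<dots> = (\<Sum>i<n. \<bar>x i\<bar> * \<bar>a i\<bar>) * (\<Sum>j<p. \<bar>b j\<bar> * \<bar>y j\<bar>)" by (rule sum_product[symmetric])
  also have "\<dots> \<le> (L2_set x {..<n} * L2_set a {..<n}) * (L2_set b {..<p} * L2_set y {..<p})"
    by (intro mult_mono L2_set_mult_ineq mult_nonneg_nonneg L2_set_nonneg sum_nonneg) simp_all
  also have "\<dots> \<le> (1 * L2_set a {..<n}) * (L2_set b {..<p} * 1)"
    by (intro mult_mono mult_nonneg_nonneg L2_set_nonneg order_refl) (use x y in \<open>simp_all add: L2_set_def sum_nonneg\<close>)
  finally show ?thesis by (simp add: L2_set_def)
qed

text \<open>Two errors are separated: \<open>W1\<close> is the error of the Taylor expansion, small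
  relative to the power \<open>B ^ L\<close>, and \<open>W2\<close> comes from replacing the product
  of the norms, rescaled by \<open>n ^ (L - 1)\<close>, by its limit \<open>\<rho>\<close>.\<close>

lemma mean_part_small:
  fixes U V :: "nat \<Rightarrow> nat \<Rightarrow> real" and h :: "real \<Rightarrow> real" and p :: "nat \<Rightarrow> nat"
  assumes L: "L \<ge> 1"
    and B: "\<And>n i j. n \<ge> 1 \<Longrightarrow> i < n \<Longrightarrow> j < p n \<Longrightarrow> B n i j = real n powr (1 - 1 / (2 * real L)) * (s n * U n i * V n j)"
    and B0: "\<And>\<delta>. \<delta> > 0 \<Longrightarrow> \<forall>\<^sub>F n in sequentially. \<forall>i<n. \<forall>j<p n. \<bar>B n i j\<bar> < \<delta>"
    and s: "\<And>n. n \<ge> 1 \<Longrightarrow> 0 \<le> s n" "\<And>n. n \<ge> 1 \<Longrightarrow> s n \<le> S"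
    and h: "\<And>\<epsilon>. \<epsilon> > 0 \<Longrightarrow> \<exists>\<delta>>0. \<forall>b. \<bar>b\<bar> \<le> \<delta> \<longrightarrow> \<bar>h b - c * b ^ L\<bar> \<le> \<epsilon> * \<bar>b\<bar> ^ L"
    and R: "(\<lambda>n. real n ^ (L - 1) * (\<alpha> n * \<beta> n)) \<longlonglongrightarrow> \<rho>"
    and \<alpha>: "\<And>n. n \<ge> 1 \<Longrightarrow> \<alpha> n = sqrt (\<Sum>i<n. (U n i ^ L)\<^sup>2)"
    and \<beta>: "\<And>n. n \<ge> 1 \<Longrightarrow> \<beta> n = sqrt (\<Sum>j<p n. (V n j ^ L)\<^sup>2)"
    and \<epsilon>: "\<epsilon> > 0"
  shows "\<forall>\<^sub>F n in sequentially. \<forall>x y. (\<Sum>i<n. (x i)\<^sup>2) \<le> 1 \<longrightarrow> (\<Sum>j<p n. (y j)\<^sup>2) \<le> 1 \<longrightarrow>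
    \<bar>bilin n (p n) (\<lambda>i j. h (B n i j) - sqrt n * (c * \<rho> * s n ^ L) * (U n i ^ L / \<alpha> n * (V n j ^ L / \<beta> n))) x y\<bar> \<le> \<epsilon> * sqrt n"
proof -
  define R' where "R' = (\<lambda>n. real n ^ (L - 1) * (\<alpha> n * \<beta> n))"
  have R': "R' \<longlonglongrightarrow> \<rho>" using R unfolding R'_def .
  have "S \<ge> 0" using s[of 1] by simp
  have \<rho>: "\<rho> \<ge> 0"
  proof (rule tendsto_lowerbound[OF R'])
    show "\<forall>\<^sub>F n in sequentially. 0 \<le> R' n" using eventually_ge_at_top[of 1]
      by eventually_elim (simp add: R'_def \<alpha> \<beta> sum_nonneg)
  qed simp
  \<comment> \<open>\<open>Q\<close> bounds \<open>s n ^ L\<close> times the rescaled product of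
    norms, which is eventually below \<open>\<rho> + 1\<close>; the last summand 1 makes it
    positive, so that \<epsilon> can be divided by it.\<close>
  define Q where "Q = S ^ L * (\<rho> + 1) + 1"
  have Q: "Q > 0" unfolding Q_def using \<open>S \<ge> 0\<close> \<rho> by (intro add_nonneg_pos mult_nonneg_nonneg) simp_all
  define e where "e = \<epsilon> / (2 * Q)"
  have e: "e > 0" using \<epsilon> Q by (simp add: e_def)
  obtain \<delta> where \<delta>: "\<delta> > 0" "\<And>b. \<bar>b\<bar> \<le> \<delta> \<Longrightarrow> \<bar>h b - c * b ^ L\<bar> \<le> e * \<bar>b\<bar> ^ L" using h[OF e] by blast
  have "(\<lambda>n. \<bar>c\<bar> * S ^ L * \<bar>R' n - \<rho>\<bar>) \<longlonglongrightarrow> \<bar>c\<bar> * S ^ L * \<bar>\<rho> - \<rho>\<bar>" by (intro tendsto_intros R')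
  then have "\<forall>\<^sub>F n in sequentially. \<bar>c\<bar> * S ^ L * \<bar>R' n - \<rho>\<bar> < \<epsilon> / 2"
    by (rule order_tendstoD) (use \<epsilon> in simp)
  moreover have "\<forall>\<^sub>F n in sequentially. R' n < \<rho> + 1" by (rule order_tendstoD[OF R']) simp
  ultimately show ?thesis using B0[OF \<delta>(1)] eventually_ge_at_top[of 1]
  proof eventually_elim
    case (elim n)
    have n: "n \<ge> 1" by (rule elim(4))
    have sn: "0 \<le> s n ^ L" "s n ^ L \<le> S ^ L" using s[OF n] by (auto intro: power_mono)
    have R0: "R' n \<ge> 0" using n by (simp add: R'_def \<alpha> \<beta> sum_nonneg)
    \<comment> \<open>If the norm is zero, then so is every power \<open>U n i ^ L\<close>, and the
      value 0 of a division by zero is the correct one.\<close>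
    have aU: "\<alpha> n * (U n i ^ L / \<alpha> n) = U n i ^ L" if i: "i < n" for i
    proof (cases "\<alpha> n = 0")
      case True
      then have "(\<Sum>i<n. (U n i ^ L)\<^sup>2) = 0" using \<alpha>[OF n] by simp
      then have "(U n i ^ L)\<^sup>2 = 0" using i by (subst (asm) sum_nonneg_eq_0_iff) simp_all
      then show ?thesis using True by simp
    qed simp
    have bV: "\<beta> n * (V n j ^ L / \<beta> n) = V n j ^ L" if j: "j < p n" for j
    proof (cases "\<beta> n = 0")
      case True
      then have "(\<Sum>j<p n. (V n j ^ L)\<^sup>2) = 0" using \<beta>[OF n] by simp
      then have "(V n j ^ L)\<^sup>2 = 0" using j by (subst (asm) sum_nonneg_eq_0_iff) simp_all
      then show ?thesis using True by simp
    qed simp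
    \<comment> \<open>The exponent \<open>1 - 1 / (2 * L)\<close> times \<open>L\<close> is
      \<open>(L - 1) + 1 / 2\<close>: the half power is the \<open>sqrt n\<close> of the
      normalization, and the rest is the growth that compensates the small norms of the Hadamard
      powers.\<close>
    have BL: "B n i j ^ L = sqrt n * (real n ^ (L - 1) * s n ^ L) * (U n i ^ L * V n j ^ L)"
      if "i < n" "j < p n" for i j
    proof -
      have "(real n powr (1 - 1 / (2 * real L))) ^ L = real n powr ((1 - 1 / (2 * real L)) * real L)"
        using n by (simp add: powr_powr flip: powr_realpow)
      also have "(1 - 1 / (2 * real L)) * real L = real (L - 1) + 1 / 2" using L by (simp add: field_simps of_nat_diff)
      also have "real n powr \<dots> = real n ^ (L - 1) * sqrt n"
        using n by (simp add: powr_add powr_realpow powr_half_sqrt)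
      finally show ?thesis unfolding B[OF n that] by (simp add: power_mult_distrib mult_ac)
    qed
    define t where "t = sqrt n * (real n ^ (L - 1) * s n ^ L)"
    have t: "t \<ge> 0" using sn by (simp add: t_def)
    define W1 where "W1 = (\<lambda>i j. h (B n i j) - c * B n i j ^ L)"
    define W2 where "W2 = (\<lambda>i j. sqrt n * (c * s n ^ L * (R' n - \<rho>)) * (U n i ^ L / \<alpha> n * (V n j ^ L / \<beta> n)))"
    show ?case
    proof (intro allI impI)
      fix x y :: "nat \<Rightarrow> real"
      assume x: "(\<Sum>i<n. (x i)\<^sup>2) \<le> 1" and y: "(\<Sum>j<p n. (y j)\<^sup>2) \<le> 1"
      have "bilin n (p n) (\<lambda>i j. h (B n i j) - sqrt n * (c * \<rho> * s n ^ L) * (U n i ^ L / \<alpha> n * (V n j ^ L / \<beta> n))) x y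
          = 1 * (bilin n (p n) W1 x y + bilin n (p n) W2 x y)"
      proof (rule bilin_linear)
        fix i j assume ij: "i < n" "j < p n"
        have "U n i ^ L * V n j ^ L = (\<alpha> n * \<beta> n) * (U n i ^ L / \<alpha> n * (V n j ^ L / \<beta> n))"
          by (subst aU[OF ij(1), symmetric], subst bV[OF ij(2), symmetric]) (simp only: mult_ac)
        then have "B n i j ^ L = sqrt n * s n ^ L * R' n * (U n i ^ L / \<alpha> n * (V n j ^ L / \<beta> n))"
          unfolding BL[OF ij] R'_def by (simp only: mult_ac)
        then show "h (B n i j) - sqrt n * (c * \<rho> * s n ^ L) * (U n i ^ L / \<alpha> n * (V n j ^ L / \<beta> n)) = 1 * (W1 i j + W2 i j)"
          unfolding W1_def W2_def by (simp only:) (simp add: algebra_simps)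
      qed
      moreover have "\<bar>bilin n (p n) W1 x y\<bar> \<le> \<epsilon> / 2 * sqrt n"
      proof -
        have "\<bar>bilin n (p n) W1 x y\<bar> \<le> sqrt (\<Sum>i<n. (e * t * U n i ^ L)\<^sup>2) * sqrt (\<Sum>j<p n. (V n j ^ L)\<^sup>2)"
        proof (rule bilin_le_norms[OF _ x y])
          fix i j assume ij: "i < n" "j < p n"
          have "\<bar>B n i j\<bar> \<le> \<delta>" using elim(3) ij by (auto intro: less_imp_le)
          from \<delta>(2)[OF this] have "\<bar>W1 i j\<bar> \<le> e * \<bar>B n i j ^ L\<bar>" by (simp add: W1_def power_abs)
          also have "\<dots> = \<bar>e * t * U n i ^ L\<bar> * \<bar>V n j ^ L\<bar>"
            unfolding BL[OF ij] t_def[symmetric] using e by (simp add: abs_mult)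
          finally show "\<bar>W1 i j\<bar> \<le> \<bar>e * t * U n i ^ L\<bar> * \<bar>V n j ^ L\<bar>" .
        qed
        also have "(\<Sum>i<n. (e * t * U n i ^ L)\<^sup>2) = (e * t)\<^sup>2 * (\<Sum>i<n. (U n i ^ L)\<^sup>2)"
          by (simp only: power_mult_distrib sum_distrib_left)
        also have "sqrt \<dots> = (e * t) * \<alpha> n" using e t by (simp add: real_sqrt_mult \<alpha>[OF n])
        also have "(e * t) * \<alpha> n * sqrt (\<Sum>j<p n. (V n j ^ L)\<^sup>2) = e * (s n ^ L * R' n) * sqrt n"
          unfolding \<beta>[OF n, symmetric] t_def R'_def by (simp only: mult_ac)
        also have "\<dots> \<le> e * Q * sqrt n"
        proof (intro mult_right_mono mult_left_mono)
          have "s n ^ L * R' n \<le> S ^ L * (\<rho> + 1)" using sn R0 elim(2) \<open>S \<ge> 0\<close> by (intro mult_mono) simp_all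
          then show "s n ^ L * R' n \<le> Q" by (simp add: Q_def)
        qed (use e in simp_all)
        also have "e * Q = \<epsilon> / 2" using Q by (simp add: e_def)
        finally show ?thesis .
      qed
      moreover have "\<bar>bilin n (p n) W2 x y\<bar> \<le> \<epsilon> / 2 * sqrt n"
      proof -
        define k where "k = sqrt n * (c * s n ^ L * (R' n - \<rho>))"
        \<comment> \<open>An inequality, because division by a vanishing norm gives the zero vector
          instead of a unit vector.\<close>
        have unit: "sqrt (\<Sum>i<N. (a i / A)\<^sup>2) \<le> 1" if "A = sqrt (\<Sum>i<N. (a i)\<^sup>2)" for a :: "nat \<Rightarrow> real" and A N
        proof -
          have "(\<Sum>i<N. (a i / A)\<^sup>2) = (\<Sum>i<N. (a i)\<^sup>2) / A\<^sup>2" by (simp add: power_divide sum_divide_distrib)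
          also have "A\<^sup>2 = (\<Sum>i<N. (a i)\<^sup>2)" by (simp add: that sum_nonneg)
          finally show ?thesis by (simp add: divide_self_if)
        qed
        have "\<bar>bilin n (p n) W2 x y\<bar> \<le> sqrt (\<Sum>i<n. (k * (U n i ^ L / \<alpha> n))\<^sup>2) * sqrt (\<Sum>j<p n. (V n j ^ L / \<beta> n)\<^sup>2)"
          by (rule bilin_le_norms[OF _ x y]) (simp add: W2_def k_def abs_mult)
        also have "(\<Sum>i<n. (k * (U n i ^ L / \<alpha> n))\<^sup>2) = k\<^sup>2 * (\<Sum>i<n. (U n i ^ L / \<alpha> n)\<^sup>2)"
          by (simp only: power_mult_distrib sum_distrib_left)
        also have "sqrt \<dots> = \<bar>k\<bar> * sqrt (\<Sum>i<n. (U n i ^ L / \<alpha> n)\<^sup>2)" by (simp add: real_sqrt_mult)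
        also have "\<dots> * sqrt (\<Sum>j<p n. (V n j ^ L / \<beta> n)\<^sup>2) \<le> \<bar>k\<bar> * 1 * 1"
          by (intro mult_mono order_refl unit \<alpha> \<beta> n mult_nonneg_nonneg) (simp_all add: sum_nonneg)
        also have "\<bar>k\<bar> * 1 * 1 = \<bar>c\<bar> * s n ^ L * \<bar>R' n - \<rho>\<bar> * sqrt n" using sn by (simp add: k_def abs_mult)
        also have "\<dots> \<le> \<bar>c\<bar> * S ^ L * \<bar>R' n - \<rho>\<bar> * sqrt n" using sn by (intro mult_right_mono mult_left_mono) simp_all
        also have "\<dots> \<le> \<epsilon> / 2 * sqrt n" using elim(1) by (intro mult_right_mono) simp_all
        finally show ?thesis .
      qed
      ultimately show "\<bar>bilin n (p n) (\<lambda>i j. h (B n i j) - sqrt n * (c * \<rho> * s n ^ L) * (U n i ^ L / \<alpha> n * (V n j ^ L / \<beta> n))) x y\<bar> \<le> \<epsilon> * sqrt n"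
        by (simp add: field_simps)
    qed
  qed
qed

text \<open>\<open>X\<close> exchanges \<open>u\<close> and \<open>v\<close> up to the factor
  \<open>s\<close>, so \<open>u + v\<close> is an eigenvector for \<open>s\<close> unless it
  vanishes; in that case \<open>v = - u\<close>, and \<open>u\<close> is an eigenvector for
  \<open>- s\<close>.\<close>

lemma symmetric_singular_value_eigenvalue:
  fixes X :: "real Matrix.mat"
  assumes X: "X \<in> carrier_mat n n" "transpose_mat X = X" and tr: "singular_triple X s u v"
  shows "eigenvalue X s \<or> eigenvalue X (- s)"
proof -
  have u: "u \<in> carrier_vec n" and v: "v \<in> carrier_vec n" and Xv: "X *\<^sub>v v = s \<cdot>\<^sub>v u" and Xu: "X *\<^sub>v u = s \<cdot>\<^sub>v v"
    and u1: "vec_norm2 u = 1"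
    using tr X by (auto simp: singular_triple_def)
  have dim: "dim_row X = n" using X by simp
  show ?thesis
  proof (cases "u + v = 0\<^sub>v n")
    case False
    have "X *\<^sub>v (u + v) = s \<cdot>\<^sub>v v + s \<cdot>\<^sub>v u"
      using mult_add_distrib_mat_vec[OF X(1) u v] Xu Xv by simp
    also have "\<dots> = s \<cdot>\<^sub>v (u + v)" using u v by (intro eq_vecI) (auto simp: algebra_simps)
    finally have "eigenvector X (u + v) s" unfolding eigenvector_def dim using u v False by simp
    then show ?thesis unfolding eigenvalue_def by blast
  next
    case True
    have neg: "vec_index v i = - vec_index u i" if "i < n" for i
    proof -
      have "vec_index (u + v) i = 0" using True that by simp
      then show ?thesis using u v that by simp
    qed
    have "X *\<^sub>v u = (- s) \<cdot>\<^sub>v u" unfolding Xu using u v neg by (intro eq_vecI) auto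
    moreover have "u \<noteq> 0\<^sub>v n" using u1 by (auto simp: vec_norm2_def)
    ultimately have "eigenvector X u (- s)" unfolding eigenvector_def dim using u by simp
    then show ?thesis unfolding eigenvalue_def by blast
  qed
qed

section \<open>Common consequences of the asymmetric and the symmetric setting\<close>

context
  fixes M :: "'a measure" and \<mu> :: "real measure" and p :: "nat \<Rightarrow> nat" and \<gamma> :: real
    and X :: "nat \<Rightarrow> real Matrix.mat" and Z :: "nat \<Rightarrow> 'a \<Rightarrow> real Matrix.mat"
  assumes setting: "asymmetric_setting M \<mu> p \<gamma> X Z \<or> symmetric_setting M \<mu> p \<gamma> X Z"
begin

lemma setting_ratio: "(\<lambda>n. real (p n) / real n) \<longlonglongrightarrow> \<gamma>" "\<gamma> > 0"
proof -
  have "(\<lambda>n. real (p n) / real n) \<longlonglongrightarrow> \<gamma> \<and> \<gamma> > 0"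
    using setting
  proof
    assume S: "symmetric_setting M \<mu> p \<gamma> X Z"
    have "\<forall>\<^sub>F n in sequentially. real (p n) / real n = 1"
      using eventually_ge_at_top[of 1] by eventually_elim (use S in \<open>simp add: symmetric_setting_def\<close>)
    then have "(\<lambda>n. real (p n) / real n) \<longlonglongrightarrow> 1" by (rule tendsto_eventually)
    then show ?thesis using S by (simp add: symmetric_setting_def)
  qed (simp add: asymmetric_setting_def)
  then show "(\<lambda>n. real (p n) / real n) \<longlonglongrightarrow> \<gamma>" "\<gamma> > 0" by simp_all
qed

lemma setting_carriers:
  assumes "n \<ge> 1"
  shows "X n \<in> carrier_mat n (p n)" and "\<omega> \<in> space M \<Longrightarrow> Z n \<omega> \<in> carrier_mat n (p n)"
  using setting assms by (auto simp: asymmetric_setting_def symmetric_setting_def)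

text \<open>The nonzero singular values, or eigenvalues, form the same set for all \<open>n\<close>,
  so each \<open>s n\<close> is compared with the single matrix \<open>X 1\<close>, whose spectrum
  is bounded by the norms of its two factors. In the symmetric setting \<open>s n\<close> is first
  matched with an eigenvalue of the same absolute value.\<close>

lemma setting_singular_value_bound:
  assumes tr: "\<And>n. n \<ge> 1 \<Longrightarrow> singular_triple (X n) (s n) (u n) (v n)"
    and pos: "\<And>n. n \<ge> 1 \<Longrightarrow> s n > 0" and rank: "mat_rank (X 1) = 1"
  obtains S where "\<And>n. n \<ge> 1 \<Longrightarrow> s n \<le> S"
proof -
  have X1: "X 1 \<in> carrier_mat 1 (p 1)" by (rule setting_carriers) simp
  obtain a b where ab: "\<forall>i<1. \<forall>j<p 1. index_mat (X 1) (i, j) = a i * b j"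
    by (rule rank_one_factorization[OF X1 rank]) blast
  define S where "S = sqrt (\<Sum>i<1. (a i)\<^sup>2) * sqrt (\<Sum>j<p 1. (b j)\<^sup>2)"
  have "s n \<le> S" if n: "n \<ge> 1" for n
    using setting
  proof
    assume A: "asymmetric_setting M \<mu> p \<gamma> X Z"
    then obtain S0 where S0: "\<And>n. n \<ge> 1 \<Longrightarrow> singular_values (X n) - {0} = S0" unfolding asymmetric_setting_def by blast
    have "s n \<in> singular_values (X n) - {0}" using tr[OF n] pos[OF n] by (auto simp: singular_values_def)
    then have "s n \<in> singular_values (X 1) - {0}" unfolding S0[OF n] using S0[of 1] by simp
    then obtain u' v' where "singular_triple (X 1) (s n) u' v'" by (auto simp: singular_values_def)
    from rank_one_singular_value(1)[OF X1 ab this pos[OF n]] show ?thesis by (simp add: S_def)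
  next
    assume A: "symmetric_setting M \<mu> p \<gamma> X Z"
    then obtain S0 where S0: "\<And>n. n \<ge> 1 \<Longrightarrow> {e. eigenvalue (X n) e} - {0} = S0" unfolding symmetric_setting_def by blast
    have p1: "p 1 = 1" using A unfolding symmetric_setting_def by blast
    have Xn: "X n \<in> carrier_mat n n" "transpose_mat (X n) = X n" using A n unfolding symmetric_setting_def by blast+
    obtain e where e: "eigenvalue (X n) e" "\<bar>e\<bar> = s n"
      using symmetric_singular_value_eigenvalue[OF Xn tr[OF n]] pos[OF n] by auto
    then have "e \<in> {e. eigenvalue (X n) e} - {0}" using pos[OF n] by auto
    then have "e \<in> {e. eigenvalue (X 1) e} - {0}" unfolding S0[OF n] using S0[of 1] by simp
    then have "eigenvalue (X 1) e" by simp
    then have "\<bar>e\<bar> \<le> S" unfolding S_def p1 by (rule rank_one_eigenvalue_le[OF X1[unfolded p1] ab[unfolded p1]])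
    then show ?thesis using e(2) by simp
  qed
  then show thesis by (rule that)
qed

lemma setting_law:
  assumes n: "n \<ge> 1" "i < n" "j < p n" and M: "prob_space M"
  shows "(\<lambda>\<omega>. index_mat (Z n \<omega>) (i, j)) \<in> borel_measurable M"
    and "distr M borel (\<lambda>\<omega>. index_mat (Z n \<omega>) (i, j)) = \<mu>"
proof -
  interpret prob_space M by (rule M)
  have "(\<lambda>\<omega>. index_mat (Z n \<omega>) (i, j)) \<in> borel_measurable M \<and> distr M borel (\<lambda>\<omega>. index_mat (Z n \<omega>) (i, j)) = \<mu>"
    using setting
  proof
    assume "asymmetric_setting M \<mu> p \<gamma> X Z"
    then have "iid_with_law M \<mu> ({..<n} \<times> {..<p n}) (\<lambda>ij \<omega>. index_mat (Z n \<omega>) ij)"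
      using n(1) unfolding asymmetric_setting_def by blast
    then show ?thesis using n by (auto simp: iid_with_law_def indep_vars_def2)
  next
    assume A: "symmetric_setting M \<mu> p \<gamma> X Z"
    then have "iid_with_law M \<mu> {(i, j). i \<le> j \<and> j < n} (\<lambda>ij \<omega>. index_mat (Z n \<omega>) ij)"
      using n(1) unfolding symmetric_setting_def by blast
    then have U: "(\<lambda>\<omega>. index_mat (Z n \<omega>) (i, j)) \<in> borel_measurable M \<and> distr M borel (\<lambda>\<omega>. index_mat (Z n \<omega>) (i, j)) = \<mu>"
      if "i \<le> j" "j < n" for i j
      using that by (auto simp: iid_with_law_def indep_vars_def2)
    have pn: "p n = n" using A n(1) unfolding symmetric_setting_def by blast
    show ?thesis
    proof (cases "i \<le> j")
      case True
      then show ?thesis using U n pn by simp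
    next
      case False
      have eq: "index_mat (Z n \<omega>) (i, j) = index_mat (Z n \<omega>) (j, i)" if "\<omega> \<in> space M" for \<omega>
      proof -
        have "Z n \<omega> \<in> carrier_mat n n" "transpose_mat (Z n \<omega>) = Z n \<omega>"
          using A n(1) that unfolding symmetric_setting_def by blast+
        then show ?thesis using n pn by (metis carrier_matD index_transpose_mat(1))
      qed
      have 1: "(\<lambda>\<omega>. index_mat (Z n \<omega>) (i, j)) \<in> borel_measurable M \<longleftrightarrow> (\<lambda>\<omega>. index_mat (Z n \<omega>) (j, i)) \<in> borel_measurable M"
        by (rule measurable_cong) (rule eq)
      have 2: "distr M borel (\<lambda>\<omega>. index_mat (Z n \<omega>) (i, j)) = distr M borel (\<lambda>\<omega>. index_mat (Z n \<omega>) (j, i))"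
        by (rule distr_cong) (simp_all add: eq)
      show ?thesis unfolding 1 2 using U[of j i] False n by simp
    qed
  qed
  then show "(\<lambda>\<omega>. index_mat (Z n \<omega>) (i, j)) \<in> borel_measurable M"
    "distr M borel (\<lambda>\<omega>. index_mat (Z n \<omega>) (i, j)) = \<mu>" by simp_all
qed

end

context smooth_density
begin

context
  fixes f :: "real \<Rightarrow> real"
  assumes f_bounded: "poly_bounded f" and f_cont: "AE x in lebesgue. isCont f x"
begin

text \<open>The law of \<open>\<zeta>\<close> has a Lebesgue density, so it does not charge a
  translate of the null set of discontinuities.\<close>

lemma isCont_translate_AE:
  assumes [measurable]: "\<zeta> \<in> borel_measurable N" and law: "distr N borel \<zeta> = \<mu>"
  shows "AE \<omega> in N. isCont f (\<zeta> \<omega> + b)"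
proof -
  have "AE x in lborel. isCont f (x + b)"
    by (intro AE_lborel_translate isCont_AE[OF f_bounded f_cont] isCont_borel_pred)
  then have "AE x in \<mu>. isCont f (x + b)" by (subst AE_density) (auto elim: eventually_mono)
  then have "AE x in distr N borel \<zeta>. isCont f (x + b)" unfolding law .
  then show ?thesis by (rule AE_distrD[rotated]) simp
qed

lemma setting_noise_small:
  fixes M :: "'a measure" and X :: "nat \<Rightarrow> real Matrix.mat"
  assumes M: "prob_space M" and setting: "asymmetric_setting M \<mu> p \<gamma> X Z \<or> symmetric_setting M \<mu> p \<gamma> X Z"
    and B: "\<And>\<delta>. \<delta> > 0 \<Longrightarrow> \<forall>\<^sub>F n in sequentially. \<forall>i<n. \<forall>j<p n. \<bar>B n i j\<bar> < \<delta>"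
  shows "AE \<omega> in M. \<forall>\<epsilon>>0. \<forall>\<^sub>F n in sequentially. \<forall>x y. (\<Sum>i<n. (x i)\<^sup>2) \<le> 1 \<longrightarrow> (\<Sum>j<p n. (y j)\<^sup>2) \<le> 1 \<longrightarrow>
      \<bar>bilin n (p n) (\<lambda>i j. centred_difference f (B n i j) (index_mat (Z n \<omega>) (i, j))) x y\<bar> \<le> \<epsilon> * sqrt n"
  using setting
proof
  note ratio = setting_ratio[OF setting]
  assume "asymmetric_setting M \<mu> p \<gamma> X Z"
  then have iid: "iid_with_law M \<mu> ({..<n} \<times> {..<p n}) (\<lambda>ij \<omega>. index_mat (Z n \<omega>) ij)" if "n \<ge> 1" for n
    using that unfolding asymmetric_setting_def by blast
  have eq: "bilin n (p n) (\<lambda>i j. if (i, j) \<in> {..<n} \<times> {..<p n} then centred_difference f (B n i j) (index_mat (Z n \<omega>) (id (i, j))) else 0) x y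
    = bilin n (p n) (\<lambda>i j. centred_difference f (B n i j) (index_mat (Z n \<omega>) (i, j))) x y" for n \<omega> x y
    unfolding bilin_def by (intro sum.cong refl) simp
  have "AE \<omega> in M. \<forall>\<epsilon>>0. \<forall>\<^sub>F n in sequentially. \<forall>x y. (\<Sum>i<n. (x i)\<^sup>2) \<le> 1 \<longrightarrow> (\<Sum>j<p n. (y j)\<^sup>2) \<le> 1 \<longrightarrow>
      \<bar>bilin n (p n) (\<lambda>i j. if (i, j) \<in> {..<n} \<times> {..<p n} then centred_difference f (B n i j) (index_mat (Z n \<omega>) (id (i, j))) else 0) x y\<bar> \<le> \<epsilon> * sqrt n"
    by (rule noise_difference_small[OF f_bounded f_cont M ratio iid _ _ B]) simp_all
  then show ?thesis unfolding eq .
next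
  note ratio = setting_ratio[OF setting]
  assume A: "symmetric_setting M \<mu> p \<gamma> X Z"
  then have iid: "iid_with_law M \<mu> {(i, j). i \<le> j \<and> j < n} (\<lambda>ij \<omega>. index_mat (Z n \<omega>) ij)" if "n \<ge> 1" for n
    using that unfolding symmetric_setting_def by blast
  define W1 where "W1 = (\<lambda>n \<omega> i j. if (i, j) \<in> {(i, j). i \<le> j \<and> j < n} then centred_difference f (B n i j) (index_mat (Z n \<omega>) (id (i, j))) else 0)"
  define W2 where "W2 = (\<lambda>n \<omega> i j. if (i, j) \<in> {(i, j). j < i \<and> i < n} then centred_difference f (B n i j) (index_mat (Z n \<omega>) (prod.swap (i, j))) else 0)"
  have "AE \<omega> in M. \<forall>\<epsilon>>0. \<forall>\<^sub>F n in sequentially. \<forall>x y. (\<Sum>i<n. (x i)\<^sup>2) \<le> 1 \<longrightarrow> (\<Sum>j<p n. (y j)\<^sup>2) \<le> 1 \<longrightarrow>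
      \<bar>bilin n (p n) (W1 n \<omega>) x y\<bar> \<le> \<epsilon> * sqrt n"
    unfolding W1_def by (rule noise_difference_small[OF f_bounded f_cont M ratio iid _ _ B]) simp_all
  moreover have "AE \<omega> in M. \<forall>\<epsilon>>0. \<forall>\<^sub>F n in sequentially. \<forall>x y. (\<Sum>i<n. (x i)\<^sup>2) \<le> 1 \<longrightarrow> (\<Sum>j<p n. (y j)\<^sup>2) \<le> 1 \<longrightarrow>
      \<bar>bilin n (p n) (W2 n \<omega>) x y\<bar> \<le> \<epsilon> * sqrt n"
    unfolding W2_def by (rule noise_difference_small[OF f_bounded f_cont M ratio iid _ _ B]) auto
  moreover have "AE \<omega> in M. \<omega> \<in> space M" by (rule AE_space)
  ultimately show ?thesis
  proof eventually_elim
    case (elim \<omega>)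
    show ?case
    proof (intro allI impI)
      fix \<epsilon> :: real assume "\<epsilon> > 0"
      then have e: "\<epsilon> / 2 > 0" by simp
      show "\<forall>\<^sub>F n in sequentially. \<forall>x y. (\<Sum>i<n. (x i)\<^sup>2) \<le> 1 \<longrightarrow> (\<Sum>j<p n. (y j)\<^sup>2) \<le> 1 \<longrightarrow>
        \<bar>bilin n (p n) (\<lambda>i j. centred_difference f (B n i j) (index_mat (Z n \<omega>) (i, j))) x y\<bar> \<le> \<epsilon> * sqrt n"
        using elim(1)[rule_format, OF e] elim(2)[rule_format, OF e] eventually_ge_at_top[of 1]
      proof eventually_elim
        case elim': (elim n)
        have pn: "p n = n" and Zn: "Z n \<omega> \<in> carrier_mat n n" "transpose_mat (Z n \<omega>) = Z n \<omega>"
          using A elim'(3) elim(3) unfolding symmetric_setting_def by blast+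
        have sym: "index_mat (Z n \<omega>) (j, i) = index_mat (Z n \<omega>) (i, j)" if "i < n" "j < n" for i j
          using Zn that by (metis carrier_matD index_transpose_mat(1))
        show ?case
        proof (intro allI impI)
          fix x y :: "nat \<Rightarrow> real"
          assume xy: "(\<Sum>i<n. (x i)\<^sup>2) \<le> 1" "(\<Sum>j<p n. (y j)\<^sup>2) \<le> 1"
          have "bilin n (p n) (\<lambda>i j. centred_difference f (B n i j) (index_mat (Z n \<omega>) (i, j))) x y
              = 1 * (bilin n (p n) (W1 n \<omega>) x y + bilin n (p n) (W2 n \<omega>) x y)"
            by (rule bilin_linear) (auto simp: W1_def W2_def pn sym)
          moreover have "\<bar>bilin n (p n) (W1 n \<omega>) x y\<bar> \<le> \<epsilon> / 2 * sqrt n" using elim'(1) xy by blast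
          moreover have "\<bar>bilin n (p n) (W2 n \<omega>) x y\<bar> \<le> \<epsilon> / 2 * sqrt n" using elim'(2) xy by blast
          ultimately show "\<bar>bilin n (p n) (\<lambda>i j. centred_difference f (B n i j) (index_mat (Z n \<omega>) (i, j))) x y\<bar> \<le> \<epsilon> * sqrt n"
            by (simp add: field_simps)
        qed
      qed
    qed
  qed
qed

end

end

section \<open>Noise and signal combined in the operator norm\<close>

theorem theorem2p4:
  fixes M :: "'a measure" and \<mu> :: "real measure" and p :: "nat \<Rightarrow> nat" and \<gamma> :: real
    and X :: "nat \<Rightarrow> real Matrix.mat" and Z :: "nat \<Rightarrow> 'a \<Rightarrow> real Matrix.mat"
    and u v :: "nat \<Rightarrow> real Matrix.vec" and mu mv :: "nat \<Rightarrow> real"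
    and w f :: "real \<Rightarrow> real" and q :: "nat \<Rightarrow> real poly" and L :: nat
    and Y A :: "nat \<Rightarrow> 'a \<Rightarrow> real Matrix.mat"
  assumes M: "prob_space M"
    and setting: "asymmetric_setting M \<mu> p \<gamma> X Z \<or> symmetric_setting M \<mu> p \<gamma> X Z"
    and q: "orthonormal_polys \<mu> q"
    and singular_vectors: "\<And>n. n \<ge> 1 \<Longrightarrow> singular_triple (X n) (sigma1 (X n)) (u n) (v n)"
    and i_rank: "\<And>n. n \<ge> 1 \<Longrightarrow> mat_rank (X n) = 1"
    and i_uniform: "\<And>\<epsilon>. \<epsilon> > 0 \<Longrightarrow> \<forall>\<^sub>F n in sequentially. \<forall>i<n. \<forall>j<p n.
          \<bar>real n powr (1 - 1 / (2 * real L)) * index_mat (X n) (i, j)\<bar> < \<epsilon>"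
    and i_mu: "\<And>l. l \<ge> 1 \<Longrightarrow> even l \<Longrightarrow>
          (\<lambda>n. 1 / real n * lnorm_pow l (sqrt (real n) \<cdot>\<^sub>v u n)) \<longlonglongrightarrow> mu l"
    and i_mv: "\<And>l. l \<ge> 1 \<Longrightarrow> even l \<Longrightarrow>
          (\<lambda>n. 1 / real (p n) * lnorm_pow l (sqrt (real (p n)) \<cdot>\<^sub>v v n)) \<longlonglongrightarrow> mv l"
    and ii_prob: "prob_space \<mu>"
    and ii_density: "w \<in> borel_measurable borel" "\<And>x. w x \<ge> 0"
          "\<mu> = density lborel (\<lambda>x. ennreal (w x))"
    and ii_supp: "closure {x. w x \<noteq> 0} = UNIV"
    and ii_mgf: "\<exists>r>0. \<forall>t. \<bar>t\<bar> < r \<longrightarrow> integrable \<mu> (\<lambda>x. exp (t * x))"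
    and ii_deriv: "\<And>l x. l < L \<Longrightarrow> (deriv ^^ l) w field_differentiable (at x)"
    and ii_bounded: "\<And>l. l \<le> L \<Longrightarrow> poly_bounded (\<lambda>x. (deriv ^^ l) w x / w x)"
    and iii_bounded: "poly_bounded f"
    and iii_cont: "AE x in lebesgue. isCont f x"
    and iii_a0: "coeff_a f \<mu> q 0 = 0"
    and iv_finite: "ell_star f \<mu> q = enat L"
    and iv_sums: "\<And>l. 1 \<le> l \<Longrightarrow> l < L \<Longrightarrow>
          \<forall>\<^sub>F K in sequentially. (\<Sum>k=l..K. coeff_a f \<mu> q k * coeff_b \<mu> q k l) = 0"
    and f_norm: "norm_mu \<mu> f > 0"
  defines "Y \<equiv> \<lambda>n \<omega>. (1 / sqrt (real n)) \<cdot>\<^sub>m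
          map_mat f (real n powr (1 - 1 / (2 * real L)) \<cdot>\<^sub>m X n + Z n \<omega>)"
    and "A \<equiv> \<lambda>n \<omega>.
          (tau f \<mu> q L * sqrt (mu (2 * L) * mv (2 * L)) * norm_mu \<mu> f
             / (fact L * \<gamma> powr ((real L - 1) / 2)) * sigma1 (X n) ^ L)
          \<cdot>\<^sub>m outer_prod (normalized_hadamard_power L (u n)) (normalized_hadamard_power L (v n))
          + (1 / sqrt (real n)) \<cdot>\<^sub>m map_mat f (Z n \<omega>)"
  shows "AE \<omega> in M. (\<lambda>n. op_norm (Y n \<omega> - A n \<omega>)) \<longlonglongrightarrow> 0"
proof -
  interpret M: prob_space M by (rule M)
  have "L \<ge> 1 \<and> tau f \<mu> q L \<noteq> 0"
  proof -
    \<comment> \<open>The infimum of the empty set would be infinite. As it is finite, the set is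
      nonempty and the infimum is attained, which gives \<open>L \<ge> 1\<close>.\<close>
    let ?T = "enat ` {l. l \<ge> 1 \<and> tau f \<mu> q l \<noteq> 0}"
    have "?T \<noteq> {}" using iv_finite by (auto simp: ell_star_def Inf_enat_def split: if_splits)
    then obtain t where "t \<in> ?T" by blast
    then have "(LEAST t. t \<in> ?T) \<in> ?T" by (rule LeastI)
    then have "Inf ?T \<in> ?T" unfolding Inf_enat_def if_not_P[OF \<open>?T \<noteq> {}\<close>] .
    then have "enat L \<in> ?T" using iv_finite unfolding ell_star_def by (simp only:)
    then show ?thesis by auto
  qed
  then have L: "L \<ge> 1" by blast
  interpret smooth_density w L
    by (rule smooth_density.intro[OF ii_density(1,2) ii_prob[unfolded ii_density(3)] ii_supp ii_mgf[unfolded ii_density(3)] ii_deriv ii_bounded L])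
  note \<mu> = ii_density(3)
  note q' = q[unfolded \<mu>] and a0' = iii_a0[unfolded \<mu>] and sums' = iv_sums[unfolded \<mu>] and norm' = f_norm[unfolded \<mu>]
  note ratio = setting_ratio[OF setting] and carriers = setting_carriers[OF setting]
  define s where "s = (\<lambda>n. sigma1 (X n))"
  define B where "B = (\<lambda>n i j. real n powr (1 - 1 / (2 * real L)) * index_mat (X n) (i, j))"
  \<comment> \<open>The coefficient of the rank-one term of \<open>A\<close> factors as
    \<open>c * \<rho> * s n ^ L\<close>: \<open>c\<close> is the Taylor coefficient of the mean,
    \<open>\<rho>\<close> the limit of the rescaled norms of the Hadamard powers.\<close>
  define c where "c = tau f \<mu> q L * norm_mu \<mu> f / fact L"
  define \<rho> where "\<rho> = sqrt (mu (2 * L) * mv (2 * L)) / \<gamma> powr ((real L - 1) / 2)"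
  define h where "h = (\<lambda>b. \<integral>x. continuous_part f (x + b) \<partial>\<mu>)"
  define \<alpha> where "\<alpha> = (\<lambda>n. vec_norm2 (hadamard_power_vec L (u n)))"
  define \<beta> where "\<beta> = (\<lambda>n. vec_norm2 (hadamard_power_vec L (v n)))"
  have B0: "\<forall>\<^sub>F n in sequentially. \<forall>i<n. \<forall>j<p n. \<bar>B n i j\<bar> < \<delta>" if "\<delta> > 0" for \<delta>
    using i_uniform[OF that] unfolding B_def .
  have tr: "singular_triple (X n) (s n) (u n) (v n)" if "n \<ge> 1" for n
    unfolding s_def by (rule singular_vectors[OF that])
  have dims: "u n \<in> carrier_vec n" "v n \<in> carrier_vec (p n)" if "n \<ge> 1" for n
    using tr[OF that] carriers(1)[OF that] by (auto simp: singular_triple_def)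
  have s_pos: "s n > 0" and X_eq: "\<And>i j. i < n \<Longrightarrow> j < p n \<Longrightarrow> index_mat (X n) (i, j) = s n * vec_index (u n) i * vec_index (v n) j"
    if n: "n \<ge> 1" for n
  proof -
    obtain a b where ab: "\<forall>i<n. \<forall>j<p n. index_mat (X n) (i, j) = a i * b j"
      and pos: "(\<Sum>i<n. (a i)\<^sup>2) > 0" "(\<Sum>j<p n. (b j)\<^sup>2) > 0"
      by (rule rank_one_factorization[OF carriers(1)[OF n] i_rank[OF n]]) blast
    show s0: "s n > 0" unfolding s_def by (rule sigma1_rank_one[OF carriers(1)[OF n] ab pos])
    show "index_mat (X n) (i, j) = s n * vec_index (u n) i * vec_index (v n) j" if "i < n" "j < p n" for i j
      by (rule rank_one_singular_value(2)[OF carriers(1)[OF n] ab tr[OF n] s0 that])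
  qed
  obtain S where S: "\<And>n. n \<ge> 1 \<Longrightarrow> s n \<le> S"
    by (rule setting_singular_value_bound[OF setting tr s_pos i_rank]) (assumption, assumption, simp, blast)
  have h_zero: "(\<integral>x. continuous_part f x \<partial>\<mu>) = 0"
    unfolding \<mu> by (rule mean_zero[OF iii_bounded iii_cont q' a0'])
  have expansion: "\<exists>\<delta>>0. \<forall>b. \<bar>b\<bar> \<le> \<delta> \<longrightarrow> \<bar>h b - c * b ^ L\<bar> \<le> \<epsilon> * \<bar>b\<bar> ^ L" if e: "\<epsilon> > 0" for \<epsilon>
  proof (rule mean_expansion[OF iii_bounded iii_cont q' a0' _ norm' e])
    let ?\<mu> = "density lborel (\<lambda>x. ennreal (w x))"
    show "\<forall>\<^sub>F K in sequentially. (\<Sum>k=l..K. coeff_a f ?\<mu> q k * coeff_b ?\<mu> q k l) = 0" if "1 \<le> l" "l < L" for l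
      by (rule sums'[OF that])
    fix \<delta> :: real assume \<delta>: "\<delta> > 0"
      "\<And>b. \<bar>b\<bar> \<le> \<delta> \<Longrightarrow> \<bar>(\<integral>x. continuous_part f (x + b) \<partial>?\<mu>) - tau f ?\<mu> q L * norm_mu ?\<mu> f * b ^ L / fact L\<bar> \<le> \<epsilon> * \<bar>b\<bar> ^ L"
    have "\<bar>h b - c * b ^ L\<bar> \<le> \<epsilon> * \<bar>b\<bar> ^ L" if "\<bar>b\<bar> \<le> \<delta>" for b
      unfolding h_def c_def times_divide_eq_left \<mu> by (rule \<delta>(2)[OF that])
    then show ?thesis by (intro exI[of _ \<delta>] conjI allI impI \<delta>(1))
  qed
  have norms: "(\<lambda>n. real n ^ (L - 1) * (\<alpha> n * \<beta> n)) \<longlonglongrightarrow> \<rho>"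
    unfolding \<alpha>_def \<beta>_def \<rho>_def
    by (rule hadamard_norms_limit[OF dims ratio L i_mu i_mv]) (use L in simp_all)
  have \<alpha>: "\<alpha> n = sqrt (\<Sum>i<n. (vec_index (u n) i ^ L)\<^sup>2)" and \<beta>: "\<beta> n = sqrt (\<Sum>j<p n. (vec_index (v n) j ^ L)\<^sup>2)"
    if "n \<ge> 1" for n
    using dims[OF that] by (simp_all add: \<alpha>_def \<beta>_def vec_norm2_def hadamard_power_vec_def)
  have mean_small: "\<forall>\<^sub>F n in sequentially. \<forall>x y. (\<Sum>i<n. (x i)\<^sup>2) \<le> 1 \<longrightarrow> (\<Sum>j<p n. (y j)\<^sup>2) \<le> 1 \<longrightarrow>
      \<bar>bilin n (p n) (\<lambda>i j. h (B n i j) - sqrt n * (c * \<rho> * s n ^ L) * (vec_index (u n) i ^ L / \<alpha> n * (vec_index (v n) j ^ L / \<beta> n))) x y\<bar> \<le> \<epsilon> * sqrt n"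
    if "\<epsilon> > 0" for \<epsilon>
    by (rule mean_part_small[OF L _ B0 _ S expansion norms \<alpha> \<beta> that]) (simp_all add: B_def X_eq less_imp_le s_pos)
  \<comment> \<open>There are countably many entries in all, so almost surely every entry, shifted
    by its signal or not, is a continuity point of \<open>f\<close>. From then on \<open>f\<close>
    may be replaced by its Borel representative. The summand 0 lets one statement about translates
    cover both cases.\<close>
  have continuity: "AE \<omega> in M. \<forall>n\<in>{1..}. \<forall>i\<in>{..<n}. \<forall>j\<in>{..<p n}. isCont f (index_mat (Z n \<omega>) (i, j) + B n i j) \<and> isCont f (index_mat (Z n \<omega>) (i, j) + 0)"
  proof (intro AE_ball_countable[THEN iffD2] ballI)
    fix n i j assume "n \<in> {1..}" "i \<in> {..<n}" "j \<in> {..<p n}"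
    then have nij: "n \<ge> 1" "i < n" "j < p n" by simp_all
    note law = setting_law[OF setting nij M]
    have "AE \<omega> in M. isCont f (index_mat (Z n \<omega>) (i, j) + b)" for b
      by (rule isCont_translate_AE[OF iii_bounded iii_cont law(1)]) (use law(2) \<mu> in simp)
    then show "AE \<omega> in M. isCont f (index_mat (Z n \<omega>) (i, j) + B n i j) \<and> isCont f (index_mat (Z n \<omega>) (i, j) + 0)"
      by (intro AE_conjI)
  qed simp_all
  have noise_small: "AE \<omega> in M. \<forall>\<epsilon>>0. \<forall>\<^sub>F n in sequentially. \<forall>x y. (\<Sum>i<n. (x i)\<^sup>2) \<le> 1 \<longrightarrow> (\<Sum>j<p n. (y j)\<^sup>2) \<le> 1 \<longrightarrow>
      \<bar>bilin n (p n) (\<lambda>i j. centred_difference f (B n i j) (index_mat (Z n \<omega>) (i, j))) x y\<bar> \<le> \<epsilon> * sqrt n"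
    by (rule setting_noise_small[OF iii_bounded iii_cont M setting[unfolded \<mu>] B0])
  show ?thesis
    using continuity noise_small AE_space
  proof eventually_elim
    case (elim \<omega>)
    show "(\<lambda>n. op_norm (Y n \<omega> - A n \<omega>)) \<longlonglongrightarrow> 0"
    proof (rule LIMSEQ_I)
      \<comment> \<open>Noise and mean part get \<epsilon> / 4 each, so the norm is at most
        \<epsilon> / 2, strictly below \<epsilon>.\<close>
      fix \<epsilon> :: real assume "\<epsilon> > 0"
      then have e: "\<epsilon> / 4 > 0" by simp
      have "\<forall>\<^sub>F n in sequentially. norm (op_norm (Y n \<omega> - A n \<omega>) - 0) < \<epsilon>"
        using elim(2)[rule_format, OF e] mean_small[OF e] eventually_ge_at_top[of 1]
      proof eventually_elim
        case elim': (elim n)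
        have n: "n \<ge> 1" by (rule elim'(3))
        have Xn: "X n \<in> carrier_mat n (p n)" and Zn: "Z n \<omega> \<in> carrier_mat n (p n)"
          using carriers[OF n] elim(3) by blast+
        let ?W1 = "\<lambda>i j. centred_difference f (B n i j) (index_mat (Z n \<omega>) (i, j))"
        let ?W2 = "\<lambda>i j. h (B n i j) - sqrt n * (c * \<rho> * s n ^ L) * (vec_index (u n) i ^ L / \<alpha> n * (vec_index (v n) j ^ L / \<beta> n))"
        have carrier: "Y n \<omega> - A n \<omega> \<in> carrier_mat n (p n)"
          using Xn Zn dims[OF n]
          by (intro carrier_matI) (simp_all add: Y_def A_def outer_prod_def normalized_hadamard_power_def hadamard_power_vec_def)
        \<comment> \<open>The mean \<open>h (B n i j)\<close> is subtracted in \<open>?W1\<close>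
          and added in \<open>?W2\<close>, and the mean of the representative itself is zero by
          \<open>h_zero\<close>. The terms \<open>f z\<close> of both matrices cancel on the side of
          the noise.\<close>
        have entry: "index_mat (Y n \<omega> - A n \<omega>) (i, j) = 1 / sqrt n * (?W1 i j + ?W2 i j)" if ij: "i < n" "j < p n" for i j
        proof -
          define z where "z = index_mat (Z n \<omega>) (i, j)"
          define k where "k = c * \<rho> * s n ^ L"
          define r where "r = vec_index (u n) i ^ L / \<alpha> n * (vec_index (v n) j ^ L / \<beta> n)"
          have k: "tau f \<mu> q L * sqrt (mu (2 * L) * mv (2 * L)) * norm_mu \<mu> f / (fact L * \<gamma> powr ((real L - 1) / 2)) * sigma1 (X n) ^ L = k"
            by (simp add: k_def c_def \<rho>_def s_def mult_ac)
          have "index_mat (Y n \<omega> - A n \<omega>) (i, j) = 1 / sqrt n * f (B n i j + z) - (k * r + 1 / sqrt n * f z)"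
            unfolding Y_def A_def k using Xn Zn dims[OF n] ij
            by (simp add: outer_prod_def normalized_hadamard_power_def hadamard_power_vec_def B_def z_def r_def \<alpha>_def \<beta>_def)
          then have Y: "index_mat (Y n \<omega> - A n \<omega>) (i, j) = 1 / sqrt n * f (z + B n i j) - (k * r + 1 / sqrt n * f z)"
            by (subst add.commute[of z])
          have "isCont f (z + B n i j)" "isCont f z" using elim(1) n ij by (auto simp: z_def)
          then have "continuous_part f (z + B n i j) = f (z + B n i j)" "continuous_part f z = f z"
            by (simp_all only: continuous_part_def if_True)
          then have W: "centred_difference f (B n i j) z = f (z + B n i j) - f z - h (B n i j)"
            unfolding centred_difference_def[OF iii_bounded iii_cont] h_def \<mu>[symmetric] h_zero by simp
          have "1 / sqrt n * (centred_difference f (B n i j) z + (h (B n i j) - sqrt n * k * r))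
            = 1 / sqrt n * f (z + B n i j) - 1 / sqrt n * f z - (1 / sqrt n * sqrt n) * (k * r)"
            unfolding W by (simp only: right_diff_distrib distrib_left mult.assoc)
          also have "1 / sqrt n * sqrt n = 1" using n by simp
          finally show ?thesis unfolding Y z_def[symmetric] k_def[symmetric] r_def[symmetric] by simp
        qed
        have bound: "\<bar>bilin n (p n) (\<lambda>i j. index_mat (Y n \<omega> - A n \<omega>) (i, j)) x y\<bar> \<le> \<epsilon> / 2"
          if xy: "(\<Sum>i<n. (x i)\<^sup>2) \<le> 1" "(\<Sum>j<p n. (y j)\<^sup>2) \<le> 1" for x y
        proof -
          have "\<bar>bilin n (p n) ?W1 x y\<bar> \<le> \<epsilon> / 4 * sqrt n" using elim'(1) xy by blast
          moreover have "\<bar>bilin n (p n) ?W2 x y\<bar> \<le> \<epsilon> / 4 * sqrt n" using elim'(2) xy by blast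
          ultimately have le: "\<bar>bilin n (p n) ?W1 x y + bilin n (p n) ?W2 x y\<bar> \<le> \<epsilon> / 2 * sqrt n" by linarith
          have "bilin n (p n) (\<lambda>i j. index_mat (Y n \<omega> - A n \<omega>) (i, j)) x y
              = 1 / sqrt n * (bilin n (p n) ?W1 x y + bilin n (p n) ?W2 x y)"
            by (rule bilin_linear) (rule entry)
          then have "\<bar>bilin n (p n) (\<lambda>i j. index_mat (Y n \<omega> - A n \<omega>) (i, j)) x y\<bar>
              = 1 / sqrt n * \<bar>bilin n (p n) ?W1 x y + bilin n (p n) ?W2 x y\<bar>"
            by (simp only: abs_mult) simp
          also have "\<dots> \<le> 1 / sqrt n * (\<epsilon> / 2 * sqrt n)" by (rule mult_left_mono[OF le]) simp
          also have "\<dots> = \<epsilon> / 2" using n by simp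
          finally show ?thesis .
        qed
        have "0 \<le> op_norm (Y n \<omega> - A n \<omega>)" by (rule op_norm_le(1)[OF carrier]) (rule bound)
        moreover have "op_norm (Y n \<omega> - A n \<omega>) \<le> \<epsilon> / 2" by (rule op_norm_le(2)[OF carrier]) (rule bound)
        ultimately show ?case using \<open>\<epsilon> > 0\<close> by simp
      qed
      then show "\<exists>no. \<forall>n\<ge>no. norm (op_norm (Y n \<omega> - A n \<omega>) - 0) < \<epsilon>" unfolding eventually_sequentially .
    qed
  qed
qed

end
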